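(* Let $F=\frac1n\sum_{i=1}^n f_i:\mathbb{R}^d\to\mathbb{R}$ and $\mathbf{x}_0\in\mathbb{R}^d$ satisfy the following, with positive finite constants $\Delta_F,L,\rho,M$: (i) $F(\mathbf{x}_0)-\inf_{\mathbf{x}}F(\mathbf{x})\le\Delta_F$; (ii) for every $i$ and all $\mathbf{x},\mathbf{y}\in\mathbb{R}^d$, $\|\nabla f_i(\mathbf{x})-\nabla f_i(\mathbf{y})\|_2\le L\|\mathbf{x}-\mathbf{y}\|_2$ and $\|\nabla^2 f_i(\mathbf{x})-\nabla^2 f_i(\mathbf{y})\|_2\le\rho\|\mathbf{x}-\mathbf{y}\|_2$; (iii) $\|\nabla f_i(\mathbf{x})-\nabla F(\mathbf{x})\|_2\le M$ for all $\mathbf{x}\in\mathbb{R}^d$ and $i\in\{1,\dots,n\}$. Let $\xi\in(0,1)$ and $0<\epsilon<L^2/(4\rho)$. Run the algorithm SRVRC$_{\mathrm{free}}$ (defined in the context) from $\mathbf{x}_0$ with $M_t=4\rho$ for all $t$, $$S^{(g)}=\frac{\sqrt{\rho\epsilon}}{L}\sqrt{n\land\frac{M^2}{\epsilon^2}},\qquad T=25\Delta_F\rho^{1/2}\epsilon^{-3/2},\qquad B_t^{(h)}=n\land\frac{1200L^2\log^2(3Td/\xi)}{\rho\epsilon}\ \text{ for all } t,$$ $$B_t^{(g)}=n\land\frac{2640L^2S^{(g)}\|\mathbf{h}_{t-1}\|_2^2\log^2(3T/\xi)}{\epsilon^2}\ \text{ if } t\bmod S^{(g)}\ne0,\qquad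 B_t^{(g)}=n\land\frac{2640M^2\log^2(3T/\xi)}{\epsilon^2}\ \text{ if } t\bmod S^{(g)}=0.$$ Then with probability at least $1-\xi$, SRVRC$_{\mathrm{free}}$ outputs an $(\epsilon,\sqrt{\rho\epsilon})$-approximate local minimum of $F$ (up to absolute constants, in the sense that $\mu(\mathbf{x}_{\mathrm{out}})\le1300\,\epsilon^{3/2}$) within $$\tilde O\bigg[\Big(n\land\frac{M^2}{\epsilon^2}\Big)+\frac{\Delta_F}{\epsilon^{3/2}}\Big(\sqrt\rho\,n\land\frac{L\sqrt n}{\sqrt\epsilon}\land\frac{LM}{\epsilon^{3/2}}\Big)+\Big(\frac{L\Delta_F}{\epsilon^2}+\frac{L}{\sqrt{\rho\epsilon}}\Big)\cdot\Big(n\land\frac{L^2}{\rho\epsilon}\Big)\bigg]$$ stochastic gradient and Hessian-vector product computations.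
   Context: Notation: $a\land b=\min\{a,b\}$; $\|\cdot\|_2$ is the Euclidean norm for vectors and the spectral norm for matrices; $\lambda_{\min}$ is the minimum eigenvalue. $\tilde O(\cdot)$ hides absolute constants and logarithmic factors (including those in $T,d,1/\xi$ and the problem parameters). The complexity counts the total number of evaluations of $\nabla f_i(\mathbf{x})$ and of products $\nabla^2f_i(\mathbf{x})\mathbf{v}$ for individual indices $i$ (each application of $\mathbf{U}_t[\cdot]$ costs $B_t^{(h)}$ Hessian-vector products). $T$, $S^{(g)}$ and the batch sizes are understood as rounded up to positive integers. All $f_i$ are twice differentiable. Define $\mu(\mathbf{x})=\max\{\|\nabla F(\mathbf{x})\|_2^{3/2},\,-\lambda_{\min}^3(\nabla^2F(\mathbf{x}))/\rho^{3/2}\}$. A point $\mathbf{x}$ is an $(\epsilon_g,\epsilon_H)$-approximate local minimum if $\|\nabla F(\mathbf{x})\|_2\le\epsilon_g$ and $\lambda_{\min}(\nabla^2F(\mathbf{x}))\ge-\epsilon_H$; thus $\mu(\mathbf{x})\le\epsilon^{3/2}$ iff $\mathbf{x}$ is an $(\epsilon,\sqrt{\rho\epsilon})$-approximate local minimum. Index sets are multisets. For an index multiset $\mathcal{I}$, $\nabla f_{\mathcal{I}}(\mathbf{x})=\frac1{|\mathcal{I}|}\sum_{i\in\mathcal{I}}\nabla f_i(\mathbf{x})$ if $|\mathcal{I}|<n$ and $\nabla f_{\mathcal I}(\mathbf{x})=\nabla F(\mathbf{x})$ otherwise; $\nabla^2 f_{\mathcal{I}}(\mathbf{x})$ is defined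 in the same way with Hessians. Sampling an index set of size $B$ means drawing $B$ indices i.i.d. uniformly from $\{1,\dots,n\}$, independently of everything previously drawn. Subroutines. For a symmetric matrix $\mathbf{A}$ (accessed through $\mathbf{A}[\mathbf{v}]=\mathbf{A}\mathbf{v}$), a vector $\mathbf{b}$ and $\tau>0$ let $g_{\mathbf{A},\mathbf{b},\tau}(\mathbf{x})=\mathbf{b}^\top\mathbf{x}+\frac12\mathbf{x}^\top\mathbf{A}\mathbf{x}+\frac\tau6\|\mathbf{x}\|_2^3$, with gradient $\mathbf{b}+\mathbf{A}\mathbf{x}+\frac\tau2\|\mathbf{x}\|_2\mathbf{x}$. The Cauchy point is $\mathrm{CP}(\mathbf{A},\mathbf{b},\tau)=-R_c\mathbf{b}/\|\mathbf{b}\|_2$ with $R_c=\frac{-\mathbf{b}^\top\mathbf{A}\mathbf{b}}{\tau\|\mathbf{b}\|_2^2}+\sqrt{\big(\frac{\mathbf{b}^\top\mathbf{A}\mathbf{b}}{\tau\|\mathbf{b}\|_2^2}\big)^2+\frac{2\|\mathbf{b}\|_2}{\tau}}$ (and $\mathrm{CP}=\mathbf{0}$ if $\mathbf{b}=\mathbf{0}$). Cubic-Subsolver$(\mathbf{A},\mathbf{b},\tau,\eta,\zeta,\epsilon',\delta')$: 1. $\mathbf{x}\leftarrow\mathrm{CP}(\mathbf{A},\mathbf{b},\tau)$; if $g_{\mathbf{A},\mathbf{b},\tau}(\mathbf{x})\le-(1-\epsilon')\tau\zeta^3/12$, return $\mathbf{x}$. 2. Set $T'=\frac{480}{\eta\tau\zeta\epsilon'}\big[6\log(1+\sqrt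 d/\delta')+32\log(\frac{12}{\eta\tau\zeta\epsilon'})\big]$; draw $\mathbf{q}$ uniformly from the unit sphere of $\mathbb{R}^d$ (independently of everything else), set $\tilde{\mathbf{b}}=\mathbf{b}+\sigma\mathbf{q}$ with $\sigma=\frac{\tau^2\zeta^3\epsilon'}{576(\beta+\tau\zeta)}$, $\beta=L$; set $\mathbf{x}\leftarrow\mathrm{CP}(\mathbf{A},\tilde{\mathbf{b}},\tau)$. 3. For up to $T'$ (rounded up) iterations: $\mathbf{x}\leftarrow\mathbf{x}-\eta\nabla g_{\mathbf{A},\tilde{\mathbf{b}},\tau}(\mathbf{x})$; if $g_{\mathbf{A},\mathbf{b},\tau}(\mathbf{x})\le-(1-\epsilon')\tau\zeta^3/12$, return $\mathbf{x}$. 4. Return $\mathbf{x}$. Cubic-Finalsolver$(\mathbf{A},\mathbf{b},\tau,\eta,\epsilon_g)$: $\Delta\leftarrow\mathrm{CP}(\mathbf{A},\mathbf{b},\tau)$; while $\|\nabla g_{\mathbf{A},\mathbf{b},\tau}(\Delta)\|_2>\epsilon_g$, set $\Delta\leftarrow\Delta-\eta\nabla g_{\mathbf{A},\mathbf{b},\tau}(\Delta)$; return $\Delta$. Algorithm SRVRC$_{\mathrm{free}}$ (inputs $T$, $B_t^{(g)},B_t^{(h)}$, $M_t$, $S^{(g)}$, $\mathbf{x}_0$, $\epsilon,\rho,L,\xi$). For $t=0,\dots,T-1$: sample $\mathcal{J}_t$ with $|\mathcal{J}_t|=B_t^{(g)}$ and $\mathcal{I}_t$ with $|\mathcal{I}_t|=B_t^{(h)}$;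 set $\mathbf{v}_t=\nabla f_{\mathcal{J}_t}(\mathbf{x}_t)$ if $t\bmod S^{(g)}=0$ and $\mathbf{v}_t=\nabla f_{\mathcal{J}_t}(\mathbf{x}_t)-\nabla f_{\mathcal{J}_t}(\mathbf{x}_{t-1})+\mathbf{v}_{t-1}$ otherwise; set $\mathbf{U}_t=\nabla^2f_{\mathcal{I}_t}(\mathbf{x}_t)$ (used only via $\mathbf{U}_t[\cdot]$); let $m_t(\mathbf{h})=\langle\mathbf{v}_t,\mathbf{h}\rangle+\frac12\langle\mathbf{U}_t\mathbf{h},\mathbf{h}\rangle+\frac{M_t}6\|\mathbf{h}\|_2^3$. Set $\mathbf{h}_t\leftarrow$ Cubic-Subsolver$(\mathbf{U}_t,\mathbf{v}_t,M_t,\frac1{16L},\sqrt{\epsilon/\rho},0.5,\xi/(3T))$. If $m_t(\mathbf{h}_t)\le-M_t\rho^{-3/2}\epsilon^{3/2}/24$ (which equals $-\rho^{-1/2}\epsilon^{3/2}/6$ for $M_t=4\rho$), set $\mathbf{x}_{t+1}=\mathbf{x}_t+\mathbf{h}_t$ and continue. Otherwise set $\mathbf{h}_t\leftarrow$ Cubic-Finalsolver$(\mathbf{U}_t,\mathbf{v}_t,M_t,\frac1{16L},\epsilon)$, stop, and output $\mathbf{x}_{\mathrm{out}}=\mathbf{x}_{t+1}=\mathbf{x}_t+\mathbf{h}_t$. *)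

theory Defs
  imports "HOL-Probability.Probability" "HOL-Library.While_Combinator"
begin

definition grad :: "('a::real_inner \<Rightarrow> real) \<Rightarrow> 'a \<Rightarrow> 'a" where
  "grad f x = (THE D. GDERIV f x :> D)"

definition hess :: "(real ^ 'd \<Rightarrow> real) \<Rightarrow> real ^ 'd \<Rightarrow> real ^ 'd ^ 'd" where
  "hess f x = jacobian (grad f) (at x)"

(* The Frobenius norm is the library norm on real ^ 'd ^ 'd, so the spectral norm needs a name. *)
definition spectral_norm :: "real ^ 'd ^ 'd \<Rightarrow> real" where
  "spectral_norm A = onorm ((*v) A)"

definition lambda_min :: "real ^ 'd ^ 'd \<Rightarrow> real" where
  "lambda_min A = Min {l. \<exists>v. v \<noteq> 0 \<and> A *v v = l *\<^sub>R v}"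

definition crit_measure :: "real \<Rightarrow> (real ^ 'd \<Rightarrow> real) \<Rightarrow> real ^ 'd \<Rightarrow> real" where
  "crit_measure \<rho> F x =
     max (norm (grad F x) powr (3/2)) ((- (lambda_min (hess F x) ^ 3)) / \<rho> powr (3/2))"

definition avg_fun :: "nat \<Rightarrow> (nat \<Rightarrow> real ^ 'd \<Rightarrow> real) \<Rightarrow> real ^ 'd \<Rightarrow> real" where
  "avg_fun n f x = (\<Sum>i=1..n. f i x) / real n"

definition round_up :: "real \<Rightarrow> nat" where
  "round_up r = max 1 (nat \<lceil>r\<rceil>)"

definition batch_grad ::
  "nat \<Rightarrow> (nat \<Rightarrow> real ^ 'd \<Rightarrow> real) \<Rightarrow> nat multiset \<Rightarrow> real ^ 'd \<Rightarrow> real ^ 'd" where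
  "batch_grad n f I x =
     (if size I < n then (1 / real (size I)) *\<^sub>R (\<Sum>i\<in>#I. grad (f i) x)
      else grad (avg_fun n f) x)"

definition batch_hess ::
  "nat \<Rightarrow> (nat \<Rightarrow> real ^ 'd \<Rightarrow> real) \<Rightarrow> nat multiset \<Rightarrow> real ^ 'd \<Rightarrow> real ^ 'd ^ 'd" where
  "batch_hess n f I x =
     (if size I < n then (1 / real (size I)) *\<^sub>R (\<Sum>i\<in>#I. hess (f i) x)
      else hess (avg_fun n f) x)"


definition cubic :: "real ^ 'd ^ 'd \<Rightarrow> real ^ 'd \<Rightarrow> real \<Rightarrow> real ^ 'd \<Rightarrow> real" where
  "cubic A b \<tau> x = b \<bullet> x + (x \<bullet> (A *v x)) / 2 + \<tau> / 6 * norm x ^ 3"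

definition cubic_grad :: "real ^ 'd ^ 'd \<Rightarrow> real ^ 'd \<Rightarrow> real \<Rightarrow> real ^ 'd \<Rightarrow> real ^ 'd" where
  "cubic_grad A b \<tau> x = b + A *v x + (\<tau> / 2 * norm x) *\<^sub>R x"

definition cauchy_point :: "real ^ 'd ^ 'd \<Rightarrow> real ^ 'd \<Rightarrow> real \<Rightarrow> real ^ 'd" where
  "cauchy_point A b \<tau> =
     (if b = 0 then 0
      else let r = (b \<bullet> (A *v b)) / (\<tau> * (norm b)\<^sup>2);
               R = - r + sqrt (r\<^sup>2 + 2 * norm b / \<tau>)
           in - ((R / norm b) *\<^sub>R b))"

(* The two solvers return the number of applications of A next to the point. Every evaluation of
   a Cauchy point, of the cubic or of its gradient counts as one application; no product is
   assumed to be cached, so an implementation that reuses products only costs less. *)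

primrec subsolver_loop ::
  "real ^ 'd ^ 'd \<Rightarrow> real ^ 'd \<Rightarrow> real ^ 'd \<Rightarrow> real \<Rightarrow> real \<Rightarrow> real \<Rightarrow> nat \<Rightarrow> real ^ 'd
    \<Rightarrow> (real ^ 'd) \<times> nat" where
  "subsolver_loop A b b' \<tau> \<eta> thr 0 x = (x, 0)"
| "subsolver_loop A b b' \<tau> \<eta> thr (Suc k) x =
     (let y = x - \<eta> *\<^sub>R cubic_grad A b' \<tau> x
      in if cubic A b \<tau> y \<le> thr then (y, 2)
         else let (z, a) = subsolver_loop A b b' \<tau> \<eta> thr k y in (z, a + 2))"

(* q is the point drawn from the unit sphere. *)
definition cubic_subsolver ::
  "real ^ 'd ^ 'd \<Rightarrow> real ^ 'd \<Rightarrow> real \<Rightarrow> real \<Rightarrow> real \<Rightarrow> real \<Rightarrow> real \<Rightarrow> real \<Rightarrow> real ^ 'd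
    \<Rightarrow> (real ^ 'd) \<times> nat" where
  "cubic_subsolver A b \<tau> \<eta> \<zeta> \<epsilon>' \<delta>' \<beta> q =
     (let thr = - ((1 - \<epsilon>') * \<tau> * \<zeta> ^ 3 / 12);
          x0 = cauchy_point A b \<tau>
      in if cubic A b \<tau> x0 \<le> thr then (x0, 2)
         else
           let K = round_up (480 / (\<eta> * \<tau> * \<zeta> * \<epsilon>') *
                     (6 * ln (1 + sqrt (real CARD('d)) / \<delta>') + 32 * ln (12 / (\<eta> * \<tau> * \<zeta> * \<epsilon>'))));
               \<sigma> = \<tau>\<^sup>2 * \<zeta> ^ 3 * \<epsilon>' / (576 * (\<beta> + \<tau> * \<zeta>));
               b' = b + \<sigma> *\<^sub>R q;
               (x, a) = subsolver_loop A b b' \<tau> \<eta> thr K (cauchy_point A b' \<tau>)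
           in (x, a + 3))"

(* None means that the while loop does not terminate. *)
definition cubic_finalsolver ::
  "real ^ 'd ^ 'd \<Rightarrow> real ^ 'd \<Rightarrow> real \<Rightarrow> real \<Rightarrow> real \<Rightarrow> ((real ^ 'd) \<times> nat) option" where
  "cubic_finalsolver A b \<tau> \<eta> \<epsilon>g =
     while_option (\<lambda>(x, a). norm (cubic_grad A b \<tau> x) > \<epsilon>g)
       (\<lambda>(x, a). (x - \<eta> *\<^sub>R cubic_grad A b \<tau> x, a + 2))
       (cauchy_point A b \<tau>, 2)"


(* Running x y v h c: before iteration t, with x = x_t, y = x_(t-1), v = v_(t-1), h = h_(t-1);
   Finished x c: stopped with output x; Diverged: the final solver did not terminate.
   c counts the evaluations of grad (f i) and of products with hess (f i). *)
datatype 'a srvrc_state = Running 'a 'a 'a 'a nat | Finished 'a nat | Diverged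

(* The draws available to one iteration: the first B entries of an infinite i.i.d. sequence of
   indices serve as a sample of size B, which lets B depend on the previous iterations. *)
type_synonym 'd draws = "(nat \<Rightarrow> nat) \<times> (nat \<Rightarrow> nat) \<times> (real ^ 'd)"

definition index_sample :: "nat \<Rightarrow> (nat \<Rightarrow> nat) \<Rightarrow> nat multiset" where
  "index_sample B j = image_mset j (mset [0..<B])"

(* The gradient batch size Bg t h may depend on the previous step h = h_(t-1). *)
definition srvrc_step ::
  "nat \<Rightarrow> (nat \<Rightarrow> real ^ 'd \<Rightarrow> real) \<Rightarrow> nat \<Rightarrow> (nat \<Rightarrow> real ^ 'd \<Rightarrow> nat) \<Rightarrow> (nat \<Rightarrow> nat) \<Rightarrow>
   (nat \<Rightarrow> real) \<Rightarrow> nat \<Rightarrow> real \<Rightarrow> real \<Rightarrow> real \<Rightarrow> real \<Rightarrow> nat \<Rightarrow> 'd draws \<Rightarrow>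
   (real ^ 'd) srvrc_state \<Rightarrow> (real ^ 'd) srvrc_state" where
  "srvrc_step n f T Bg Bh Mt S \<epsilon> \<rho> L \<xi> t w s =
     (case s of
        Running x y v h c \<Rightarrow>
          (let (j, i, q) = w;
               J = index_sample (Bg t h) j;
               I = index_sample (Bh t) i;
               v' = (if t mod S = 0 then batch_grad n f J x
                     else batch_grad n f J x - batch_grad n f J y + v);
               cg = (if t mod S = 0 then 1 else 2) * min n (Bg t h);
               U = batch_hess n f I x;
               (h', a) = cubic_subsolver U v' (Mt t) (1 / (16 * L)) (sqrt (\<epsilon> / \<rho>)) (1/2)
                           (\<xi> / (3 * real T)) L q
           in if cubic U v' (Mt t) h' \<le> - (Mt t * \<rho> powr (-3/2) * \<epsilon> powr (3/2) / 24)
              then Running (x + h') x v' h' (c + cg + (a + 1) * Bh t)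
              else (case cubic_finalsolver U v' (Mt t) (1 / (16 * L)) \<epsilon> of
                      None \<Rightarrow> Diverged
                    | Some (h'', a') \<Rightarrow> Finished (x + h'') (c + cg + (a + 1 + a') * Bh t)))
      | _ \<Rightarrow> s)"

(* State after t iterations. The entries other than x0 and the count are placeholders: iteration 0
   is a reset iteration and does not use them. *)
primrec srvrc_iter ::
  "nat \<Rightarrow> (nat \<Rightarrow> real ^ 'd \<Rightarrow> real) \<Rightarrow> nat \<Rightarrow> (nat \<Rightarrow> real ^ 'd \<Rightarrow> nat) \<Rightarrow> (nat \<Rightarrow> nat) \<Rightarrow>
   (nat \<Rightarrow> real) \<Rightarrow> nat \<Rightarrow> real ^ 'd \<Rightarrow> real \<Rightarrow> real \<Rightarrow> real \<Rightarrow> real \<Rightarrow> (nat \<Rightarrow> 'd draws) \<Rightarrow>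
   nat \<Rightarrow> (real ^ 'd) srvrc_state" where
  "srvrc_iter n f T Bg Bh Mt S x0 \<epsilon> \<rho> L \<xi> \<omega> 0 = Running x0 x0 0 0 0"
| "srvrc_iter n f T Bg Bh Mt S x0 \<epsilon> \<rho> L \<xi> \<omega> (Suc t) =
     srvrc_step n f T Bg Bh Mt S \<epsilon> \<rho> L \<xi> t (\<omega> t)
       (srvrc_iter n f T Bg Bh Mt S x0 \<epsilon> \<rho> L \<xi> \<omega> t)"

definition srvrc_free ::
  "nat \<Rightarrow> (nat \<Rightarrow> real ^ 'd \<Rightarrow> real) \<Rightarrow> nat \<Rightarrow> (nat \<Rightarrow> real ^ 'd \<Rightarrow> nat) \<Rightarrow> (nat \<Rightarrow> nat) \<Rightarrow>
   (nat \<Rightarrow> real) \<Rightarrow> nat \<Rightarrow> real ^ 'd \<Rightarrow> real \<Rightarrow> real \<Rightarrow> real \<Rightarrow> real \<Rightarrow> (nat \<Rightarrow> 'd draws) \<Rightarrow>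
   (real ^ 'd) srvrc_state" where
  "srvrc_free n f T Bg Bh Mt S x0 \<epsilon> \<rho> L \<xi> \<omega> =
     srvrc_iter n f T Bg Bh Mt S x0 \<epsilon> \<rho> L \<xi> \<omega> T"


(* The radial projection of a uniform point of the unit ball is uniform on the unit sphere. *)
definition sphere_measure :: "(real ^ 'd) measure" where
  "sphere_measure = distr (uniform_measure lborel (cball 0 1)) borel sgn"

definition index_seq_measure :: "nat \<Rightarrow> (nat \<Rightarrow> nat) measure" where
  "index_seq_measure n = (\<Pi>\<^sub>M _\<in>UNIV. measure_pmf (pmf_of_set {1..n}))"

definition draws_measure :: "nat \<Rightarrow> (nat \<Rightarrow> 'd::finite draws) measure" where
  "draws_measure n =
     (\<Pi>\<^sub>M _\<in>UNIV. index_seq_measure n \<Otimes>\<^sub>M index_seq_measure n \<Otimes>\<^sub>M sphere_measure)"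

(* C * Lambda ^ 3 instantiates the factor hidden by the soft-O, with an absolute numerical constant.
   The constant is explicit because an existential one in a theorem about real ^ 'd could depend
   on the dimension. *)
definition log_factor :: "nat \<Rightarrow> nat \<Rightarrow> real \<Rightarrow> real \<Rightarrow> real \<Rightarrow> real \<Rightarrow> real" where
  "log_factor T d \<xi> L \<rho> \<epsilon> = ln (3 * real T * real d / \<xi>) + ln (L / sqrt (\<rho> * \<epsilon>))"

definition soft_O_const :: real where
  "soft_O_const = 10 ^ 15"

end

theory Submission
  imports Defs
begin

text \<open>
  Outside an event of probability at most \<open>\<xi>\<close>, at every iteration \<open>\<parallel>v\<^sub>t - \<nabla>F(x\<^sub>t)\<parallel> \<le> \<epsilon> / 10\<close>,
  \<open>\<parallel>U\<^sub>t - \<nabla>\<^sup>2F(x\<^sub>t)\<parallel> \<le> sqrt (\<rho> \<epsilon>) / 7\<close>, and the subsolver reaches its threshold unless the minimum of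
  the cubic model lies above twice that threshold.  The gradient error is a martingale between resets;
  the moment function \<open>cosh (r \<parallel>\<cdot>\<parallel>)\<close> grows under a centred bounded increment by at most a Gaussian
  factor, with no dependence on the dimension.  For the Hessian error the even trace moments of the sum
  are bounded by resampling one summand at a time, in place of a matrix Bernstein inequality.  For the
  subsolver, the random perturbation makes the component of the linear term along the bottom eigenvector
  not too small, so gradient descent cannot stay near a stationary point of negative curvature.

  On the good event an accepted step lowers \<open>F\<close> by \<open>\<rho>\<^sup>-\<^sup>1\<^sup>/\<^sup>2 \<epsilon>\<^sup>3\<^sup>/\<^sup>2 / 20 + \<rho> \<parallel>h\<^sub>t\<parallel>\<^sup>3 / 4\<close>.  The first term forces
  a stop before iteration \<open>T\<close>; the second bounds \<open>\<Sum> \<parallel>h\<^sub>t\<parallel>\<^sup>2\<close> and with it the adaptive batch sizes.  At the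
  stopping iteration the cubic model is bounded below, which bounds the negative curvature of \<open>U\<^sub>t\<close>, and
  the final solver returns a short step with small model gradient.
\<close>

section \<open>Symmetric matrices\<close>

text \<open>Lengths are measured in units of \<open>\<zeta> = sqrt (\<epsilon> / \<rho>)\<close> and
  function values in units of \<open>R = \<rho> * \<zeta> ^ 3\<close>; most constants come from
  inequalities in the ratio of a step length to \<zeta>. A step is accepted at model value
  \<open>- R / 6\<close>. The gradient and Hessian errors cost at most \<open>7 * R / 60\<close>
  plus a multiple of the cube of the step that the cubic term can pay, so \<open>R / 20\<close>
  survives. Two dependences shape the probabilistic part. The gradient batch size depends on the
  previous step, but in such a way that the variance added by one iteration is below a constant; a
  one-step bound valid for every past state can then be iterated. The perturbation enters after the
  model is fixed, so its failure is bounded with the model frozen. In dimension one the sphere has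
  two points and no anticoncentration; there the Cauchy point is already optimal if the linear term
  is nonzero. Gradient descent on the model is controlled by monotone norms: the regularised
  curvature, once almost nonnegative, stays so.\<close>

definition symmetric_matrix :: "real ^ 'n ^ 'n \<Rightarrow> bool" where
  "symmetric_matrix A \<longleftrightarrow> transpose A = A"

lemma symmetric_matrix_inner:
  "symmetric_matrix A \<Longrightarrow> (A *v x) \<bullet> y = x \<bullet> (A *v y)"
  by (metis dot_lmul_matrix inner_commute symmetric_matrix_def vector_transpose_matrix)

lemma symmetric_matrixI:
  assumes "\<And>x y. (A *v x) \<bullet> y = x \<bullet> (A *v (y :: real ^ 'n))"
  shows "symmetric_matrix A"
  unfolding symmetric_matrix_def
proof (rule matrix_eq[THEN iffD2], rule allI)
  fix x
  have "(transpose A *v x) \<bullet> y = (A *v x) \<bullet> y" for y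
    using assms[of x y] by (metis dot_lmul_matrix vector_transpose_matrix transpose_transpose)
  then show "transpose A *v x = A *v x"
    using vector_eq_rdot by blast
qed

text \<open>First-order optimality without derivatives: with a nonzero linear coefficient a small
  \<open>t\<close> of the opposite sign makes the quadratic negative. Adding 1 to \<open>g\<close>
  keeps the witness \<open>- a / (1 + g)\<close> meaningful for \<open>g = 0\<close>.\<close>

lemma linear_coeff_eq_0_of_quadratic_nonneg:
  fixes a g :: real
  assumes q: "\<And>t. 0 \<le> 2 * t * a + t\<^sup>2 * g" and g: "0 \<le> g"
  shows "a = 0"
proof (rule ccontr)
  assume "a \<noteq> 0"
  then have a: "a\<^sup>2 > 0" by simp
  define t where "t = - a / (1 + g)"
  have "2 * t * a + t\<^sup>2 * g = - (a\<^sup>2 * (2 + g)) / (1 + g)\<^sup>2"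
    using g by (simp add: t_def power_divide divide_simps) (simp add: power2_eq_square algebra_simps)
  also have "\<dots> < 0" using a g by (intro divide_neg_pos) auto
  finally show False using q[of t] by simp
qed

text \<open>A maximiser of the Rayleigh quotient on the compact unit sphere of \<open>V\<close>
  works. Its first-order condition makes \<open>m *\<^sub>R x - f x\<close> orthogonal to
  \<open>V\<close>; by invariance this residual lies in \<open>V\<close> and is orthogonal to
  itself.\<close>

lemma selfadjoint_max_eigenvector:
  fixes f :: "'a::euclidean_space \<Rightarrow> 'a"
  assumes lin: "linear f" and sa: "\<And>x y. f x \<bullet> y = x \<bullet> f y"
    and V: "subspace V" "f ` V \<subseteq> V" "V \<noteq> {0}"
  shows "\<exists>x m. x \<in> V \<and> norm x = 1 \<and> f x = m *\<^sub>R x"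
proof -
  interpret f: linear f by fact
  let ?K = "V \<inter> sphere 0 1"
  obtain v where v: "v \<in> V" "v \<noteq> 0"
    using V(1,3) subspace_0 by blast
  have "(1 / norm v) *\<^sub>R v \<in> ?K"
    using v V(1) by (simp add: subspace_scale)
  then have ne: "?K \<noteq> {}" by blast
  have cpt: "compact ?K"
    by (simp add: V(1) closed_subspace closed_Int_compact)
  have "continuous_on ?K (\<lambda>x. x \<bullet> f x)"
    by (intro continuous_intros linear_continuous_on linear_linear[THEN iffD2] lin linear_conv_bounded_linear[THEN iffD1])
  from continuous_attains_sup[OF cpt ne this]
  obtain x where x: "x \<in> ?K" and mx: "\<And>y. y \<in> ?K \<Longrightarrow> y \<bullet> f y \<le> x \<bullet> f x" by blast
  define m where "m = x \<bullet> f x"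
  have xV: "x \<in> V" and nx: "norm x = 1" and xx: "x \<bullet> x = 1"
    using x by (auto simp: norm_eq_1)
  have bound: "z \<bullet> f z \<le> m * (z \<bullet> z)" if "z \<in> V" for z
  proof (cases "z = 0")
    case False
    have "(1 / norm z) *\<^sub>R z \<in> ?K" using that V(1) False by (simp add: subspace_scale)
    from mx[OF this] have "(z \<bullet> f z) / (norm z)\<^sup>2 \<le> m"
      by (simp add: f.scale m_def power2_eq_square)
    then show ?thesis using False by (simp add: divide_le_eq dot_square_norm)
  qed (simp add: f.zero)
  have orth: "y \<bullet> (m *\<^sub>R x - f x) = 0" if y: "y \<in> V" for y
  proof -
    let ?a = "y \<bullet> (m *\<^sub>R x - f x)"
    let ?g = "m * (y \<bullet> y) - y \<bullet> f y"
    have g0: "0 \<le> ?g" using bound[OF y] by simp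
    have q: "0 \<le> 2 * t * ?a + t\<^sup>2 * ?g" for t
    proof -
      have "x + t *\<^sub>R y \<in> V" using xV y V(1) by (simp add: subspace_add subspace_scale)
      then have b: "(x + t *\<^sub>R y) \<bullet> f (x + t *\<^sub>R y) \<le> m * ((x + t *\<^sub>R y) \<bullet> (x + t *\<^sub>R y))"
        by (rule bound)
      have 1: "(x + t *\<^sub>R y) \<bullet> f (x + t *\<^sub>R y) = m + 2 * t * (y \<bullet> f x) + t\<^sup>2 * (y \<bullet> f y)"
        using sa[of x y] by (simp add: f.add f.scale inner_add_left inner_add_right m_def
            inner_commute[of "f x" y] power2_eq_square algebra_simps)
      have 2: "(x + t *\<^sub>R y) \<bullet> (x + t *\<^sub>R y) = 1 + 2 * t * (y \<bullet> x) + t\<^sup>2 * (y \<bullet> y)"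
        by (simp add: inner_add_left inner_add_right xx inner_commute[of x y] power2_eq_square algebra_simps)
      show ?thesis
        using b unfolding 1 2 by (simp add: inner_diff_right algebra_simps)
    qed
    show ?thesis by (rule linear_coeff_eq_0_of_quadratic_nonneg[OF q g0])
  qed
  have "m *\<^sub>R x - f x \<in> V" using xV V by (simp add: subspace_diff subspace_scale image_subset_iff)
  from orth[OF this] have "f x = m *\<^sub>R x" by simp
  then show ?thesis using xV nx by blast
qed

text \<open>Deflation: self-adjointness makes the part of \<open>V\<close> orthogonal to an
  eigenvector invariant again, and its dimension is smaller.\<close>

lemma selfadjoint_eigenbasis_subspace:
  fixes f :: "'a::euclidean_space \<Rightarrow> 'a"
  assumes lin: "linear f" and sa: "\<And>x y. f x \<bullet> y = x \<bullet> f y"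
  shows "subspace V \<Longrightarrow> f ` V \<subseteq> V \<Longrightarrow>
    \<exists>B. B \<subseteq> V \<and> pairwise orthogonal B \<and> (\<forall>b\<in>B. norm b = 1 \<and> (\<exists>l. f b = l *\<^sub>R b)) \<and> span B = V"
proof (induction "dim V" arbitrary: V rule: less_induct)
  case less
  interpret f: linear f by fact
  show ?case
  proof (cases "V = {0}")
    case True
    then show ?thesis by (intro exI[of _ "{}"]) auto
  next
    case False
    obtain x m where x: "x \<in> V" "norm x = 1" "f x = m *\<^sub>R x"
      using selfadjoint_max_eigenvector[OF lin sa less.prems False] by blast
    have xx: "x \<bullet> x = 1" using x(2) by (simp add: norm_eq_1)
    define W where "W = V \<inter> {y. x \<bullet> y = 0}"
    have W: "subspace W" unfolding W_def
      by (intro subspace_inter less.prems subspace_hyperplane)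
    have fW: "f ` W \<subseteq> W"
    proof
      fix z assume "z \<in> f ` W"
      then obtain y where y: "y \<in> V" "x \<bullet> y = 0" "z = f y" unfolding W_def by blast
      have "x \<bullet> f y = 0" using sa[of x y] x(3) y(2) by simp
      then show "z \<in> W" using y less.prems unfolding W_def by blast
    qed
    have "x \<notin> W" using xx by (simp add: W_def)
    then have "W \<subset> V" using x(1) unfolding W_def by blast
    then have "dim W < dim V"
      using W less.prems(1) by (metis dim_psubset span_eq_iff)
    from less.hyps[OF this W fW] obtain B where B: "B \<subseteq> W" "pairwise orthogonal B"
      "\<And>b. b \<in> B \<Longrightarrow> norm b = 1 \<and> (\<exists>l. f b = l *\<^sub>R b)" "span B = W" by blast
    have "span (insert x B) = V"
    proof
      show "span (insert x B) \<subseteq> V"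
        using B(1) x(1) less.prems(1) by (intro span_minimal) (auto simp: W_def)
      show "V \<subseteq> span (insert x B)"
      proof
        fix v assume v: "v \<in> V"
        have "v - (x \<bullet> v) *\<^sub>R x \<in> W"
          using v x(1) less.prems(1) xx by (simp add: W_def subspace_diff subspace_scale inner_diff_right)
        then show "v \<in> span (insert x B)"
          unfolding span_insert B(4) by blast
      qed
    qed
    moreover have "pairwise orthogonal (insert x B)"
      using B(1,2) by (auto simp: pairwise_insert orthogonal_def W_def inner_commute)
    moreover have "insert x B \<subseteq> V" using B(1) x(1) unfolding W_def by blast
    moreover have "\<forall>b\<in>insert x B. norm b = 1 \<and> (\<exists>l. f b = l *\<^sub>R b)"
      using B(3) x(2,3) by blast
    ultimately show ?thesis by blast
  qed
qed

text \<open>The eigenvectors are indexed by the coordinate type itself, so a full orthonormal basis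
  involves neither an enumeration nor an ordering of the eigenvalues.\<close>

definition eigenbasis :: "real ^ 'n ^ 'n \<Rightarrow> ('n \<Rightarrow> real ^ 'n) \<Rightarrow> ('n \<Rightarrow> real) \<Rightarrow> bool" where
  "eigenbasis A e l \<longleftrightarrow>
     (\<forall>i j. e i \<bullet> e j = (if i = j then 1 else 0)) \<and> (\<forall>i. A *v e i = l i *\<^sub>R e i)"

lemma symmetric_matrix_eigenbasis:
  fixes A :: "real ^ 'n ^ 'n"
  assumes "symmetric_matrix A"
  shows "\<exists>e l. eigenbasis A e l"
proof -
  obtain B where B: "pairwise orthogonal B"
    "\<And>b. b \<in> B \<Longrightarrow> norm b = 1 \<and> (\<exists>l. A *v b = l *\<^sub>R b)" "span B = UNIV"
    using selfadjoint_eigenbasis_subspace[OF matrix_vector_mul_linear[of A]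
        symmetric_matrix_inner[OF assms], of UNIV, OF subspace_UNIV subset_UNIV] by blast
  have "independent B"
  proof (rule pairwise_orthogonal_independent)
    show "0 \<notin> B"
    proof
      assume "0 \<in> B"
      then have "norm (0 :: real ^ 'n) = 1" using B(2) by blast
      then show False by simp
    qed
  qed (rule B(1))
  then have "card B = CARD('n)" "finite B"
    using dim_span_eq_card_independent[of B] B(3) independent_imp_finite[of B] by (auto simp: dim_UNIV)
  then obtain e where e: "bij_betw e (UNIV :: 'n set) B"
    using finite_same_card_bij[OF finite[of "UNIV :: 'n set"]] by metis
  then have eB: "e i \<in> B" for i by (auto simp: bij_betw_def)
  have "\<forall>i. \<exists>l. A *v e i = l *\<^sub>R e i" using B(2) eB by blast
  then obtain l where l: "\<And>i. A *v e i = l i *\<^sub>R e i" by metis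
  have "e i \<bullet> e j = (if i = j then 1 else 0)" for i j
  proof (cases "i = j")
    case False
    then have "e i \<noteq> e j" using e by (meson bij_betw_def injD)
    then show ?thesis using B(1) eB False by (auto simp: pairwise_def orthogonal_def)
  qed (use B(2) eB norm_eq_1 in auto)
  then show ?thesis using l unfolding eigenbasis_def by blast
qed

text \<open>The residual of the expansion is orthogonal to every \<open>e i\<close>; these span the
  space, so it is orthogonal to itself.\<close>

lemma orthonormal_expansion:
  fixes e :: "'n::finite \<Rightarrow> real ^ 'n"
  assumes on: "\<And>i j. e i \<bullet> e j = (if i = j then 1 else 0)"
  shows "x = (\<Sum>i\<in>UNIV. (x \<bullet> e i) *\<^sub>R e i)"
proof -
  have inj: "inj e"
  proof (rule injI)
    fix i j assume "e i = e j"
    then have "e i \<bullet> e j = 1" using on[of i i] by simp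
    then show "i = j" using on[of i j] by (simp split: if_splits)
  qed
  have "pairwise orthogonal (range e)"
    using on by (auto simp: pairwise_def orthogonal_def)
  moreover have "0 \<notin> range e" using on by (metis (no_types, lifting) imageE inner_zero_left zero_neq_one)
  ultimately have "independent (range e)" by (rule pairwise_orthogonal_independent)
  moreover have "card (range e) = CARD('n)" using inj by (simp add: card_image)
  ultimately have "span (range e) = UNIV"
    using card_eq_dim[of "range e" UNIV] by (auto simp: dim_UNIV)
  then have "x - (\<Sum>i\<in>UNIV. (x \<bullet> e i) *\<^sub>R e i) \<in> span (range e)" by simp
  moreover have "orthogonal (x - (\<Sum>i\<in>UNIV. (x \<bullet> e i) *\<^sub>R e i)) y" if "y \<in> range e" for y
    using that
    by (auto simp: orthogonal_def inner_diff_left inner_sum_left on if_distrib[of "\<lambda>u. _ * u"] cong: if_cong)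
  ultimately have "orthogonal (x - (\<Sum>i\<in>UNIV. (x \<bullet> e i) *\<^sub>R e i)) (x - (\<Sum>i\<in>UNIV. (x \<bullet> e i) *\<^sub>R e i))"
    by (meson orthogonal_to_span)
  then show ?thesis by (simp add: orthogonal_self)
qed

lemma orthonormal_inner:
  fixes e :: "'n::finite \<Rightarrow> real ^ 'n"
  assumes on: "\<And>i j. e i \<bullet> e j = (if i = j then 1 else 0)"
  shows "x \<bullet> y = (\<Sum>i\<in>UNIV. (x \<bullet> e i) * (y \<bullet> e i))"
proof -
  have "x \<bullet> y = (\<Sum>i\<in>UNIV. (x \<bullet> e i) *\<^sub>R e i) \<bullet> y"
    using orthonormal_expansion[OF on, of x] by simp
  also have "\<dots> = (\<Sum>i\<in>UNIV. (x \<bullet> e i) * (y \<bullet> e i))"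
    by (simp only: inner_sum_left inner_scaleR_left inner_commute[of "e _" y])
  finally show ?thesis .
qed

context
  fixes A :: "real ^ 'n ^ 'n" and e l
  assumes eb: "eigenbasis A e l"
begin

lemma eigenbasis_orthonormal: "e i \<bullet> e j = (if i = j then 1 else 0)"
  using eb by (simp add: eigenbasis_def)

lemma eigenbasis_eigenvector: "A *v e i = l i *\<^sub>R e i"
  using eb by (simp add: eigenbasis_def)

lemmas eigenbasis_expansion = orthonormal_expansion[of e, OF eigenbasis_orthonormal]
lemmas eigenbasis_inner = orthonormal_inner[of e, OF eigenbasis_orthonormal]

lemma eigenbasis_norm: "norm (e i) = 1"
  using eigenbasis_orthonormal[of i i] by (simp add: norm_eq_1)

lemma eigenbasis_norm_power2: "(norm x)\<^sup>2 = (\<Sum>i\<in>UNIV. (x \<bullet> e i)\<^sup>2)"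
  using eigenbasis_inner[of x x] by (simp only: power2_norm_eq_inner) (simp only: power2_eq_square)

lemma eigenbasis_apply_inner: "(A *v x) \<bullet> e i = l i * (x \<bullet> e i)"
proof -
  have "A *v x = (\<Sum>j\<in>UNIV. (x \<bullet> e j) *\<^sub>R (A *v e j))"
    by (subst eigenbasis_expansion[of x])
      (simp only: linear_sum[OF matrix_vector_mul_linear] matrix_vector_mult_scaleR)
  then show ?thesis
    by (simp add: inner_sum_left eigenbasis_eigenvector eigenbasis_orthonormal if_distrib cong: if_cong)
qed

lemma eigenbasis_quadratic: "x \<bullet> (A *v x) = (\<Sum>i\<in>UNIV. l i * (x \<bullet> e i)\<^sup>2)"
  by (subst eigenbasis_inner) (simp add: eigenbasis_apply_inner power2_eq_square algebra_simps)

lemma eigenbasis_eigenvalues: "{c. \<exists>v. v \<noteq> 0 \<and> A *v v = c *\<^sub>R v} = range l"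
proof (intro equalityI subsetI)
  fix c assume "c \<in> {c. \<exists>v. v \<noteq> 0 \<and> A *v v = c *\<^sub>R v}"
  then obtain v where v: "v \<noteq> 0" "A *v v = c *\<^sub>R v" by blast
  have "\<exists>i. v \<bullet> e i \<noteq> 0"
  proof (rule ccontr)
    assume "\<not> ?thesis"
    then have "v = 0" using eigenbasis_expansion[of v] by simp
    then show False using v(1) by simp
  qed
  then obtain i where i: "v \<bullet> e i \<noteq> 0" by blast
  then show "c \<in> range l" using eigenbasis_apply_inner[of v i] v(2) by auto
next
  fix c assume "c \<in> range l"
  then obtain i where "c = l i" by blast
  moreover have "e i \<noteq> 0" using eigenbasis_norm[of i] by auto
  ultimately show "c \<in> {c. \<exists>v. v \<noteq> 0 \<and> A *v v = c *\<^sub>R v}"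
    using eigenbasis_eigenvector by blast
qed

lemma eigenbasis_lambda_min: "lambda_min A = Min (range l)"
  unfolding lambda_min_def eigenbasis_eigenvalues ..

lemma eigenbasis_lambda_min_le: "lambda_min A \<le> l i"
  by (simp add: eigenbasis_lambda_min)

lemma eigenbasis_lambda_min_attained: "\<exists>i. l i = lambda_min A"
proof -
  have "Min (range l) \<in> range l" by (intro Min_in) auto
  then show ?thesis unfolding eigenbasis_lambda_min by (metis imageE)
qed

end

lemma lambda_min_le_quadratic:
  assumes "symmetric_matrix A"
  shows "lambda_min A * (norm x)\<^sup>2 \<le> x \<bullet> (A *v x)"
proof -
  obtain e l where eb: "eigenbasis A e l" using symmetric_matrix_eigenbasis[OF assms] by blast
  show ?thesis
    unfolding eigenbasis_quadratic[OF eb] eigenbasis_norm_power2[OF eb] sum_distrib_left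
    by (intro sum_mono mult_right_mono eigenbasis_lambda_min_le[OF eb]) auto
qed

lemma lambda_min_eigenvector:
  assumes "symmetric_matrix A"
  shows "\<exists>v. norm v = 1 \<and> A *v v = lambda_min A *\<^sub>R v"
proof -
  obtain e l where eb: "eigenbasis A e l" using symmetric_matrix_eigenbasis[OF assms] by blast
  obtain i where "l i = lambda_min A" using eigenbasis_lambda_min_attained[OF eb] by blast
  then show ?thesis using eigenbasis_norm[OF eb] eigenbasis_eigenvector[OF eb] by metis
qed

lemma spectral_norm_apply: "norm (A *v x) \<le> spectral_norm A * norm x"
  unfolding spectral_norm_def
  by (rule onorm) (simp add: linear_conv_bounded_linear[symmetric])

lemma spectral_norm_le:
  assumes "\<And>x. norm (A *v x) \<le> c * norm x"
  shows "spectral_norm A \<le> c"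
  unfolding spectral_norm_def by (rule onorm_le) (rule assms)

lemma quadratic_le_spectral_norm: "\<bar>x \<bullet> (A *v x)\<bar> \<le> spectral_norm A * (norm x)\<^sup>2"
proof -
  have "\<bar>x \<bullet> (A *v x)\<bar> \<le> norm x * norm (A *v x)" by (rule Cauchy_Schwarz_ineq2)
  also have "\<dots> \<le> norm x * (spectral_norm A * norm x)"
    by (intro mult_left_mono spectral_norm_apply) auto
  finally show ?thesis by (simp add: power2_eq_square mult_ac)
qed

text \<open>Weyl's perturbation bound: a unit bottom eigenvector of \<open>A\<close> is the test
  vector in the quadratic form of \<open>B\<close>.\<close>

lemma lambda_min_diff_le:
  fixes A B :: "real ^ 'n ^ 'n"
  assumes "symmetric_matrix A" "symmetric_matrix B"
  shows "lambda_min A \<ge> lambda_min B - spectral_norm (A - B)"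
proof -
  obtain v where v: "norm v = 1" "A *v v = lambda_min A *\<^sub>R v"
    using lambda_min_eigenvector[OF assms(1)] by blast
  have "lambda_min A = v \<bullet> (A *v v)" using v by (simp add: norm_eq_1)
  also have "\<dots> = v \<bullet> (B *v v) + v \<bullet> ((A - B) *v v)"
    by (simp add: matrix_vector_mult_diff_rdistrib inner_diff_right)
  also have "\<dots> \<ge> lambda_min B - spectral_norm (A - B)"
    using lambda_min_le_quadratic[OF assms(2), of v] quadratic_le_spectral_norm[of v "A - B"] v(1) by simp
  finally show ?thesis .
qed

section \<open>Gradient descent on the cubic model\<close>

text \<open>An identity rather than an estimate: the last summand is the exact remainder of the
  cubic norm term, nonnegative for \<open>\<tau> \<ge> 0\<close>. It can therefore be used for upper
  bounds (one descent step) and for lower bounds (around an almost stationary point).\<close>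

lemma cubic_expansion:
  assumes "symmetric_matrix A"
  shows "cubic A b \<tau> y = cubic A b \<tau> x + cubic_grad A b \<tau> x \<bullet> (y - x)
    + ((y - x) \<bullet> (A *v (y - x)) + \<tau> / 2 * norm x * (norm (y - x))\<^sup>2) / 2
    + \<tau> / 12 * (norm y - norm x)\<^sup>2 * (2 * norm y + norm x)"
proof -
  define X Y p where "X = norm x" and "Y = norm y" and "p = x \<bullet> y"
  have n: "x \<bullet> x = X\<^sup>2" "y \<bullet> y = Y\<^sup>2" by (simp_all add: X_def Y_def dot_square_norm)
  have "(norm (y - x))\<^sup>2 = Y\<^sup>2 - 2 * p + X\<^sup>2"
    by (simp add: power2_norm_eq_inner inner_diff_left inner_diff_right n p_def inner_commute[of y x])
  moreover have "(y - x) \<bullet> (A *v (y - x)) = y \<bullet> (A *v y) - 2 * ((A *v x) \<bullet> y) + x \<bullet> (A *v x)"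
    using symmetric_matrix_inner[OF assms, of x y]
    by (simp add: matrix_vector_mult_diff_distrib inner_diff_left inner_diff_right inner_commute[of y "A *v x"])
  moreover have "cubic_grad A b \<tau> x \<bullet> (y - x)
      = b \<bullet> y - b \<bullet> x + (A *v x) \<bullet> y - x \<bullet> (A *v x) + (\<tau> / 2 * X) * (p - X\<^sup>2)"
    by (simp add: cubic_grad_def inner_diff_right inner_add_left n p_def X_def[symmetric]
        inner_commute[of "A *v x" x] algebra_simps)
  moreover have "cubic A b \<tau> x = b \<bullet> x + (x \<bullet> (A *v x)) / 2 + \<tau> / 6 * X ^ 3"
    "cubic A b \<tau> y = b \<bullet> y + (y \<bullet> (A *v y)) / 2 + \<tau> / 6 * Y ^ 3"
    by (simp_all add: cubic_def X_def Y_def)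
  ultimately show ?thesis
    unfolding X_def[symmetric] Y_def[symmetric]
    by (simp only:) (simp add: field_simps power2_eq_square power3_eq_cube)
qed

lemma cauchy_point_zero [simp]: "cauchy_point A 0 \<tau> = 0"
  by (simp add: cauchy_point_def)

lemma cubic_zero [simp]: "cubic A b \<tau> 0 = 0"
  by (simp add: cubic_def)

text \<open>\<open>R\<close> is the nonnegative root of the stationarity equation of the cubic along
  the ray through \<open>- b\<close>; in the estimates this quadratic equation replaces the explicit
  square root.\<close>

lemma cauchy_point_radius:
  assumes \<tau>: "\<tau> > 0" and b: "b \<noteq> 0"
  obtains R where "R \<ge> 0" "cauchy_point A b \<tau> = - ((R / norm b) *\<^sub>R b)"
    "\<tau> / 2 * R\<^sup>2 + (b \<bullet> (A *v b)) / (norm b)\<^sup>2 * R = norm b"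
proof -
  define r where "r = (b \<bullet> (A *v b)) / (\<tau> * (norm b)\<^sup>2)"
  define R where "R = - r + sqrt (r\<^sup>2 + 2 * norm b / \<tau>)"
  have nn: "0 \<le> 2 * norm b / \<tau>" using \<tau> by simp
  have "\<bar>r\<bar> \<le> sqrt (r\<^sup>2 + 2 * norm b / \<tau>)"
    using nn by (intro real_le_rsqrt) simp
  then have R0: "R \<ge> 0" by (simp add: R_def)
  have "(R + r)\<^sup>2 = r\<^sup>2 + 2 * norm b / \<tau>"
    using nn by (simp add: R_def)
  then have "R\<^sup>2 + 2 * r * R = 2 * norm b / \<tau>"
    by (simp add: power2_eq_square algebra_simps)
  then have "\<tau> / 2 * (R\<^sup>2 + 2 * r * R) = norm b" using \<tau> by simp
  moreover have "(b \<bullet> (A *v b)) / (norm b)\<^sup>2 = \<tau> * r" using \<tau> by (simp add: r_def)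
  ultimately have "\<tau> / 2 * R\<^sup>2 + (b \<bullet> (A *v b)) / (norm b)\<^sup>2 * R = norm b"
    by (simp add: algebra_simps)
  moreover have "cauchy_point A b \<tau> = - ((R / norm b) *\<^sub>R b)"
    using b by (simp add: cauchy_point_def R_def r_def Let_def)
  ultimately show ?thesis using that R0 by blast
qed

text \<open>The stationarity equation eliminates the curvature \<open>b \<bullet> (A *v b)\<close>
  from the value and says that the derivative along \<open>b\<close> vanishes.\<close>

lemma cubic_along_ray:
  assumes b: "b \<noteq> 0" and R: "R \<ge> 0"
    and eq: "\<tau> / 2 * R\<^sup>2 + (b \<bullet> (A *v b)) / (norm b)\<^sup>2 * R = norm b"
  shows "cubic A b \<tau> (- ((R / norm b) *\<^sub>R b)) = - norm b * R / 2 - \<tau> * R ^ 3 / 12"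
    and "cubic_grad A b \<tau> (- ((R / norm b) *\<^sub>R b)) \<bullet> b = 0"
proof -
  define k where "k = (b \<bullet> (A *v b)) / (norm b)\<^sup>2"
  have kk: "b \<bullet> (A *v b) = k * (norm b)\<^sup>2" using b by (simp add: k_def)
  have nb: "norm b = \<tau> / 2 * R\<^sup>2 + k * R" using eq by (simp add: k_def)
  let ?x = "- ((R / norm b) *\<^sub>R b)"
  have nx: "norm ?x = R" using b R by simp
  have Ax: "A *v ?x = - ((R / norm b) *\<^sub>R (A *v b))"
    by (metis matrix_vector_mult_scaleR scaleR_minus_left)
  have 1: "b \<bullet> ?x = - (R * norm b)"
    using b by (simp add: dot_square_norm power2_eq_square)
  have 2: "?x \<bullet> (A *v ?x) = k * R\<^sup>2"
    using b unfolding Ax by (simp add: kk power2_eq_square)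
  have "cubic A b \<tau> ?x = - (R * norm b) + k * R\<^sup>2 / 2 + \<tau> / 6 * R ^ 3"
    unfolding cubic_def 1 2 nx ..
  also have "\<dots> = - norm b * R / 2 - \<tau> * R ^ 3 / 12 + R / 2 * (\<tau> / 2 * R\<^sup>2 + k * R - norm b)"
    by (simp add: power2_eq_square power3_eq_cube field_simps)
  finally show "cubic A b \<tau> ?x = - norm b * R / 2 - \<tau> * R ^ 3 / 12"
    using nb by simp
  have "cubic_grad A b \<tau> ?x \<bullet> b = (norm b)\<^sup>2 - (R / norm b) * (k * (norm b)\<^sup>2)
      - \<tau> / 2 * R * (R / norm b) * (norm b)\<^sup>2"
    unfolding cubic_grad_def nx
    by (simp only: inner_add_left Ax inner_minus_left inner_scaleR_left dot_square_norm kk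
        inner_commute[of "A *v b" b] scaleR_minus_right)
  also have "\<dots> = norm b * (norm b - (\<tau> / 2 * R\<^sup>2 + k * R))"
    using b by (simp add: power2_eq_square field_simps)
  finally show "cubic_grad A b \<tau> ?x \<bullet> b = 0" using nb by simp
qed

lemma cauchy_point_cubic_le:
  assumes \<tau>: "\<tau> > 0"
  shows "cubic A b \<tau> (cauchy_point A b \<tau>) \<le> - \<tau> * norm (cauchy_point A b \<tau>) ^ 3 / 12"
proof (cases "b = 0")
  case False
  obtain R where R: "R \<ge> 0" "cauchy_point A b \<tau> = - ((R / norm b) *\<^sub>R b)"
    "\<tau> / 2 * R\<^sup>2 + (b \<bullet> (A *v b)) / (norm b)\<^sup>2 * R = norm b"
    using cauchy_point_radius[OF \<tau> False] by blast
  have "norm (cauchy_point A b \<tau>) = R" using R False by simp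
  then show ?thesis using cubic_along_ray(1)[OF False R(1,3)] R(1,2) by simp
qed simp

lemma power3_le_cancel:
  fixes a b :: real assumes "a ^ 3 \<le> b ^ 3" "0 \<le> b" shows "a \<le> b"
  using power_mono_iff[of _ _ 3] assms by (metis linorder_le_cases power_strict_mono not_le zero_less_numeral)

text \<open>A Cauchy point that is not deep has radius at most \<zeta>, because its value is at most
  \<open>- \<tau> * R ^ 3 / 12\<close>; the radius equation turns this into a bound on
  \<open>b\<close>. Gradient descent after a failed Cauchy point thus starts with a bounded linear
  term.\<close>

lemma cauchy_point_shallow_norm_le:
  assumes \<tau>: "\<tau> > 0" and \<zeta>: "\<zeta> > 0" and small: "\<tau> * \<zeta> \<le> 2 * L"
    and A: "\<And>x. norm (A *v x) \<le> L * norm x"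
    and shallow: "cubic A b \<tau> (cauchy_point A b \<tau>) > - \<tau> * \<zeta> ^ 3 / 12"
  shows "norm b \<le> 2 * L * \<zeta>"
proof (cases "b = 0")
  case True
  then show ?thesis using \<tau> \<zeta> small by (simp add: zero_le_mult_iff) (smt (verit) mult_pos_pos)
next
  case False
  obtain R where R: "R \<ge> 0" "cauchy_point A b \<tau> = - ((R / norm b) *\<^sub>R b)"
    "\<tau> / 2 * R\<^sup>2 + (b \<bullet> (A *v b)) / (norm b)\<^sup>2 * R = norm b"
    using cauchy_point_radius[OF \<tau> False] by blast
  have "norm (cauchy_point A b \<tau>) = R" using R False by simp
  then have "\<tau> * R ^ 3 < \<tau> * \<zeta> ^ 3" using cauchy_point_cubic_le[OF \<tau>, of A b] shallow by simp
  then have "R ^ 3 < \<zeta> ^ 3" using \<tau> by simp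
  then have R\<zeta>: "R \<le> \<zeta>" using power3_le_cancel[of R \<zeta>] \<zeta> by simp
  have "b \<bullet> (A *v b) \<le> norm b * (L * norm b)"
    by (meson A norm_cauchy_schwarz mult_left_mono norm_ge_zero order_trans)
  then have "(b \<bullet> (A *v b)) / (norm b)\<^sup>2 \<le> L" using False by (simp add: divide_le_eq power2_eq_square mult_ac)
  then have "(b \<bullet> (A *v b)) / (norm b)\<^sup>2 * R \<le> L * R" using R(1) by (rule mult_right_mono)
  moreover have "\<tau> / 2 * R\<^sup>2 \<le> \<tau> / 2 * (\<zeta> * R)"
    using R\<zeta> R(1) \<tau> by (simp add: power2_eq_square mult_right_mono)
  moreover have "\<tau> / 2 * (\<zeta> * R) = (\<tau> * \<zeta>) * R / 2" by simp
  moreover have "(\<tau> * \<zeta>) * R \<le> (2 * L) * R" using small R(1) by (rule mult_right_mono)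
  ultimately have "norm b \<le> 2 * L * R" using R(3) by linarith
  also have "\<dots> \<le> 2 * L * \<zeta>"
    using R\<zeta> \<tau> \<zeta> small by (intro mult_left_mono) (auto, smt (verit) mult_pos_pos)
  finally show ?thesis .
qed

section \<open>Gradient descent iterates: invariant ball, monotone norm, descent\<close>

definition cubic_gd :: "real ^ 'n ^ 'n \<Rightarrow> real ^ 'n \<Rightarrow> real \<Rightarrow> real \<Rightarrow> nat \<Rightarrow> real ^ 'n \<Rightarrow> real ^ 'n" where
  "cubic_gd A b \<tau> \<eta> t x = ((\<lambda>x. x - \<eta> *\<^sub>R cubic_grad A b \<tau> x) ^^ t) x"

lemma cubic_gd_0 [simp]: "cubic_gd A b \<tau> \<eta> 0 x = x"
  and cubic_gd_Suc: "cubic_gd A b \<tau> \<eta> (Suc t) x =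
    cubic_gd A b \<tau> \<eta> t x - \<eta> *\<^sub>R cubic_grad A b \<tau> (cubic_gd A b \<tau> \<eta> t x)"
  and cubic_gd_Suc_shift: "cubic_gd A b \<tau> \<eta> (Suc t) x =
    cubic_gd A b \<tau> \<eta> t (x - \<eta> *\<^sub>R cubic_grad A b \<tau> x)"
proof -
  let ?f = "\<lambda>x. x - \<eta> *\<^sub>R cubic_grad A b \<tau> x"
  show "cubic_gd A b \<tau> \<eta> (Suc t) x = cubic_gd A b \<tau> \<eta> t x - \<eta> *\<^sub>R cubic_grad A b \<tau> (cubic_gd A b \<tau> \<eta> t x)"
    by (simp add: cubic_gd_def)
  show "cubic_gd A b \<tau> \<eta> (Suc t) x = cubic_gd A b \<tau> \<eta> t (x - \<eta> *\<^sub>R cubic_grad A b \<tau> x)"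
    using funpow_swap1[of ?f t x] by (simp add: cubic_gd_def)
qed (simp add: cubic_gd_def)

lemma subsolver_loop_cost: "snd (subsolver_loop A b b' \<tau> \<eta> thr k x) \<le> 2 * k"
  by (induction k arbitrary: x) (auto simp: Let_def split: prod.split, metis snd_conv)

text \<open>The start point is not tested inside the loop, hence \<open>1 \<le> t\<close>. The
  iterates do not depend on the test, so a good iterate within the budget forces a return at that
  point or at an earlier one that passed.\<close>

lemma subsolver_loop_success:
  assumes "1 \<le> t" "t \<le> k" "cubic A b \<tau> (cubic_gd A b' \<tau> \<eta> t x) \<le> thr"
  shows "cubic A b \<tau> (fst (subsolver_loop A b b' \<tau> \<eta> thr k x)) \<le> thr"
  using assms
proof (induction k arbitrary: x t)
  case (Suc k)
  let ?y = "x - \<eta> *\<^sub>R cubic_grad A b' \<tau> x"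
  show ?case
  proof (cases "cubic A b \<tau> ?y \<le> thr")
    case False
    obtain t' where t': "t = Suc t'" using Suc.prems(1) by (cases t) auto
    have *: "cubic A b \<tau> (cubic_gd A b' \<tau> \<eta> t' ?y) \<le> thr"
      using Suc.prems(3) by (simp add: t' cubic_gd_Suc_shift)
    then have "t' \<noteq> 0" using False by (intro notI) simp
    then have "cubic A b \<tau> (fst (subsolver_loop A b b' \<tau> \<eta> thr k ?y)) \<le> thr"
      using Suc.IH[OF _ _ *] Suc.prems(2) t' by simp
    then show ?thesis using False by (simp add: Let_def case_prod_beta)
  qed (simp add: Let_def)
qed simp

text \<open>The bound on \<open>b\<close> is what a shallow Cauchy point provides:
  \<open>norm b \<le> 2 * L * \<zeta>\<close> and \<open>\<tau> * \<zeta> \<le> 2 * L\<close> give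
  \<open>4 * L\<^sup>2\<close>, and the remaining tenth leaves room for the perturbation.\<close>

locale cubic_descent =
  fixes A :: "real ^ 'n ^ 'n" and b :: "real ^ 'n" and \<tau> L :: real
    and e :: "'n \<Rightarrow> real ^ 'n" and l :: "'n \<Rightarrow> real"
  assumes sym: "symmetric_matrix A" and eb: "eigenbasis A e l"
    and \<tau>: "\<tau> > 0" and L: "L > 0"
    and A_bound: "\<And>x. norm (A *v x) \<le> L * norm x"
    and b_bound: "\<tau> * norm b \<le> 41 / 10 * L\<^sup>2"
begin

definition \<eta> where "\<eta> = 1 / (16 * L)"

definition x where "x t = cubic_gd A b \<tau> \<eta> t (cauchy_point A b \<tau>)"

lemma x_0: "x 0 = cauchy_point A b \<tau>"
  and x_Suc: "x (Suc t) = x t - \<eta> *\<^sub>R cubic_grad A b \<tau> (x t)"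
  by (simp_all add: x_def cubic_gd_Suc)

lemma \<eta>: "\<eta> > 0" and \<eta>L: "\<eta> * L = 1 / 16"
  using L by (simp_all add: \<eta>_def)

lemma eigenvalue_bound: "\<bar>l i\<bar> \<le> L"
proof -
  have "norm (A *v e i) = \<bar>l i\<bar>"
    using eigenbasis_eigenvector[OF eb, of i] eigenbasis_norm[OF eb, of i] by simp
  then show ?thesis using A_bound[of "e i"] eigenbasis_norm[OF eb, of i] by simp
qed

lemma cauchy_scale: "\<exists>c\<ge>0. x 0 = - (c *\<^sub>R b)"
proof (cases "b = 0")
  case True
  then have "x 0 = 0" using x_0 cauchy_point_zero by metis
  then show ?thesis by (intro exI[of _ 0]) simp
next
  case False
  then show ?thesis using cauchy_point_radius[OF \<tau> False, of A] unfolding x_0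
    by (metis divide_nonneg_nonneg norm_ge_zero)
qed

text \<open>In \<open>w = \<tau> * R\<close> the radius equation yields
  \<open>w\<^sup>2 - 2 * L * w \<le> 82 / 10 * L\<^sup>2\<close>, which fails beyond
  \<open>5 * L\<close>.\<close>

lemma norm_x_0: "\<tau> * norm (x 0) \<le> 5 * L"
proof (cases "b = 0")
  case True
  then have "x 0 = 0" using x_0 cauchy_point_zero by metis
  then show ?thesis using L by simp
next
  case False
  obtain R where R: "R \<ge> 0" "cauchy_point A b \<tau> = - ((R / norm b) *\<^sub>R b)"
    "\<tau> / 2 * R\<^sup>2 + (b \<bullet> (A *v b)) / (norm b)\<^sup>2 * R = norm b"
    using cauchy_point_radius[OF \<tau> False] by blast
  have nR: "norm (x 0) = R" using R False by (simp add: x_0)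
  have "- (b \<bullet> (A *v b)) \<le> norm b * (L * norm b)"
    using Cauchy_Schwarz_ineq2[of b "A *v b"] mult_left_mono[OF A_bound[of b] norm_ge_zero[of b]] by linarith
  then have "- L \<le> (b \<bullet> (A *v b)) / (norm b)\<^sup>2"
    using False by (simp add: le_divide_eq power2_eq_square mult_ac)
  then have "- L * R \<le> (b \<bullet> (A *v b)) / (norm b)\<^sup>2 * R" using R(1) by (rule mult_right_mono)
  then have "\<tau> / 2 * R\<^sup>2 - L * R \<le> norm b" using R(3) by linarith
  then have "\<tau> * (\<tau> / 2 * R\<^sup>2 - L * R) \<le> 41 / 10 * L\<^sup>2"
    using \<tau> b_bound by (meson mult_left_mono less_imp_le order_trans)
  then have 1: "(\<tau> * R)\<^sup>2 - 2 * L * (\<tau> * R) \<le> 82 / 10 * L\<^sup>2"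
    by (simp add: power2_eq_square algebra_simps)
  show ?thesis
  proof (rule ccontr)
    assume "\<not> ?thesis"
    then have w: "\<tau> * R > 5 * L" by (simp add: nR)
    have "0 \<le> (\<tau> * R - 5 * L) * (\<tau> * R + 3 * L)" using w L by simp
    then have "15 * L\<^sup>2 \<le> (\<tau> * R)\<^sup>2 - 2 * L * (\<tau> * R)"
      by (simp add: power2_eq_square algebra_simps)
    moreover have "0 < L\<^sup>2" using L by simp
    ultimately show False using 1 by linarith
  qed
qed

text \<open>The ball of radius \<open>5 * L / \<tau>\<close> is invariant: the cubic damping
  contributes \<open>- w\<^sup>2 / (32 * L)\<close>, and
  \<open>(5 * L - w) * (29 * L - w) \<ge> 0\<close> bounds the quadratic in \<open>w\<close> that
  remains.\<close>

lemma norm_x_bound: "\<tau> * norm (x t) \<le> 5 * L"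
proof (induction t)
  case (Suc t)
  define w where "w = \<tau> * norm (x t)"
  have w: "0 \<le> w" "w \<le> 5 * L" using Suc \<tau> by (simp_all add: w_def)
  have d: "1 - \<eta> * w / 2 \<ge> 0"
    using w L by (simp add: \<eta>_def field_simps)
  have eq: "x (Suc t) = (1 - \<eta> * w / 2) *\<^sub>R x t - \<eta> *\<^sub>R (A *v x t) - \<eta> *\<^sub>R b"
    by (simp add: x_Suc cubic_grad_def w_def algebra_simps)
  have "norm (x (Suc t)) \<le> norm ((1 - \<eta> * w / 2) *\<^sub>R x t) + norm (\<eta> *\<^sub>R (A *v x t)) + norm (\<eta> *\<^sub>R b)"
    unfolding eq by (intro order_trans[OF norm_triangle_ineq4] add_right_mono) simp
  also have "\<dots> \<le> (1 - \<eta> * w / 2) * norm (x t) + \<eta> * (L * norm (x t)) + \<eta> * norm b"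
    using d \<eta> A_bound[of "x t"] by simp
  finally have "\<tau> * norm (x (Suc t)) \<le> \<tau> * ((1 - \<eta> * w / 2) * norm (x t) + \<eta> * (L * norm (x t)) + \<eta> * norm b)"
    using \<tau> by simp
  also have "\<dots> = (1 - \<eta> * w / 2) * w + (\<eta> * L) * w + \<eta> * (\<tau> * norm b)"
    by (simp add: w_def algebra_simps)
  also have "\<dots> \<le> (1 - \<eta> * w / 2) * w + 1 / 16 * w + \<eta> * (41 / 10 * L\<^sup>2)"
    using b_bound \<eta> by (simp add: \<eta>L)
  also have "\<dots> = (34 * L * w - w\<^sup>2 + 82 / 10 * L\<^sup>2) / (32 * L)"
    using L by (simp add: \<eta>_def field_simps power2_eq_square)
  also have "\<dots> \<le> 5 * L"
  proof -
    have "0 \<le> (5 * L - w) * (29 * L - w)" using w L by simp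
    then have "34 * L * w - w\<^sup>2 \<le> 145 * L\<^sup>2" by (simp add: power2_eq_square algebra_simps)
    moreover have "0 \<le> L\<^sup>2" by simp
    ultimately have "34 * L * w - w\<^sup>2 + 82 / 10 * L\<^sup>2 \<le> 160 * L\<^sup>2" by linarith
    then show ?thesis using L by (simp add: divide_le_eq power2_eq_square)
  qed
  finally show ?case .
qed (rule norm_x_0)

text \<open>The factor that one step applies to the \<open>i\<close>-th eigencoordinate, apart from
  the constant drift caused by \<open>b\<close>. The current norm enters as a shift common to all
  coordinates.\<close>

definition D where "D t i = 1 - \<eta> * (l i + \<tau> / 2 * norm (x t))"

lemma D_lower: "D t i \<ge> 3 / 4" and D_antimono: "l i \<le> l j \<Longrightarrow> D t j \<le> D t i"
proof -
  have "\<eta> * (l i + \<tau> / 2 * norm (x t)) \<le> \<eta> * (L + 5 / 2 * L)"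
    using norm_x_bound[of t] eigenvalue_bound[of i] \<eta> by (intro mult_left_mono) linarith+
  also have "\<dots> = 7 / 32" using L by (simp add: \<eta>_def field_simps)
  finally show "D t i \<ge> 3 / 4" by (simp add: D_def)
  show "l i \<le> l j \<Longrightarrow> D t j \<le> D t i" using \<eta> by (simp add: D_def)
qed

lemma x_Suc_coord: "x (Suc t) \<bullet> e i = D t i * (x t \<bullet> e i) - \<eta> * (b \<bullet> e i)"
  by (simp add: x_Suc cubic_grad_def D_def inner_diff_left inner_add_left eigenbasis_apply_inner[OF eb]
      algebra_simps)

definition c0 where "c0 = (SOME c. c \<ge> 0 \<and> x 0 = - (c *\<^sub>R b))"

lemma c0: "c0 \<ge> 0" "x 0 = - (c0 *\<^sub>R b)"
  using someI_ex[OF cauchy_scale[simplified Bex_def]] unfolding c0_def by auto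

text \<open>The eigencoordinate of \<open>x t\<close> divided by
  \<open>- \<eta> * (b \<bullet> e i)\<close>. The recursion replaces the division, so vanishing
  coordinates of \<open>b\<close> are harmless, and it keeps \<open>z\<close> nonnegative: no
  coordinate of an iterate has the sign of that of \<open>b\<close>.\<close>

primrec z where
  "z 0 i = c0 / \<eta>"
| "z (Suc t) i = D t i * z t i + 1"

lemma z_nonneg: "z t i \<ge> 0"
proof (induction t)
  case (Suc t)
  then show ?case using D_lower[of t i] by simp
qed (use c0 \<eta> in simp)

lemma z_Suc_pos: "z (Suc t) i > 0"
  using z_nonneg[of t i] D_lower[of t i] by (simp add: add_nonneg_pos)

lemma x_coord: "x t \<bullet> e i = - \<eta> * (b \<bullet> e i) * z t i"
proof (induction t)
  case 0
  then show ?case using \<eta> by (simp add: c0)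
next
  case (Suc t)
  then show ?case by (simp add: x_Suc_coord algebra_simps)
qed

lemma b_x_nonpos: "b \<bullet> x t \<le> 0"
proof -
  have "b \<bullet> x t = - (\<Sum>i\<in>UNIV. \<eta> * (b \<bullet> e i)\<^sup>2 * z t i)"
    by (subst eigenbasis_inner[OF eb]) (simp add: x_coord sum_negf[symmetric] power2_eq_square algebra_simps)
  also have "\<dots> \<le> 0" using \<eta> z_nonneg by (simp add: sum_nonneg)
  finally show ?thesis .
qed

definition u where "u t i = z (Suc t) i - z t i"

lemma u_Suc: "u (Suc t) i = D t i * u t i - \<eta> * \<tau> / 2 * (norm (x (Suc t)) - norm (x t)) * z (Suc t) i"
proof -
  have "u (Suc t) i = D (Suc t) i * z (Suc t) i - D t i * z t i"
    unfolding u_def by simp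
  also have "D (Suc t) i = D t i - \<eta> * \<tau> / 2 * (norm (x (Suc t)) - norm (x t))"
    by (simp add: D_def algebra_simps)
  finally show ?thesis unfolding u_def by (simp add: algebra_simps del: z.simps)
qed

lemma step_coord: "(x (Suc t) - x t) \<bullet> e i = - \<eta> * (b \<bullet> e i) * u t i"
  by (simp add: inner_diff_left x_coord u_def algebra_simps del: z.simps)

lemma x_Suc_step: "x (Suc t) \<bullet> (x (Suc t) - x t) = (\<Sum>i\<in>UNIV. (\<eta> * (b \<bullet> e i))\<^sup>2 * z (Suc t) i * u t i)"
  by (subst eigenbasis_inner[OF eb]) (simp only: x_coord step_coord, simp add: power2_eq_square mult_ac del: z.simps)

lemma x_0_grad: "x 0 \<bullet> cubic_grad A b \<tau> (x 0) = 0"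
proof (cases "b = 0")
  case True
  then have "x 0 = 0" using x_0 cauchy_point_zero by metis
  then show ?thesis by simp
next
  case False
  obtain R where R: "R \<ge> 0" "cauchy_point A b \<tau> = - ((R / norm b) *\<^sub>R b)"
    "\<tau> / 2 * R\<^sup>2 + (b \<bullet> (A *v b)) / (norm b)\<^sup>2 * R = norm b"
    using cauchy_point_radius[OF \<tau> False] by blast
  show ?thesis using cubic_along_ray(2)[OF False R(1,3)] unfolding x_0 R(2)
    by (simp add: inner_commute)
qed

text \<open>Once an eigencoordinate stops growing it never grows again, and the coordinates that still
  grow are those of the smallest eigenvalues.  This makes the norm of the iterates monotone.\<close>

definition ordered_growth where
  "ordered_growth t \<longleftrightarrow> (\<forall>i j. l i \<le> l j \<longrightarrow> u t j > 0 \<longrightarrow>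
     u t i > 0 \<and> u t j / z (Suc t) j \<le> u t i / z (Suc t) i)"

lemma ratio_mono:
  fixes a a' z z' :: real
  assumes "a / z \<le> a' / z'" "z > 0" "z' > 0" "a > 0" "a' > 0"
  shows "a / (z + a) \<le> a' / (z' + a')"
  using assms by (simp add: field_simps)

text \<open>All \<open>z 0 i\<close> share the value \<open>c0 / \<eta>\<close>, so the first
  increments and ratios are ordered by the multipliers alone.\<close>

lemma ordered_growth_0: "ordered_growth 0"
  unfolding ordered_growth_def
proof (intro allI impI)
  fix i j assume ij: "l i \<le> l j" and uj: "u 0 j > 0"
  have le: "u 0 j \<le> u 0 i"
    using mult_right_mono[OF D_antimono[OF ij, of 0], of "c0 / \<eta>"] c0 \<eta> by (simp add: u_def)
  then have ui: "u 0 i > 0" using uj by simp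
  have z0: "c0 / \<eta> \<ge> 0" using c0 \<eta> by simp
  have "u 0 j / (c0 / \<eta> + u 0 j) \<le> u 0 i / (c0 / \<eta> + u 0 i)"
  proof -
    have "(c0 / \<eta>) * u 0 j \<le> (c0 / \<eta>) * u 0 i" using le z0 by (rule mult_left_mono)
    moreover have "c0 / \<eta> + u 0 j > 0" "c0 / \<eta> + u 0 i > 0" using z0 uj ui by auto
    ultimately show ?thesis by (simp only: divide_le_eq le_divide_eq frac_le_eq)
        (simp add: field_simps)
  qed
  moreover have "z (Suc 0) k = c0 / \<eta> + u 0 k" for k by (simp add: u_def)
  ultimately show "u 0 i > 0 \<and> u 0 j / z (Suc 0) j \<le> u 0 i / z (Suc 0) i" using ui by metis
qed

text \<open>Dividing the recursion of \<open>u\<close> by \<open>z (Suc t)\<close> gives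
  \<open>D t m\<close> times the old ratio minus a number \<open>k\<close> common to all
  coordinates. It is nonnegative since the norm did not decrease, so a coordinate that grows now was
  growing before. \<open>ratio_mono\<close> passes on to the next denominator.\<close>

lemma ordered_growth_Suc:
  assumes og: "ordered_growth t" and mono: "norm (x t) \<le> norm (x (Suc t))"
  shows "ordered_growth (Suc t)"
  unfolding ordered_growth_def
proof (intro allI impI)
  fix i j assume ij: "l i \<le> l j" and uj: "u (Suc t) j > 0"
  define k where "k = \<eta> * \<tau> / 2 * (norm (x (Suc t)) - norm (x t))"
  have k: "k \<ge> 0" using mono \<eta> \<tau> by (simp add: k_def)
  have zp: "z (Suc t) i > 0" "z (Suc t) j > 0" by (rule z_Suc_pos)+
  have U: "u (Suc t) m = D t m * u t m - k * z (Suc t) m" for m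
    unfolding u_Suc k_def ..
  have q: "u (Suc t) m / z (Suc t) m = D t m * (u t m / z (Suc t) m) - k" for m
    using z_Suc_pos[of t m] by (simp add: U diff_divide_distrib del: z.simps)
  have "D t j * u t j > 0" using uj U[of j] k zp(2) by (smt (verit) mult_nonneg_nonneg)
  then have utj: "u t j > 0" using D_lower[of t j] by (simp add: zero_less_mult_iff)
  then have r: "u t j / z (Suc t) j \<le> u t i / z (Suc t) i" "u t i > 0"
    using og ij unfolding ordered_growth_def by blast+
  have "D t j * (u t j / z (Suc t) j) \<le> D t i * (u t i / z (Suc t) i)"
    using r D_antimono[OF ij, of t] D_lower[of t i] utj zp by (intro mult_mono) auto
  then have r': "u (Suc t) j / z (Suc t) j \<le> u (Suc t) i / z (Suc t) i" unfolding q by simp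
  have "u (Suc t) j / z (Suc t) j > 0" using uj zp by simp
  with r' have "u (Suc t) i / z (Suc t) i > 0" by linarith
  then have ui: "u (Suc t) i > 0" using zp by (simp add: zero_less_divide_iff)
  have "z (Suc (Suc t)) m = z (Suc t) m + u (Suc t) m" for m by (simp add: u_def)
  then show "u (Suc t) i > 0 \<and> u (Suc t) j / z (Suc (Suc t)) j \<le> u (Suc t) i / z (Suc (Suc t)) i"
    using ratio_mono[OF r' zp(2,1) uj ui] ui by metis
qed


lemma norm_mono_step:
  assumes "0 \<le> x t \<bullet> (x (Suc t) - x t)"
  shows "norm (x t) \<le> norm (x (Suc t))"
    and "(norm (x (Suc t)))\<^sup>2 - (norm (x t))\<^sup>2 \<le> 2 * (x (Suc t) \<bullet> (x (Suc t) - x t))"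
    and "0 \<le> x (Suc t) \<bullet> (x (Suc t) - x t)"
proof -
  define w where "w = x (Suc t) - x t"
  have xs: "x (Suc t) = x t + w" by (simp add: w_def)
  have sq: "(norm (x (Suc t)))\<^sup>2 = (norm (x t))\<^sup>2 + 2 * (x t \<bullet> w) + w \<bullet> w"
    unfolding xs power2_norm_eq_inner by (simp add: inner_add_left inner_add_right inner_commute)
  have q: "x (Suc t) \<bullet> w = x t \<bullet> w + w \<bullet> w" unfolding xs by (simp add: inner_add_left)
  have a: "0 \<le> x t \<bullet> w" using assms by (simp add: w_def)
  have "(norm (x t))\<^sup>2 \<le> (norm (x (Suc t)))\<^sup>2" unfolding sq using a by simp
  then show "norm (x t) \<le> norm (x (Suc t))" by simp
  show "(norm (x (Suc t)))\<^sup>2 - (norm (x t))\<^sup>2 \<le> 2 * (x (Suc t) \<bullet> (x (Suc t) - x t))"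
    unfolding w_def[symmetric] sq q by simp
  show "0 \<le> x (Suc t) \<bullet> (x (Suc t) - x t)"
    unfolding w_def[symmetric] q using a by simp
qed

text \<open>The correlation \<open>Q\<close> of point and increment evolves as a sum with weights
  \<open>D t i\<close> minus the effect of the longer norm. Positive summands belong to smaller
  eigenvalues and carry the larger weights, so the weighted sum keeps at least 3/4 of
  \<open>Q\<close>. The invariant ball limits the loss to 5/16 of \<open>Q\<close>.\<close>

lemma growth_invariant: "ordered_growth t \<and> 0 \<le> x t \<bullet> (x (Suc t) - x t)"
proof (induction t)
  case 0
  then show ?case using ordered_growth_0 x_0_grad by (simp add: x_Suc)
next
  case (Suc t)
  then have og: "ordered_growth t" and xw: "0 \<le> x t \<bullet> (x (Suc t) - x t)" by auto
  note mono = norm_mono_step[OF xw]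
  define Q where "Q = x (Suc t) \<bullet> (x (Suc t) - x t)"
  define k where "k = \<eta> * \<tau> / 2 * (norm (x (Suc t)) - norm (x t))"
  define p where "p i = (\<eta> * (b \<bullet> e i))\<^sup>2 * z (Suc t) i * u t i" for i
  have Q: "Q = sum p UNIV" unfolding Q_def p_def by (rule x_Suc_step)
  have Q0: "Q \<ge> 0" using mono(3) by (simp add: Q_def)
  have sq: "(norm (x (Suc t)))\<^sup>2 = (\<Sum>i\<in>UNIV. (\<eta> * (b \<bullet> e i))\<^sup>2 * (z (Suc t) i)\<^sup>2)"
    unfolding eigenbasis_norm_power2[OF eb] x_coord by (simp add: power_mult_distrib del: z.simps)
  have "x (Suc t) \<bullet> (x (Suc (Suc t)) - x (Suc t))
      = (\<Sum>i\<in>UNIV. (\<eta> * (b \<bullet> e i))\<^sup>2 * z (Suc t) i * u (Suc t) i)"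
    by (subst eigenbasis_inner[OF eb])
      (simp only: x_coord step_coord, simp add: power2_eq_square mult_ac del: z.simps)
  also have "\<dots> = (\<Sum>i\<in>UNIV. D t i * p i) - k * (norm (x (Suc t)))\<^sup>2"
    unfolding u_Suc k_def[symmetric] sq p_def sum_distrib_left sum_subtractf[symmetric]
    by (intro sum.cong refl) (simp add: power2_eq_square algebra_simps del: z.simps)
  finally have eq: "x (Suc t) \<bullet> (x (Suc (Suc t)) - x (Suc t)) = (\<Sum>i\<in>UNIV. D t i * p i) - k * (norm (x (Suc t)))\<^sup>2" .
  have psign: "p i \<le> 0" if "u t i \<le> 0" for i
    unfolding p_def using that z_Suc_pos[of t i] by (intro mult_nonneg_nonpos mult_nonneg_nonneg) auto
  have ppos: "p i \<ge> 0" if "u t i \<ge> 0" for i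
    unfolding p_def using that z_Suc_pos[of t i] by (intro mult_nonneg_nonneg) auto
  have "\<exists>d \<ge> 3 / 4. \<forall>i. d * p i \<le> D t i * p i"
  proof (cases "\<exists>i. u t i > 0")
    case False
    then have "p i \<le> 0" for i using psign not_less by blast
    then have "p i = 0" for i
      using Q0 Q sum_nonneg_eq_0_iff[of UNIV "\<lambda>i. - p i"] sum_nonpos[of UNIV p]
      by (simp add: sum_negf)
    then show ?thesis by (intro exI[of _ "3 / 4"]) simp
  next
    case True
    define G where "G = {i. u t i > 0}"
    have G: "finite (l ` G)" "l ` G \<noteq> {}" using True by (auto simp: G_def)
    \<comment> \<open>The separating weight is that of the largest eigenvalue whose coordinate still
      grows.\<close>
    obtain j where j: "j \<in> G" "l j = Max (l ` G)" using Max_in[OF G] by auto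
    have "D t j * p i \<le> D t i * p i" for i
    proof (cases "u t i > 0")
      case True
      then have "l i \<le> l j" using j(2) Max_ge[OF G(1)] by (simp add: G_def)
      then show ?thesis using D_antimono ppos[of i] True by (intro mult_right_mono) auto
    next
      case False
      then have "\<not> l i \<le> l j"
        using og j(1) unfolding ordered_growth_def G_def by blast
      then have "D t i \<le> D t j" by (intro D_antimono) simp
      then show ?thesis using psign[of i] False by (intro mult_right_mono_neg) auto
    qed
    then show ?thesis using D_lower by blast
  qed
  then obtain d where d: "d \<ge> 3 / 4" "\<And>i. d * p i \<le> D t i * p i" by blast
  have "3 / 4 * Q \<le> d * Q" using d(1) Q0 by (rule mult_right_mono)
  also have "\<dots> \<le> (\<Sum>i\<in>UNIV. D t i * p i)"
    unfolding Q sum_distrib_left by (intro sum_mono d(2))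
  finally have lower: "3 / 4 * Q \<le> (\<Sum>i\<in>UNIV. D t i * p i)" .
  let ?X = "norm (x t)" and ?Y = "norm (x (Suc t))"
  have "?Y * (?Y - ?X) \<le> ?Y\<^sup>2 - ?X\<^sup>2"
    using mono(1) by (simp add: power2_eq_square algebra_simps mult_left_mono)
  also have "\<dots> \<le> 2 * Q" using mono(2) by (simp add: Q_def)
  finally have "(\<eta> * \<tau> / 2 * ?Y) * (?Y * (?Y - ?X)) \<le> (\<eta> * \<tau> / 2 * ?Y) * (2 * Q)"
    using \<eta> \<tau> by (intro mult_left_mono) auto
  also have "\<dots> = \<eta> * (\<tau> * ?Y) * Q" by simp
  also have "\<dots> \<le> \<eta> * (5 * L) * Q"
    using norm_x_bound[of "Suc t"] \<eta> Q0 by (intro mult_right_mono mult_left_mono) auto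
  also have "\<dots> = 5 / 16 * Q" using \<eta>L by (simp add: algebra_simps)
  finally have "k * ?Y\<^sup>2 \<le> 5 / 16 * Q" by (simp add: k_def power2_eq_square algebra_simps)
  then have "0 \<le> x (Suc t) \<bullet> (x (Suc (Suc t)) - x (Suc t))"
    using lower Q0 unfolding eq by linarith
  then show ?case using ordered_growth_Suc[OF og mono(1)] by blast
qed

lemma norm_x_mono: "s \<le> t \<Longrightarrow> norm (x s) \<le> norm (x t)"
  using lift_Suc_mono_le[of "\<lambda>t. norm (x t)"] norm_mono_step(1) growth_invariant by blast

text \<open>In units of \<open>V = L * (norm w)\<^sup>2\<close> the quadratic part costs half of
  \<open>V + 5 / 2 * V\<close> and the cubic remainder \<open>5 / 4 * V\<close>, where 15 = 2 * 5 +
  5 uses the invariant ball at both points. By \<open>\<eta> * L = 1 / 16\<close> the total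
  \<open>3 * V\<close> is 3/16 of \<open>\<eta> * (norm g)\<^sup>2\<close>, less than the half that
  may be lost.\<close>

lemma descent: "cubic A b \<tau> (x (Suc t)) \<le> cubic A b \<tau> (x t) - \<eta> / 2 * (norm (cubic_grad A b \<tau> (x t)))\<^sup>2"
proof -
  define g where "g = cubic_grad A b \<tau> (x t)"
  define w where "w = x (Suc t) - x t"
  have w: "w = - (\<eta> *\<^sub>R g)" by (simp add: w_def g_def x_Suc)
  have nw: "(norm w)\<^sup>2 = \<eta>\<^sup>2 * (norm g)\<^sup>2" using \<eta> by (simp add: w power_mult_distrib)
  let ?X = "norm (x t)" and ?Y = "norm (x (Suc t))"
  have 1: "g \<bullet> w = - \<eta> * (norm g)\<^sup>2" by (simp add: w dot_square_norm)
  have 2: "w \<bullet> (A *v w) \<le> L * (norm w)\<^sup>2"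
    using norm_cauchy_schwarz[of w "A *v w"] mult_left_mono[OF A_bound[of w] norm_ge_zero[of w]]
    by (simp add: power2_eq_square mult_ac)
  have 3: "\<tau> / 2 * ?X * (norm w)\<^sup>2 \<le> 5 / 2 * (L * (norm w)\<^sup>2)"
    using mult_right_mono[OF norm_x_bound[of t], of "(norm w)\<^sup>2 / 2"] by simp
  have "\<bar>?Y - ?X\<bar> \<le> norm w" unfolding w_def by (rule norm_triangle_ineq3)
  then have "(?Y - ?X)\<^sup>2 \<le> (norm w)\<^sup>2" by (metis abs_ge_zero power2_abs power_mono)
  then have "(?Y - ?X)\<^sup>2 * (\<tau> * (2 * ?Y + ?X)) \<le> (norm w)\<^sup>2 * (15 * L)"
  proof (rule mult_mono)
    have "\<tau> * (2 * ?Y + ?X) = 2 * (\<tau> * ?Y) + \<tau> * ?X" by (simp add: algebra_simps)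
    then show "\<tau> * (2 * ?Y + ?X) \<le> 15 * L" using norm_x_bound[of t] norm_x_bound[of "Suc t"] by linarith
  qed (use \<tau> in auto)
  then have 4: "\<tau> / 12 * (?Y - ?X)\<^sup>2 * (2 * ?Y + ?X) \<le> 5 / 4 * (L * (norm w)\<^sup>2)"
    by (simp add: algebra_simps)
  have combine: "c' \<le> c + G + 3 * V"
    if "c' = c + k + (q + r) / 2 + m" "k = G" "q \<le> V" "r \<le> 5 / 2 * V" "m \<le> 5 / 4 * V"
    for c' c k q r m G V :: real
    using that unfolding add_divide_distrib by linarith
  have "cubic A b \<tau> (x (Suc t)) \<le> cubic A b \<tau> (x t) + - \<eta> * (norm g)\<^sup>2 + 3 * (L * (norm w)\<^sup>2)"
    by (rule combine[OF _ 1 2 3 4]) (unfold g_def w_def, rule cubic_expansion[OF sym])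
  then have "cubic A b \<tau> (x (Suc t)) \<le> cubic A b \<tau> (x t) - \<eta> * (norm g)\<^sup>2 + 3 * (L * (norm w)\<^sup>2)" by simp
  also have "3 * (L * (norm w)\<^sup>2) = 3 / 16 * (\<eta> * (norm g)\<^sup>2)"
    using \<eta>L unfolding nw by (simp add: power2_eq_square algebra_simps)
  finally have "cubic A b \<tau> (x (Suc t)) \<le> cubic A b \<tau> (x t) - \<eta> * (norm g)\<^sup>2 + 3 / 16 * (\<eta> * (norm g)\<^sup>2)" .
  moreover have "0 \<le> \<eta> * (norm g)\<^sup>2" using \<eta> by simp
  moreover have "\<eta> / 2 * (norm g)\<^sup>2 = \<eta> * (norm g)\<^sup>2 / 2" by simp
  ultimately show ?thesis unfolding g_def[symmetric] by linarith
qed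

lemma descent_sum:
  "cubic A b \<tau> (x (t + k)) \<le> cubic A b \<tau> (x t) - (\<Sum>s<k. \<eta> / 2 * (norm (cubic_grad A b \<tau> (x (t + s))))\<^sup>2)"
proof (induction k)
  case (Suc k)
  then show ?case using descent[of "t + k"] by simp
qed simp

lemma cubic_x_nonpos: "cubic A b \<tau> (x t) \<le> 0"
proof -
  have "cubic A b \<tau> (x 0) \<le> - \<tau> * norm (x 0) ^ 3 / 12"
    unfolding x_0 by (rule cauchy_point_cubic_le[OF \<tau>])
  also have "\<dots> \<le> 0" using \<tau> by simp
  finally have "cubic A b \<tau> (x 0) \<le> 0" .
  moreover have "0 \<le> (\<Sum>s<t. \<eta> / 2 * (norm (cubic_grad A b \<tau> (x (0 + s))))\<^sup>2)"
    using \<eta> by (intro sum_nonneg) auto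
  ultimately show ?thesis using descent_sum[of 0 t] by simp
qed

text \<open>A multiplier of at least \<open>1 + a\<close> makes \<open>z\<close> dominate a
  geometric sum started from zero; of the Cauchy point only the nonnegativity of \<open>z\<close>
  enters. The bound \<open>5 * L / \<tau>\<close> on the right-hand norm later limits how long this
  growth can last.\<close>

lemma growth:
  assumes a: "a \<ge> 0" and low: "\<And>s. s < t \<Longrightarrow> a \<le> \<eta> * (- l i - \<tau> / 2 * norm (x s))"
  shows "\<eta> * \<bar>b \<bullet> e i\<bar> * ((1 + a) ^ t - 1) \<le> a * norm (x t)"
proof -
  have "(1 + a) ^ t - 1 \<le> a * z t i" using low
  proof (induction t)
    case (Suc t)
    have "1 + a \<le> D t i" using Suc.prems[of t] by (simp add: D_def algebra_simps)
    then have "(1 + a) * z t i \<le> D t i * z t i" using z_nonneg by (rule mult_right_mono)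
    then have "a * ((1 + a) * z t i + 1) \<le> a * z (Suc t) i" using a by (simp add: mult_left_mono)
    moreover have "(1 + a) * ((1 + a) ^ t - 1) \<le> (1 + a) * (a * z t i)"
      using Suc a by (intro mult_left_mono) auto
    ultimately show ?case by (simp add: algebra_simps del: z.simps)
  qed (use mult_nonneg_nonneg[OF a z_nonneg[of 0 i]] in simp)
  then have "\<eta> * \<bar>b \<bullet> e i\<bar> * ((1 + a) ^ t - 1) \<le> \<eta> * \<bar>b \<bullet> e i\<bar> * (a * z t i)"
    using \<eta> by (intro mult_left_mono) auto
  also have "\<dots> = a * \<bar>x t \<bullet> e i\<bar>" using \<eta> z_nonneg[of t i] by (simp add: x_coord abs_mult)
  also have "\<dots> \<le> a * norm (x t)"
    using Cauchy_Schwarz_ineq2[of "x t" "e i"] eigenbasis_norm[OF eb, of i] a by (intro mult_left_mono) auto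
  finally show ?thesis .
qed

end

section \<open>Escape from points of negative curvature\<close>

lemma cubic_eq_grad:
  "cubic A b \<tau> x = (cubic_grad A b \<tau> x \<bullet> x) / 2 + (b \<bullet> x) / 2 - \<tau> / 12 * norm x ^ 3"
proof -
  have "cubic_grad A b \<tau> x \<bullet> x = b \<bullet> x + x \<bullet> (A *v x) + \<tau> / 2 * norm x ^ 3"
    by (simp add: cubic_grad_def inner_add_left dot_square_norm power2_eq_square power3_eq_cube
        inner_commute[of "A *v x" x])
  then show ?thesis by (simp only: cubic_def) (simp add: field_simps)
qed

text \<open>The gap inequality in units of \<zeta>: \<open>p\<close> and \<open>r\<close> are the
  lengths of the almost stationary point and of its competitor, and 1/30 is 1/12 - 1/20. For small
  \<open>r\<close> the error terms stay below 1/30; for large \<open>r\<close> the cubic remainder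
  dominates them.\<close>

lemma stationary_gap_arith:
  fixes p r :: real
  assumes p: "0 \<le> p" "p \<le> 9 / 10" and r: "0 \<le> r"
  shows "r / 1728 + (p + r) / 200 + (p + r)\<^sup>2 / 400 < (r - p)\<^sup>2 * (2 * r + p) / 12 + 1 / 30"
proof (cases "r \<le> 3 / 2")
  case True
  have "(p + r)\<^sup>2 \<le> (24 / 10)\<^sup>2" using p r True by (intro power_mono) auto
  then have "(p + r)\<^sup>2 / 400 \<le> 144 / 10000" by (simp add: power2_eq_square)
  moreover have "(r - p)\<^sup>2 * (2 * r + p) / 12 \<ge> 0" using p r by simp
  moreover have "r / 1728 + (p + r) / 200 < 13 / 1000" using p r True unfolding add_divide_distrib by linarith
  ultimately show ?thesis by linarith
next
  case False
  then have r: "r \<ge> 3 / 2" by simp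
  have "(2 / 5 * r)\<^sup>2 \<le> (r - p)\<^sup>2" using p r by (intro power_mono) auto
  then have "(2 / 5 * r)\<^sup>2 * (2 * r) \<le> (r - p)\<^sup>2 * (2 * r + p)" using p r by (intro mult_mono) auto
  then have 1: "8 / 300 * r ^ 3 \<le> (r - p)\<^sup>2 * (2 * r + p) / 12"
    by (simp add: power2_eq_square power3_eq_cube)
  have "3 / 2 * r \<le> r * r" using r by (intro mult_right_mono) auto
  moreover have "3 / 2 * (r * r) \<le> r * (r * r)" using r by (intro mult_right_mono) auto
  ultimately have 2: "3 / 2 * r \<le> r\<^sup>2" "3 / 2 * r\<^sup>2 \<le> r ^ 3"
    by (simp_all add: power2_eq_square power3_eq_cube)
  have "(p + r)\<^sup>2 \<le> (8 / 5 * r)\<^sup>2" using p r by (intro power_mono) auto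
  then have 3: "(p + r)\<^sup>2 \<le> 64 / 25 * r\<^sup>2" by (simp add: power2_eq_square)
  show ?thesis using 1 2 3 p r unfolding add_divide_distrib by linarith
qed

text \<open>If the regularised Hessian at an almost stationary point is almost nonnegative, the
  exact expansion rules out a much deeper competitor. It is used in contrapositive form: if a deep
  \<open>y\<close> exists and the value at \<open>x\<close> is still above
  \<open>- \<tau> * \<zeta> ^ 3 / 20\<close>, the gradient at \<open>x\<close> must be large. The
  slope 1/1728 leaves room for the perturbed linear term.\<close>

lemma approx_stationary_cubic_gap:
  fixes A :: "real ^ 'n ^ 'n"
  assumes sym: "symmetric_matrix A" and \<tau>: "\<tau> > 0" and \<zeta>: "\<zeta> > 0"
    and grad: "norm (cubic_grad A b \<tau> x) \<le> \<tau> * \<zeta>\<^sup>2 / 200" and bx: "b \<bullet> x \<le> 0"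
    and val: "cubic A b \<tau> x \<ge> - \<tau> * \<zeta> ^ 3 / 20"
    and curv: "\<And>v. v \<bullet> (A *v v) + \<tau> / 2 * norm x * (norm v)\<^sup>2 \<ge> - (\<tau> * \<zeta> / 200) * (norm v)\<^sup>2"
  shows "- \<tau> * \<zeta> ^ 3 / 12 + \<tau> * \<zeta>\<^sup>2 / 1728 * norm y < cubic A b \<tau> y"
proof -
  define p r where "p = norm x / \<zeta>" and "r = norm y / \<zeta>"
  have nx: "norm x = p * \<zeta>" and ny: "norm y = r * \<zeta>" using \<zeta> by (simp_all add: p_def r_def)
  have p0: "p \<ge> 0" and r0: "r \<ge> 0" using \<zeta> by (simp_all add: p_def r_def)
  have T: "\<tau> * \<zeta> ^ 3 > 0" using \<tau> \<zeta> by simp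
  have "cubic_grad A b \<tau> x \<bullet> x \<le> (\<tau> * \<zeta>\<^sup>2 / 200) * norm x"
    using norm_cauchy_schwarz[of "cubic_grad A b \<tau> x" x] mult_right_mono[OF grad norm_ge_zero[of x]] by linarith
  then have "cubic A b \<tau> x \<le> (\<tau> * \<zeta>\<^sup>2 / 400) * (p * \<zeta>) - \<tau> / 12 * (p * \<zeta>) ^ 3"
    using bx by (simp add: cubic_eq_grad nx)
  also have "\<dots> = (\<tau> * \<zeta> ^ 3) * (p / 400 - p ^ 3 / 12)"
    by (simp add: power2_eq_square power3_eq_cube algebra_simps)
  finally have "(\<tau> * \<zeta> ^ 3) * (- 1 / 20) \<le> (\<tau> * \<zeta> ^ 3) * (p / 400 - p ^ 3 / 12)" using val by simp
  then have pc: "- 1 / 20 \<le> p / 400 - p ^ 3 / 12" using T by (simp only: mult_le_cancel_left_pos)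
  \<comment> \<open>With a small gradient and \<open>b \<bullet> x \<le> 0\<close> the value is at
    most \<open>p / 400 - p ^ 3 / 12\<close> in units of \<open>\<tau> * \<zeta> ^ 3\<close>, so a
    longer \<open>x\<close> would lie below the assumed level.\<close>
  have p9: "p \<le> 9 / 10"
  proof (rule ccontr)
    assume "\<not> ?thesis"
    then have p: "p > 9 / 10" by simp
    then have "(9 / 10 * (9 / 10)) * p \<le> p * p * p" by (intro mult_mono) auto
    then have "81 / 100 * p \<le> p ^ 3" by (simp add: power3_eq_cube)
    then show False using pc p by linarith
  qed
  let ?g = "cubic_grad A b \<tau> x"
  have "norm (y - x) \<le> norm y + norm x" by (rule norm_triangle_ineq4)
  then have d: "norm (y - x) \<le> (p + r) * \<zeta>" by (simp add: nx ny algebra_simps)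
  have "- (?g \<bullet> (y - x)) \<le> norm ?g * norm (y - x)" 
    using Cauchy_Schwarz_ineq2[of ?g "y - x"] by linarith
  also have "\<dots> \<le> (\<tau> * \<zeta>\<^sup>2 / 200) * ((p + r) * \<zeta>)"
    using grad d \<tau> by (intro mult_mono) auto
  finally have 1: "- (?g \<bullet> (y - x)) \<le> (\<tau> * \<zeta> ^ 3) * ((p + r) / 200)"
    by (simp add: power2_eq_square power3_eq_cube mult_ac)
  have "(norm (y - x))\<^sup>2 \<le> ((p + r) * \<zeta>)\<^sup>2" using d by (intro power_mono) auto
  then have "(\<tau> * \<zeta> / 200) * (norm (y - x))\<^sup>2 \<le> (\<tau> * \<zeta> / 200) * ((p + r) * \<zeta>)\<^sup>2"
    using \<tau> \<zeta> by (intro mult_left_mono) auto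
  also have "\<dots> = (\<tau> * \<zeta> ^ 3) * ((p + r)\<^sup>2 / 200)"
    by (simp add: power2_eq_square power3_eq_cube algebra_simps)
  finally have 2: "(y - x) \<bullet> (A *v (y - x)) + \<tau> / 2 * norm x * (norm (y - x))\<^sup>2 \<ge> - ((\<tau> * \<zeta> ^ 3) * ((p + r)\<^sup>2 / 200))"
    using curv[of "y - x"] by linarith
  have 3: "\<tau> / 12 * (norm y - norm x)\<^sup>2 * (2 * norm y + norm x) = (\<tau> * \<zeta> ^ 3) * ((r - p)\<^sup>2 * (2 * r + p) / 12)"
    by (simp add: nx ny power2_eq_square power3_eq_cube field_simps)
  have "(\<tau> * \<zeta> ^ 3) * (r / 1728 + (p + r) / 200 + (p + r)\<^sup>2 / 400)
      < (\<tau> * \<zeta> ^ 3) * ((r - p)\<^sup>2 * (2 * r + p) / 12 + 1 / 30)"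
    using stationary_gap_arith[OF p0 p9 r0] T by (simp only: mult_less_cancel_left_pos)
  then have 4: "(\<tau> * \<zeta> ^ 3) * (r / 1728) + (\<tau> * \<zeta> ^ 3) * ((p + r) / 200) + (\<tau> * \<zeta> ^ 3) * ((p + r)\<^sup>2 / 200) / 2
      < (\<tau> * \<zeta> ^ 3) * ((r - p)\<^sup>2 * (2 * r + p) / 12) + (\<tau> * \<zeta> ^ 3) / 30"
    by (simp add: algebra_simps)
  have 5: "\<tau> * \<zeta>\<^sup>2 / 1728 * norm y = (\<tau> * \<zeta> ^ 3) * (r / 1728)"
    by (simp add: ny power2_eq_square power3_eq_cube)
  have combine: "- U / 12 + Y < c'"
    if "c' = c + k + q / 2 + m" "- k \<le> P" "q \<ge> - Q" "m = M" "R + P + Q / 2 < M + U / 30" "Y = R" "c \<ge> - U / 20"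
    for c' c k q m P Q R U M Y :: real
    using that unfolding add_divide_distrib by linarith
  have "- (\<tau> * \<zeta> ^ 3) / 12 + \<tau> * \<zeta>\<^sup>2 / 1728 * norm y < cubic A b \<tau> y"
    by (rule combine[OF cubic_expansion[OF sym, of b \<tau> y x] 1 2 3 4 5]) (use val in simp)
  then show ?thesis by simp
qed

context cubic_descent
begin

lemma min_eigenvalue_curvature:
  assumes i: "l i = lambda_min A"
  shows "v \<bullet> (A *v v) \<ge> l i * (norm v)\<^sup>2"
  using lambda_min_le_quadratic[OF sym, of v] i by simp

text \<open>If the regularised curvature along \<open>e i\<close> stayed below
  \<open>- \<tau> * \<zeta> / 200\<close> at the first \<open>N\<close> points, that coordinate
  would outgrow the invariant ball. Once above, the monotone norm keeps it there; every point that
  is not deep then has a gradient above \<open>\<tau> * \<zeta>\<^sup>2 / 200\<close>, and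
  \<open>4000 / (\<eta> * \<tau> * \<zeta>)\<close> such steps use up the whole admissible
  decrease.\<close>

lemma descent_reaches_gap:
  assumes \<zeta>: "\<zeta> > 0"
    and i: "l i = lambda_min A"
    and y: "cubic A b \<tau> y \<le> - \<tau> * \<zeta> ^ 3 / 12 + \<tau> * \<zeta>\<^sup>2 / 1728 * norm y"
    and N: "N \<ge> 1" "5 * L * \<zeta> / 200 < \<bar>b \<bullet> e i\<bar> * ((1 + \<eta> * \<tau> * \<zeta> / 200) ^ N - 1)"
    and K: "real K > real N + 4000 / (\<eta> * \<tau> * \<zeta>)"
  shows "\<exists>t\<in>{1..K}. cubic A b \<tau> (x t) < - \<tau> * \<zeta> ^ 3 / 20"
proof (rule ccontr)
  assume "\<not> ?thesis"
  then have val: "\<And>t. 1 \<le> t \<Longrightarrow> t \<le> K \<Longrightarrow> cubic A b \<tau> (x t) \<ge> - \<tau> * \<zeta> ^ 3 / 20" by force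
  define a where "a = \<eta> * \<tau> * \<zeta> / 200"
  have a: "a > 0" using \<eta> \<tau> \<zeta> by (simp add: a_def)
  have "\<exists>s<N. \<eta> * (- l i - \<tau> / 2 * norm (x s)) < a"
  proof (rule ccontr)
    assume "\<not> ?thesis"
    then have "\<And>s. s < N \<Longrightarrow> a \<le> \<eta> * (- l i - \<tau> / 2 * norm (x s))" by force
    from growth[of a N i, OF less_imp_le[OF a] this]
    have "\<tau> * (\<eta> * \<bar>b \<bullet> e i\<bar> * ((1 + a) ^ N - 1)) \<le> \<tau> * (a * norm (x N))" using \<tau> by simp
    also have "\<dots> = a * (\<tau> * norm (x N))" by simp
    also have "\<dots> \<le> a * (5 * L)" using norm_x_bound a by (intro mult_left_mono) auto
    also have "\<dots> = (\<tau> * \<eta>) * (5 * L * \<zeta> / 200)" by (simp add: a_def)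
    finally have "(\<tau> * \<eta>) * (\<bar>b \<bullet> e i\<bar> * ((1 + a) ^ N - 1)) \<le> (\<tau> * \<eta>) * (5 * L * \<zeta> / 200)"
      by (simp add: mult_ac)
    moreover have "\<tau> * \<eta> > 0" using \<tau> \<eta> by simp
    ultimately have "\<bar>b \<bullet> e i\<bar> * ((1 + a) ^ N - 1) \<le> 5 * L * \<zeta> / 200"
      by (simp only: mult_le_cancel_left_pos)
    then show False using N(2) by (simp add: a_def)
  qed
  then obtain s where s: "s < N" "\<eta> * (- l i - \<tau> / 2 * norm (x s)) < a" by blast
  have "\<eta> * (- l i - \<tau> / 2 * norm (x s)) < \<eta> * (\<tau> * \<zeta> / 200)" using s(2) by (simp add: a_def)
  then have s': "- l i - \<tau> / 2 * norm (x s) < \<tau> * \<zeta> / 200" using \<eta> by simp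
  have big: "norm (cubic_grad A b \<tau> (x t)) > \<tau> * \<zeta>\<^sup>2 / 200" if t: "N \<le> t" "t < K" for t
  proof (rule ccontr)
    assume "\<not> ?thesis"
    then have g: "norm (cubic_grad A b \<tau> (x t)) \<le> \<tau> * \<zeta>\<^sup>2 / 200" by simp
    have "\<tau> / 2 * norm (x s) \<le> \<tau> / 2 * norm (x t)"
      using norm_x_mono[of s t] s(1) t \<tau> by simp
    then have "l i + \<tau> / 2 * norm (x t) \<ge> - (\<tau> * \<zeta> / 200)" using s' by linarith
    then have "(l i + \<tau> / 2 * norm (x t)) * (norm v)\<^sup>2 \<ge> - (\<tau> * \<zeta> / 200) * (norm v)\<^sup>2" for v :: "real ^ 'n"
      by (intro mult_right_mono) auto
    then have "v \<bullet> (A *v v) + \<tau> / 2 * norm (x t) * (norm v)\<^sup>2 \<ge> - (\<tau> * \<zeta> / 200) * (norm v)\<^sup>2" for v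
      using min_eigenvalue_curvature[OF i, of v] unfolding distrib_right by (meson add_right_mono order_trans)
    then have "- \<tau> * \<zeta> ^ 3 / 12 + \<tau> * \<zeta>\<^sup>2 / 1728 * norm y < cubic A b \<tau> y"
      using t N(1) by (intro approx_stationary_cubic_gap[OF sym \<tau> \<zeta> g b_x_nonpos val]) auto
    then show False using y by linarith
  qed
  define k where "k = K - N"
  have "0 \<le> 4000 / (\<eta> * \<tau> * \<zeta>)" using \<eta> \<tau> \<zeta> by simp
  then have "N < K" using K by linarith
  then have k: "K = N + k" and rk: "real k > 4000 / (\<eta> * \<tau> * \<zeta>)" using K by (simp_all add: k_def)
  have "(\<Sum>s<k. \<eta> / 2 * (\<tau> * \<zeta>\<^sup>2 / 200)\<^sup>2) \<le> (\<Sum>s<k. \<eta> / 2 * (norm (cubic_grad A b \<tau> (x (N + s))))\<^sup>2)"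
    using \<eta> \<tau> big k by (intro sum_mono mult_left_mono power_mono) (auto intro: less_imp_le)
  then have "real k * (\<eta> / 2 * (\<tau> * \<zeta>\<^sup>2 / 200)\<^sup>2) \<le> - cubic A b \<tau> (x K)"
    using descent_sum[of N k] cubic_x_nonpos[of N] k by simp
  also have "\<dots> \<le> \<tau> * \<zeta> ^ 3 / 20" using val[of K] k N by simp
  finally have "real k * (\<eta> / 2 * (\<tau> * \<zeta>\<^sup>2 / 200)\<^sup>2) \<le> \<tau> * \<zeta> ^ 3 / 20" .
  moreover have "4000 / (\<eta> * \<tau> * \<zeta>) * (\<eta> / 2 * (\<tau> * \<zeta>\<^sup>2 / 200)\<^sup>2) < real k * (\<eta> / 2 * (\<tau> * \<zeta>\<^sup>2 / 200)\<^sup>2)"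
    using rk \<eta> \<tau> \<zeta> by (intro mult_strict_right_mono) auto
  moreover have "4000 / (\<eta> * \<tau> * \<zeta>) * (\<eta> / 2 * (\<tau> * \<zeta>\<^sup>2 / 200)\<^sup>2) = \<tau> * \<zeta> ^ 3 / 20"
    using \<eta> \<tau> \<zeta> by (simp add: field_simps power2_eq_square power3_eq_cube)
  ultimately show False by linarith
qed

end

section \<open>Success of the perturbed subsolver\<close>

lemma cubic_linear_shift: "cubic A (b + c) \<tau> x = cubic A b \<tau> x + c \<bullet> x"
  by (simp add: cubic_def inner_add_left)

text \<open>On a line the model gradient at the Cauchy point vanishes, being orthogonal to
  \<open>b \<noteq> 0\<close>, and the radius equation makes \<open>l i + \<tau> / 2 * R\<close>
  nonnegative; all terms of the expansion are then nonnegative. This replaces the perturbation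
  argument, which relies on a sphere of positive dimension.\<close>

lemma cauchy_point_optimal_1D:
  fixes A :: "real ^ 'n ^ 'n"
  assumes sym: "symmetric_matrix A" and \<tau>: "\<tau> > 0" and b: "b \<noteq> 0" and card: "CARD('n) = 1"
  shows "cubic A b \<tau> (cauchy_point A b \<tau>) \<le> cubic A b \<tau> y"
proof -
  obtain e l where eb: "eigenbasis A e l" using symmetric_matrix_eigenbasis[OF sym] by blast
  obtain i where U: "(UNIV :: 'n set) = {i}" using card by (meson card_1_singletonE)
  obtain R where R: "R \<ge> 0" "cauchy_point A b \<tau> = - ((R / norm b) *\<^sub>R b)"
    "\<tau> / 2 * R\<^sup>2 + (b \<bullet> (A *v b)) / (norm b)\<^sup>2 * R = norm b"
    using cauchy_point_radius[OF \<tau> b] by blast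
  define x where "x = cauchy_point A b \<tau>"
  have nx: "norm x = R" using R b by (simp add: x_def)
  have Av: "v \<bullet> (A *v v) = l i * (norm v)\<^sup>2" for v
    unfolding eigenbasis_quadratic[OF eb] eigenbasis_norm_power2[OF eb] U by simp
  have inner: "v \<bullet> w = (v \<bullet> e i) * (w \<bullet> e i)" for v w
    by (subst eigenbasis_inner[OF eb]) (simp add: U)
  have "cubic_grad A b \<tau> x \<bullet> b = 0"
    using cubic_along_ray(2)[OF b R(1,3)] by (simp add: x_def R(2))
  moreover have "b \<bullet> e i \<noteq> 0" using b inner[of b b] by auto
  ultimately have "cubic_grad A b \<tau> x \<bullet> e i = 0" using inner[of "cubic_grad A b \<tau> x" b] by simp
  then have g: "cubic_grad A b \<tau> x \<bullet> v = 0" for v using inner[of "cubic_grad A b \<tau> x" v] by simp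
  have "R > 0" using R b by (cases "R = 0") auto
  have "(l i + \<tau> / 2 * R) * R = norm b"
    using R(3) b unfolding Av by (simp add: power2_eq_square algebra_simps)
  then have "l i + \<tau> / 2 * R \<ge> 0" using \<open>R > 0\<close> norm_ge_zero[of b] by (metis zero_le_mult_iff not_less)
  then have "0 \<le> (l i + \<tau> / 2 * R) * (norm (y - x))\<^sup>2" by simp
  then have "0 \<le> (y - x) \<bullet> (A *v (y - x)) + \<tau> / 2 * norm x * (norm (y - x))\<^sup>2"
    unfolding Av nx by (simp add: algebra_simps)
  moreover have "0 \<le> \<tau> / 12 * (norm y - norm x)\<^sup>2 * (2 * norm y + norm x)" using \<tau> by simp
  ultimately have "cubic A b \<tau> x \<le> cubic A b \<tau> y"
    using cubic_expansion[OF sym, of b \<tau> y x] g by simp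
  then show ?thesis by (simp add: x_def)
qed

text \<open>\<open>P\<close> stands for \<open>1 / (\<eta> * \<tau> * \<zeta>)\<close> and
  \<open>1 / Y ^ 18\<close> for the size of the random coordinate relative to the perturbation. The
  factor 202 instead of 200 pays for \<open>ln (1 + a)\<close> being slightly smaller than
  \<open>a\<close>.\<close>

lemma growth_time_arith:
  fixes P Y :: real
  assumes P: "P \<ge> 8" and Y: "Y \<ge> 1"
    and N: "real N \<ge> 202 * P * (2 * ln (24 * P) + 18 * ln Y)"
  shows "1 + 27 / 80 * P\<^sup>2 * Y ^ 18 < (1 + 1 / (200 * P)) ^ N"
proof -
  define a where "a = 1 / (200 * P)"
  have a: "0 < a" "a \<le> 1 / 1600" using P by (simp_all add: a_def field_simps)
  have "a - a\<^sup>2 \<le> ln (1 + a)" using a by (intro ln_one_plus_pos_lower_bound) auto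
  moreover have "a\<^sup>2 \<le> a * (1 / 1600)" unfolding power2_eq_square using a by (intro mult_left_mono) auto
  ultimately have ln: "a * (1599 / 1600) \<le> ln (1 + a)" by simp
  let ?w = "2 * ln (24 * P) + 18 * ln Y"
  have w: "?w \<ge> 0" using P Y by simp
  have "?w \<le> 202 * (1 / 200) * (1599 / 1600) * ?w" using w by simp
  also have "\<dots> = (202 * P * ?w) * (a * (1599 / 1600))" using P by (simp add: a_def)
  also have "\<dots> \<le> real N * ln (1 + a)" using N ln a w P by (intro mult_mono) auto
  finally have "exp ?w \<le> (1 + a) ^ N"
    using a by (simp add: ln_realpow[symmetric] ln_ge_iff)
  moreover have "exp ?w = (24 * P)\<^sup>2 * Y ^ 18"
  proof -
    have "ln ((24 * P)\<^sup>2 * Y ^ 18) = ln ((24 * P)\<^sup>2) + ln (Y ^ 18)"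
      using P Y by (intro ln_mult_pos) auto
    also have "\<dots> = ?w" using P Y by (simp only: ln_realpow)
    finally have "ln ((24 * P)\<^sup>2 * Y ^ 18) = ?w" .
    moreover have "(24 * P)\<^sup>2 * Y ^ 18 > 0" using P Y by simp
    ultimately show ?thesis by (metis exp_ln)
  qed
  moreover have "1 + 27 / 80 * P\<^sup>2 * Y ^ 18 < (24 * P)\<^sup>2 * Y ^ 18"
  proof -
    have "1 * 1 \<le> P\<^sup>2 * Y ^ 18" using P Y by (intro mult_mono one_le_power) auto
    moreover have "(24 * P)\<^sup>2 * Y ^ 18 = 576 * (P\<^sup>2 * Y ^ 18)" by (simp add: power2_eq_square)
    ultimately show ?thesis by simp
  qed
  ultimately show ?thesis by (simp add: a_def)
qed

text \<open>The radius of the perturbation in \<open>cubic_subsolver\<close> for accuracy 1/2 and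
  smoothness parameter \<open>L\<close>.\<close>

definition perturbation :: "real \<Rightarrow> real \<Rightarrow> real \<Rightarrow> real" where
  "perturbation \<tau> \<zeta> L = \<tau>\<^sup>2 * \<zeta> ^ 3 * (1 / 2) / (576 * (L + \<tau> * \<zeta>))"

lemma perturbation_bounds:
  assumes \<tau>: "\<tau> > 0" and \<zeta>: "\<zeta> > 0" and small: "\<tau> * \<zeta> \<le> 2 * L"
  shows "perturbation \<tau> \<zeta> L > 0" "perturbation \<tau> \<zeta> L \<le> \<tau> * \<zeta>\<^sup>2 / 1728"
    "L * perturbation \<tau> \<zeta> L \<le> \<tau>\<^sup>2 * \<zeta> ^ 3 / 1152" "\<tau>\<^sup>2 * \<zeta> ^ 3 / 3456 \<le> L * perturbation \<tau> \<zeta> L"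
proof -
  have p: "\<tau> * \<zeta> > 0" using \<tau> \<zeta> by simp
  then have L: "L > 0" using small by simp
  define w where "w = L + \<tau> * \<zeta>"
  have w: "w > 0" "3 / 2 * (\<tau> * \<zeta>) \<le> w" "L \<le> w" "w \<le> 3 * L" using p L small by (simp_all add: w_def)
  have e: "perturbation \<tau> \<zeta> L = \<tau>\<^sup>2 * \<zeta> ^ 3 / 1152 / w" by (simp add: perturbation_def w_def)
  have c: "\<tau>\<^sup>2 * \<zeta> ^ 3 > 0" using \<tau> \<zeta> by simp
  show "perturbation \<tau> \<zeta> L > 0" unfolding e using c w by simp
  have "(\<tau> * \<zeta>\<^sup>2) * (3 / 2 * (\<tau> * \<zeta>)) \<le> (\<tau> * \<zeta>\<^sup>2) * w" using w \<tau> by (intro mult_left_mono) auto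
  then show "perturbation \<tau> \<zeta> L \<le> \<tau> * \<zeta>\<^sup>2 / 1728"
    unfolding e using w by (simp add: divide_le_eq power2_eq_square power3_eq_cube mult_ac)
  have "L / w \<le> 1" using w by simp
  then have "(\<tau>\<^sup>2 * \<zeta> ^ 3 / 1152) * (L / w) \<le> (\<tau>\<^sup>2 * \<zeta> ^ 3 / 1152) * 1" using c by (intro mult_left_mono) auto
  then show "L * perturbation \<tau> \<zeta> L \<le> \<tau>\<^sup>2 * \<zeta> ^ 3 / 1152" unfolding e by (simp add: mult_ac)
  have "1 / 3 \<le> L / w" using w by (simp add: le_divide_eq)
  then have "(\<tau>\<^sup>2 * \<zeta> ^ 3 / 1152) * (1 / 3) \<le> (\<tau>\<^sup>2 * \<zeta> ^ 3 / 1152) * (L / w)" using c by (intro mult_left_mono) auto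
  then show "\<tau>\<^sup>2 * \<zeta> ^ 3 / 3456 \<le> L * perturbation \<tau> \<zeta> L" unfolding e by (simp add: mult_ac)
qed

definition subsolver_steps :: "nat \<Rightarrow> real \<Rightarrow> real \<Rightarrow> real \<Rightarrow> real \<Rightarrow> nat" where
  "subsolver_steps d \<tau> \<zeta> L \<delta> = round_up (480 / (1 / (16 * L) * \<tau> * \<zeta> * (1 / 2)) *
     (6 * ln (1 + sqrt (real d) / \<delta>) + 32 * ln (12 / (1 / (16 * L) * \<tau> * \<zeta> * (1 / 2)))))"

lemma round_up_ge: "r \<le> real (round_up r)"
  unfolding round_up_def by linarith

lemma cubic_subsolver_eq:
  fixes A :: "real ^ 'n ^ 'n"
  shows "cubic_subsolver A b \<tau> (1 / (16 * L)) \<zeta> (1 / 2) \<delta> L q =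
    (let thr = - (\<tau> * \<zeta> ^ 3 / 24); x0 = cauchy_point A b \<tau> in
     if cubic A b \<tau> x0 \<le> thr then (x0, 2)
     else let b' = b + perturbation \<tau> \<zeta> L *\<^sub>R q;
       (x, a) = subsolver_loop A b b' \<tau> (1 / (16 * L)) thr (subsolver_steps CARD('n) \<tau> \<zeta> L \<delta>) (cauchy_point A b' \<tau>)
       in (x, a + 3))"
  unfolding cubic_subsolver_def subsolver_steps_def perturbation_def by (simp add: Let_def)

lemma cubic_subsolver_cost:
  fixes A :: "real ^ 'n ^ 'n"
  shows "snd (cubic_subsolver A b \<tau> (1 / (16 * L)) \<zeta> (1 / 2) \<delta> L q) \<le> 2 * subsolver_steps CARD('n) \<tau> \<zeta> L \<delta> + 3"
  unfolding cubic_subsolver_eq Let_def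
  using subsolver_loop_cost[of A b "b + perturbation \<tau> \<zeta> L *\<^sub>R q" \<tau> "1 / (16 * L)" "- (\<tau> * \<zeta> ^ 3 / 24)"]
  by (auto simp: case_prod_beta)

text \<open>All randomness is confined to \<open>rand\<close>. A deep point of the model is deep for
  the perturbed model up to the slope 1/1728; descent on the perturbed model reaches
  \<open>- \<tau> * \<zeta> ^ 3 / 20\<close>; returning to the original model costs at most
  \<open>5 / 1152 * (\<tau> * \<zeta> ^ 3)\<close>, which still leaves the constant 1/24.\<close>

theorem cubic_subsolver_success:
  fixes A :: "real ^ 'n ^ 'n"
  assumes sym: "symmetric_matrix A" and eb: "eigenbasis A e l" and i: "l i = lambda_min A"
    and \<tau>: "\<tau> > 0" and \<zeta>: "\<zeta> > 0" and small: "\<tau> * \<zeta> \<le> 2 * L"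
    and A: "\<And>x. norm (A *v x) \<le> L * norm x" and q: "norm q \<le> 1" and \<delta>: "\<delta> > 0"
    and deep: "cubic A b \<tau> y < - (\<tau> * \<zeta> ^ 3 / 12)"
    and rand: "perturbation \<tau> \<zeta> L / (1 + sqrt (real CARD('n)) / \<delta>) ^ 18
      \<le> \<bar>(b + perturbation \<tau> \<zeta> L *\<^sub>R q) \<bullet> e i\<bar>"
  shows "cubic A b \<tau> (fst (cubic_subsolver A b \<tau> (1 / (16 * L)) \<zeta> (1 / 2) \<delta> L q)) \<le> - (\<tau> * \<zeta> ^ 3 / 24)"
proof (cases "cubic A b \<tau> (cauchy_point A b \<tau>) \<le> - (\<tau> * \<zeta> ^ 3 / 24)")
  case True
  then show ?thesis unfolding cubic_subsolver_eq by (simp add: Let_def)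
next
  case False
  define \<sigma> where "\<sigma> = perturbation \<tau> \<zeta> L"
  define b' where "b' = b + \<sigma> *\<^sub>R q"
  note sb = perturbation_bounds[OF \<tau> \<zeta> small, folded \<sigma>_def]
  have p: "\<tau> * \<zeta> > 0" using \<tau> \<zeta> by simp
  then have L: "L > 0" using small by simp
  have T: "\<tau> * \<zeta> ^ 3 > 0" using \<tau> \<zeta> by simp
  have "norm b \<le> 2 * L * \<zeta>"
    using False T by (intro cauchy_point_shallow_norm_le[OF \<tau> \<zeta> small A]) simp
  moreover have "norm (\<sigma> *\<^sub>R q) \<le> \<sigma>" using q sb(1) by (simp add: mult_left_le)
  ultimately have "norm b' \<le> 2 * L * \<zeta> + \<tau> * \<zeta>\<^sup>2 / 1728"
    unfolding b'_def using norm_triangle_ineq[of b "\<sigma> *\<^sub>R q"] sb(2) by linarith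
  then have "\<tau> * norm b' \<le> \<tau> * (2 * L * \<zeta> + \<tau> * \<zeta>\<^sup>2 / 1728)" using \<tau> by simp
  also have "\<dots> = 2 * L * (\<tau> * \<zeta>) + (\<tau> * \<zeta>) * (\<tau> * \<zeta>) / 1728" by (simp add: power2_eq_square algebra_simps)
  also have "\<dots> \<le> 2 * L * (2 * L) + (2 * L) * (2 * L) / 1728"
  proof (rule add_mono)
    show "2 * L * (\<tau> * \<zeta>) \<le> 2 * L * (2 * L)" using small L by (intro mult_left_mono) auto
    have "(\<tau> * \<zeta>) * (\<tau> * \<zeta>) \<le> (2 * L) * (2 * L)" by (rule mult_mono[OF small small]) (use p L in auto)
    then show "(\<tau> * \<zeta>) * (\<tau> * \<zeta>) / 1728 \<le> (2 * L) * (2 * L) / 1728" by (rule divide_right_mono) simp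
  qed
  also have "\<dots> \<le> 41 / 10 * L\<^sup>2" by (simp add: power2_eq_square)
  finally have b': "\<tau> * norm b' \<le> 41 / 10 * L\<^sup>2" .
  interpret cubic_descent A b' \<tau> L e l
    by unfold_locales (use sym eb \<tau> L A b' in auto)
  define P where "P = 1 / (\<eta> * \<tau> * \<zeta>)"
  have P16: "P = 16 * L / (\<tau> * \<zeta>)" using p L by (simp add: P_def \<eta>_def)
  have P: "P \<ge> 8" using small p by (simp add: P16 le_divide_eq)
  define Y where "Y = 1 + sqrt (real CARD('n)) / \<delta>"
  have Y: "Y \<ge> 1" using \<delta> by (simp add: Y_def)
  define W where "W = 202 * P * (2 * ln (24 * P) + 18 * ln Y)"
  define N where "N = nat \<lceil>W\<rceil>"
  define K where "K = subsolver_steps CARD('n) \<tau> \<zeta> L \<delta>"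
  have "exp 1 \<le> 24 * P" using exp_le P by simp
  then have lnP: "ln (24 * P) \<ge> 1" using P by (simp add: ln_ge_iff)
  have lnY: "ln Y \<ge> 0" using Y by simp
  have "202 * 8 * (2 * 1 + 0) \<le> W"
    unfolding W_def using P lnP lnY by (intro mult_mono add_mono) auto
  then have W: "W \<ge> 1" by simp
  have N: "real N \<ge> W" "real N \<le> W + 1" "N \<ge> 1" using W unfolding N_def by linarith+
  have "real K \<ge> 480 / (1 / (16 * L) * \<tau> * \<zeta> * (1 / 2)) *
     (6 * ln Y + 32 * ln (12 / (1 / (16 * L) * \<tau> * \<zeta> * (1 / 2))))"
    unfolding K_def subsolver_steps_def Y_def by (rule round_up_ge)
  also have "480 / (1 / (16 * L) * \<tau> * \<zeta> * (1 / 2)) = 960 * P" using p L by (simp add: P16)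
  also have "12 / (1 / (16 * L) * \<tau> * \<zeta> * (1 / 2)) = 24 * P" using p L by (simp add: P16)
  finally have K: "960 * P * (6 * ln Y + 32 * ln (24 * P)) \<le> real K" .
  have "P * 1 \<le> P * ln (24 * P)" "0 \<le> P * ln Y" using P lnP lnY by (intro mult_left_mono mult_nonneg_nonneg; simp)+
  \<comment> \<open>Per unit of \<open>P * ln (24 * P)\<close> and \<open>P * ln Y\<close> the
    iteration cap offers 30720 and 5760 steps, against 404 and 3636 for the growth phase; the
    surplus in the first covers the \<open>4000 * P\<close> steps of the descent phase.\<close>
  then have KN: "real K > real N + 4000 / (\<eta> * \<tau> * \<zeta>)"
  proof -
    have "4000 / (\<eta> * \<tau> * \<zeta>) = 4000 * P" by (simp add: P_def)
    moreover have "W = 404 * (P * ln (24 * P)) + 3636 * (P * ln Y)" by (simp add: W_def algebra_simps)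
    moreover have "960 * P * (6 * ln Y + 32 * ln (24 * P)) = 5760 * (P * ln Y) + 30720 * (P * ln (24 * P))"
      by (simp add: algebra_simps)
    ultimately show ?thesis
      using K N(2) P \<open>P * 1 \<le> P * ln (24 * P)\<close> \<open>0 \<le> P * ln Y\<close> by linarith
  qed
  have a: "\<eta> * \<tau> * \<zeta> / 200 = 1 / (200 * P)" by (simp add: P_def)
  have "1 + 27 / 80 * P\<^sup>2 * Y ^ 18 < (1 + 1 / (200 * P)) ^ N"
    by (rule growth_time_arith[OF P Y]) (use N(1) in \<open>simp add: W_def\<close>)
  then have pw: "27 / 80 * P\<^sup>2 * Y ^ 18 < (1 + \<eta> * \<tau> * \<zeta> / 200) ^ N - 1" unfolding a by simp
  have rand': "\<sigma> / Y ^ 18 \<le> \<bar>b' \<bullet> e i\<bar>" using rand by (simp add: Y_def b'_def \<sigma>_def)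
  \<comment> \<open>27/80 is the constant for which \<open>P\<^sup>2 * \<sigma>\<close> and the
    lower bound on \<open>L * \<sigma>\<close> reproduce exactly the left-hand side.\<close>
  have "5 * L * \<zeta> / 200 \<le> \<sigma> / Y ^ 18 * (27 / 80 * P\<^sup>2 * Y ^ 18)"
  proof -
    have "\<sigma> / Y ^ 18 * (27 / 80 * P\<^sup>2 * Y ^ 18) = 27 / 80 * P\<^sup>2 * \<sigma>" using Y by simp
    also have "\<dots> = 864 / 10 * L / (\<tau> * \<zeta>)\<^sup>2 * (L * \<sigma>)"
      by (simp add: P16 power_divide power_mult_distrib power2_eq_square)
    also have "\<dots> \<ge> 864 / 10 * L / (\<tau> * \<zeta>)\<^sup>2 * (\<tau>\<^sup>2 * \<zeta> ^ 3 / 3456)"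
      using sb(4) L by (intro mult_left_mono) auto
    also have "864 / 10 * L / (\<tau> * \<zeta>)\<^sup>2 * (\<tau>\<^sup>2 * \<zeta> ^ 3 / 3456) = 5 * L * \<zeta> / 200"
      using p \<tau> \<zeta> by (simp add: power2_eq_square power3_eq_cube field_simps)
    finally show ?thesis .
  qed
  also have "\<dots> \<le> \<bar>b' \<bullet> e i\<bar> * (27 / 80 * P\<^sup>2 * Y ^ 18)"
    using rand' Y by (intro mult_right_mono) auto
  also have "\<dots> < \<bar>b' \<bullet> e i\<bar> * ((1 + \<eta> * \<tau> * \<zeta> / 200) ^ N - 1)"
  proof -
    have "0 < \<sigma> / Y ^ 18" using sb(1) Y by simp
    then have "\<bar>b' \<bullet> e i\<bar> > 0" using rand' by linarith
    then show ?thesis using pw by (rule mult_strict_left_mono[rotated])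
  qed
  finally have N2: "5 * L * \<zeta> / 200 < \<bar>b' \<bullet> e i\<bar> * ((1 + \<eta> * \<tau> * \<zeta> / 200) ^ N - 1)" .
  have qv: "\<bar>(\<sigma> *\<^sub>R q) \<bullet> v\<bar> \<le> \<sigma> * norm v" for v
    using Cauchy_Schwarz_ineq2[of q v] mult_right_mono[OF q norm_ge_zero[of v]] sb(1)
    by (simp add: abs_mult)
  have "cubic A b' \<tau> y \<le> - (\<tau> * \<zeta> ^ 3 / 12) + \<sigma> * norm y"
    using qv[of y] deep unfolding b'_def cubic_linear_shift by linarith
  also have "\<sigma> * norm y \<le> \<tau> * \<zeta>\<^sup>2 / 1728 * norm y" using sb(2) by (rule mult_right_mono) simp
  finally have "cubic A b' \<tau> y \<le> - \<tau> * \<zeta> ^ 3 / 12 + \<tau> * \<zeta>\<^sup>2 / 1728 * norm y" by simp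
  from descent_reaches_gap[OF \<zeta> i this N(3) N2 KN]
  obtain t where t: "t \<in> {1..K}" "cubic A b' \<tau> (x t) < - \<tau> * \<zeta> ^ 3 / 20" by blast
  have "\<sigma> * norm (x t) \<le> 5 / 1152 * (\<tau> * \<zeta> ^ 3)"
  proof -
    have "(\<tau> * L) * (\<sigma> * norm (x t)) = (L * \<sigma>) * (\<tau> * norm (x t))" by simp
    also have "\<dots> \<le> (\<tau>\<^sup>2 * \<zeta> ^ 3 / 1152) * (5 * L)"
      by (rule mult_mono[OF sb(3) norm_x_bound]) (use \<tau> \<zeta> in auto)
    also have "\<dots> = (\<tau> * L) * (5 / 1152 * (\<tau> * \<zeta> ^ 3))" by (simp add: power2_eq_square)
    finally show ?thesis using \<tau> L by (simp add: mult_le_cancel_left_pos)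
  qed
  moreover have "cubic A b \<tau> (x t) \<le> cubic A b' \<tau> (x t) + \<sigma> * norm (x t)"
    using qv[of "x t"] unfolding b'_def cubic_linear_shift by linarith
  ultimately have "cubic A b \<tau> (x t) \<le> - (\<tau> * \<zeta> ^ 3 / 24)" using t(2) T by simp
  then have "cubic A b \<tau> (cubic_gd A b' \<tau> (1 / (16 * L)) t (cauchy_point A b' \<tau>)) \<le> - (\<tau> * \<zeta> ^ 3 / 24)"
    by (simp add: x_def \<eta>_def)
  from subsolver_loop_success[OF _ _ this, of K]
  have "cubic A b \<tau> (fst (subsolver_loop A b b' \<tau> (1 / (16 * L)) (- (\<tau> * \<zeta> ^ 3 / 24)) K (cauchy_point A b' \<tau>)))
    \<le> - (\<tau> * \<zeta> ^ 3 / 24)" using t(1) by simp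
  then show ?thesis
    using False unfolding cubic_subsolver_eq Let_def
    by (simp add: case_prod_beta K_def b'_def \<sigma>_def)
qed

section \<open>Termination of the final solver\<close>

context cubic_descent
begin

text \<open>Every step with a gradient above \<epsilon> lowers the model by at least
  \<open>\<epsilon>\<^sup>2 / (32 * L)\<close>, while the model starts at a nonpositive value and
  never falls below \<open>- m\<close>.\<close>

lemma finalsolver_terminates:
  assumes low: "\<And>y. - m \<le> cubic A b \<tau> y" and \<epsilon>: "\<epsilon> > 0"
  shows "\<exists>N. cubic_finalsolver A b \<tau> (1 / (16 * L)) \<epsilon> = Some (x N, 2 + 2 * N) \<and>
    norm (cubic_grad A b \<tau> (x N)) \<le> \<epsilon> \<and> real N \<le> 32 * L * m / \<epsilon>\<^sup>2"
proof -
  define Q where "Q = (\<lambda>(x, a :: nat). norm (cubic_grad A b \<tau> x) > \<epsilon>)"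
  define f where "f = (\<lambda>(x, a). (x - (1 / (16 * L)) *\<^sub>R cubic_grad A b \<tau> x, a + 2 :: nat))"
  have it: "(f ^^ k) (cauchy_point A b \<tau>, 2) = (x k, 2 + 2 * k)" for k
    by (induction k) (simp_all add: x_0 x_Suc f_def \<eta>_def)
  have few: "real n \<le> 32 * L * m / \<epsilon>\<^sup>2" if big: "\<And>k. k < n \<Longrightarrow> norm (cubic_grad A b \<tau> (x k)) > \<epsilon>" for n
  proof -
    have "(\<Sum>s<n. \<eta> / 2 * \<epsilon>\<^sup>2) \<le> (\<Sum>s<n. \<eta> / 2 * (norm (cubic_grad A b \<tau> (x (0 + s))))\<^sup>2)"
      using \<eta> \<epsilon> big by (intro sum_mono mult_left_mono power_mono) (auto intro: less_imp_le)
    then have "real n * (\<eta> / 2 * \<epsilon>\<^sup>2) \<le> m"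
      using descent_sum[of 0 n] cubic_x_nonpos[of 0] low[of "x n"] by simp
    then show ?thesis using L \<epsilon> by (simp add: \<eta>_def field_simps)
  qed
  have ex: "\<exists>k. \<not> Q ((f ^^ k) (cauchy_point A b \<tau>, 2))"
  proof (rule ccontr)
    assume "\<not> ?thesis"
    then have "\<And>k. norm (cubic_grad A b \<tau> (x k)) > \<epsilon>" unfolding it Q_def by auto
    then have "\<And>n. real n \<le> 32 * L * m / \<epsilon>\<^sup>2" using few by blast
    then show False using reals_Archimedean2[of "32 * L * m / \<epsilon>\<^sup>2"] by (meson not_less)
  qed
  define N where "N = (LEAST k. \<not> Q ((f ^^ k) (cauchy_point A b \<tau>, 2)))"
  have "\<not> Q ((f ^^ N) (cauchy_point A b \<tau>, 2))" unfolding N_def by (rule LeastI_ex[OF ex])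
  then have g: "norm (cubic_grad A b \<tau> (x N)) \<le> \<epsilon>" unfolding it Q_def by simp
  have "cubic_finalsolver A b \<tau> (1 / (16 * L)) \<epsilon> = Some ((f ^^ N) (cauchy_point A b \<tau>, 2))"
    using ex unfolding cubic_finalsolver_def while_option_def N_def Q_def f_def by simp
  moreover have "real N \<le> 32 * L * m / \<epsilon>\<^sup>2"
    using not_less_Least[of _ "\<lambda>k. \<not> Q ((f ^^ k) (cauchy_point A b \<tau>, 2))", folded N_def]
    unfolding it Q_def by (intro few) simp
  ultimately show ?thesis using g it by (intro exI[of _ N]) simp
qed

end

section \<open>Anticoncentration on the unit sphere\<close>

text \<open>Volume packing: the translates of \<open>G\<close> by multiples of \<open>h\<close>
  along \<open>w\<close> are disjoint, about \<open>1 / (d * h)\<close> of them fit into the ball of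
  radius \<open>1 + 1 / d\<close>, and that ball has at most 3 times the unit volume. Rounding the
  number of translates down costs the other factor 2.\<close>

lemma measure_le_of_disjoint_translates:
  fixes G :: "'a::euclidean_space set"
  assumes G: "G \<in> sets borel" "G \<subseteq> cball 0 1" and w: "norm w = 1" and h: "h > 0"
    and sep: "\<And>z t. z \<in> G \<Longrightarrow> z + t *\<^sub>R w \<in> G \<Longrightarrow> \<bar>t\<bar> < h"
  shows "measure lborel G \<le> 6 * real DIM('a) * h * measure lborel (cball (0 :: 'a) 1)"
proof -
  define d where "d = real DIM('a)"
  define V where "V = measure lborel (cball (0 :: 'a) 1)"
  have d: "d \<ge> 1" unfolding d_def using DIM_positive[where ?'a = 'a] by linarith
  have V: "V \<ge> 0" by (simp add: V_def)
  have finC: "emeasure lborel (cball (0 :: 'a) r) < \<infinity>" for r by (rule emeasure_lborel_cball_finite)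
  have finG: "emeasure lborel G < \<infinity>"
    using emeasure_mono[OF G(2), of lborel] finC[of 1] by (simp add: le_less_trans)
  show ?thesis
  proof (cases "d * h \<ge> 1")
    case True
    have "measure lborel G \<le> V"
      unfolding V_def using finC G by (intro measure_mono_fmeasurable) (auto simp: fmeasurable_def)
    also have "\<dots> \<le> 6 * (d * h) * V" using True V by (simp add: mult_le_cancel_right1)
    finally show ?thesis by (simp add: d_def V_def mult_ac)
  next
    case False
    define N where "N = nat \<lfloor>1 / (d * h)\<rfloor>"
    have "1 / (d * h) \<ge> 1" using False d h by (simp add: field_simps)
    then have "1 \<le> \<lfloor>1 / (d * h)\<rfloor>" by (simp only: le_floor_iff of_int_1)
    then have N: "real N \<le> 1 / (d * h)" "1 / (d * h) < real N + 1" "real N \<ge> 1"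
      unfolding N_def by linarith+
    define F where "F k = (+) ((real k * h) *\<^sub>R w) ` G" for k :: nat
    have Fm: "F k \<in> sets lborel" for k
    proof -
      have "F k = (\<lambda>z. z - (real k * h) *\<^sub>R w) -` G \<inter> space borel"
        unfolding F_def by (auto simp: image_iff algebra_simps intro!: bexI[of _ "_ - _"])
      also have "\<dots> \<in> sets borel" by (rule measurable_sets[OF _ G(1)]) simp
      finally show ?thesis by simp
    qed
    have disj: "disjoint_family_on F {..<N}"
      unfolding disjoint_family_on_def
    proof (intro ballI impI, rule ccontr)
      fix m n assume mn: "m \<noteq> n" and "F m \<inter> F n \<noteq> {}"
      then obtain a c where a: "a \<in> G" and c: "c \<in> G"
        and eq: "(real m * h) *\<^sub>R w + a = (real n * h) *\<^sub>R w + c" unfolding F_def by auto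
      have "a + (real m * h - real n * h) *\<^sub>R w = c" using eq by (simp add: algebra_simps)
      with sep[OF a] c have "\<bar>real m * h - real n * h\<bar> < h" by metis
      then have "\<bar>real m - real n\<bar> * h < 1 * h" using h by (simp add: left_diff_distrib[symmetric] abs_mult)
      then have "\<bar>real m - real n\<bar> < 1" using h by (simp only: mult_less_cancel_right_pos)
      then show False using mn by linarith
    qed
    have Fmeas: "measure lborel (F k) = measure lborel G" for k
      using measure_translation[of "(real k * h) *\<^sub>R w" G] Fm[of k] G(1)
      by (simp add: F_def measure_completion)
    have Ffin: "emeasure lborel (F k) \<noteq> \<infinity>" for k
    proof -
      have "bounded (F k)" unfolding F_def
        using G(2) bounded_cball bounded_subset bounded_translation by metis
      then show ?thesis using emeasure_bounded_finite[of "F k"] by simp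
    qed
    have "real N * measure lborel G = (\<Sum>k<N. measure lborel (F k))" by (simp add: Fmeas)
    also have "\<dots> = measure lborel (\<Union>k<N. F k)"
      using disj Fm Ffin by (intro measure_finite_Union[symmetric]) auto
    also have "\<dots> \<le> measure lborel (cball (0 :: 'a) (1 + 1 / d))"
    proof (rule measure_mono_fmeasurable)
      show "(\<Union>k<N. F k) \<subseteq> cball 0 (1 + 1 / d)"
      proof
        fix z assume "z \<in> (\<Union>k<N. F k)"
        then obtain k a where k: "k < N" and a: "a \<in> G" and z: "z = (real k * h) *\<^sub>R w + a"
          unfolding F_def by auto
        have "real k * h \<le> real N * h" using k h by simp
        also have "\<dots> \<le> 1 / (d * h) * h" using N(1) h by (intro mult_right_mono) auto
        finally have "real k * h \<le> 1 / d" using h by simp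
        moreover have "norm z \<le> norm ((real k * h) *\<^sub>R w) + norm a" unfolding z by (rule norm_triangle_ineq)
        moreover have "norm a \<le> 1" using a G(2) by auto
        ultimately show "z \<in> cball 0 (1 + 1 / d)" using w h by simp
      qed
    qed (use Fm finC in \<open>auto simp: fmeasurable_def\<close>)
    also have "\<dots> = (1 + 1 / d) ^ DIM('a) * V"
      using d by (simp add: V_def content_cball)
    also have "\<dots> \<le> 3 * V"
    proof (rule mult_right_mono[OF _ V])
      have "(1 + 1 / d) ^ DIM('a) \<le> exp 1"
        unfolding d_def by (rule exp_ge_one_plus_x_over_n_power_n) auto
      then show "(1 + 1 / d) ^ DIM('a) \<le> 3" using exp_le by linarith
    qed
    finally have NG: "real N * measure lborel G \<le> 3 * V" .
    have "1 / (2 * (d * h)) \<le> real N" using N by (simp add: field_simps)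
    then have "1 / (2 * (d * h)) * measure lborel G \<le> 3 * V"
      using NG by (meson measure_nonneg mult_right_mono order_trans)
    then show ?thesis using d h unfolding d_def[symmetric] V_def[symmetric] by (simp add: field_simps)
  qed
qed

text \<open>The derivative of \<open>x / sqrt (x\<^sup>2 + r)\<close> is
  \<open>r / (x\<^sup>2 + r) powr (3/2)\<close>, which is at least \<open>r\<close> while
  \<open>x\<^sup>2 + r \<le> 1\<close>. An intermediate point satisfies this because one of the end
  points has at least as large a square.\<close>

lemma slope_on_unit_ball:
  fixes p p' r :: real
  assumes r: "r > 0" and p: "p < p'" "p\<^sup>2 + r \<le> 1" "p'\<^sup>2 + r \<le> 1"
  shows "r * (p' - p) \<le> p' / sqrt (p'\<^sup>2 + r) - p / sqrt (p\<^sup>2 + r)"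
proof -
  define g where "g x = x / sqrt (x\<^sup>2 + r)" for x
  have pos: "x\<^sup>2 + r > 0" for x using r by (simp add: add_nonneg_pos)
  have "(g has_real_derivative (r / ((x\<^sup>2 + r) * sqrt (x\<^sup>2 + r)))) (at x)" for x
  proof -
    have s: "sqrt (x\<^sup>2 + r) > 0" "sqrt (x\<^sup>2 + r) * sqrt (x\<^sup>2 + r) = x\<^sup>2 + r" using pos[of x] by auto
    have "((\<lambda>x. x\<^sup>2 + r) has_real_derivative (2 * x)) (at x)"
      by (auto intro!: derivative_eq_intros)
    from DERIV_chain2[OF DERIV_real_sqrt[OF pos[of x]] this]
    have "((\<lambda>x. sqrt (x\<^sup>2 + r)) has_real_derivative (x / sqrt (x\<^sup>2 + r))) (at x)"
      by (simp add: field_simps)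
    from DERIV_quotient[OF DERIV_ident this] s(1)
    have "(g has_real_derivative ((1 * sqrt (x\<^sup>2 + r) - (x / sqrt (x\<^sup>2 + r)) * x) / (sqrt (x\<^sup>2 + r))\<^sup>2)) (at x)"
      unfolding g_def by (simp add: power2_eq_square)
    moreover have "(1 * sqrt (x\<^sup>2 + r) - (x / sqrt (x\<^sup>2 + r)) * x) = r / sqrt (x\<^sup>2 + r)"
      using s by (simp add: field_simps power2_eq_square)
    moreover have "(sqrt (x\<^sup>2 + r))\<^sup>2 = x\<^sup>2 + r" using pos[of x] by simp
    ultimately show ?thesis by (simp add: mult.commute)
  qed
  from MVT2[OF p(1), of g, OF this]
  obtain y where y: "p < y" "y < p'" "g p' - g p = (p' - p) * (r / ((y\<^sup>2 + r) * sqrt (y\<^sup>2 + r)))" by blast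
  have "y\<^sup>2 \<le> p\<^sup>2 \<or> y\<^sup>2 \<le> p'\<^sup>2"
    using y(1,2) by (cases "y \<ge> 0") (auto simp: power2_le_iff_abs_le abs_le_square_iff[symmetric])
  then have y1: "y\<^sup>2 + r \<le> 1" using p by auto
  then have "(y\<^sup>2 + r) * sqrt (y\<^sup>2 + r) \<le> 1 * 1"
    using pos[of y] by (intro mult_mono) auto
  moreover have "0 < (y\<^sup>2 + r) * sqrt (y\<^sup>2 + r)" using pos[of y] by simp
  ultimately have "r \<le> r / ((y\<^sup>2 + r) * sqrt (y\<^sup>2 + r))"
    using r by (simp add: le_divide_eq mult_left_le)
  then have "r * (p' - p) \<le> (p' - p) * (r / ((y\<^sup>2 + r) * sqrt (y\<^sup>2 + r)))"
    using p(1) mult_left_mono[of r _ "p' - p"] by (simp only: mult.commute[of r] diff_ge_0_iff_ge less_imp_le)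
  then show ?thesis using y(3) by (simp add: g_def)
qed

text \<open>The part of \<open>z\<close> orthogonal to \<open>v\<close> is constant along the line
  and has length at least \<open>\<bar>z \<bullet> u\<bar>\<close>. Away from the axis through
  \<open>v\<close>, radial projection hence compresses motion along \<open>v\<close> by no more than
  the factor \<open>r\<^sup>2\<close>.\<close>

lemma sgn_inner_increment:
  fixes v u z :: "'a::real_inner"
  assumes v: "norm v = 1" and u: "norm u = 1" "u \<bullet> v = 0"
    and r: "r > 0" "r \<le> \<bar>z \<bullet> u\<bar>" and t: "t > 0" and z: "norm z \<le> 1" "norm (z + t *\<^sub>R v) \<le> 1"
  shows "r\<^sup>2 * t \<le> sgn (z + t *\<^sub>R v) \<bullet> v - sgn z \<bullet> v"
proof -
  define p where "p = z \<bullet> v"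
  define R where "R = (norm z)\<^sup>2 - p\<^sup>2"
  have vv: "v \<bullet> v = 1" and uu: "u \<bullet> u = 1" using v u by (simp_all add: norm_eq_1)
  have "0 \<le> (z - p *\<^sub>R v - (z \<bullet> u) *\<^sub>R u) \<bullet> (z - p *\<^sub>R v - (z \<bullet> u) *\<^sub>R u)" by simp
  also have "\<dots> = (norm z)\<^sup>2 - p\<^sup>2 - (z \<bullet> u)\<^sup>2"
    unfolding power2_norm_eq_inner using u(2) by (simp add: inner_diff_left inner_diff_right vv uu p_def
        inner_commute[of v z] inner_commute[of u z] inner_commute[of v u] power2_eq_square algebra_simps)
  finally have "(z \<bullet> u)\<^sup>2 \<le> R" by (simp add: R_def)
  moreover have "r\<^sup>2 \<le> (z \<bullet> u)\<^sup>2" using r by (simp add: abs_le_square_iff[symmetric])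
  ultimately have R: "r\<^sup>2 \<le> R" by simp
  then have R0: "R > 0" using r(1) by (smt (verit) zero_less_power)
  have n1: "(norm z)\<^sup>2 = p\<^sup>2 + R" by (simp add: R_def)
  have n2: "(norm (z + t *\<^sub>R v))\<^sup>2 = (p + t)\<^sup>2 + R"
    unfolding R_def power2_norm_eq_inner
    by (simp add: inner_add_left inner_add_right vv p_def
        inner_commute[of v z] power2_eq_square algebra_simps)
  have le: "p\<^sup>2 + R \<le> 1" "(p + t)\<^sup>2 + R \<le> 1"
    using z unfolding n1[symmetric] n2[symmetric] by (simp_all add: power_le_one)
  have "r\<^sup>2 * t \<le> R * t" using R t by simp
  also have "\<dots> \<le> (p + t) / sqrt ((p + t)\<^sup>2 + R) - p / sqrt (p\<^sup>2 + R)"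
    using slope_on_unit_ball[OF R0 _ le] t by simp
  also have "\<dots> = sgn (z + t *\<^sub>R v) \<bullet> v - sgn z \<bullet> v"
    unfolding n1[symmetric] n2[symmetric]
    by (simp add: sgn_div_norm inner_add_left vv p_def divide_inverse mult.commute)
  finally show ?thesis .
qed

lemma prob_space_sphere_measure: "prob_space (sphere_measure :: (real ^ 'd) measure)"
  unfolding sphere_measure_def
proof (rule prob_space.prob_space_distr)
  show "prob_space (uniform_measure lborel (cball (0 :: real ^ 'd) 1))"
  proof (rule prob_space_uniform_measure)
    show "emeasure lborel (cball (0 :: real ^ 'd) 1) \<noteq> 0"
      using emeasure_lborel_ball_finite[of "0 :: real ^ 'd" 1] content_cball[of 1 "0 :: real ^ 'd"]
      by (auto simp: emeasure_cball unit_ball_vol_pos)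
    show "emeasure lborel (cball (0 :: real ^ 'd) 1) \<noteq> \<infinity>"
      using emeasure_lborel_cball_finite[of "0 :: real ^ 'd" 1] by auto
  qed
qed (simp add: sgn_div_norm[abs_def])

lemma measure_sphere_measure:
  fixes S :: "(real ^ 'd) set"
  assumes "S \<in> sets borel"
  shows "measure sphere_measure S = measure lborel (cball 0 1 \<inter> sgn -` S) / measure lborel (cball (0 :: real ^ 'd) 1)"
proof -
  have ne: "unit_ball_vol (real CARD('d)) \<noteq> 0"
    by (metis less_irrefl of_nat_0_le_iff unit_ball_vol_pos)
  have m: "(sgn :: real ^ 'd \<Rightarrow> _) \<in> borel_measurable borel" by (simp add: sgn_div_norm[abs_def])
  have S': "sgn -` S \<in> sets borel" using measurable_sets[OF m assms] by simp
  have "measure sphere_measure S = measure (uniform_measure lborel (cball 0 1)) (sgn -` S)"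
    unfolding sphere_measure_def using m assms by (subst measure_distr) (auto simp: uniform_measure_def)
  also have "\<dots> = measure lborel (cball 0 1 \<inter> sgn -` S) / measure lborel (cball (0 :: real ^ 'd) 1)"
    using S' ne by (intro measure_uniform_measure) (auto simp: emeasure_cball)
  finally show ?thesis .
qed

text \<open>The event is pulled back to the ball and split by the slab
  \<open>\<bar>z \<bullet> u\<bar> < r\<close>, for a unit vector \<open>u\<close> orthogonal to
  \<open>v\<close>, which exists from dimension 2 on. The slab is thin along \<open>u\<close>; the
  rest is thin along \<open>v\<close>, with thickness \<open>2 * s / r\<^sup>2\<close>. The bound
  \<open>s \<le> r ^ 3\<close> balances both parts, and \<open>r = \<delta> / (24 * n)\<close> makes
  their sum \<delta>.\<close>

theorem sphere_anticoncentration: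
  fixes v :: "real ^ 'd"
  assumes v: "norm v = 1" and d: "CARD('d) \<ge> 2" and \<delta>: "\<delta> > 0"
    and s: "s \<le> (\<delta> / (24 * real CARD('d))) ^ 3"
  shows "measure sphere_measure {q. \<bar>c + q \<bullet> v\<bar> < s} \<le> \<delta>"
proof (cases "s > 0")
  case False
  then have "{q. \<bar>c + q \<bullet> v\<bar> < s} = {}" by force
  then show ?thesis using \<delta> by simp
next
  case s0: True
  obtain u0 where u0: "u0 \<noteq> 0" "orthogonal v u0"
    using orthogonal_to_vector_exists[of v] d by auto
  define u where "u = sgn u0"
  have u: "norm u = 1" "u \<bullet> v = 0"
    using u0 by (auto simp: u_def norm_sgn sgn_div_norm orthogonal_def inner_commute)
  define n where "n = real CARD('d)"
  have n: "n \<ge> 2" using d by (simp add: n_def)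
  define r where "r = \<delta> / (24 * n)"
  have r: "r > 0" using \<delta> n by (simp add: r_def)
  define V where "V = measure lborel (cball (0 :: real ^ 'd) 1)"
  have V: "V > 0" unfolding V_def by (simp add: content_cball unit_ball_vol_pos)
  define S where "S = {q :: real ^ 'd. \<bar>c + q \<bullet> v\<bar> < s}"
  have "open S" unfolding S_def by (intro open_Collect_less continuous_intros)
  then have Sb: "S \<in> sets borel" by simp
  define G where "G = cball 0 1 \<inter> sgn -` S"
  have Gb: "G \<in> sets borel" unfolding G_def
    using measurable_sets[of "sgn :: real ^ 'd \<Rightarrow> _" borel borel S] Sb by (simp add: sgn_div_norm[abs_def])
  define G1 where "G1 = cball 0 1 \<inter> {z. \<bar>z \<bullet> u\<bar> < r}"
  define G2 where "G2 = G \<inter> {z. r \<le> \<bar>z \<bullet> u\<bar>}"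
  have G1b: "G1 \<in> sets borel" unfolding G1_def
    by (intro sets.Int borel_closed closed_cball borel_open open_Collect_less continuous_intros)
  have G2b: "G2 \<in> sets borel" unfolding G2_def
    by (intro sets.Int Gb borel_closed closed_Collect_le continuous_intros)
  have uu: "u \<bullet> u = 1" using u by (simp add: norm_eq_1)
  have m1: "measure lborel G1 \<le> 6 * real DIM(real ^ 'd) * (2 * r) * V"
    unfolding V_def
  proof (rule measure_le_of_disjoint_translates[OF G1b _ u(1)])
    fix z t assume "z \<in> G1" "z + t *\<^sub>R u \<in> G1"
    then have "\<bar>z \<bullet> u\<bar> < r" "\<bar>z \<bullet> u + t\<bar> < r" by (simp_all add: G1_def inner_add_left uu)
    then show "\<bar>t\<bar> < 2 * r" by linarith
  qed (use r in \<open>auto simp: G1_def\<close>)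
  have key: "t < 2 * s / r\<^sup>2" if "z \<in> G2" "z + t *\<^sub>R v \<in> G2" "t > 0" for z t
  proof -
    have "r\<^sup>2 * t \<le> sgn (z + t *\<^sub>R v) \<bullet> v - sgn z \<bullet> v"
      by (rule sgn_inner_increment[OF v u r]) (use that in \<open>auto simp: G2_def G_def\<close>)
    also have "\<dots> < 2 * s" using that by (auto simp: G2_def G_def S_def)
    finally show ?thesis using r by (simp add: less_divide_eq mult.commute)
  qed
  have m2: "measure lborel G2 \<le> 6 * real DIM(real ^ 'd) * (2 * s / r\<^sup>2) * V"
    unfolding V_def
  proof (rule measure_le_of_disjoint_translates[OF G2b _ v])
    fix z t assume z: "z \<in> G2" "z + t *\<^sub>R v \<in> G2"
    have "- t < 2 * s / r\<^sup>2" if "t < 0"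
      using key[OF z(2), of "- t"] z(1) that by simp
    moreover have "0 < 2 * s / r\<^sup>2" using s0 r by simp
    ultimately show "\<bar>t\<bar> < 2 * s / r\<^sup>2" using key[OF z] by (cases "t > 0"; cases "t < 0") auto
  qed (use r s0 in \<open>auto simp: G2_def G_def\<close>)
  have fin: "X \<in> fmeasurable lborel" if "X \<in> sets borel" "X \<subseteq> cball 0 1" for X :: "(real ^ 'd) set"
    using that emeasure_mono[OF that(2), of lborel] emeasure_lborel_cball_finite[of "0 :: real ^ 'd" 1]
    by (auto simp: fmeasurable_def le_less_trans)
  have "measure lborel G \<le> measure lborel (G1 \<union> G2)"
    using Gb G1b G2b by (intro measure_mono_fmeasurable fin) (auto simp: G1_def G2_def G_def)
  also have "\<dots> \<le> measure lborel G1 + measure lborel G2"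
    using G1b G2b by (intro measure_Un_le) auto
  also have "\<dots> \<le> 6 * n * (2 * r) * V + 6 * n * (2 * s / r\<^sup>2) * V"
    using m1 m2 by (simp add: n_def)
  also have "\<dots> \<le> 6 * n * (2 * r) * V + 6 * n * (2 * r) * V"
  proof -
    have "s \<le> r ^ 3" using s by (simp add: r_def n_def)
    then have "s / r\<^sup>2 \<le> r" using r by (simp add: divide_le_eq power2_eq_square power3_eq_cube)
    then have "(12 * n * V) * (s / r\<^sup>2) \<le> (12 * n * V) * r" using n V by (intro mult_left_mono) auto
    then show ?thesis by (simp add: mult_ac)
  qed
  also have "\<dots> = \<delta> * V" using n by (simp add: r_def)
  finally have "measure lborel G / V \<le> \<delta>" using V by (simp add: divide_le_eq)
  then show ?thesis using measure_sphere_measure[OF Sb] by (simp add: S_def G_def V_def)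
qed

section \<open>Concentration of vector averages\<close>

text \<open>Convexity of \<open>w ^ k\<close> on the nonnegative axis, with the denominator
  \<open>v - u\<close> cleared so that a degenerate interval causes no case split.\<close>

lemma power_chord:
  fixes u v w :: real
  assumes "0 \<le> u" "u \<le> w" "w \<le> v"
  shows "(v - u) * w ^ k \<le> (v - w) * u ^ k + (w - u) * v ^ k"
proof (induction k)
  case (Suc k)
  have "(v - u) * w ^ Suc k = w * ((v - u) * w ^ k)" by simp
  also have "\<dots> \<le> w * ((v - w) * u ^ k + (w - u) * v ^ k)"
    using Suc assms by (intro mult_left_mono) auto
  also have "\<dots> = (v - w) * u ^ Suc k + (w - u) * v ^ Suc k - (v - w) * (w - u) * (v ^ k - u ^ k)"
    by (simp add: algebra_simps)
  also have "\<dots> \<le> (v - w) * u ^ Suc k + (w - u) * v ^ Suc k"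
    using assms power_mono[of u v k] by simp
  finally show ?case .
qed simp

text \<open>The power series of cosh has nonnegative coefficients and only even powers, each a power
  of \<open>t\<^sup>2\<close> that lies below its chord in that variable.\<close>

lemma cosh_chord:
  fixes p q t :: real
  assumes "0 \<le> p" "p \<le> t" "t \<le> q"
  shows "(q\<^sup>2 - p\<^sup>2) * cosh t \<le> (q\<^sup>2 - t\<^sup>2) * cosh p + (t\<^sup>2 - p\<^sup>2) * cosh q"
proof (rule sums_le)
  show "(\<lambda>n. (q\<^sup>2 - p\<^sup>2) * (if even n then t ^ n /\<^sub>R fact n else 0)) sums ((q\<^sup>2 - p\<^sup>2) * cosh t)"
    by (intro sums_mult cosh_converges)
  show "(\<lambda>n. (q\<^sup>2 - t\<^sup>2) * (if even n then p ^ n /\<^sub>R fact n else 0)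
      + (t\<^sup>2 - p\<^sup>2) * (if even n then q ^ n /\<^sub>R fact n else 0))
    sums ((q\<^sup>2 - t\<^sup>2) * cosh p + (t\<^sup>2 - p\<^sup>2) * cosh q)"
    by (intro sums_add sums_mult cosh_converges)
  fix n :: nat
  show "(q\<^sup>2 - p\<^sup>2) * (if even n then t ^ n /\<^sub>R fact n else 0)
    \<le> (q\<^sup>2 - t\<^sup>2) * (if even n then p ^ n /\<^sub>R fact n else 0)
      + (t\<^sup>2 - p\<^sup>2) * (if even n then q ^ n /\<^sub>R fact n else 0)"
  proof (cases "even n")
    case True
    then obtain k where n: "n = 2 * k" by (elim evenE)
    have "(q\<^sup>2 - p\<^sup>2) * (t\<^sup>2) ^ k \<le> (q\<^sup>2 - t\<^sup>2) * (p\<^sup>2) ^ k + (t\<^sup>2 - p\<^sup>2) * (q\<^sup>2) ^ k"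
      using assms by (intro power_chord power_mono) auto
    then have "((q\<^sup>2 - p\<^sup>2) * t ^ n) / fact n \<le> ((q\<^sup>2 - t\<^sup>2) * p ^ n + (t\<^sup>2 - p\<^sup>2) * q ^ n) / fact n"
      unfolding n power_mult by (intro divide_right_mono) auto
    moreover have "((q\<^sup>2 - t\<^sup>2) * p ^ n + (t\<^sup>2 - p\<^sup>2) * q ^ n) / fact n
        = (q\<^sup>2 - t\<^sup>2) * (p ^ n /\<^sub>R fact n) + (t\<^sup>2 - p\<^sup>2) * (q ^ n /\<^sub>R fact n)"
      by (simp add: divide_inverse distrib_right distrib_left mult_ac)
    moreover have "((q\<^sup>2 - p\<^sup>2) * t ^ n) / fact n = (q\<^sup>2 - p\<^sup>2) * (t ^ n /\<^sub>R fact n)"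
      by (simp add: divide_inverse mult_ac)
    ultimately show ?thesis using True by (simp only: if_True)
  qed simp
qed

lemma sinh_le_mult_cosh:
  fixes x :: real assumes "0 \<le> x" shows "sinh x \<le> x * cosh x"
proof -
  have "0 * cosh 0 - sinh 0 \<le> x * cosh x - sinh x"
  proof (rule DERIV_nonneg_imp_nondecreasing[OF assms])
    fix y :: real assume y: "0 \<le> y" "y \<le> x"
    have "((\<lambda>y. y * cosh y - sinh y) has_real_derivative y * sinh y) (at y)"
      by (auto intro!: derivative_eq_intros)
    moreover have "0 \<le> y * sinh y" using y by simp
    ultimately show "\<exists>D. ((\<lambda>y. y * cosh y - sinh y) has_real_derivative D) (at y) \<and> 0 \<le> D" by blast
  qed
  then show ?thesis by simp
qed

lemma cosh_le_exp_half_square: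
  fixes x :: real shows "cosh x \<le> exp (x\<^sup>2 / 2)"
proof -
  have "cosh y \<le> exp (y\<^sup>2 / 2)" if "0 \<le> y" for y :: real
  proof -
    have "cosh y * exp (- (y\<^sup>2 / 2)) \<le> cosh 0 * exp (- (0\<^sup>2 / 2))"
    proof (rule DERIV_nonpos_imp_nonincreasing[OF that])
      fix z :: real assume z: "0 \<le> z" "z \<le> y"
      have "((\<lambda>z. cosh z * exp (- (z\<^sup>2 / 2))) has_real_derivative (sinh z - z * cosh z) * exp (- (z\<^sup>2 / 2))) (at z)"
        by (auto intro!: derivative_eq_intros simp: algebra_simps)
      moreover have "(sinh z - z * cosh z) * exp (- (z\<^sup>2 / 2)) \<le> 0"
        using sinh_le_mult_cosh[OF z(1)] by (intro mult_nonpos_nonneg) auto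
      ultimately show "\<exists>D. ((\<lambda>z. cosh z * exp (- (z\<^sup>2 / 2))) has_real_derivative D) (at z) \<and> D \<le> 0" by blast
    qed
    then show ?thesis by (simp add: exp_minus field_simps)
  qed
  from this[of "\<bar>x\<bar>"] show ?thesis by simp
qed

text \<open>The function \<open>cosh (r * sqrt w)\<close> is convex in \<open>w\<close>, so in terms of \<open>x \<bullet> y\<close> it lies below its
  chord over the range allowed by Cauchy-Schwarz.  The chord is affine in \<open>y\<close> and averages out.\<close>

lemma cosh_norm_add_le:
  fixes x y :: "'a::real_inner"
  assumes y: "norm y \<le> b" and r: "r \<ge> 0" and a: "norm x > 0" and b: "b > 0"
  shows "cosh (r * norm (x + y)) \<le> cosh (r * norm x) * cosh (r * b)
    + (x \<bullet> y) / (norm x * b) * (sinh (r * norm x) * sinh (r * b))"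
proof (cases "r = 0")
  case False
  with r have r: "r > 0" by simp
  \<comment> \<open>An upper bound for \<open>(norm (x + y))\<^sup>2\<close> that is affine in
    \<open>x \<bullet> y\<close> and lies between the squares of \<open>norm x - b\<close> and
    \<open>norm x + b\<close>.\<close>
  define w where "w = (norm x)\<^sup>2 + 2 * (x \<bullet> y) + b\<^sup>2"
  let ?a = "norm x"
  have cs: "\<bar>x \<bullet> y\<bar> \<le> ?a * b"
    using Cauchy_Schwarz_ineq2[of x y] mult_left_mono[OF y norm_ge_zero[of x]] by linarith
  have lo: "(?a - b)\<^sup>2 \<le> w" and hi: "w \<le> (?a + b)\<^sup>2"
    using cs by (auto simp: w_def power2_eq_square algebra_simps abs_le_iff)
  have w0: "w \<ge> 0" using lo zero_le_power2[of "?a - b"] by linarith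
  have "(norm (x + y))\<^sup>2 \<le> w"
    using power_mono[OF y norm_ge_zero, of 2]
    by (simp add: w_def power2_norm_eq_inner inner_add_left inner_add_right inner_commute)
  then have "norm (x + y) \<le> sqrt w" by (simp add: real_le_rsqrt)
  then have "cosh (r * norm (x + y)) \<le> cosh (r * sqrt w)"
    using r w0 by (subst cosh_real_nonneg_le_iff) auto
  moreover have "((r * (?a + b))\<^sup>2 - (r * \<bar>?a - b\<bar>)\<^sup>2) * cosh (r * sqrt w)
     \<le> ((r * (?a + b))\<^sup>2 - (r * sqrt w)\<^sup>2) * cosh (r * \<bar>?a - b\<bar>)
      + ((r * sqrt w)\<^sup>2 - (r * \<bar>?a - b\<bar>)\<^sup>2) * cosh (r * (?a + b))"
  proof (rule cosh_chord)
    show "r * \<bar>?a - b\<bar> \<le> r * sqrt w" using lo r by (simp add: real_le_rsqrt)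
    show "r * sqrt w \<le> r * (?a + b)" using hi r a b by (simp add: real_le_lsqrt)
  qed (use r in auto)
  moreover have "(r * (?a + b))\<^sup>2 - (r * \<bar>?a - b\<bar>)\<^sup>2 = r\<^sup>2 * (4 * ?a * b)"
    by (simp add: power_mult_distrib) (simp add: power2_eq_square algebra_simps)
  moreover have "(r * (?a + b))\<^sup>2 - (r * sqrt w)\<^sup>2 = r\<^sup>2 * (2 * ?a * b - 2 * (x \<bullet> y))"
    using w0 by (simp add: power_mult_distrib w_def) (simp add: power2_eq_square algebra_simps)
  moreover have "(r * sqrt w)\<^sup>2 - (r * \<bar>?a - b\<bar>)\<^sup>2 = r\<^sup>2 * (2 * ?a * b + 2 * (x \<bullet> y))"
    using w0 by (simp add: power_mult_distrib w_def) (simp add: power2_eq_square algebra_simps)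
  moreover have "cosh (r * \<bar>?a - b\<bar>) = cosh (r * ?a) * cosh (r * b) - sinh (r * ?a) * sinh (r * b)"
  proof -
    have "r * \<bar>?a - b\<bar> = \<bar>r * ?a - r * b\<bar>"
      using r by (simp add: right_diff_distrib[symmetric] abs_mult)
    then show ?thesis by (simp add: cosh_diff)
  qed
  moreover have "cosh (r * (?a + b)) = cosh (r * ?a) * cosh (r * b) + sinh (r * ?a) * sinh (r * b)"
    by (simp add: distrib_left cosh_add)
  moreover have "r\<^sup>2 * (2 * ?a * b - 2 * (x \<bullet> y)) * (P - Q) + r\<^sup>2 * (2 * ?a * b + 2 * (x \<bullet> y)) * (P + Q)
      = r\<^sup>2 * (4 * ?a * b) * (P + (x \<bullet> y) / (?a * b) * Q)" for P Q :: real
  proof -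
    have "(4 * ?a * b) * ((x \<bullet> y) / (?a * b) * Q) = 4 * (x \<bullet> y) * Q" using a b by simp
    then have "r\<^sup>2 * (4 * ?a * b) * (P + (x \<bullet> y) / (?a * b) * Q) = r\<^sup>2 * (4 * ?a * b * P + 4 * (x \<bullet> y) * Q)"
      by (simp only: distrib_left mult.assoc)
    then show ?thesis by (simp add: algebra_simps)
  qed
  ultimately have "r\<^sup>2 * (4 * ?a * b) * cosh (r * sqrt w) \<le>
     r\<^sup>2 * (4 * ?a * b) * (cosh (r * ?a) * cosh (r * b)
    + (x \<bullet> y) / (?a * b) * (sinh (r * ?a) * sinh (r * b)))"
    by (simp only:)
  moreover have "r\<^sup>2 * (4 * ?a * b) > 0" using r a b by simp
  ultimately have "cosh (r * sqrt w) \<le> cosh (r * ?a) * cosh (r * b)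
    + (x \<bullet> y) / (?a * b) * (sinh (r * ?a) * sinh (r * b))"
    by (simp only: mult_le_cancel_left_pos)
  then show ?thesis using \<open>cosh (r * norm (x + y)) \<le> cosh (r * sqrt w)\<close> by linarith
qed simp

text \<open>The term linear in \<open>Y i\<close> sums to zero. The chord divides by
  \<open>norm x * b\<close>, so the two degenerate cases are treated directly.\<close>

lemma sum_cosh_norm_add_le:
  fixes x :: "'a::real_inner"
  assumes I: "finite I" and mean: "(\<Sum>i\<in>I. Y i) = 0" and Y: "\<And>i. i \<in> I \<Longrightarrow> norm (Y i) \<le> b"
    and r: "r \<ge> 0" and b: "b \<ge> 0"
  shows "(\<Sum>i\<in>I. cosh (r * norm (x + Y i))) \<le> real (card I) * (cosh (r * b) * cosh (r * norm x))"
proof -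
  consider "x = 0" | "b = 0" | "norm x > 0" "b > 0" using b by fastforce
  then show ?thesis
  proof cases
    case 1
    have "(\<Sum>i\<in>I. cosh (r * norm (x + Y i))) \<le> (\<Sum>i\<in>I. cosh (r * b))"
      using 1 Y r b by (intro sum_mono) (subst cosh_real_nonneg_le_iff, auto simp: mult_left_mono)
    then show ?thesis using 1 by simp
  next
    case 2
    have "(\<Sum>i\<in>I. cosh (r * norm (x + Y i))) = (\<Sum>i\<in>I. cosh (r * norm x))"
      using Y 2 by (intro sum.cong) auto
    then show ?thesis using 2 by simp
  next
    case 3
    have "(\<Sum>i\<in>I. cosh (r * norm (x + Y i))) \<le> (\<Sum>i\<in>I. cosh (r * norm x) * cosh (r * b)
      + (x \<bullet> Y i) / (norm x * b) * (sinh (r * norm x) * sinh (r * b)))"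
      by (intro sum_mono cosh_norm_add_le Y r 3)
    also have "\<dots> = real (card I) * (cosh (r * norm x) * cosh (r * b))
      + (x \<bullet> (\<Sum>i\<in>I. Y i)) / (norm x * b) * (sinh (r * norm x) * sinh (r * b))"
      by (simp add: sum.distrib inner_sum_right sum_divide_distrib sum_distrib_right)
    finally show ?thesis using mean by (simp add: mult.commute)
  qed
qed

lemma sequence_space_index: "sequence_space (measure_pmf p)"
  by unfold_locales

lemma prob_space_index_seq_measure: "prob_space (index_seq_measure n)"
proof -
  interpret sequence_space "measure_pmf (pmf_of_set {1..n})" by (rule sequence_space_index)
  show ?thesis unfolding index_seq_measure_def by unfold_locales
qed

lemma space_index_seq_measure [simp]: "space (index_seq_measure n) = UNIV"
  by (auto simp: index_seq_measure_def space_PiM)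

lemma measurable_index_component [measurable]:
  "(\<lambda>j. j k) \<in> measurable (index_seq_measure n) (count_space UNIV)"
  unfolding index_seq_measure_def
  using measurable_component_singleton[of k UNIV "\<lambda>_. measure_pmf (pmf_of_set {1..n})"]
  by (simp cong: measurable_cong_sets)

text \<open>The infinite sample is a uniform first index followed by an independent copy of the
  whole, which allows induction on the batch size.\<close>

lemma nn_integral_index_seq_first:
  assumes n: "n \<ge> 1" and G: "G \<in> borel_measurable (index_seq_measure n)"
  shows "(\<integral>\<^sup>+ j. G j \<partial>index_seq_measure n)
    = (\<Sum>i=1..n. (\<integral>\<^sup>+ j. G (case_nat i j) \<partial>index_seq_measure n)) / real n"
proof -
  let ?p = "measure_pmf (pmf_of_set {1..n})"
  interpret sequence_space ?p by (rule sequence_space_index)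
  have S: "index_seq_measure n = PiM UNIV (\<lambda>_. ?p)" by (simp add: index_seq_measure_def)
  have meas: "(\<lambda>(s, \<omega>). case_nat s \<omega>) \<in> measurable (?p \<Otimes>\<^sub>M PiM UNIV (\<lambda>_. ?p)) (PiM UNIV (\<lambda>_ :: nat. ?p))"
    by measurable
  have "(\<integral>\<^sup>+ j. G j \<partial>index_seq_measure n)
    = (\<integral>\<^sup>+ j. G j \<partial>distr (?p \<Otimes>\<^sub>M PiM UNIV (\<lambda>_. ?p)) (PiM UNIV (\<lambda>_. ?p)) (\<lambda>(s, \<omega>). case_nat s \<omega>))"
    unfolding PiM_iter S ..
  also have "\<dots> = (\<integral>\<^sup>+ z. G (case_nat (fst z) (snd z)) \<partial>(?p \<Otimes>\<^sub>M PiM UNIV (\<lambda>_. ?p)))"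
    using G unfolding S by (subst nn_integral_distr[OF meas]) (auto simp: case_prod_beta)
  also have "\<dots> = (\<integral>\<^sup>+ i. (\<integral>\<^sup>+ j. G (case_nat i j) \<partial>PiM UNIV (\<lambda>_. ?p)) \<partial>?p)"
    using measurable_compose[OF meas, of G] G unfolding S
    by (subst nn_integral_fst[symmetric]) (auto simp: case_prod_beta)
  also have "\<dots> = (\<Sum>i=1..n. (\<integral>\<^sup>+ j. G (case_nat i j) \<partial>index_seq_measure n)) / real n"
    using n by (subst nn_integral_pmf_of_set) (auto simp: S ennreal_of_nat_eq_real_of_nat)
  finally show ?thesis .
qed

text \<open>The offset \<open>e\<close> is general for two reasons: the induction moves the first
  drawn summand into it, and later it carries the error inherited from earlier iterations.\<close>

theorem nn_integral_cosh_norm_sample_sum: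
  fixes e :: "'a::euclidean_space"
  assumes n: "n \<ge> 1" and mean: "(\<Sum>i=1..n. Y i) = 0"
    and Y: "\<And>i. i \<in> {1..n} \<Longrightarrow> norm (Y i) \<le> b" and r: "r \<ge> 0" and b: "b \<ge> 0"
  shows "(\<integral>\<^sup>+ j. ennreal (cosh (r * norm (e + (\<Sum>k<B. Y (j k))))) \<partial>index_seq_measure n)
    \<le> ennreal (cosh (r * b) ^ B * cosh (r * norm e))"
proof (induction B arbitrary: e)
  case 0
  interpret prob_space "index_seq_measure n" by (rule prob_space_index_seq_measure)
  show ?case by (simp add: emeasure_space_1[simplified])
next
  case (Suc B)
  let ?S = "index_seq_measure n"
  have m: "(\<lambda>j. e + (\<Sum>k<B. Y (j k))) \<in> borel_measurable ?S" for B e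
  proof -
    have "(\<lambda>j. Y (j k)) \<in> borel_measurable ?S" for k
      by (rule measurable_compose[OF measurable_index_component]) simp
    then show ?thesis by (intro borel_measurable_add borel_measurable_sum borel_measurable_const)
  qed
  have cont: "continuous_on UNIV (\<lambda>x :: 'a. cosh (r * norm x))"
    unfolding cosh_field_def by (intro continuous_intros) auto
  have c: "(\<lambda>x :: 'a. cosh (r * norm x)) \<in> borel_measurable borel"
    by (rule borel_measurable_continuous_onI[OF cont])
  have "(\<lambda>j. cosh (r * norm (e + (\<Sum>k<Suc B. Y (j k))))) \<in> borel_measurable ?S"
    by (rule measurable_compose[OF m c])
  then have "(\<integral>\<^sup>+ j. ennreal (cosh (r * norm (e + (\<Sum>k<Suc B. Y (j k))))) \<partial>?S)
    = (\<Sum>i=1..n. (\<integral>\<^sup>+ j. ennreal (cosh (r * norm (e + (\<Sum>k<Suc B. Y (case_nat i j k))))) \<partial>?S)) / real n"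
    by (intro nn_integral_index_seq_first[OF n]) simp
  also have "\<dots> = (\<Sum>i=1..n. (\<integral>\<^sup>+ j. ennreal (cosh (r * norm ((e + Y i) + (\<Sum>k<B. Y (j k))))) \<partial>?S)) / real n"
    by (subst sum.lessThan_Suc_shift) (simp add: add.assoc)
  also have "\<dots> \<le> (\<Sum>i=1..n. ennreal (cosh (r * b) ^ B * cosh (r * norm (e + Y i)))) / real n"
    by (intro divide_right_mono_ennreal sum_mono Suc.IH)
  also have "\<dots> = ennreal ((\<Sum>i=1..n. cosh (r * b) ^ B * cosh (r * norm (e + Y i))) / real n)"
    using n by (subst sum_ennreal) (auto simp: divide_ennreal sum_nonneg ennreal_of_nat_eq_real_of_nat)
  also have "\<dots> \<le> ennreal (cosh (r * b) ^ Suc B * cosh (r * norm e))"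
  proof (rule ennreal_leI)
    have "(\<Sum>i=1..n. cosh (r * b) ^ B * cosh (r * norm (e + Y i)))
      = cosh (r * b) ^ B * (\<Sum>i=1..n. cosh (r * norm (e + Y i)))" by (simp add: sum_distrib_left)
    also have "\<dots> \<le> cosh (r * b) ^ B * (real (card {1..n}) * (cosh (r * b) * cosh (r * norm e)))"
      by (intro mult_left_mono sum_cosh_norm_add_le mean Y r b) auto
    finally show "(\<Sum>i=1..n. cosh (r * b) ^ B * cosh (r * norm (e + Y i))) / real n
      \<le> cosh (r * b) ^ Suc B * cosh (r * norm e)"
      using n by (simp add: divide_le_eq mult_ac)
  qed
  finally show ?case .
qed

section \<open>Functions with Lipschitz Hessian\<close>

text \<open>As \<open>grad\<close> is a definite description, existence comes from the Riesz
  representation of the derivative and uniqueness from that of derivatives.\<close>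

lemma grad_has_derivative:
  fixes f :: "'a::euclidean_space \<Rightarrow> real"
  assumes "f differentiable (at x)"
  shows "(f has_derivative (\<lambda>h. h \<bullet> grad f x)) (at x)"
proof -
  obtain g where g: "(f has_derivative g) (at x)" using assms by (auto simp: differentiable_def)
  interpret g: bounded_linear g by (rule has_derivative_bounded_linear[OF g])
  define D where "D = (\<Sum>b\<in>Basis. g b *\<^sub>R b)"
  have gD: "g h = h \<bullet> D" for h
  proof -
    have "g h = g (\<Sum>b\<in>Basis. (h \<bullet> b) *\<^sub>R b)" by (simp add: euclidean_representation)
    also have "\<dots> = h \<bullet> D" by (simp add: g.sum g.scale D_def inner_sum_right mult.commute)
    finally show ?thesis .
  qed
  have D: "GDERIV f x :> D" using g unfolding gderiv_def by (metis (no_types) gD ext)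
  have uniq: "E = D" if "GDERIV f x :> E" for E
  proof -
    have "(\<lambda>h. h \<bullet> E) = (\<lambda>h. h \<bullet> D)"
      using that D unfolding gderiv_def by (rule has_derivative_unique)
    then show ?thesis using vector_eq_ldot by metis
  qed
  have "grad f x = D" unfolding grad_def by (rule the_equality) (rule D, erule uniq)
  then show ?thesis using D by (simp add: gderiv_def)
qed

lemma grad_unique:
  fixes f :: "'a::euclidean_space \<Rightarrow> real"
  assumes "(f has_derivative (\<lambda>h. h \<bullet> D)) (at x)"
  shows "grad f x = D"
proof -
  have "f differentiable (at x)" using assms by (auto simp: differentiable_def)
  from has_derivative_unique[OF grad_has_derivative[OF this] assms]
  show ?thesis using vector_eq_ldot by metis
qed

lemma hess_has_derivative:
  assumes "grad f differentiable (at x)"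
  shows "(grad f has_derivative ((*v) (hess f x))) (at x)"
  using assms unfolding hess_def by (simp add: jacobian_works)

lemma hess_unique:
  assumes "(grad f has_derivative ((*v) A)) (at x)"
  shows "hess f x = A"
proof -
  have "grad f differentiable (at x)" using assms by (auto simp: differentiable_def)
  from has_derivative_unique[OF hess_has_derivative[OF this] assms]
  show ?thesis by (metis matrix_of_matrix_vector_mul)
qed

lemma le_of_le_add_mult:
  fixes a b c :: real
  assumes "\<And>t. 0 < t \<Longrightarrow> a \<le> b + t * c"
  shows "a \<le> b"
proof (rule field_le_epsilon)
  fix e :: real assume e: "0 < e"
  have "a \<le> b + e / (1 + \<bar>c\<bar>) * c" using e by (intro assms) auto
  also have "e / (1 + \<bar>c\<bar>) * c \<le> e / (1 + \<bar>c\<bar>) * (1 + \<bar>c\<bar>)"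
    using e by (intro mult_left_mono) auto
  also have "\<dots> = e" by simp
  finally show "a \<le> b + e" by simp
qed

locale lipschitz_hessian =
  fixes f :: "real ^ 'd \<Rightarrow> real" and \<rho> :: real
  assumes rho_nonneg: "0 \<le> \<rho>"
    and f_diff: "\<And>x. f differentiable (at x)"
    and grad_diff: "\<And>x. grad f differentiable (at x)"
    and hess_lip: "\<And>x y. spectral_norm (hess f x - hess f y) \<le> \<rho> * norm (x - y)"
begin

lemma hess_diff_apply: "norm (hess f x *v v - hess f y *v v) \<le> \<rho> * norm (x - y) * norm v"
  using order_trans[OF spectral_norm_apply mult_right_mono[OF hess_lip norm_ge_zero], of x y v]
  by (simp add: matrix_vector_mult_diff_rdistrib)

lemma line_deriv: "((\<lambda>s. f (x + s *\<^sub>R h)) has_real_derivative (grad f (x + s *\<^sub>R h) \<bullet> h)) (at s)"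
proof -
  have "((\<lambda>s. x + s *\<^sub>R h) has_derivative (\<lambda>s. s *\<^sub>R h)) (at s)"
    by (auto intro!: derivative_eq_intros)
  from has_derivative_compose[OF this grad_has_derivative[OF f_diff]]
  show ?thesis by (simp add: has_field_derivative_def inner_commute mult.commute[of _ "_ \<bullet> _"] cong: if_cong)
qed

lemma line_grad_deriv:
  "((\<lambda>s. grad f (x + s *\<^sub>R h) \<bullet> w) has_real_derivative ((hess f (x + s *\<^sub>R h) *v h) \<bullet> w)) (at s)"
proof -
  have "((\<lambda>s. x + s *\<^sub>R h) has_derivative (\<lambda>s. s *\<^sub>R h)) (at s)"
    by (auto intro!: derivative_eq_intros)
  from has_derivative_inner_left[OF has_derivative_compose[OF this hess_has_derivative[OF grad_diff]], of w]
  show ?thesis by (simp add: has_field_derivative_def matrix_vector_mult_scaleR mult.commute[of _ "_ \<bullet> _"])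
qed

text \<open>Pairing with the remainder \<open>w\<close> itself reduces the vector estimate to the
  monotonicity of a real function on the unit interval, and the left-hand side becomes
  \<open>norm w * norm w\<close>.\<close>

lemma grad_taylor: "norm (grad f (x + h) - grad f x - hess f x *v h) \<le> \<rho> / 2 * (norm h)\<^sup>2"
proof -
  define w where "w = grad f (x + h) - grad f x - hess f x *v h"
  define H where "H = hess f x *v h"
  define K where "K = \<rho> * (norm h)\<^sup>2 * norm w"
  define g where "g s = grad f (x + s *\<^sub>R h) \<bullet> w - s * (H \<bullet> w) - K * s\<^sup>2 / 2" for s
  have "g 1 \<le> g 0"
  proof (rule DERIV_nonpos_imp_nonincreasing[of 0 1 g])
    fix s :: real assume s: "0 \<le> s" "s \<le> 1"
    have "(g has_real_derivative ((hess f (x + s *\<^sub>R h) *v h) \<bullet> w - H \<bullet> w - K * s)) (at s)"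
      unfolding g_def by (auto intro!: derivative_eq_intros line_grad_deriv)
    moreover have "(hess f (x + s *\<^sub>R h) *v h) \<bullet> w - H \<bullet> w - K * s \<le> 0"
    proof -
      have "(hess f (x + s *\<^sub>R h) *v h) \<bullet> w - H \<bullet> w = (hess f (x + s *\<^sub>R h) *v h - hess f x *v h) \<bullet> w"
        by (simp add: H_def inner_diff_left)
      also have "\<dots> \<le> norm (hess f (x + s *\<^sub>R h) *v h - hess f x *v h) * norm w" by (rule norm_cauchy_schwarz)
      also have "\<dots> \<le> \<rho> * norm ((x + s *\<^sub>R h) - x) * norm h * norm w"
        by (intro mult_right_mono hess_diff_apply) auto
      also have "\<dots> = K * s" using s by (simp add: K_def power2_eq_square)
      finally show ?thesis by simp
    qed
    ultimately show "\<exists>D. (g has_real_derivative D) (at s) \<and> D \<le> 0" by blast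
  qed simp
  then have "(grad f (x + h) - grad f x - H) \<bullet> w \<le> K / 2"
    by (simp add: g_def inner_diff_left)
  then have "w \<bullet> w \<le> K / 2" by (simp add: w_def H_def)
  then have "norm w * norm w \<le> (\<rho> / 2 * (norm h)\<^sup>2) * norm w"
    by (simp add: K_def dot_square_norm power2_eq_square)
  moreover have "0 \<le> \<rho> / 2 * (norm h)\<^sup>2" using rho_nonneg by simp
  ultimately show ?thesis unfolding w_def[symmetric]
    by (cases "norm w = 0") (auto simp: mult_le_cancel_right)
qed

text \<open>The correction \<open>\<rho> / 6 * norm h ^ 3 * s ^ 3\<close> integrates the quadratic
  error of the gradient, so \<open>grad_taylor\<close> makes the derivative of \<open>g\<close>
  nonpositive.\<close>

lemma taylor: "f (x + h) \<le> f x + grad f x \<bullet> h + h \<bullet> (hess f x *v h) / 2 + \<rho> / 6 * norm h ^ 3"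
proof -
  define H where "H = hess f x *v h"
  define g where "g s = f (x + s *\<^sub>R h) - s * (grad f x \<bullet> h) - s\<^sup>2 * (h \<bullet> H) / 2 - \<rho> / 6 * norm h ^ 3 * s ^ 3" for s
  have "g 1 \<le> g 0"
  proof (rule DERIV_nonpos_imp_nonincreasing[of 0 1 g])
    fix s :: real assume s: "0 \<le> s" "s \<le> 1"
    have "(g has_real_derivative (grad f (x + s *\<^sub>R h) \<bullet> h - grad f x \<bullet> h - s * (h \<bullet> H) - \<rho> / 2 * norm h ^ 3 * s\<^sup>2)) (at s)"
      unfolding g_def by (auto intro!: derivative_eq_intros line_deriv)
    moreover have "grad f (x + s *\<^sub>R h) \<bullet> h - grad f x \<bullet> h - s * (h \<bullet> H) \<le> \<rho> / 2 * norm h ^ 3 * s\<^sup>2"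
    proof -
      have "grad f (x + s *\<^sub>R h) \<bullet> h - grad f x \<bullet> h - s * (h \<bullet> H)
          = (grad f (x + s *\<^sub>R h) - grad f x - hess f x *v (s *\<^sub>R h)) \<bullet> h"
        by (simp add: inner_diff_left H_def matrix_vector_mult_scaleR inner_commute[of h])
      also have "\<dots> \<le> norm (grad f (x + s *\<^sub>R h) - grad f x - hess f x *v (s *\<^sub>R h)) * norm h"
        by (rule norm_cauchy_schwarz)
      also have "\<dots> \<le> (\<rho> / 2 * (norm (s *\<^sub>R h))\<^sup>2) * norm h" by (intro mult_right_mono grad_taylor) auto
      also have "\<dots> = \<rho> / 2 * norm h ^ 3 * s\<^sup>2" by (simp add: power_mult_distrib power2_eq_square power3_eq_cube)
      finally show ?thesis .
    qed
    ultimately show "\<exists>D. (g has_real_derivative D) (at s) \<and> D \<le> 0" by force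
  qed simp
  then show ?thesis by (simp add: g_def H_def)
qed

text \<open>The mean value theorem is applied along \<open>u\<close> to the difference of
  \<open>f\<close> on two parallel lines; expanding the two gradients around \<open>x\<close> leaves
  the Hessian applied to \<open>v\<close>.\<close>

lemma second_difference:
  assumes t: "t > 0"
  shows "\<bar>f (x + t *\<^sub>R u + t *\<^sub>R v) - f (x + t *\<^sub>R u) - f (x + t *\<^sub>R v) + f x - t\<^sup>2 * ((hess f x *v v) \<bullet> u)\<bar>
    \<le> t ^ 3 * (\<rho> * (norm u + norm v)\<^sup>2 * norm u)"
proof -
  define H where "H = hess f x"
  define g where "g s = f ((x + t *\<^sub>R v) + s *\<^sub>R u) - f (x + s *\<^sub>R u)" for s
  have d: "(g has_real_derivative (grad f ((x + t *\<^sub>R v) + s *\<^sub>R u) \<bullet> u - grad f (x + s *\<^sub>R u) \<bullet> u)) (at s)" for s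
    unfolding g_def by (intro DERIV_diff line_deriv)
  from MVT2[OF t, of g, OF d] obtain s where s: "0 < s" "s < t"
    "g t - g 0 = (t - 0) * (grad f ((x + t *\<^sub>R v) + s *\<^sub>R u) \<bullet> u - grad f (x + s *\<^sub>R u) \<bullet> u)" by blast
  define a where "a = t *\<^sub>R v + s *\<^sub>R u"
  define r1 where "r1 = grad f (x + a) - grad f x - H *v a"
  define r2 where "r2 = grad f (x + s *\<^sub>R u) - grad f x - H *v (s *\<^sub>R u)"
  have r: "norm (grad f (x + h) - grad f x - H *v h) \<le> \<rho> / 2 * (t * (norm u + norm v))\<^sup>2" if "norm h \<le> t * (norm u + norm v)" for h
  proof -
    have "\<rho> / 2 * (norm h)\<^sup>2 \<le> \<rho> / 2 * (t * (norm u + norm v))\<^sup>2"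
      using rho_nonneg that by (intro mult_left_mono power_mono) auto
    then show ?thesis using grad_taylor[of x h] by (simp add: H_def)
  qed
  have na: "norm a \<le> t * (norm u + norm v)"
  proof -
    have "norm a \<le> norm (t *\<^sub>R v) + norm (s *\<^sub>R u)" unfolding a_def by (rule norm_triangle_ineq)
    also have "\<dots> \<le> t * norm v + t * norm u" using s t by (intro add_mono) (auto intro: mult_right_mono)
    finally show ?thesis by (simp add: algebra_simps)
  qed
  have nu: "norm (s *\<^sub>R u) \<le> t * (norm u + norm v)"
    using s t by (auto intro!: mult_mono)
  have "g t - g 0 - t\<^sup>2 * ((H *v v) \<bullet> u) = t * ((r1 - r2) \<bullet> u)"
    unfolding s(3) r1_def r2_def a_def
    by (simp add: inner_diff_left matrix_vector_right_distrib matrix_vector_mult_scaleR inner_add_left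
        power2_eq_square algebra_simps)
  then have "\<bar>g t - g 0 - t\<^sup>2 * ((H *v v) \<bullet> u)\<bar> = t * \<bar>(r1 - r2) \<bullet> u\<bar>" using t by (simp add: abs_mult)
  also have "\<dots> \<le> t * (norm (r1 - r2) * norm u)"
    using t by (intro mult_left_mono Cauchy_Schwarz_ineq2) auto
  also have "\<dots> \<le> t * ((\<rho> * (t * (norm u + norm v))\<^sup>2) * norm u)"
  proof -
    have "norm (r1 - r2) \<le> norm r1 + norm r2" by (rule norm_triangle_ineq4)
    also have "\<dots> \<le> \<rho> * (t * (norm u + norm v))\<^sup>2"
      using r[OF na] r[OF nu] unfolding r1_def r2_def by simp
    finally show ?thesis using t by (intro mult_left_mono mult_right_mono) auto
  qed
  also have "\<dots> = t ^ 3 * (\<rho> * (norm u + norm v)\<^sup>2 * norm u)"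
    by (simp add: power_mult_distrib power2_eq_square power3_eq_cube)
  finally show ?thesis by (simp add: g_def H_def algebra_simps)
qed

text \<open>The second difference is symmetric in \<open>u\<close> and \<open>v\<close>, so both
  mixed forms approximate the same number; after division by \<open>t\<^sup>2\<close> the error is
  of order \<open>t\<close>.\<close>

lemma hess_symmetric: "symmetric_matrix (hess f x)"
proof (rule symmetric_matrixI)
  fix u v
  let ?p = "(hess f x *v u) \<bullet> v" and ?q = "(hess f x *v v) \<bullet> u"
  define C where "C = \<rho> * (norm u + norm v)\<^sup>2 * norm u + \<rho> * (norm u + norm v)\<^sup>2 * norm v"
  have "\<bar>?p - ?q\<bar> \<le> 0 + t * C" if t: "t > 0" for t
  proof -
    let ?d = "f (x + t *\<^sub>R u + t *\<^sub>R v) - f (x + t *\<^sub>R u) - f (x + t *\<^sub>R v) + f x"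
    have 1: "\<bar>?d - t\<^sup>2 * ?q\<bar> \<le> t ^ 3 * (\<rho> * (norm u + norm v)\<^sup>2 * norm u)"
      by (rule second_difference[OF t])
    have 2: "\<bar>?d - t\<^sup>2 * ?p\<bar> \<le> t ^ 3 * (\<rho> * (norm u + norm v)\<^sup>2 * norm v)"
      using second_difference[OF t, of x v u] by (simp add: algebra_simps)
    have "\<bar>t\<^sup>2 * ?p - t\<^sup>2 * ?q\<bar> \<le> t ^ 3 * C"
      using 1 2 unfolding C_def distrib_left by linarith
    then have "t\<^sup>2 * \<bar>?p - ?q\<bar> \<le> t\<^sup>2 * (t * C)"
      by (simp add: right_diff_distrib[symmetric] abs_mult power2_eq_square power3_eq_cube mult_ac)
    moreover have "t\<^sup>2 > 0" using t by simp
    ultimately show ?thesis by (simp only: mult_le_cancel_left_pos add_0)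
  qed
  then have "\<bar>?p - ?q\<bar> \<le> 0" by (rule le_of_le_add_mult)
  then show "(hess f x *v u) \<bullet> v = u \<bullet> (hess f x *v v)" by (simp add: inner_commute)
qed

text \<open>The Hessian is a limit of difference quotients of the gradient, with a Taylor error of
  order \<open>t\<close>.\<close>

lemma hess_apply_le:
  assumes lip: "\<And>x y. norm (grad f x - grad f y) \<le> L * norm (x - y)"
  shows "norm (hess f x *v h) \<le> L * norm h"
proof (rule le_of_le_add_mult)
  fix t :: real assume t: "0 < t"
  have "norm (hess f x *v (t *\<^sub>R h)) \<le> norm (grad f (x + t *\<^sub>R h) - grad f x)
      + norm (grad f (x + t *\<^sub>R h) - grad f x - hess f x *v (t *\<^sub>R h))"
    using norm_triangle_ineq4[of "grad f (x + t *\<^sub>R h) - grad f x"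
        "grad f (x + t *\<^sub>R h) - grad f x - hess f x *v (t *\<^sub>R h)"] by simp
  also have "\<dots> \<le> L * norm ((x + t *\<^sub>R h) - x) + \<rho> / 2 * (norm (t *\<^sub>R h))\<^sup>2"
    by (intro add_mono lip grad_taylor)
  finally have "t * norm (hess f x *v h) \<le> t * (L * norm h + t * (\<rho> / 2 * (norm h)\<^sup>2))"
    using t by (simp add: matrix_vector_mult_scaleR power_mult_distrib power2_eq_square algebra_simps)
  then show "norm (hess f x *v h) \<le> L * norm h + t * (\<rho> / 2 * (norm h)\<^sup>2)"
    using t by (simp only: mult_le_cancel_left_pos)
qed

end

lemma grad_avg_fun:
  assumes "\<And>i. i \<in> {1..n} \<Longrightarrow> f i differentiable (at x)"
  shows "grad (avg_fun n f) x = (1 / real n) *\<^sub>R (\<Sum>i=1..n. grad (f i) x)"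
    and "avg_fun n f differentiable (at x)"
proof -
  have "(avg_fun n f has_derivative (\<lambda>h. (\<Sum>i=1..n. h \<bullet> grad (f i) x) / real n)) (at x)"
  proof -
    have "((\<lambda>x. (1 / real n) *\<^sub>R (\<Sum>i=1..n. f i x)) has_derivative
        (\<lambda>h. (1 / real n) *\<^sub>R (\<Sum>i=1..n. h \<bullet> grad (f i) x))) (at x)"
      by (intro has_derivative_scaleR_right has_derivative_sum grad_has_derivative assms)
    moreover have "avg_fun n f = (\<lambda>x. (1 / real n) *\<^sub>R (\<Sum>i=1..n. f i x))"
      by (simp add: avg_fun_def fun_eq_iff)
    ultimately show ?thesis by simp
  qed
  then have d: "(avg_fun n f has_derivative (\<lambda>h. h \<bullet> ((1 / real n) *\<^sub>R (\<Sum>i=1..n. grad (f i) x)))) (at x)"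
    by (simp add: inner_sum_right)
  then show "grad (avg_fun n f) x = (1 / real n) *\<^sub>R (\<Sum>i=1..n. grad (f i) x)" by (rule grad_unique)
  show "avg_fun n f differentiable (at x)" using d by (auto simp: differentiable_def)
qed

lemma hess_avg_fun:
  fixes f :: "nat \<Rightarrow> real ^ 'd \<Rightarrow> real"
  assumes "\<And>i x. i \<in> {1..n} \<Longrightarrow> f i differentiable (at x)"
    and "\<And>i x. i \<in> {1..n} \<Longrightarrow> grad (f i) differentiable (at x)"
  shows "hess (avg_fun n f) x = (1 / real n) *\<^sub>R (\<Sum>i=1..n. hess (f i) x)"
    and "grad (avg_fun n f) differentiable (at x)"
proof -
  have g: "grad (avg_fun n f) = (\<lambda>x. (1 / real n) *\<^sub>R (\<Sum>i=1..n. grad (f i) x))"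
    by (rule ext) (rule grad_avg_fun(1)[of n f, OF assms(1)])
  have lin: "((\<lambda>x. (1 / real n) *\<^sub>R (\<Sum>i=1..n. grad (f i) x)) has_derivative
      (\<lambda>h. (1 / real n) *\<^sub>R (\<Sum>i=1..n. hess (f i) x *v h))) (at x)"
    by (intro has_derivative_scaleR_right has_derivative_sum hess_has_derivative assms)
  have sum_mv: "(\<Sum>i\<in>I. hess (f i) x *v h) = (\<Sum>i\<in>I. hess (f i) x) *v h" for I :: "nat set" and h
    by (induction I rule: infinite_finite_induct) (simp_all add: matrix_vector_mult_add_rdistrib)
  have d: "(grad (avg_fun n f) has_derivative ((*v) ((1 / real n) *\<^sub>R (\<Sum>i=1..n. hess (f i) x)))) (at x)"
  proof -
    have "(\<lambda>h. (1 / real n) *\<^sub>R (\<Sum>i=1..n. hess (f i) x *v h)) = (*v) ((1 / real n) *\<^sub>R (\<Sum>i=1..n. hess (f i) x))"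
      by (rule ext) (simp only: sum_mv scaleR_matrix_vector_assoc)
    then show ?thesis unfolding g using lin by simp
  qed
  then show "hess (avg_fun n f) x = (1 / real n) *\<^sub>R (\<Sum>i=1..n. hess (f i) x)" by (rule hess_unique)
  show "grad (avg_fun n f) differentiable (at x)" using d by (auto simp: differentiable_def)
qed

lemma spectral_norm_triangle: "spectral_norm (A + B) \<le> spectral_norm A + spectral_norm B"
  by (rule spectral_norm_le)
    (metis matrix_vector_mult_add_rdistrib norm_triangle_le add_mono spectral_norm_apply distrib_right)

lemma spectral_norm_sum_le: "spectral_norm (\<Sum>i\<in>I. A i) \<le> (\<Sum>i\<in>I. spectral_norm (A i))"
proof (induction I rule: infinite_finite_induct)
  case (insert i I)
  then show ?case using spectral_norm_triangle[of "A i" "\<Sum>i\<in>I. A i"] by simp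
qed (auto intro!: spectral_norm_le)

lemma spectral_norm_scaleR_le: "0 \<le> c \<Longrightarrow> spectral_norm (c *\<^sub>R A) \<le> c * spectral_norm A"
  by (rule spectral_norm_le) (simp add: scaleR_matrix_vector_assoc[symmetric] mult.assoc mult_left_mono spectral_norm_apply)

lemma lipschitz_hessian_avg_fun:
  fixes f :: "nat \<Rightarrow> real ^ 'd \<Rightarrow> real"
  assumes n: "n \<ge> 1" and \<rho>: "0 \<le> \<rho>" and f: "\<And>i. i \<in> {1..n} \<Longrightarrow> lipschitz_hessian (f i) \<rho>"
  shows "lipschitz_hessian (avg_fun n f) \<rho>"
proof
  have fd: "\<And>i x. i \<in> {1..n} \<Longrightarrow> f i differentiable (at x)" "\<And>i x. i \<in> {1..n} \<Longrightarrow> grad (f i) differentiable (at x)"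
    using f by (auto simp: lipschitz_hessian_def)
  show "0 \<le> \<rho>" by (rule \<rho>)
  show "avg_fun n f differentiable (at x)" for x by (intro grad_avg_fun fd)
  show "grad (avg_fun n f) differentiable (at x)" for x by (intro hess_avg_fun fd)
  fix x y
  have "spectral_norm (hess (avg_fun n f) x - hess (avg_fun n f) y)
      = spectral_norm ((1 / real n) *\<^sub>R (\<Sum>i=1..n. hess (f i) x - hess (f i) y))"
    by (simp only: hess_avg_fun(1)[of n f, OF fd] sum_subtractf scaleR_diff_right)
  also have "\<dots> \<le> (1 / real n) * spectral_norm (\<Sum>i=1..n. hess (f i) x - hess (f i) y)"
    by (rule spectral_norm_scaleR_le) simp
  also have "\<dots> \<le> (1 / real n) * (\<Sum>i=1..n. \<rho> * norm (x - y))"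
    using f by (intro mult_left_mono order_trans[OF spectral_norm_sum_le] sum_mono) (auto simp: lipschitz_hessian_def)
  also have "\<dots> = \<rho> * norm (x - y)" using n by simp
  finally show "spectral_norm (hess (avg_fun n f) x - hess (avg_fun n f) y) \<le> \<rho> * norm (x - y)" .
qed

section \<open>Concentration of matrix averages\<close>

text \<open>One fixed choice of spectral decomposition, which makes the traces below functions of
  the matrix alone.\<close>

definition eigsys :: "real ^ 'n ^ 'n \<Rightarrow> ('n \<Rightarrow> real ^ 'n) \<times> ('n \<Rightarrow> real)" where
  "eigsys A = (SOME p. eigenbasis A (fst p) (snd p))"

abbreviation eigvec where "eigvec A \<equiv> fst (eigsys A)"
abbreviation eigval where "eigval A \<equiv> snd (eigsys A)"

lemma eigsys: "symmetric_matrix A \<Longrightarrow> eigenbasis A (eigvec A) (eigval A)"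
  unfolding eigsys_def by (rule someI_ex) (use symmetric_matrix_eigenbasis in force)

text \<open>For symmetric \<open>A\<close> the trace of the \<open>q\<close>-th matrix power,
  written through eigenvalues so that no matrix powers have to be formed.\<close>

definition trace_power :: "nat \<Rightarrow> real ^ 'n ^ 'n \<Rightarrow> real" where
  "trace_power q A = (\<Sum>a\<in>UNIV. eigval A a ^ q)"

text \<open>For symmetric \<open>A\<close> this is the trace of \<open>A ^ q * C\<close>.\<close>
definition trace_power_mult :: "nat \<Rightarrow> real ^ 'n ^ 'n \<Rightarrow> real ^ 'n ^ 'n \<Rightarrow> real" where
  "trace_power_mult q A C = (\<Sum>a\<in>UNIV. eigval A a ^ q * (eigvec A a \<bullet> (C *v eigvec A a)))"

lemma trace_power_mult_diff: "trace_power_mult q A (C - D) = trace_power_mult q A C - trace_power_mult q A D"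
  by (simp add: trace_power_mult_def matrix_vector_mult_diff_rdistrib inner_diff_right
      right_diff_distrib sum_subtractf)

lemma trace_power_mult_zero [simp]: "trace_power_mult q A 0 = 0"
  by (simp add: trace_power_mult_def)

lemma trace_power_mult_add: "trace_power_mult q A (C + D) = trace_power_mult q A C + trace_power_mult q A D"
  by (simp add: trace_power_mult_def matrix_vector_mult_add_rdistrib inner_add_right
      distrib_left sum.distrib)

lemma trace_power_mult_sum: "trace_power_mult q A (\<Sum>i\<in>I. C i) = (\<Sum>i\<in>I. trace_power_mult q A (C i))"
  by (induction I rule: infinite_finite_induct) (simp_all add: trace_power_mult_add)

lemma trace_power_mult_self:
  assumes "symmetric_matrix A" shows "trace_power_mult q A A = trace_power (Suc q) A"
proof -
  note eb = eigsys[OF assms]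
  show ?thesis
    unfolding trace_power_mult_def trace_power_def
    by (simp add: eigenbasis_eigenvector[OF eb] eigenbasis_orthonormal[OF eb] mult.commute)
qed

lemma trace_power_even_nonneg: "trace_power (2 * m) A \<ge> 0"
  unfolding trace_power_def by (intro sum_nonneg) (simp add: power_mult)

text \<open>Rearrangement: \<open>\<bar>x\<bar> ^ i - \<bar>y\<bar> ^ i\<close> and the same
  difference with exponent \<open>2 * m - i\<close> never have opposite signs.\<close>

lemma power_convolution_le:
  fixes x y :: real assumes i: "i \<le> 2 * m"
  shows "y ^ (2 * m - i) * x ^ i + y ^ i * x ^ (2 * m - i) \<le> x ^ (2 * m) + y ^ (2 * m)"
proof -
  let ?a = "\<bar>x\<bar>" and ?b = "\<bar>y\<bar>"
  have "0 \<le> (?a ^ i - ?b ^ i) * (?a ^ (2 * m - i) - ?b ^ (2 * m - i))"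
    by (cases "?a \<le> ?b") (auto intro!: mult_nonneg_nonneg mult_nonpos_nonpos simp: power_mono)
  also have "\<dots> = ?a ^ i * ?a ^ (2 * m - i) + ?b ^ i * ?b ^ (2 * m - i)
      - (?b ^ (2 * m - i) * ?a ^ i + ?b ^ i * ?a ^ (2 * m - i))"
    by (simp add: algebra_simps)
  also have "?a ^ i * ?a ^ (2 * m - i) = x ^ (2 * m)" using i by (simp flip: power_add) (simp add: power_even_abs)
  also have "?b ^ i * ?b ^ (2 * m - i) = y ^ (2 * m)" using i by (simp flip: power_add) (simp add: power_even_abs)
  finally have "?b ^ (2 * m - i) * ?a ^ i + ?b ^ i * ?a ^ (2 * m - i) \<le> x ^ (2 * m) + y ^ (2 * m)" by simp
  moreover have "y ^ (2 * m - i) * x ^ i \<le> ?b ^ (2 * m - i) * ?a ^ i" "y ^ i * x ^ (2 * m - i) \<le> ?b ^ i * ?a ^ (2 * m - i)"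
    by (metis abs_ge_self abs_mult power_abs)+
  ultimately show ?thesis by linarith
qed

text \<open>The quotient of the power difference by \<open>x - y\<close> is a convolution sum;
  adding its reversal pairs the terms for \<open>power_convolution_le\<close>, and this pairing
  produces the factor 1/2.\<close>

lemma power_diff_mult_diff_le:
  fixes x y :: real
  shows "(x ^ Suc (2 * m) - y ^ Suc (2 * m)) * (x - y)
    \<le> real (Suc (2 * m)) / 2 * ((x - y)\<^sup>2 * (x ^ (2 * m) + y ^ (2 * m)))"
proof -
  define s where "s = (\<Sum>i<Suc (2 * m). y ^ (2 * m - i) * x ^ i)"
  have eq: "x ^ Suc (2 * m) - y ^ Suc (2 * m) = (x - y) * s"
    unfolding s_def by (subst power_diff_sumr2) simp
  have "s = (\<Sum>i<Suc (2 * m). y ^ (2 * m - (Suc (2 * m) - Suc i)) * x ^ (Suc (2 * m) - Suc i))"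
    unfolding s_def by (rule sum.nat_diff_reindex[symmetric])
  also have "\<dots> = (\<Sum>i<Suc (2 * m). y ^ i * x ^ (2 * m - i))"
    by (intro sum.cong) auto
  finally have "2 * s = (\<Sum>i<Suc (2 * m). y ^ (2 * m - i) * x ^ i + y ^ i * x ^ (2 * m - i))"
    unfolding sum.distrib by (simp add: s_def)
  also have "\<dots> \<le> (\<Sum>i<Suc (2 * m). x ^ (2 * m) + y ^ (2 * m))"
    by (intro sum_mono power_convolution_le) auto
  finally have "s \<le> real (Suc (2 * m)) / 2 * (x ^ (2 * m) + y ^ (2 * m))" by simp
  then have "(x - y)\<^sup>2 * s \<le> (x - y)\<^sup>2 * (real (Suc (2 * m)) / 2 * (x ^ (2 * m) + y ^ (2 * m)))"
    by (rule mult_left_mono) simp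
  then show ?thesis unfolding eq by (simp add: power2_eq_square mult_ac)
qed

text \<open>In the two eigenbases \<open>u\<close> of \<open>A\<close> and \<open>v\<close> of \<open>B\<close> the matrix \<open>A - B\<close> has the entries
  \<open>(\<lambda> a - \<mu> b) * (u a \<bullet> v b)\<close>, which reduces the trace inequality to one between real numbers.\<close>

lemma trace_power_mult_diff_le:
  fixes A B :: "real ^ 'n ^ 'n"
  assumes A: "symmetric_matrix A" and B: "symmetric_matrix B"
    and c: "\<And>v. norm ((A - B) *v v) \<le> c * norm v"
  shows "trace_power_mult (Suc (2 * m)) A (A - B) - trace_power_mult (Suc (2 * m)) B (A - B)
    \<le> real (Suc (2 * m)) / 2 * (c\<^sup>2 * (trace_power (2 * m) A + trace_power (2 * m) B))"
proof -
  define u v l k where "u = eigvec A" and "v = eigvec B" and "l = eigval A" and "k = eigval B"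
  have ea: "eigenbasis A u l" and ebb: "eigenbasis B v k"
    using eigsys A B by (simp_all add: u_def v_def l_def k_def)
  define w where "w a b = u a \<bullet> v b" for a b
  let ?C = "A - B"
  have uCv: "u a \<bullet> (?C *v v b) = (l a - k b) * w a b" for a b
    using symmetric_matrix_inner[OF A, of "u a" "v b"]
    by (simp add: matrix_vector_mult_diff_rdistrib inner_diff_right w_def eigenbasis_eigenvector[OF ea]
        eigenbasis_eigenvector[OF ebb] left_diff_distrib)
  have Csym: "(?C *v x) \<bullet> y = x \<bullet> (?C *v y)" for x y
    using symmetric_matrix_inner[OF A] symmetric_matrix_inner[OF B]
    by (simp add: matrix_vector_mult_diff_rdistrib inner_diff_left inner_diff_right)
  have uCu: "u a \<bullet> (?C *v u a) = (\<Sum>b\<in>UNIV. (l a - k b) * (w a b)\<^sup>2)" for a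
    by (subst eigenbasis_inner[OF ebb]) (simp add: Csym uCv, simp add: w_def power2_eq_square mult_ac)
  have vCv: "v b \<bullet> (?C *v v b) = (\<Sum>a\<in>UNIV. (l a - k b) * (w a b)\<^sup>2)" for b
    by (subst eigenbasis_inner[OF ea])
      (simp add: inner_commute[of _ "u _"] uCv, simp add: w_def power2_eq_square mult_ac)
  have Cu: "(norm (?C *v u a))\<^sup>2 = (\<Sum>b\<in>UNIV. (l a - k b)\<^sup>2 * (w a b)\<^sup>2)" for a
    unfolding eigenbasis_norm_power2[OF ebb] by (simp add: Csym uCv power_mult_distrib)
  have Cv: "(norm (?C *v v b))\<^sup>2 = (\<Sum>a\<in>UNIV. (l a - k b)\<^sup>2 * (w a b)\<^sup>2)" for b
    unfolding eigenbasis_norm_power2[OF ea] by (simp add: inner_commute[of _ "u _"] uCv power_mult_distrib)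
  have c2: "(norm (?C *v x))\<^sup>2 \<le> c\<^sup>2" if "norm x = 1" for x
    using c[of x] that by (intro power_mono) auto
  let ?q = "Suc (2 * m)"
  have "trace_power_mult ?q A ?C - trace_power_mult ?q B ?C
    = (\<Sum>a\<in>UNIV. \<Sum>b\<in>UNIV. l a ^ ?q * ((l a - k b) * (w a b)\<^sup>2))
      - (\<Sum>b\<in>UNIV. \<Sum>a\<in>UNIV. k b ^ ?q * ((l a - k b) * (w a b)\<^sup>2))"
    unfolding trace_power_mult_def u_def[symmetric] v_def[symmetric] l_def[symmetric] k_def[symmetric] uCu vCv
      sum_distrib_left ..
  also have "\<dots> = (\<Sum>a\<in>UNIV. \<Sum>b\<in>UNIV. ((l a ^ ?q - k b ^ ?q) * (l a - k b)) * (w a b)\<^sup>2)"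
    by (subst (2) sum.swap) (simp only: sum_subtractf[symmetric] left_diff_distrib mult.assoc)
  also have "\<dots> \<le> (\<Sum>a\<in>UNIV. \<Sum>b\<in>UNIV. (real ?q / 2 * ((l a - k b)\<^sup>2 * (l a ^ (2 * m) + k b ^ (2 * m)))) * (w a b)\<^sup>2)"
    by (intro sum_mono mult_right_mono power_diff_mult_diff_le) simp
  also have "\<dots> = real ?q / 2 * ((\<Sum>a\<in>UNIV. l a ^ (2 * m) * (\<Sum>b\<in>UNIV. (l a - k b)\<^sup>2 * (w a b)\<^sup>2))
      + (\<Sum>b\<in>UNIV. k b ^ (2 * m) * (\<Sum>a\<in>UNIV. (l a - k b)\<^sup>2 * (w a b)\<^sup>2)))"
  proof -
    have "(\<Sum>b\<in>UNIV. k b ^ (2 * m) * (\<Sum>a\<in>UNIV. (l a - k b)\<^sup>2 * (w a b)\<^sup>2))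
      = (\<Sum>a\<in>UNIV. \<Sum>b\<in>UNIV. k b ^ (2 * m) * ((l a - k b)\<^sup>2 * (w a b)\<^sup>2))"
      unfolding sum_distrib_left by (rule sum.swap)
    then show ?thesis
      by (simp only: sum_distrib_left sum.distrib[symmetric]) (simp only: distrib_left distrib_right mult_ac)
  qed
  also have "\<dots> \<le> real ?q / 2 * ((\<Sum>a\<in>UNIV. l a ^ (2 * m) * c\<^sup>2) + (\<Sum>b\<in>UNIV. k b ^ (2 * m) * c\<^sup>2))"
    unfolding Cu[symmetric] Cv[symmetric]
    by (intro mult_left_mono add_mono sum_mono c2 eigenbasis_norm[OF ea] eigenbasis_norm[OF ebb])
      (auto simp: power_mult)
  also have "\<dots> = real ?q / 2 * (c\<^sup>2 * (trace_power (2 * m) A + trace_power (2 * m) B))"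
    unfolding trace_power_def l_def k_def by (simp add: sum_distrib_left distrib_left mult_ac)
  finally show ?thesis .
qed

text \<open>Some eigenvalue exceeds \<open>R\<close> in absolute value, and for an even exponent the
  other eigenvalues can only add to the trace.\<close>

lemma spectral_bound_of_trace_power:
  fixes A :: "real ^ 'n ^ 'n"
  assumes A: "symmetric_matrix A" and R: "R \<ge> 0" and x: "norm (A *v x) > R * norm x"
  shows "R ^ (2 * p) \<le> trace_power (2 * p) A"
proof -
  note eb = eigsys[OF A]
  have "\<exists>a. \<bar>eigval A a\<bar> > R"
  proof (rule ccontr)
    assume "\<not> ?thesis"
    then have le: "\<And>a. (eigval A a)\<^sup>2 \<le> R\<^sup>2"
      using R by (metis abs_le_square_iff abs_of_nonneg not_less)
    have "(norm (A *v x))\<^sup>2 = (\<Sum>a\<in>UNIV. (eigval A a)\<^sup>2 * (x \<bullet> eigvec A a)\<^sup>2)"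
      unfolding eigenbasis_norm_power2[OF eb] by (simp add: eigenbasis_apply_inner[OF eb] power_mult_distrib)
    also have "\<dots> \<le> (\<Sum>a\<in>UNIV. R\<^sup>2 * (x \<bullet> eigvec A a)\<^sup>2)"
      by (intro sum_mono mult_right_mono le) simp
    also have "\<dots> = (R * norm x)\<^sup>2"
      by (simp add: power_mult_distrib eigenbasis_norm_power2[OF eb] sum_distrib_left)
    finally have "norm (A *v x) \<le> R * norm x" by (rule power2_le_imp_le) (use R in simp)
    then show False using x by simp
  qed
  then obtain a where a: "\<bar>eigval A a\<bar> > R" by blast
  have "R ^ (2 * p) \<le> \<bar>eigval A a\<bar> ^ (2 * p)" using a R by (intro power_mono) auto
  also have "\<dots> = eigval A a ^ (2 * p)" by (simp add: power_even_abs)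
  also have "\<dots> \<le> trace_power (2 * p) A"
    unfolding trace_power_def by (rule member_le_sum) (auto simp: power_mult)
  finally show ?thesis .
qed

lemma symmetric_matrix_add: "symmetric_matrix A \<Longrightarrow> symmetric_matrix B \<Longrightarrow> symmetric_matrix (A + B)"
  by (intro symmetric_matrixI)
    (simp add: matrix_vector_mult_add_rdistrib inner_add_left inner_add_right symmetric_matrix_inner)

lemma symmetric_matrix_diff: "symmetric_matrix A \<Longrightarrow> symmetric_matrix B \<Longrightarrow> symmetric_matrix (A - B)"
  by (intro symmetric_matrixI)
    (simp add: matrix_vector_mult_diff_rdistrib inner_diff_left inner_diff_right symmetric_matrix_inner)

lemma symmetric_matrix_scaleR: "symmetric_matrix A \<Longrightarrow> symmetric_matrix (c *\<^sub>R A)"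
  by (intro symmetric_matrixI) (simp add: scaleR_matrix_vector_assoc[symmetric] symmetric_matrix_inner)

lemma symmetric_matrix_zero: "symmetric_matrix 0"
  by (intro symmetric_matrixI) simp

lemma symmetric_matrix_sum: "(\<And>i. i \<in> I \<Longrightarrow> symmetric_matrix (A i)) \<Longrightarrow> symmetric_matrix (\<Sum>i\<in>I. A i)"
  by (induction I rule: infinite_finite_induct) (auto simp: symmetric_matrix_zero symmetric_matrix_add)

locale matrix_sampling =
  fixes n :: nat and Y :: "nat \<Rightarrow> real ^ 'd ^ 'd" and c :: real and B :: nat
  assumes n: "n \<ge> 1" and mean: "(\<Sum>i=1..n. Y i) = 0"
    and Y_sym: "\<And>i. i \<in> {1..n} \<Longrightarrow> symmetric_matrix (Y i)"
    and Y_diff: "\<And>i k v. i \<in> {1..n} \<Longrightarrow> k \<in> {1..n} \<Longrightarrow> norm ((Y i - Y k) *v v) \<le> c * norm v"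
begin

text \<open>All index tuples of length \<open>B\<close>. Expectations are plain sums over this
  finite set until the tail bound is transferred to \<open>index_seq_measure\<close>.\<close>

definition J where "J = ({..<B} \<rightarrow>\<^sub>E {1..n})"

definition X where "X j = (\<Sum>k<B. Y (j k))"

lemma finite_J: "finite J" and card_J: "card J = n ^ B"
  by (auto simp: J_def finite_PiE card_PiE)

lemma J_mem: "j \<in> J \<Longrightarrow> k < B \<Longrightarrow> j k \<in> {1..n}"
  by (auto simp: J_def PiE_iff)

lemma X_sym: "j \<in> J \<Longrightarrow> symmetric_matrix (X j)"
  unfolding X_def by (intro symmetric_matrix_sum Y_sym J_mem) auto

lemma X_upd:
  assumes "k < B" shows "X j - X (j(k := i)) = Y (j k) - Y i"
proof -
  have "X j = Y (j k) + (\<Sum>m\<in>{..<B} - {k}. Y (j m))"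
    "X (j(k := i)) = Y i + (\<Sum>m\<in>{..<B} - {k}. Y ((j(k := i)) m))"
    unfolding X_def using assms by (subst sum.remove[of _ k]; simp)+
  moreover have "(\<Sum>m\<in>{..<B} - {k}. Y ((j(k := i)) m)) = (\<Sum>m\<in>{..<B} - {k}. Y (j m))"
    by (intro sum.cong) auto
  ultimately show ?thesis by simp
qed

text \<open>Swapping entry \<open>k\<close> of the tuple with the fresh index \<open>i\<close> is an
  involution, so tuple and resampled tuple form an exchangeable pair.\<close>

lemma resample:
  assumes k: "k < B"
  shows "(\<Sum>(j, i)\<in>J \<times> {1..n}. G j i) = (\<Sum>(j, i)\<in>J \<times> {1..n}. G (j(k := i)) (j k))"
proof -
  have mem: "j(k := i) \<in> J" if "j \<in> J" "i \<in> {1..n}" for j i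
    using that k unfolding J_def by (auto simp: PiE_iff extensional_def)
  show ?thesis
    by (rule sum.reindex_bij_witness[where i = "\<lambda>(j, i). (j(k := i), j k)" and j = "\<lambda>(j, i). (j(k := i), j k)"])
      (auto simp: mem J_mem[OF _ k] simp del: atLeastAtMost_iff One_nat_def)
qed

text \<open>One factor of the power is written as the sum of the \<open>Y (j k)\<close>, and a fresh
  \<open>Y i\<close> of mean zero is subtracted. Swapping \<open>j k\<close> with \<open>i\<close>
  flips the sign of this difference, so twice the sum compares powers of two matrices that differ by
  \<open>Y (j k) - Y i\<close>; \<open>trace_power_mult_diff_le\<close> bounds it by moments of
  order two less.\<close>

lemma trace_moment_recursion:
  "(\<Sum>j\<in>J. trace_power (2 * Suc m) (X j)) \<le> real (Suc (2 * m)) / 2 * c\<^sup>2 * real B * (\<Sum>j\<in>J. trace_power (2 * m) (X j))"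
proof -
  let ?q = "Suc (2 * m)"
  let ?I = "{1..n}"
  define M where "M = (\<Sum>j\<in>J. trace_power (2 * m) (X j))"
  have T: "(\<Sum>(j, i)\<in>J \<times> ?I. trace_power_mult ?q (X j) (Y (j k) - Y i)) \<le> real ?q / 2 * c\<^sup>2 * (real n * M)"
    (is "?T \<le> _") if k: "k < B" for k
  proof -
    have "?T = (\<Sum>(j, i)\<in>J \<times> ?I. trace_power_mult ?q (X (j(k := i))) (Y i - Y (j k)))"
      by (subst resample[OF k]) simp
    also have "\<dots> = (\<Sum>(j, i)\<in>J \<times> ?I. - trace_power_mult ?q (X (j(k := i))) (Y (j k) - Y i))"
      by (intro sum.cong) (auto simp: trace_power_mult_diff)
    finally have "2 * ?T = (\<Sum>(j, i)\<in>J \<times> ?I. trace_power_mult ?q (X j) (Y (j k) - Y i)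
        - trace_power_mult ?q (X (j(k := i))) (Y (j k) - Y i))"
      by (simp add: case_prod_beta sum_subtractf sum_negf)
    also have "\<dots> \<le> (\<Sum>(j, i)\<in>J \<times> ?I. real ?q / 2 * (c\<^sup>2 * (trace_power (2 * m) (X j) + trace_power (2 * m) (X (j(k := i))))))"
    proof (rule sum_mono, clarify)
      fix j i assume j: "j \<in> J" and i: "i \<in> ?I"
      have j': "j(k := i) \<in> J" using j i k by (auto simp: J_def PiE_iff extensional_def)
      show "trace_power_mult ?q (X j) (Y (j k) - Y i) - trace_power_mult ?q (X (j(k := i))) (Y (j k) - Y i)
        \<le> real ?q / 2 * (c\<^sup>2 * (trace_power (2 * m) (X j) + trace_power (2 * m) (X (j(k := i)))))"
        unfolding X_upd[OF k, of j i, symmetric]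
        by (rule trace_power_mult_diff_le[OF X_sym[OF j] X_sym[OF j']])
          (unfold X_upd[OF k], rule Y_diff[OF J_mem[OF j k] i])
    qed
    also have "\<dots> = real ?q / 2 * c\<^sup>2 * ((\<Sum>(j, i)\<in>J \<times> ?I. trace_power (2 * m) (X j))
        + (\<Sum>(j, i)\<in>J \<times> ?I. trace_power (2 * m) (X (j(k := i)))))"
      by (simp add: case_prod_beta sum.distrib sum_distrib_left distrib_left mult.assoc)
    also have "(\<Sum>(j, i)\<in>J \<times> ?I. trace_power (2 * m) (X (j(k := i)))) = (\<Sum>(j, i)\<in>J \<times> ?I. trace_power (2 * m) (X j))"
      by (rule resample[OF k, symmetric])
    also have "(\<Sum>(j, i)\<in>J \<times> ?I. trace_power (2 * m) (X j)) = real n * M"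
      by (simp add: M_def sum.cartesian_product[symmetric] sum_distrib_left)
    finally have "2 * ?T \<le> real ?q / 2 * c\<^sup>2 * (real n * M + real n * M)" .
    moreover have "real ?q / 2 * c\<^sup>2 * (real n * M + real n * M) = 2 * (real ?q / 2 * c\<^sup>2 * (real n * M))"
      by (simp only: distrib_left mult_2)
    ultimately show ?thesis by linarith
  qed
  have "real n * (\<Sum>j\<in>J. trace_power (2 * Suc m) (X j)) = (\<Sum>j\<in>J. \<Sum>i\<in>?I. trace_power_mult ?q (X j) (X j))"
    by (simp add: trace_power_mult_self X_sym sum_distrib_left)
  also have "\<dots> = (\<Sum>j\<in>J. \<Sum>i\<in>?I. \<Sum>k<B. trace_power_mult ?q (X j) (Y (j k)))"
    unfolding X_def[of "_", abs_def] trace_power_mult_sum ..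
  also have "\<dots> = (\<Sum>j\<in>J. \<Sum>i\<in>?I. \<Sum>k<B. trace_power_mult ?q (X j) (Y (j k) - Y i))"
  proof (rule sum.cong[OF refl])
    fix j
    have "(\<Sum>i\<in>?I. trace_power_mult ?q (X j) (Y i)) = 0"
      unfolding trace_power_mult_sum[symmetric] mean by simp
    then have "(\<Sum>k<B. \<Sum>i\<in>?I. trace_power_mult ?q (X j) (Y (j k)))
      = (\<Sum>k<B. \<Sum>i\<in>?I. trace_power_mult ?q (X j) (Y (j k) - Y i))"
      by (simp add: trace_power_mult_diff sum_subtractf)
    then show "(\<Sum>i\<in>?I. \<Sum>k<B. trace_power_mult ?q (X j) (Y (j k)))
      = (\<Sum>i\<in>?I. \<Sum>k<B. trace_power_mult ?q (X j) (Y (j k) - Y i))"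
      by (subst (1 2) sum.swap)
  qed
  also have "\<dots> = (\<Sum>k<B. \<Sum>(j, i)\<in>J \<times> ?I. trace_power_mult ?q (X j) (Y (j k) - Y i))"
    unfolding sum.cartesian_product[symmetric] sum.swap[of _ "{..<B}" ?I] by (rule sum.swap)
  also have "\<dots> \<le> (\<Sum>k<B. real ?q / 2 * c\<^sup>2 * (real n * M))"
    by (intro sum_mono T) simp
  also have "\<dots> = real n * (real ?q / 2 * c\<^sup>2 * real B * M)" by simp
  finally show ?thesis using n by (simp add: M_def)
qed

text \<open>For \<open>m < p\<close> the recursion factor \<open>(2 * m + 1) / 2\<close> is at most
  \<open>p\<close>; freezing it at \<open>p\<close> turns the product into a power.\<close>

lemma trace_moment_bound:
  "m \<le> p \<Longrightarrow> (\<Sum>j\<in>J. trace_power (2 * m) (X j)) \<le> (real p * c\<^sup>2 * real B) ^ m * (real CARD('d) * real n ^ B)"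
proof (induction m)
  case 0
  then show ?case by (simp add: trace_power_def card_J)
next
  case (Suc m)
  have M0: "0 \<le> (\<Sum>j\<in>J. trace_power (2 * m) (X j))" by (intro sum_nonneg trace_power_even_nonneg)
  have "(\<Sum>j\<in>J. trace_power (2 * Suc m) (X j)) \<le> real (Suc (2 * m)) / 2 * c\<^sup>2 * real B * (\<Sum>j\<in>J. trace_power (2 * m) (X j))"
    by (rule trace_moment_recursion)
  also have "\<dots> \<le> (real p * c\<^sup>2 * real B) * (\<Sum>j\<in>J. trace_power (2 * m) (X j))"
    using Suc.prems M0 by (intro mult_right_mono) auto
  also have "\<dots> \<le> (real p * c\<^sup>2 * real B) * ((real p * c\<^sup>2 * real B) ^ m * (real CARD('d) * real n ^ B))"
    using Suc by (intro mult_left_mono) auto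
  finally show ?case by (simp add: mult.assoc)
qed

text \<open>Markov's inequality for the moment of order \<open>2 * p\<close>; the order stays free
  so that it can be matched to the desired probability.\<close>

lemma card_large_deviation:
  assumes R: "R > 0"
  shows "real (card {j \<in> J. \<exists>v. norm (X j *v v) > R * norm v})
    \<le> (real p * c\<^sup>2 * real B / R\<^sup>2) ^ p * (real CARD('d) * real n ^ B)"
proof -
  let ?S = "{j \<in> J. \<exists>v. norm (X j *v v) > R * norm v}"
  have "real (card ?S) * R ^ (2 * p) = (\<Sum>j\<in>?S. R ^ (2 * p))" by simp
  also have "\<dots> \<le> (\<Sum>j\<in>?S. trace_power (2 * p) (X j))"
    using R by (intro sum_mono) (auto intro: spectral_bound_of_trace_power[OF X_sym])
  also have "\<dots> \<le> (\<Sum>j\<in>J. trace_power (2 * p) (X j))"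
    by (intro sum_mono2 finite_J trace_power_even_nonneg) auto
  also have "\<dots> \<le> (real p * c\<^sup>2 * real B) ^ p * (real CARD('d) * real n ^ B)"
    by (rule trace_moment_bound) simp
  finally show ?thesis using R by (simp add: power_divide le_divide_eq power_mult[symmetric])
qed

end

text \<open>The event is covered by cylinders over the favourable tuples, each of measure
  \<open>1 / n ^ B\<close>, together with the null set of sequences having an index outside the
  range.\<close>

lemma emeasure_index_seq_le_card:
  assumes n: "n \<ge> 1"
  shows "emeasure (index_seq_measure n) {j. Q (restrict j {..<B})}
    \<le> ennreal (real (card {j \<in> {..<B} \<rightarrow>\<^sub>E {1..n}. Q j}) / real n ^ B)"
proof -
  let ?p = "measure_pmf (pmf_of_set {1..n})"
  let ?S = "index_seq_measure n"
  let ?F = "{j \<in> {..<B} \<rightarrow>\<^sub>E {1..n}. Q j}"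
  interpret sequence_space ?p by (rule sequence_space_index)
  have S: "?S = PiM UNIV (\<lambda>_. ?p)" by (simp add: index_seq_measure_def)
  define C where "C f = {j :: nat \<Rightarrow> nat. \<forall>k<B. j k = f k}" for f
  have Cemb: "C f = prod_emb UNIV (\<lambda>_. ?p) {..<B} (\<Pi>\<^sub>E k\<in>{..<B}. {f k})" for f
    by (rule set_eqI) (simp add: C_def prod_emb_iff restrict_PiE_iff Pi_iff Ball_def del: prod_emb_PiE)
  have Cs: "C f \<in> sets ?S" for f
    unfolding Cemb S by (intro measurable_prod_emb sets_PiM_I_finite) auto
  have Ce: "emeasure ?S (C f) = ennreal (1 / real n ^ B)" if f: "f \<in> {..<B} \<rightarrow>\<^sub>E {1..n}" for f
  proof -
    have "emeasure ?S (C f) = (\<Prod>k<B. emeasure ?p {f k})"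
      unfolding Cemb S by (rule emeasure_PiM_emb) auto
    also have "\<dots> = (\<Prod>k<B. ennreal (1 / real n))"
      using f n by (intro prod.cong refl, subst emeasure_pmf_single) (auto simp: PiE_iff)
    also have "\<dots> = ennreal (1 / real n ^ B)"
      by (simp add: prod_ennreal ennreal_power power_one_over)
    finally show ?thesis .
  qed
  define N where "N = (\<Union>k<B. {j :: nat \<Rightarrow> nat. j k \<notin> {1..n}})"
  have Nk: "{j :: nat \<Rightarrow> nat. j k \<notin> {1..n}} \<in> null_sets ?S" for k
  proof -
    have e: "{j :: nat \<Rightarrow> nat. j k \<notin> {1..n}} = prod_emb UNIV (\<lambda>_. ?p) {k} (\<Pi>\<^sub>E m\<in>{k}. - {1..n})"
      by (rule set_eqI) (simp add: prod_emb_iff restrict_PiE_iff Pi_iff del: prod_emb_PiE)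
    have "emeasure ?S {j :: nat \<Rightarrow> nat. j k \<notin> {1..n}} = (\<Prod>m\<in>{k}. emeasure ?p (- {1..n}))"
      unfolding e S by (rule emeasure_PiM_emb) auto
    also have "\<dots> = 0" using n by (simp add: emeasure_pmf_of_set)
    finally have "emeasure ?S {j :: nat \<Rightarrow> nat. j k \<notin> {1..n}} = 0" .
    moreover have "{j :: nat \<Rightarrow> nat. j k \<notin> {1..n}} \<in> sets ?S"
      unfolding e S by (intro measurable_prod_emb sets_PiM_I_finite) auto
    ultimately show ?thesis by (rule null_setsI)
  qed
  have N: "N \<in> null_sets ?S" unfolding N_def by (intro null_sets_UN' Nk) auto
  have "{j. Q (restrict j {..<B})} \<subseteq> (\<Union>f\<in>?F. C f) \<union> N"
  proof
    fix j assume j: "j \<in> {j. Q (restrict j {..<B})}"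
    show "j \<in> (\<Union>f\<in>?F. C f) \<union> N"
    proof (cases "\<forall>k<B. j k \<in> {1..n}")
      case True
      then have "restrict j {..<B} \<in> ?F" using j by (auto simp: PiE_iff)
      moreover have "j \<in> C (restrict j {..<B})" by (simp add: C_def)
      ultimately show ?thesis by blast
    qed (auto simp: N_def)
  qed
  then have "emeasure ?S {j. Q (restrict j {..<B})} \<le> emeasure ?S ((\<Union>f\<in>?F. C f) \<union> N)"
    using Cs N by (intro emeasure_mono) (auto intro!: sets.Un sets.finite_UN finite_PiE simp: null_setsD2)
  also have "\<dots> = emeasure ?S (\<Union>f\<in>?F. C f)"
    using Cs N by (intro emeasure_Un_null_set) (auto intro!: sets.finite_UN finite_PiE)
  also have "\<dots> \<le> (\<Sum>f\<in>?F. emeasure ?S (C f))"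
    using Cs by (intro emeasure_subadditive_finite) (auto intro!: finite_PiE)
  also have "\<dots> = (\<Sum>f\<in>?F. ennreal (1 / real n ^ B))"
    by (intro sum.cong Ce) auto
  also have "\<dots> = ennreal (real (card ?F) / real n ^ B)"
    by (simp add: ennreal_of_nat_eq_real_of_nat ennreal_mult[symmetric])
  finally show ?thesis .
qed

theorem (in matrix_sampling) matrix_sampling_tail:
  assumes R: "R > 0"
  shows "emeasure (index_seq_measure n) {j. \<exists>v. norm ((\<Sum>k<B. Y (j k)) *v v) > R * norm v}
    \<le> ennreal ((real p * c\<^sup>2 * real B / R\<^sup>2) ^ p * real CARD('d))"
proof -
  have X: "X (restrict j {..<B}) = (\<Sum>k<B. Y (j k))" for j
    unfolding X_def by (intro sum.cong) auto
  have "emeasure (index_seq_measure n) {j. \<exists>v. norm (X (restrict j {..<B}) *v v) > R * norm v}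
    \<le> ennreal (real (card {j \<in> {..<B} \<rightarrow>\<^sub>E {1..n}. \<exists>v. norm (X j *v v) > R * norm v}) / real n ^ B)"
    by (rule emeasure_index_seq_le_card[OF n])
  also have "\<dots> \<le> ennreal ((real p * c\<^sup>2 * real B / R\<^sup>2) ^ p * real CARD('d))"
    using card_large_deviation[OF R, of p] n
    by (intro ennreal_leI) (simp add: J_def divide_le_eq mult.assoc)
  finally show ?thesis by (simp add: X)
qed

section \<open>Measurability of gradients and Hessians\<close>

text \<open>The set of points at which \<open>f\<close> has the approximate gradient \<open>A\<close> up to slope \<open>e\<close> within
  distance \<open>r\<close>.  It is closed for every function \<open>f\<close>, because a limit point \<open>x\<close> of the set is itself
  one of the points \<open>y\<close> of the condition.  Hence gradients are Borel without any assumption on \<open>f\<close>.\<close>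

definition slope_set :: "('a::real_inner \<Rightarrow> real) \<Rightarrow> 'a \<Rightarrow> real \<Rightarrow> real \<Rightarrow> 'a set" where
  "slope_set f A e r = {x. \<forall>y. dist y x < r \<longrightarrow> \<bar>f y - f x - (y - x) \<bullet> A\<bar> \<le> e * norm (y - x)}"

lemma closed_slope_set:
  assumes r: "r > 0"
  shows "closed (slope_set f A e r)"
  unfolding closed_sequential_limits
proof (intro allI impI, elim conjE)
  fix u x assume u: "\<forall>k. u k \<in> slope_set f A e r" and lim: "u \<longlonglongrightarrow> x"
  have near: "\<bar>f y - f (u k) - (y - u k) \<bullet> A\<bar> \<le> e * norm (y - u k)" if "dist y (u k) < r" for y k
    using u that by (auto simp: slope_set_def)
  have ev: "\<forall>\<^sub>F k in sequentially. dist y (u k) < r" if "dist y x < r" for y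
  proof -
    have "(\<lambda>k. dist y (u k)) \<longlonglongrightarrow> dist y x" by (intro tendsto_intros lim)
    then show ?thesis using that by (rule order_tendstoD(2))
  qed
  have fu: "(\<lambda>k. f (u k)) \<longlonglongrightarrow> f x"
  proof -
    have "\<forall>\<^sub>F k in sequentially. norm (f (u k) - f x) \<le> e * norm (x - u k) + \<bar>(x - u k) \<bullet> A\<bar>"
      using ev[of x] r by (auto elim!: eventually_mono dest!: near)
    moreover have "(\<lambda>k. e * norm (x - u k) + \<bar>(x - u k) \<bullet> A\<bar>) \<longlonglongrightarrow> e * norm (x - x) + \<bar>(x - x) \<bullet> A\<bar>"
      by (intro tendsto_intros lim)
    then have "(\<lambda>k. e * norm (x - u k) + \<bar>(x - u k) \<bullet> A\<bar>) \<longlonglongrightarrow> 0" by simp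
    ultimately have "(\<lambda>k. f (u k) - f x) \<longlonglongrightarrow> 0" by (rule Lim_null_comparison)
    then show ?thesis by (simp add: LIM_zero_iff)
  qed
  show "x \<in> slope_set f A e r"
    unfolding slope_set_def
  proof (intro CollectI allI impI)
    fix y assume y: "dist y x < r"
    show "\<bar>f y - f x - (y - x) \<bullet> A\<bar> \<le> e * norm (y - x)"
    proof (rule tendsto_le[OF sequentially_bot])
      show "(\<lambda>k. \<bar>f y - f (u k) - (y - u k) \<bullet> A\<bar>) \<longlonglongrightarrow> \<bar>f y - f x - (y - x) \<bullet> A\<bar>"
        by (intro tendsto_intros lim fu)
      show "(\<lambda>k. e * norm (y - u k)) \<longlonglongrightarrow> e * norm (y - x)" by (intro tendsto_intros lim)
      show "\<forall>\<^sub>F k in sequentially. \<bar>f y - f (u k) - (y - u k) \<bullet> A\<bar> \<le> e * norm (y - u k)"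
        using ev[OF y] by (auto elim!: eventually_mono dest!: near)
    qed
  qed
qed

text \<open>Both slopes predict the increment of \<open>f\<close> along \<open>A - A'\<close>; close
  to \<open>x\<close> both approximations hold and must agree up to the combined error.\<close>

lemma slope_set_unique:
  assumes x: "x \<in> slope_set f A e r" "x \<in> slope_set f A' e' r'" and r: "r > 0" "r' > 0"
    and e: "e \<ge> 0" "e' \<ge> 0"
  shows "norm (A - A') \<le> e + e'"
proof (cases "A = A'")
  case True
  then show ?thesis using e by simp
next
  case False
  define w where "w = A - A'"
  have w: "norm w > 0" using False by (simp add: w_def)
  define t where "t = min r r' / (2 * norm w)"
  have t: "t > 0" using r w by (simp add: t_def)
  define y where "y = x + t *\<^sub>R w"
  have ny: "norm (y - x) = t * norm w" using t by (simp add: y_def)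
  have "norm (y - x) = min r r' / 2" using w by (simp add: ny t_def)
  then have "\<bar>f y - f x - (y - x) \<bullet> A\<bar> \<le> e * norm (y - x)" "\<bar>f y - f x - (y - x) \<bullet> A'\<bar> \<le> e' * norm (y - x)"
    using x r by (auto simp: slope_set_def dist_norm)
  then have "(y - x) \<bullet> A - (y - x) \<bullet> A' \<le> (e + e') * norm (y - x)" unfolding distrib_right by linarith
  then have "t * (norm w * norm w) \<le> t * ((e + e') * norm w)"
    unfolding inner_diff_right[symmetric] w_def[symmetric] ny
    by (simp add: y_def dot_square_norm power2_eq_square mult_ac)
  then have "norm w * norm w \<le> (e + e') * norm w" using t by (simp only: mult_le_cancel_left_pos)
  then show ?thesis using w by (simp add: w_def)
qed

lemma has_derivative_slope_set:
  fixes f :: "'a::euclidean_space \<Rightarrow> real"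
  assumes d: "(f has_derivative (\<lambda>h. h \<bullet> G)) (at x)" and e: "e > 0" and A: "norm (A - G) \<le> e / 2"
  shows "\<exists>m. x \<in> slope_set f A e (1 / real (Suc m))"
proof -
  obtain r where r: "r > 0" and near: "\<And>y. norm (y - x) < r \<Longrightarrow> norm (f y - f x - (y - x) \<bullet> G) \<le> e / 2 * norm (y - x)"
    using d e unfolding has_derivative_at_alt by (metis half_gt_zero)
  obtain m where m: "1 / real (Suc m) < r" using r nat_approx_posE by blast
  have "\<bar>f y - f x - (y - x) \<bullet> A\<bar> \<le> e * norm (y - x)" if "dist y x < 1 / real (Suc m)" for y
  proof -
    have "\<bar>f y - f x - (y - x) \<bullet> G\<bar> \<le> e / 2 * norm (y - x)"
      using near[of y] that m by (simp add: dist_norm)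
    moreover have "\<bar>(y - x) \<bullet> (A - G)\<bar> \<le> e / 2 * norm (y - x)"
      using Cauchy_Schwarz_ineq2[of "y - x" "A - G"] mult_right_mono[OF A norm_ge_zero[of "y - x"]]
      by (simp add: mult.commute)
    ultimately show ?thesis unfolding inner_diff_right[of "y - x" A G] by linarith
  qed
  then show ?thesis unfolding slope_set_def by blast
qed

lemma slope_set_grad:
  fixes f :: "'a::euclidean_space \<Rightarrow> real"
  assumes d: "(f has_derivative (\<lambda>h. h \<bullet> G)) (at x)" and x: "x \<in> slope_set f A e r" and r: "r > 0"
    and e: "e \<ge> 0"
  shows "norm (A - G) \<le> e"
proof (rule field_le_epsilon)
  fix e' :: real assume e': "0 < e'"
  obtain m where m: "x \<in> slope_set f G e' (1 / real (Suc m))"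
    using has_derivative_slope_set[OF d e', of G] e' by auto
  show "norm (A - G) \<le> e + e'" by (rule slope_set_unique[OF x m r]) (use e e' in auto)
qed

text \<open>The slopes for the accuracies \<open>1 / Suc k\<close> form a Cauchy sequence by
  \<open>slope_set_unique\<close>, and their limit is the gradient.\<close>

lemma slope_sets_differentiable:
  fixes f :: "'a::euclidean_space \<Rightarrow> real"
  assumes ex: "\<And>k. \<exists>A m. x \<in> slope_set f A (1 / real (Suc k)) (1 / real (Suc m))"
  shows "f differentiable (at x)"
proof -
  obtain A m where A: "\<And>k. x \<in> slope_set f (A k) (1 / real (Suc k)) (1 / real (Suc (m k)))"
    using ex by metis
  have close: "norm (A k - A l) \<le> 1 / real (Suc k) + 1 / real (Suc l)" for k l
    by (rule slope_set_unique[OF A A]) auto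
  have "Cauchy A"
  proof (rule CauchyI)
    fix e :: real assume "0 < e"
    then obtain N where N: "1 / real (Suc N) < e / 2" using nat_approx_posE[of "e / 2"] by auto
    have "norm (A k - A l) < e" if "k \<ge> N" "l \<ge> N" for k l
    proof -
      have "1 / real (Suc k) \<le> 1 / real (Suc N)" "1 / real (Suc l) \<le> 1 / real (Suc N)"
        using that by (simp_all add: frac_le)
      then show ?thesis using close[of k l] N by linarith
    qed
    then show "\<exists>M. \<forall>m\<ge>M. \<forall>n\<ge>M. norm (A m - A n) < e" by blast
  qed
  then obtain G where G: "A \<longlonglongrightarrow> G" using Cauchy_convergent_iff convergent_def by blast
  have AG: "norm (A k - G) \<le> 1 / real (Suc k)" for k
  proof (rule tendsto_le[OF sequentially_bot])
    show "(\<lambda>l. norm (A k - A l)) \<longlonglongrightarrow> norm (A k - G)" by (intro tendsto_intros G)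
    show "(\<lambda>l. 1 / real (Suc k) + 1 / real (Suc l)) \<longlonglongrightarrow> 1 / real (Suc k)"
      using tendsto_add[OF tendsto_const LIMSEQ_Suc[OF lim_1_over_n]] by fastforce
    show "\<forall>\<^sub>F l in sequentially. norm (A k - A l) \<le> 1 / real (Suc k) + 1 / real (Suc l)"
      using close by simp
  qed
  have "(f has_derivative (\<lambda>h. h \<bullet> G)) (at x)"
    unfolding has_derivative_at_alt
  proof (intro conjI allI impI)
    show "bounded_linear (\<lambda>h. h \<bullet> G)" by (rule bounded_linear_inner_left)
    fix e :: real assume e: "0 < e"
    then obtain k where k: "1 / real (Suc k) < e / 2" using nat_approx_posE[of "e / 2"] by auto
    show "\<exists>d>0. \<forall>y. norm (y - x) < d \<longrightarrow> norm (f y - f x - (y - x) \<bullet> G) \<le> e * norm (y - x)"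
    proof (intro exI conjI allI impI)
      show "0 < 1 / real (Suc (m k))" by simp
      fix y assume y: "norm (y - x) < 1 / real (Suc (m k))"
      have "\<bar>f y - f x - (y - x) \<bullet> A k\<bar> \<le> 1 / real (Suc k) * norm (y - x)"
        using A[of k] y by (auto simp: slope_set_def dist_norm)
      moreover have "\<bar>(y - x) \<bullet> (A k - G)\<bar> \<le> 1 / real (Suc k) * norm (y - x)"
        using Cauchy_Schwarz_ineq2[of "y - x" "A k - G"] mult_right_mono[OF AG[of k] norm_ge_zero[of "y - x"]]
        by (simp add: mult.commute)
      moreover have "1 / real (Suc k) * norm (y - x) \<le> e / 2 * norm (y - x)"
        using k by (intro mult_right_mono) auto
      moreover have "e / 2 * norm (y - x) = (e * norm (y - x)) / 2" by simp
      ultimately show "norm (f y - f x - (y - x) \<bullet> G) \<le> e * norm (y - x)"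
        unfolding inner_diff_right[of "y - x" "A k" G] real_norm_def by linarith
    qed
  qed
  then show ?thesis by (auto simp: differentiable_def)
qed

text \<open>The result covers arbitrary functions because draws contain, on a null set, indices
  outside \<open>{1..n}\<close>, where \<open>f i\<close> is unconstrained while the iteration still
  has to be measurable. With slopes from a countable dense set, the set of differentiability and the
  sublevel sets of the gradient components are countable combinations of closed slope sets;
  elsewhere \<open>grad f\<close> is one constant.\<close>

lemma grad_borel_measurable:
  fixes f :: "'a::euclidean_space \<Rightarrow> real"
  shows "{x. f differentiable (at x)} \<in> sets borel" and "grad f \<in> borel_measurable borel"
proof -
  obtain Q :: "'a set" where Q: "countable Q" "\<And>X. open X \<Longrightarrow> X \<noteq> {} \<Longrightarrow> \<exists>d\<in>Q. d \<in> X"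
    using countable_dense_exists by blast
  have dense: "\<exists>A\<in>Q. norm (A - G) \<le> e" if "e > 0" for G and e :: real
    using Q(2)[of "ball G e"] that by (auto simp: dist_norm norm_minus_commute intro: less_imp_le)
  let ?D = "{x. f differentiable (at x)}"
  let ?P = "\<lambda>A k m. slope_set f A (1 / real (Suc k)) (1 / real (Suc m))"
  have Pb: "?P A k m \<in> sets borel" for A k m by (intro borel_closed closed_slope_set) simp
  have inP: "\<exists>A\<in>Q. norm (A - grad f x) \<le> 1 / real (Suc k) / 2 \<and> (\<exists>m. x \<in> ?P A k m)" if "x \<in> ?D" for x k
  proof -
    obtain A where "A \<in> Q" "norm (A - grad f x) \<le> 1 / real (Suc k) / 2"
      using dense[of "1 / real (Suc k) / 2" "grad f x"] by auto
    then show ?thesis using has_derivative_slope_set[OF grad_has_derivative, of f x "1 / real (Suc k)" A] that by auto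
  qed
  have "?D = (\<Inter>k. \<Union>A\<in>Q. \<Union>m. ?P A k m)"
  proof (intro equalityI subsetI)
    fix x assume "x \<in> ?D"
    then have "\<exists>A\<in>Q. \<exists>m. x \<in> ?P A k m" for k using inP[of x k] by blast
    then show "x \<in> (\<Inter>k. \<Union>A\<in>Q. \<Union>m. ?P A k m)" by (simp only: INT_iff UN_iff) simp
  next
    fix x assume "x \<in> (\<Inter>k. \<Union>A\<in>Q. \<Union>m. ?P A k m)"
    then have "\<exists>A m. x \<in> ?P A k m" for k by (simp only: INT_iff UN_iff) blast
    then show "x \<in> ?D" by (intro CollectI slope_sets_differentiable)
  qed
  then show D: "?D \<in> sets borel"
    using Pb Q(1) by (auto intro!: sets.countable_INT sets.countable_UN' sets.countable_UN)
  have G: "{x \<in> ?D. grad f x \<bullet> v < c} \<in> sets borel" for v c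
  proof -
    have eq: "{x \<in> ?D. grad f x \<bullet> v < c} = ?D \<inter> (\<Union>A\<in>Q. \<Union>k. \<Union>m. if A \<bullet> v + 1 / real (Suc k) * norm v < c then ?P A k m else {})"
    proof (intro equalityI subsetI)
      fix x assume x: "x \<in> {x \<in> ?D. grad f x \<bullet> v < c}"
      \<comment> \<open>An accuracy finer than \<open>g\<close> fits both the slope error and the
        distance of \<open>A\<close> from the gradient, each scaled by \<open>norm v\<close>, into
        the gap below \<open>c\<close>.\<close>
      define g where "g = (c - grad f x \<bullet> v) / (2 * (norm v + 1))"
      have g: "g > 0" using x by (simp add: g_def divide_pos_pos add_nonneg_pos)
      then obtain k where k: "1 / real (Suc k) < g" using nat_approx_posE by blast
      obtain A m where A: "A \<in> Q" "norm (A - grad f x) \<le> 1 / real (Suc k) / 2" "x \<in> ?P A k m"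
        using inP[of x k] x by blast
      have "(A - grad f x) \<bullet> v \<le> norm (A - grad f x) * norm v" by (rule norm_cauchy_schwarz)
      also have "\<dots> \<le> 1 / real (Suc k) * norm v"
      proof (rule mult_right_mono)
        have half: "y / 2 \<le> y" if "0 \<le> y" for y :: real using that by simp
        show "norm (A - grad f x) \<le> 1 / real (Suc k)"
          by (rule order_trans[OF A(2)], rule half) simp
      qed simp
      finally have "A \<bullet> v + 1 / real (Suc k) * norm v \<le> grad f x \<bullet> v + 2 * (1 / real (Suc k) * norm v)"
        by (simp add: inner_diff_left)
      also have "1 / real (Suc k) * norm v \<le> g * norm v" using k by (intro mult_right_mono) auto
      also have "g * norm v < g * (norm v + 1)" using g by simp
      also have "grad f x \<bullet> v + 2 * (g * (norm v + 1)) = c"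
      proof -
        have cancel: "X / (2 * N) * N = X / 2" if "N > 0" for X N :: real using that by simp
        have "g * (norm v + 1) = (c - grad f x \<bullet> v) / 2"
          unfolding g_def by (rule cancel) (simp add: add_nonneg_pos)
        then show ?thesis by simp
      qed
      finally have "A \<bullet> v + 1 / real (Suc k) * norm v < c" by simp
      then show "x \<in> ?D \<inter> (\<Union>A\<in>Q. \<Union>k. \<Union>m. if A \<bullet> v + 1 / real (Suc k) * norm v < c then ?P A k m else {})"
        using A x by (intro IntI UN_I[of A] UN_I[of k] UN_I[of m]) auto
    next
      fix x assume "x \<in> ?D \<inter> (\<Union>A\<in>Q. \<Union>k. \<Union>m. if A \<bullet> v + 1 / real (Suc k) * norm v < c then ?P A k m else {})"
      then obtain A k m where x: "x \<in> ?D" and Ak: "A \<bullet> v + 1 / real (Suc k) * norm v < c" "x \<in> ?P A k m"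
        by (auto split: if_splits)
      have "norm (A - grad f x) \<le> 1 / real (Suc k)"
        using x by (intro slope_set_grad[OF grad_has_derivative Ak(2)]) auto
      then have "norm (grad f x - A) * norm v \<le> 1 / real (Suc k) * norm v"
        by (intro mult_right_mono) (simp_all add: norm_minus_commute)
      then have "(grad f x - A) \<bullet> v \<le> 1 / real (Suc k) * norm v"
        using norm_cauchy_schwarz[of "grad f x - A" v] by linarith
      then show "x \<in> {x \<in> ?D. grad f x \<bullet> v < c}" using Ak(1) x by (simp add: inner_diff_left)
    qed
    show ?thesis unfolding eq
      using Pb Q(1) D by (auto intro!: sets.Int sets.countable_UN' sets.countable_UN)
  qed
  have "(\<lambda>x. grad f x \<bullet> v) \<in> borel_measurable borel" for v
  proof -
    have nd: "grad f x = (THE D. False)" if "x \<notin> ?D" for x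
    proof -
      have "\<not> (GDERIV f x :> D)" for D using that by (auto simp: gderiv_def differentiable_def)
      then show ?thesis by (simp add: grad_def)
    qed
    show ?thesis
    proof (rule borel_measurableI_less)
      fix c
      have "{x \<in> space borel. grad f x \<bullet> v < c} = {x \<in> ?D. grad f x \<bullet> v < c} \<union> (if (THE D. False) \<bullet> v < c then - ?D else {})"
      proof (rule set_eqI)
        fix x
        show "x \<in> {x \<in> space borel. grad f x \<bullet> v < c} \<longleftrightarrow>
          x \<in> {x \<in> ?D. grad f x \<bullet> v < c} \<union> (if (THE D. False) \<bullet> v < c then - ?D else {})"
          by (cases "x \<in> ?D") (use nd[of x] in auto)
      qed
      then show "{x \<in> space borel. grad f x \<bullet> v < c} \<in> sets borel" using G D by auto
    qed
  qed
  then show "grad f \<in> borel_measurable borel"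
    by (subst borel_measurable_euclidean_space) auto
qed

text \<open>Where the gradient is differentiable, row \<open>i\<close> of the Hessian is the
  gradient of its \<open>i\<close>-th component, so measurability of gradients applies twice;
  elsewhere the Hessian is one constant matrix.\<close>

lemma hess_borel_measurable:
  fixes f :: "real ^ 'd \<Rightarrow> real"
  shows "hess f \<in> borel_measurable borel"
proof -
  let ?D = "{x. grad f differentiable (at x)}"
  define g where "g i x = grad f x \<bullet> axis i 1" for i x
  have dd: "grad f differentiable (at x) \<longleftrightarrow> (\<forall>i. g i differentiable (at x))" for x
    unfolding g_def differentiable_componentwise_within[of "grad f" x UNIV]
    by (auto simp: Basis_vec_def)
  then have "?D = (\<Inter>i. {x. g i differentiable (at x)})" by auto
  then have D: "?D \<in> sets borel" using grad_borel_measurable(1) by (auto intro!: sets.countable_INT)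
  have in_D: "hess f x $ i $ j = grad (g i) x $ j" if x: "x \<in> ?D" for x i j
  proof -
    have "(grad f has_derivative ((*v) (hess f x))) (at x)" using x by (intro hess_has_derivative) simp
    from has_derivative_inner_left[OF this, of "axis i 1"]
    have "(g i has_derivative (\<lambda>h. (hess f x *v h) \<bullet> axis i 1)) (at x)" by (simp add: g_def[abs_def])
    moreover have "(hess f x *v h) \<bullet> axis i 1 = h \<bullet> (hess f x $ i)" for h
      by (subst inner_axis) (simp add: matrix_vector_mul_component inner_commute)
    ultimately have "grad (g i) x = hess f x $ i" by (intro grad_unique) simp
    then show ?thesis by simp
  qed
  have nd: "hess f x = matrix (SOME f'. False)" if "x \<notin> ?D" for x
  proof -
    have "\<not> ((grad f has_derivative f') (at x))" for f' using that by (auto simp: differentiable_def)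
    then show ?thesis by (simp add: hess_def jacobian_def frechet_derivative_def)
  qed
  have eq: "hess f x $ i $ j = (if x \<in> ?D then grad (g i) x $ j else matrix (SOME f'. False) $ i $ j)" for x i j
    using in_D nd by simp
  have "(\<lambda>x. hess f x $ i $ j) \<in> borel_measurable borel" for i j
    unfolding eq
  proof (rule measurable_If_set)
    have "(\<lambda>x. grad (g i) x \<bullet> axis j 1) \<in> borel_measurable borel"
      by (intro borel_measurable_inner grad_borel_measurable) auto
    then show "(\<lambda>x. grad (g i) x $ j) \<in> borel_measurable borel" by (simp add: inner_axis)
  qed (use D in auto)
  then have "(\<lambda>x. hess f x \<bullet> axis i (axis j 1)) \<in> borel_measurable borel" for i j
    by (simp add: inner_axis)
  then show ?thesis
    by (subst borel_measurable_euclidean_space) (auto simp: Basis_vec_def)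
qed

section \<open>The iteration as a measurable process\<close>

lemma borel_measurable_matrix_vector_mult [measurable (raw)]:
  fixes A :: "'w \<Rightarrow> real ^ 'n ^ 'm"
  assumes "A \<in> borel_measurable N" "x \<in> borel_measurable N"
  shows "(\<lambda>w. A w *v x w) \<in> borel_measurable N"
proof (rule borel_measurable_continuous_Pair[OF assms, of "(*v)"])
  show "continuous_on UNIV (\<lambda>p :: (real ^ 'n ^ 'm) \<times> (real ^ 'n). fst p *v snd p)"
    unfolding matrix_vector_mult_def
    by (intro continuous_on_vec_lambda continuous_intros continuous_on_component)
qed

context
  fixes A :: "'w \<Rightarrow> real ^ 'd ^ 'd" and b :: "'w \<Rightarrow> real ^ 'd" and N :: "'w measure"
  assumes A [measurable]: "A \<in> borel_measurable N" and b [measurable]: "b \<in> borel_measurable N"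
begin

lemma borel_measurable_cubic:
  assumes [measurable]: "x \<in> borel_measurable N"
  shows "(\<lambda>w. cubic (A w) (b w) \<tau> (x w)) \<in> borel_measurable N"
  unfolding cubic_def by measurable

lemma borel_measurable_cubic_grad:
  assumes [measurable]: "x \<in> borel_measurable N"
  shows "(\<lambda>w. cubic_grad (A w) (b w) \<tau> (x w)) \<in> borel_measurable N"
  unfolding cubic_grad_def by measurable

lemma borel_measurable_cauchy_point:
  "(\<lambda>w. cauchy_point (A w) (b w) \<tau>) \<in> borel_measurable N"
proof -
  have "(\<lambda>w. cauchy_point (A w) (b w) \<tau>) = (\<lambda>w. if norm (b w) = 0 then 0
      else let r = (b w \<bullet> (A w *v b w)) / (\<tau> * (norm (b w))\<^sup>2);
               R = - r + sqrt (r\<^sup>2 + 2 * norm (b w) / \<tau>)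
           in - ((R / norm (b w)) *\<^sub>R b w))"
    by (simp add: cauchy_point_def fun_eq_iff)
  also have "\<dots> \<in> borel_measurable N" unfolding Let_def by measurable
  finally show ?thesis .
qed

lemma borel_measurable_cubic_gd:
  assumes x: "x \<in> borel_measurable N"
  shows "(\<lambda>w. cubic_gd (A w) (b w) \<tau> \<eta> t (x w)) \<in> borel_measurable N"
proof (induction t)
  case (Suc t)
  then show ?case unfolding cubic_gd_Suc
    by (intro borel_measurable_diff borel_measurable_scaleR borel_measurable_const borel_measurable_cubic_grad)
qed (simp add: x)

end

lemma measurable_subsolver_loop:
  fixes A :: "'w \<Rightarrow> real ^ 'd ^ 'd"
  assumes A: "A \<in> borel_measurable N" and b: "b \<in> borel_measurable N" and b': "b' \<in> borel_measurable N"
    and x: "x \<in> borel_measurable N"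
  shows "(\<lambda>w. subsolver_loop (A w) (b w) (b' w) \<tau> \<eta> thr k (x w)) \<in> N \<rightarrow>\<^sub>M borel \<Otimes>\<^sub>M count_space UNIV"
  using x
proof (induction k arbitrary: x)
  case 0
  then show ?case by simp
next
  case (Suc k)
  define y where "y w = x w - \<eta> *\<^sub>R cubic_grad (A w) (b' w) \<tau> (x w)" for w
  have y [measurable]: "y \<in> borel_measurable N"
    unfolding y_def[abs_def] using Suc.prems
    by (intro borel_measurable_diff borel_measurable_scaleR borel_measurable_const borel_measurable_cubic_grad A b')
  have [measurable]: "(\<lambda>w. cubic (A w) (b w) \<tau> (y w)) \<in> borel_measurable N"
    by (intro borel_measurable_cubic A b y)
  have [measurable]: "(\<lambda>w. subsolver_loop (A w) (b w) (b' w) \<tau> \<eta> thr k (y w)) \<in> N \<rightarrow>\<^sub>M borel \<Otimes>\<^sub>M count_space UNIV"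
    by (rule Suc.IH[OF y])
  have [measurable]: "(\<lambda>w. snd (subsolver_loop (A w) (b w) (b' w) \<tau> \<eta> thr k (y w))) \<in> N \<rightarrow>\<^sub>M count_space UNIV"
    by measurable
  have "(\<lambda>w. snd (subsolver_loop (A w) (b w) (b' w) \<tau> \<eta> thr k (y w)) + 2) \<in> N \<rightarrow>\<^sub>M count_space UNIV"
    by (rule measurable_compose[of _ N "count_space UNIV"]) measurable
  then have "(\<lambda>w. if cubic (A w) (b w) \<tau> (y w) \<le> thr then (y w, 2)
      else (fst (subsolver_loop (A w) (b w) (b' w) \<tau> \<eta> thr k (y w)),
        snd (subsolver_loop (A w) (b w) (b' w) \<tau> \<eta> thr k (y w)) + 2)) \<in> N \<rightarrow>\<^sub>M borel \<Otimes>\<^sub>M count_space UNIV"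
    by (intro measurable_If measurable_Pair) auto
  then show ?case unfolding subsolver_loop.simps Let_def case_prod_beta y_def .
qed

lemma measurable_cubic_subsolver:
  fixes A :: "'w \<Rightarrow> real ^ 'd ^ 'd"
  assumes A: "A \<in> borel_measurable N" and b: "b \<in> borel_measurable N" and q: "q \<in> borel_measurable N"
  shows "(\<lambda>w. cubic_subsolver (A w) (b w) \<tau> (1 / (16 * L)) \<zeta> (1 / 2) \<delta> L (q w)) \<in> N \<rightarrow>\<^sub>M borel \<Otimes>\<^sub>M count_space UNIV"
proof -
  define b' where "b' w = b w + perturbation \<tau> \<zeta> L *\<^sub>R q w" for w
  have b': "b' \<in> borel_measurable N"
    unfolding b'_def[abs_def] by (intro borel_measurable_add borel_measurable_scaleR borel_measurable_const b q)
  define R where "R w = subsolver_loop (A w) (b w) (b' w) \<tau> (1 / (16 * L)) (- (\<tau> * \<zeta> ^ 3 / 24))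
    (subsolver_steps CARD('d) \<tau> \<zeta> L \<delta>) (cauchy_point (A w) (b' w) \<tau>)" for w
  have R [measurable]: "R \<in> N \<rightarrow>\<^sub>M borel \<Otimes>\<^sub>M count_space UNIV"
    unfolding R_def[abs_def] by (intro measurable_subsolver_loop A b b' borel_measurable_cauchy_point)
  have cp [measurable]: "(\<lambda>w. cauchy_point (A w) (b w) \<tau>) \<in> borel_measurable N"
    by (intro borel_measurable_cauchy_point A b)
  have [measurable]: "(\<lambda>w. cubic (A w) (b w) \<tau> (cauchy_point (A w) (b w) \<tau>)) \<in> borel_measurable N"
    by (intro borel_measurable_cubic A b cp)
  have [measurable]: "(\<lambda>w. snd (R w)) \<in> N \<rightarrow>\<^sub>M count_space UNIV" by measurable
  have "(\<lambda>w. snd (R w) + 3) \<in> N \<rightarrow>\<^sub>M count_space UNIV"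
    by (rule measurable_compose[of _ N "count_space UNIV"]) measurable
  then have "(\<lambda>w. if cubic (A w) (b w) \<tau> (cauchy_point (A w) (b w) \<tau>) \<le> - (\<tau> * \<zeta> ^ 3 / 24)
      then (cauchy_point (A w) (b w) \<tau>, 2) else (fst (R w), snd (R w) + 3)) \<in> N \<rightarrow>\<^sub>M borel \<Otimes>\<^sub>M count_space UNIV"
    by (intro measurable_If measurable_Pair) auto
  then show ?thesis
    unfolding cubic_subsolver_eq Let_def case_prod_beta R_def b'_def .
qed

section \<open>Solver outcome and algorithm state as random variables\<close>

definition final_iterate where
  "final_iterate A b \<tau> \<eta> k = cubic_gd A b \<tau> \<eta> k (cauchy_point A b \<tau>)"

definition final_count where
  "final_count A b \<tau> \<eta> \<epsilon> = (LEAST k. norm (cubic_grad A b \<tau> (final_iterate A b \<tau> \<eta> k)) \<le> \<epsilon>)"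

text \<open>The loop becomes a search for the first good member of a fixed sequence: a countable
  case distinction, hence measurable in the matrix and the vector.\<close>

lemma cubic_finalsolver_eq:
  "cubic_finalsolver A b \<tau> \<eta> \<epsilon> =
    (if \<exists>k. norm (cubic_grad A b \<tau> (final_iterate A b \<tau> \<eta> k)) \<le> \<epsilon>
     then Some (final_iterate A b \<tau> \<eta> (final_count A b \<tau> \<eta> \<epsilon>), 2 + 2 * final_count A b \<tau> \<eta> \<epsilon>) else None)"
proof -
  define f where "f = (\<lambda>(x, a). (x - \<eta> *\<^sub>R cubic_grad A b \<tau> x, a + 2 :: nat))"
  have it: "(f ^^ k) (cauchy_point A b \<tau>, 2) = (final_iterate A b \<tau> \<eta> k, 2 + 2 * k)" for k
    by (induction k) (simp_all add: f_def final_iterate_def cubic_gd_Suc)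
  show ?thesis
    unfolding cubic_finalsolver_def while_option_def f_def[symmetric] it final_count_def
    by (simp add: not_less)
qed

text \<open>An embedding of the datatype into a product of a tag, four vectors and a counter, absent
  fields being zero. Pulling the product sigma-algebra back along it reduces measurability of fields
  and constructors to that of products.\<close>

definition state_code :: "'a::zero srvrc_state \<Rightarrow> nat \<times> 'a \<times> 'a \<times> 'a \<times> 'a \<times> nat" where
  "state_code s = (case s of Running x y v h c \<Rightarrow> (0, x, y, v, h, c)
     | Finished x c \<Rightarrow> (1, x, 0, 0, 0, c) | Diverged \<Rightarrow> (2, 0, 0, 0, 0, 0))"

definition state_measure :: "(real ^ 'd) srvrc_state measure" where
  "state_measure = vimage_algebra UNIV state_code
     (count_space UNIV \<Otimes>\<^sub>M borel \<Otimes>\<^sub>M borel \<Otimes>\<^sub>M borel \<Otimes>\<^sub>M borel \<Otimes>\<^sub>M count_space UNIV)"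

definition "st_tag s = fst (state_code s)"
definition "st_x s = fst (snd (state_code s))"
definition "st_y s = fst (snd (snd (state_code s)))"
definition "st_v s = fst (snd (snd (snd (state_code s))))"
definition "st_h s = fst (snd (snd (snd (snd (state_code s)))))"
definition "st_c s = snd (snd (snd (snd (snd (state_code s)))))"

lemmas st_defs = st_tag_def st_x_def st_y_def st_v_def st_h_def st_c_def state_code_def

lemma st_Running [simp]:
  "st_tag (Running x y v h c) = 0" "st_x (Running x y v h c) = x" "st_y (Running x y v h c) = y"
  "st_v (Running x y v h c) = v" "st_h (Running x y v h c) = h" "st_c (Running x y v h c) = c"
  by (simp_all add: st_defs)

lemma st_Finished [simp]: "st_tag (Finished x c) = 1" "st_x (Finished x c) = x" "st_c (Finished x c) = c"
  by (simp_all add: st_defs)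

lemma st_Diverged [simp]: "st_tag Diverged = 2"
  by (simp add: st_defs)

lemma space_state_measure [simp]: "space state_measure = UNIV"
  by (simp add: state_measure_def)

lemma measurable_state_code [measurable]:
  "state_code \<in> state_measure \<rightarrow>\<^sub>M
     (count_space UNIV \<Otimes>\<^sub>M borel \<Otimes>\<^sub>M borel \<Otimes>\<^sub>M borel \<Otimes>\<^sub>M borel \<Otimes>\<^sub>M count_space UNIV)"
  unfolding state_measure_def by (rule measurable_vimage_algebra1) (auto simp: space_pair_measure)

lemma measurable_st [measurable]:
  "st_tag \<in> state_measure \<rightarrow>\<^sub>M count_space UNIV" "st_x \<in> borel_measurable state_measure"
  "st_y \<in> borel_measurable state_measure" "st_v \<in> borel_measurable state_measure"
  "st_h \<in> borel_measurable state_measure" "st_c \<in> state_measure \<rightarrow>\<^sub>M count_space UNIV"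
  unfolding st_tag_def[abs_def] st_x_def[abs_def] st_y_def[abs_def] st_v_def[abs_def] st_h_def[abs_def] st_c_def[abs_def]
  by measurable

lemma measurable_into_state:
  assumes "(\<lambda>w. state_code (g w)) \<in> N \<rightarrow>\<^sub>M
     (count_space UNIV \<Otimes>\<^sub>M borel \<Otimes>\<^sub>M borel \<Otimes>\<^sub>M borel \<Otimes>\<^sub>M borel \<Otimes>\<^sub>M count_space UNIV)"
  shows "g \<in> N \<rightarrow>\<^sub>M state_measure"
  unfolding state_measure_def using assms by (intro measurable_vimage_algebra2) auto

lemma measurable_Running:
  assumes "x \<in> borel_measurable N" "y \<in> borel_measurable N" "v \<in> borel_measurable N"
    "h \<in> borel_measurable N" "c \<in> N \<rightarrow>\<^sub>M count_space UNIV"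
  shows "(\<lambda>w. Running (x w) (y w) (v w) (h w) (c w)) \<in> N \<rightarrow>\<^sub>M state_measure"
  by (rule measurable_into_state) (use assms in \<open>simp add: state_code_def\<close>)

lemma measurable_Finished:
  assumes "x \<in> borel_measurable N" "c \<in> N \<rightarrow>\<^sub>M count_space UNIV"
  shows "(\<lambda>w. Finished (x w) (c w)) \<in> N \<rightarrow>\<^sub>M state_measure"
  by (rule measurable_into_state) (use assms in \<open>simp add: state_code_def\<close>)

lemma sum_mset_index_sample: "(\<Sum>i\<in>#index_sample B j. g i) = (\<Sum>k<B. g (j k))"
  unfolding index_sample_def
  by (induction B) (simp_all add: add.commute)

lemma size_index_sample [simp]: "size (index_sample B j) = B"
  by (simp add: index_sample_def)

lemma measurable_index_average:
  fixes G :: "nat \<Rightarrow> 'a::euclidean_space \<Rightarrow> 'b::euclidean_space"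
  assumes G: "\<And>i. G i \<in> borel_measurable borel"
    and j: "j \<in> N \<rightarrow>\<^sub>M index_seq_measure n" and x: "x \<in> borel_measurable N"
  shows "(\<lambda>w. (1 / real B) *\<^sub>R (\<Sum>k<B. G (j w k) (x w))) \<in> borel_measurable N"
proof -
  have "(\<lambda>w. G (j w k) (x w)) \<in> borel_measurable N" for k
  proof (rule measurable_compose_countable[of "\<lambda>i w. G i (x w)"])
    show "(\<lambda>w. G i (x w)) \<in> borel_measurable N" for i by (rule measurable_compose[OF x G])
    show "(\<lambda>w. j w k) \<in> N \<rightarrow>\<^sub>M count_space UNIV" by (rule measurable_compose[OF j]) simp
  qed
  then show ?thesis by (intro borel_measurable_scaleR borel_measurable_sum borel_measurable_const)
qed

lemma measurable_batch_grad:
  fixes f :: "nat \<Rightarrow> real ^ 'd \<Rightarrow> real"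
  assumes B: "B \<in> N \<rightarrow>\<^sub>M count_space UNIV" and j: "j \<in> N \<rightarrow>\<^sub>M index_seq_measure n" and x: "x \<in> borel_measurable N"
  shows "(\<lambda>w. batch_grad m f (index_sample (B w) (j w)) (x w)) \<in> borel_measurable N"
proof (rule measurable_compose_countable[OF _ B])
  fix k
  show "(\<lambda>w. batch_grad m f (index_sample k (j w)) (x w)) \<in> borel_measurable N"
  proof (cases "k < m")
    case True
    then show ?thesis unfolding batch_grad_def sum_mset_index_sample
      using measurable_index_average[of "\<lambda>i. grad (f i)", OF grad_borel_measurable(2) j x, of k] by simp
  next
    case False
    then show ?thesis unfolding batch_grad_def
      using measurable_compose[OF x grad_borel_measurable(2)[of "avg_fun m f"]] by simp
  qed
qed

lemma measurable_batch_hess: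
  fixes f :: "nat \<Rightarrow> real ^ 'd \<Rightarrow> real"
  assumes i: "i \<in> N \<rightarrow>\<^sub>M index_seq_measure n" and x: "x \<in> borel_measurable N"
  shows "(\<lambda>w. batch_hess m f (index_sample k (i w)) (x w)) \<in> borel_measurable N"
proof (cases "k < m")
  case True
  then show ?thesis unfolding batch_hess_def sum_mset_index_sample
    using measurable_index_average[of "\<lambda>i. hess (f i)", OF hess_borel_measurable i x, of k] by simp
next
  case False
  then show ?thesis unfolding batch_hess_def
    using measurable_compose[OF x hess_borel_measurable[of "avg_fun m f"]] by simp
qed

section \<open>The probability space of the draws\<close>

definition draw_measure :: "nat \<Rightarrow> 'd::finite draws measure" where
  "draw_measure n = index_seq_measure n \<Otimes>\<^sub>M index_seq_measure n \<Otimes>\<^sub>M sphere_measure"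

lemma sets_sphere_measure [measurable_cong, simp]: "sets sphere_measure = sets borel"
  by (simp add: sphere_measure_def)

lemma space_sphere_measure [simp]: "space sphere_measure = UNIV"
  by (simp add: sphere_measure_def)

lemma draws_measure_eq: "draws_measure n = PiM UNIV (\<lambda>_. draw_measure n)"
  by (simp add: draws_measure_def draw_measure_def)

lemma prob_space_draw_measure: "prob_space (draw_measure n :: 'd::finite draws measure)"
proof -
  interpret S: prob_space "sphere_measure :: (real ^ 'd) measure" by (rule prob_space_sphere_measure)
  interpret I: prob_space "index_seq_measure n" by (rule prob_space_index_seq_measure)
  interpret IS: pair_prob_space "index_seq_measure n" "sphere_measure :: (real ^ 'd) measure" ..
  interpret IIS: pair_prob_space "index_seq_measure n" "index_seq_measure n \<Otimes>\<^sub>M (sphere_measure :: (real ^ 'd) measure)" ..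
  show ?thesis unfolding draw_measure_def by unfold_locales
qed

lemma space_draw_measure [simp]: "space (draw_measure n) = UNIV"
  by (auto simp: draw_measure_def space_pair_measure)

lemma sequence_space_draws: "sequence_space (draw_measure n :: 'd::finite draws measure)"
proof -
  interpret W: prob_space "draw_measure n :: 'd draws measure" by (rule prob_space_draw_measure)
  show ?thesis by unfold_locales
qed

lemma prob_space_draws_measure: "prob_space (draws_measure n :: (nat \<Rightarrow> 'd::finite draws) measure)"
proof -
  interpret sequence_space "draw_measure n :: 'd draws measure" by (rule sequence_space_draws)
  show ?thesis unfolding draws_measure_eq by unfold_locales
qed

lemma space_draws_measure [simp]: "space (draws_measure n) = UNIV"
  by (auto simp: draws_measure_eq space_PiM)

lemma measurable_draw [measurable]: "(\<lambda>\<omega>. \<omega> t) \<in> draws_measure n \<rightarrow>\<^sub>M draw_measure n"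
  unfolding draws_measure_eq by (rule measurable_component_singleton) simp

lemma nn_integral_draw_measure:
  assumes \<Phi>: "\<Phi> \<in> borel_measurable (draw_measure n :: 'd::finite draws measure)"
  shows "(\<integral>\<^sup>+ w. \<Phi> w \<partial>draw_measure n)
    = (\<integral>\<^sup>+ j. (\<integral>\<^sup>+ i. (\<integral>\<^sup>+ q. \<Phi> (j, i, q) \<partial>sphere_measure) \<partial>index_seq_measure n) \<partial>index_seq_measure n)"
proof -
  interpret S: prob_space "sphere_measure :: (real ^ 'd) measure" by (rule prob_space_sphere_measure)
  interpret I: prob_space "index_seq_measure n" by (rule prob_space_index_seq_measure)
  interpret IS: pair_prob_space "index_seq_measure n" "sphere_measure :: (real ^ 'd) measure" ..
  have m: "\<Phi> \<in> borel_measurable (index_seq_measure n \<Otimes>\<^sub>M (index_seq_measure n \<Otimes>\<^sub>M sphere_measure))"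
    using \<Phi> by (simp add: draw_measure_def)
  have "(\<integral>\<^sup>+ w. \<Phi> w \<partial>draw_measure n)
    = (\<integral>\<^sup>+ j. (\<integral>\<^sup>+ p. \<Phi> (j, p) \<partial>(index_seq_measure n \<Otimes>\<^sub>M sphere_measure)) \<partial>index_seq_measure n)"
    unfolding draw_measure_def by (rule IS.nn_integral_fst[OF m, symmetric])
  also have "\<dots> = (\<integral>\<^sup>+ j. (\<integral>\<^sup>+ i. (\<integral>\<^sup>+ q. \<Phi> (j, i, q) \<partial>sphere_measure) \<partial>index_seq_measure n) \<partial>index_seq_measure n)"
    using m by (intro nn_integral_cong S.nn_integral_fst[symmetric]) simp
  finally show ?thesis .
qed

text \<open>Conditioning on the past: cutting the sequence at \<open>t\<close> gives an independent
  pair. By \<open>past\<close> the state sees the first part only, and draw number \<open>t\<close>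
  is the first entry of the second part.\<close>

lemma nn_integral_draws_step:
  fixes st :: "(nat \<Rightarrow> 'd::finite draws) \<Rightarrow> (real ^ 'd) srvrc_state"
  assumes st: "st \<in> draws_measure n \<rightarrow>\<^sub>M state_measure"
    and past: "\<And>\<omega> \<omega>'. st (comb_seq t \<omega> \<omega>') = st \<omega>"
    and \<Phi>: "(\<lambda>(w, s). \<Phi> w s) \<in> borel_measurable (draw_measure n \<Otimes>\<^sub>M state_measure)"
  shows "(\<integral>\<^sup>+ \<omega>. \<Phi> (\<omega> t) (st \<omega>) \<partial>draws_measure n)
    = (\<integral>\<^sup>+ \<omega>. (\<integral>\<^sup>+ w. \<Phi> w (st \<omega>) \<partial>draw_measure n) \<partial>draws_measure n)"
proof -
  interpret sequence_space "draw_measure n :: 'd draws measure" by (rule sequence_space_draws)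
  let ?D = "draws_measure n :: (nat \<Rightarrow> 'd draws) measure"
  have D: "?D = PiM UNIV (\<lambda>_. draw_measure n)" by (rule draws_measure_eq)
  have cs: "(\<lambda>(\<omega>, \<omega>'). comb_seq t \<omega> \<omega>') \<in> ?D \<Otimes>\<^sub>M ?D \<rightarrow>\<^sub>M ?D" unfolding D by (rule measurable_comb_seq)
  have comp: "distr ?D (draw_measure n) (\<lambda>\<omega>. \<omega> 0) = draw_measure n"
    unfolding D by (rule PiM_component) simp
  have m1: "(\<lambda>\<omega>. \<Phi> (\<omega> t) (st \<omega>)) \<in> borel_measurable ?D"
    using measurable_compose[OF measurable_Pair[OF measurable_draw st] \<Phi>] by simp
  have "(\<integral>\<^sup>+ \<omega>. \<Phi> (\<omega> t) (st \<omega>) \<partial>?D)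
    = (\<integral>\<^sup>+ \<omega>. \<Phi> (\<omega> t) (st \<omega>) \<partial>distr (?D \<Otimes>\<^sub>M ?D) ?D (\<lambda>(\<omega>, \<omega>'). comb_seq t \<omega> \<omega>'))"
    unfolding D PiM_comb_seq ..
  also have "\<dots> = (\<integral>\<^sup>+ z. \<Phi> (snd z 0) (st (fst z)) \<partial>(?D \<Otimes>\<^sub>M ?D))"
    by (subst nn_integral_distr[OF cs]) (use m1 in \<open>simp_all add: case_prod_beta past comb_seq_def\<close>)
  also have "\<dots> = (\<integral>\<^sup>+ \<omega>. (\<integral>\<^sup>+ \<omega>'. \<Phi> (\<omega>' 0) (st \<omega>) \<partial>?D) \<partial>?D)"
  proof -
    have "(\<lambda>z. \<Phi> (snd z 0) (st (fst z))) \<in> borel_measurable (?D \<Otimes>\<^sub>M ?D)"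
      using measurable_compose[OF measurable_Pair[OF measurable_compose[OF measurable_snd measurable_draw]
          measurable_compose[OF measurable_fst st]] \<Phi>] by simp
    from nn_integral_fst[OF this[unfolded D]] show ?thesis unfolding D by simp
  qed
  also have "\<dots> = (\<integral>\<^sup>+ \<omega>. (\<integral>\<^sup>+ w. \<Phi> w (st \<omega>) \<partial>draw_measure n) \<partial>?D)"
  proof (rule nn_integral_cong)
    fix \<omega>
    have "(\<lambda>w. \<Phi> w (st \<omega>)) \<in> borel_measurable (draw_measure n)"
      using measurable_compose[OF measurable_Pair[OF measurable_ident measurable_const[of "st \<omega>" state_measure]] \<Phi>] by simp
    then show "(\<integral>\<^sup>+ \<omega>'. \<Phi> (\<omega>' 0) (st \<omega>) \<partial>?D) = (\<integral>\<^sup>+ w. \<Phi> w (st \<omega>) \<partial>draw_measure n)"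
      by (subst comp[symmetric], subst nn_integral_distr) auto
  qed
  finally show ?thesis .
qed

lemma AE_index_seq_measure:
  assumes n: "n \<ge> 1"
  shows "AE j in index_seq_measure n. \<forall>k. j k \<in> {1..n}"
proof -
  let ?p = "measure_pmf (pmf_of_set {1..n})"
  interpret sequence_space ?p by (rule sequence_space_index)
  have "AE j in index_seq_measure n. j k \<in> {1..n}" for k
  proof -
    have d: "distr (index_seq_measure n) ?p (\<lambda>j. j k) = ?p"
      unfolding index_seq_measure_def by (rule PiM_component) simp
    have "AE i in ?p. i \<in> {1..n}" using n by (simp add: AE_measure_pmf_iff)
    then have "AE i in distr (index_seq_measure n) ?p (\<lambda>j. j k). i \<in> {1..n}" unfolding d .
    then show ?thesis
      using measurable_index_component[of k n]
      by (subst (asm) AE_distr_iff) (auto cong: measurable_cong_sets)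
  qed
  then show ?thesis unfolding AE_all_countable by blast
qed

text \<open>Only almost everywhere, since \<open>sgn 0 = 0\<close>; the origin is a null set of the
  ball.\<close>

lemma sphere_measure_norm_eq: "AE q in sphere_measure. norm (q :: real ^ 'd) = 1"
proof -
  have m: "(sgn :: real ^ 'd \<Rightarrow> _) \<in> measurable (uniform_measure lborel (cball 0 1)) borel"
    by (simp add: sgn_div_norm[abs_def] uniform_measure_def)
  have "AE z in lborel. (z :: real ^ 'd) \<noteq> 0" by (rule AE_lborel_singleton)
  then have "AE z in uniform_measure lborel (cball 0 1). (z :: real ^ 'd) \<noteq> 0"
    by (intro AE_uniform_measureI) auto
  then have "AE z in uniform_measure lborel (cball 0 1). norm (sgn (z :: real ^ 'd)) = 1"
    by eventually_elim (simp add: norm_sgn)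
  then show ?thesis unfolding sphere_measure_def by (subst AE_distr_iff[OF m]) auto
qed

text \<open>Failure forces the random coordinate below \<open>\<sigma> / Y ^ 18\<close>. From
  dimension 2 on, division by \<sigma> yields an event of \<open>sphere_anticoncentration\<close>.
  In dimension 1 a unit vector \<open>q\<close> cannot fail: for \<open>b \<noteq> 0\<close> the
  Cauchy point is a minimiser, and for \<open>b = 0\<close> the coordinate has absolute value
  \<sigma>.\<close>

lemma cubic_subsolver_failure_prob:
  fixes U :: "real ^ 'd ^ 'd"
  assumes sym: "symmetric_matrix U" and U: "\<And>x. norm (U *v x) \<le> L * norm x"
    and \<tau>: "\<tau> > 0" and \<zeta>: "\<zeta> > 0" and small: "\<tau> * \<zeta> \<le> 2 * L" and \<delta>: "\<delta> > 0" "\<delta> \<le> 1 / 3"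
    and deep: "cubic U b \<tau> y < - (\<tau> * \<zeta> ^ 3 / 12)"
  shows "emeasure sphere_measure {q. - (\<tau> * \<zeta> ^ 3 / 24)
      < cubic U b \<tau> (fst (cubic_subsolver U b \<tau> (1 / (16 * L)) \<zeta> (1 / 2) \<delta> L q))} \<le> ennreal \<delta>"
    (is "emeasure _ ?B \<le> _")
proof -
  interpret S: prob_space "sphere_measure :: (real ^ 'd) measure" by (rule prob_space_sphere_measure)
  obtain e l where eb: "eigenbasis U e l" using symmetric_matrix_eigenbasis[OF sym] by blast
  obtain i where i: "l i = lambda_min U" using eigenbasis_lambda_min_attained[OF eb] by blast
  define \<sigma> where "\<sigma> = perturbation \<tau> \<zeta> L"
  have \<sigma>: "\<sigma> > 0" unfolding \<sigma>_def by (rule perturbation_bounds(1)[OF \<tau> \<zeta> small])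
  define Y where "Y = 1 + sqrt (real CARD('d)) / \<delta>"
  have d1: "real CARD('d) \<ge> 1" by (simp add: Suc_leI)
  have Y4: "Y \<ge> 4"
  proof -
    have "3 * 1 \<le> 1 / \<delta> * sqrt (real CARD('d))" using \<delta> d1 by (intro mult_mono) (auto simp: field_simps)
    then show ?thesis by (simp add: Y_def)
  qed
  have success: "\<bar>(b + \<sigma> *\<^sub>R q) \<bullet> e i\<bar> < \<sigma> / Y ^ 18" if "q \<in> ?B" "norm q \<le> 1" for q
    using cubic_subsolver_success[OF sym eb i \<tau> \<zeta> small U that(2) \<delta>(1) deep] that(1)
    unfolding \<sigma>_def Y_def by force
  show ?thesis
  proof (cases "CARD('d) \<ge> 2")
    case True
    define s where "s = 1 / Y ^ 18"
    let ?G = "{q. \<bar>(b \<bullet> e i) / \<sigma> + q \<bullet> e i\<bar> < s}"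
    have "?G \<in> sets borel" by (intro borel_open open_Collect_less continuous_intros)
    then have G: "?G \<in> sets sphere_measure" by simp
    have "AE q in sphere_measure. q \<in> ?B \<longrightarrow> q \<in> ?G"
      using sphere_measure_norm_eq
    proof eventually_elim
      fix q :: "real ^ 'd" assume q: "norm q = 1"
      show "q \<in> ?B \<longrightarrow> q \<in> ?G"
      proof
        assume "q \<in> ?B"
        from success[OF this] q have "\<bar>(b + \<sigma> *\<^sub>R q) \<bullet> e i\<bar> < \<sigma> / Y ^ 18" by simp
        also have "(b + \<sigma> *\<^sub>R q) \<bullet> e i = \<sigma> * ((b \<bullet> e i) / \<sigma> + q \<bullet> e i)"
          using \<sigma> by (simp add: inner_add_left distrib_left)
        finally have "\<sigma> * \<bar>(b \<bullet> e i) / \<sigma> + q \<bullet> e i\<bar> < \<sigma> * s"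
          using \<sigma> by (simp add: abs_mult s_def)
        then show "q \<in> ?G" using \<sigma> by (simp only: mult_less_cancel_left_pos mem_Collect_eq)
      qed
    qed
    then have "emeasure sphere_measure ?B \<le> emeasure sphere_measure ?G"
      using G by (rule emeasure_mono_AE)
    also have "\<dots> = ennreal (measure sphere_measure ?G)" by (rule S.emeasure_eq_measure)
    also have "\<dots> \<le> ennreal \<delta>"
    proof (intro ennreal_leI sphere_anticoncentration eigenbasis_norm[OF eb] True \<delta>(1))
      \<comment> \<open>The exponent 18 is 6 * 3: two powers of \<open>Y\<close> dominate the
        quotient of dimension and \<delta>, four dominate the constant 24, and anticoncentration
        cubes the result.\<close>
      have "24 * real CARD('d) / \<delta> \<le> Y ^ 6"
      proof -
        have "real CARD('d) / \<delta> \<le> real CARD('d) / \<delta>\<^sup>2"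
          using \<delta> d1 by (intro divide_left_mono) (auto simp: power2_eq_square mult_left_le)
        also have "\<dots> = (sqrt (real CARD('d)) / \<delta>)\<^sup>2" by (simp add: power_divide)
        also have "\<dots> \<le> Y\<^sup>2" using \<delta> by (intro power_mono) (auto simp: Y_def)
        finally have "real CARD('d) / \<delta> \<le> Y\<^sup>2" .
        moreover have "4 ^ 4 \<le> Y ^ 4" using Y4 by (intro power_mono) auto
        ultimately have "24 * (real CARD('d) / \<delta>) \<le> Y ^ 4 * Y\<^sup>2" using \<delta> by (intro mult_mono) auto
        then show ?thesis by (simp add: power_add[symmetric])
      qed
      then have "1 / Y ^ 6 \<le> \<delta> / (24 * real CARD('d))"
        using \<delta> d1 Y4 by (simp add: field_simps)
      then have "(1 / Y ^ 6) ^ 3 \<le> (\<delta> / (24 * real CARD('d))) ^ 3"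
        using Y4 by (intro power_mono) auto
      then show "s \<le> (\<delta> / (24 * real CARD('d))) ^ 3"
        by (simp add: s_def power_divide power_mult[symmetric])
    qed
    finally show ?thesis .
  next
    case False
    then have c1: "CARD('d) = 1" using d1 by linarith
    have "AE q in sphere_measure. q \<in> ?B \<longrightarrow> q \<in> {}"
      using sphere_measure_norm_eq
    proof eventually_elim
      fix q :: "real ^ 'd" assume q: "norm q = 1"
      have "q \<notin> ?B"
      proof
        assume B: "q \<in> ?B"
        have T: "\<tau> * \<zeta> ^ 3 > 0" using \<tau> \<zeta> by simp
        show False
        proof (cases "b = 0")
          case True
          have "\<bar>\<sigma> * (q \<bullet> e i)\<bar> < \<sigma> / Y ^ 18" using success[OF B] q True by simp
          moreover have "\<bar>q \<bullet> e i\<bar> = 1"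
          proof -
            have U1: "(UNIV :: 'd set) = {i}" using c1 by (metis card_1_singletonE UNIV_I singletonD)
            have "(norm q)\<^sup>2 = (q \<bullet> e i)\<^sup>2" unfolding eigenbasis_norm_power2[OF eb] U1 by simp
            then show ?thesis using q by (metis abs_1 power2_eq_iff_nonneg abs_ge_zero norm_ge_zero power2_abs)
          qed
          ultimately have "\<sigma> < \<sigma> / Y ^ 18" using \<sigma> by (simp add: abs_mult)
          moreover have "\<sigma> / Y ^ 18 \<le> \<sigma>" using \<sigma> Y4 by (simp add: divide_le_eq mult_le_cancel_left1 one_le_power)
          ultimately show False by simp
        next
          case False
          have "cubic U b \<tau> (cauchy_point U b \<tau>) \<le> cubic U b \<tau> y"
            by (rule cauchy_point_optimal_1D[OF sym \<tau> False c1])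
          then have "cubic U b \<tau> (cauchy_point U b \<tau>) \<le> - (\<tau> * \<zeta> ^ 3 / 24)" using deep T by simp
          then show False using B unfolding cubic_subsolver_eq by (simp add: Let_def)
        qed
      qed
      then show "q \<in> ?B \<longrightarrow> q \<in> {}" by simp
    qed
    then have "emeasure sphere_measure ?B \<le> emeasure sphere_measure ({} :: (real ^ 'd) set)"
      by (rule emeasure_mono_AE) simp
    then show ?thesis by simp
  qed
qed

section \<open>The algorithm as a state process\<close>

lemma round_up_pos: "round_up r \<ge> 1"
  by (simp add: round_up_def)

text \<open>A rounded size below the cap was not cut off by it. At the cap the exact average is
  used, so only this case carries a sampling error.\<close>

lemma round_up_min_less:
  "round_up (min (real m) r) < m \<Longrightarrow> r \<le> real (round_up (min (real m) r))"
proof -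
  assume less: "round_up (min (real m) r) < m"
  have "r \<le> real m"
  proof (rule ccontr)
    assume "\<not> ?thesis"
    then have "real m \<le> real (round_up (min (real m) r))" using round_up_ge[of "real m"] by (simp add: min_absorb1)
    then show False using less by simp
  qed
  then show ?thesis using round_up_ge[of r] by (simp add: min_absorb2)
qed

locale srvrc =
  fixes f :: "nat \<Rightarrow> real ^ 'd \<Rightarrow> real"
    and F :: "real ^ 'd \<Rightarrow> real"
    and x0 :: "real ^ 'd"
    and n T S :: nat
    and \<Delta>F L \<rho> M \<xi> \<epsilon> :: real
    and Bg :: "nat \<Rightarrow> real ^ 'd \<Rightarrow> nat"
    and Bh :: "nat \<Rightarrow> nat"
  assumes n: "n \<ge> 1"
    and F: "F = avg_fun n f"
    and pos: "\<Delta>F > 0" "L > 0" "\<rho> > 0" "M > 0"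
    and twice_diff: "\<And>i x. i \<in> {1..n} \<Longrightarrow> f i differentiable (at x)"
      "\<And>i x. i \<in> {1..n} \<Longrightarrow> grad (f i) differentiable (at x)"
    and bounded_below: "bdd_below (range F)"
    and gap: "F x0 - (INF x. F x) \<le> \<Delta>F"
    and grad_lipschitz: "\<And>i x y. i \<in> {1..n} \<Longrightarrow>
      norm (grad (f i) x - grad (f i) y) \<le> L * norm (x - y)"
    and hess_lipschitz: "\<And>i x y. i \<in> {1..n} \<Longrightarrow>
      spectral_norm (hess (f i) x - hess (f i) y) \<le> \<rho> * norm (x - y)"
    and grad_deviation: "\<And>i x. i \<in> {1..n} \<Longrightarrow> norm (grad (f i) x - grad F x) \<le> M"
    and \<xi>: "0 < \<xi>" "\<xi> < 1"
    and \<epsilon>: "0 < \<epsilon>" "\<epsilon> < L\<^sup>2 / (4 * \<rho>)"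
    and S: "S = round_up (sqrt (\<rho> * \<epsilon>) / L * sqrt (min (real n) (M\<^sup>2 / \<epsilon>\<^sup>2)))"
    and T: "T = round_up (25 * \<Delta>F * \<rho> powr (1/2) * \<epsilon> powr (-3/2))"
    and Bh: "\<And>t. Bh t = round_up (min (real n)
      (1200 * L\<^sup>2 * (ln (3 * real T * real CARD('d) / \<xi>))\<^sup>2 / (\<rho> * \<epsilon>)))"
    and Bg: "\<And>t h. Bg t h =
      (if t mod S \<noteq> 0
       then round_up (min (real n)
         (2640 * L\<^sup>2 * real S * (norm h)\<^sup>2 * (ln (3 * real T / \<xi>))\<^sup>2 / \<epsilon>\<^sup>2))
       else round_up (min (real n) (2640 * M\<^sup>2 * (ln (3 * real T / \<xi>))\<^sup>2 / \<epsilon>\<^sup>2)))"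
begin

abbreviation "\<tau> \<equiv> 4 * \<rho>"
text \<open>The unit of length: \<open>\<rho> * \<zeta>\<^sup>2\<close> is the gradient tolerance,
  \<open>\<rho> * \<zeta>\<close> the curvature tolerance and \<open>\<rho> * \<zeta> ^ 3\<close>
  the unit of decrease.\<close>

definition "\<zeta> = sqrt (\<epsilon> / \<rho>)"
text \<open>The failure probability of one event in one iteration: three kinds of failure over
  \<open>T\<close> iterations add up to \<xi>. \<open>lg\<close> is the logarithm of its reciprocal,
  and \<open>lh\<close> adds the dimension factor of the matrix bound.\<close>

definition "\<delta> = \<xi> / (3 * real T)"
definition "lg = ln (3 * real T / \<xi>)"
definition "lh = ln (3 * real T * real CARD('d) / \<xi>)"

lemma T1: "T \<ge> 1" and S1: "S \<ge> 1"
  unfolding T S by (rule round_up_pos)+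

lemma \<zeta>: "\<zeta> > 0" and \<rho>\<zeta>2: "\<rho> * \<zeta>\<^sup>2 = \<epsilon>" and \<rho>\<zeta>: "\<rho> * \<zeta> = sqrt (\<rho> * \<epsilon>)"
proof -
  show "\<zeta> > 0" "\<rho> * \<zeta>\<^sup>2 = \<epsilon>" using pos \<epsilon> by (simp_all add: \<zeta>_def)
  have "(\<rho> * \<zeta>)\<^sup>2 = \<rho> * (\<rho> * \<zeta>\<^sup>2)" by (simp add: power2_eq_square)
  then have "(\<rho> * \<zeta>)\<^sup>2 = \<rho> * \<epsilon>" using \<open>\<rho> * \<zeta>\<^sup>2 = \<epsilon>\<close> by simp
  then show "\<rho> * \<zeta> = sqrt (\<rho> * \<epsilon>)" using \<open>\<zeta> > 0\<close> pos by (simp add: real_sqrt_unique)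
qed

lemma small: "2 * (\<rho> * \<zeta>) < L"
proof -
  have "(2 * (\<rho> * \<zeta>))\<^sup>2 = 4 * \<rho> * (\<rho> * \<zeta>\<^sup>2)" by (simp add: power2_eq_square)
  also have "\<dots> = 4 * \<rho> * \<epsilon>" by (simp only: \<rho>\<zeta>2)
  also have "\<dots> < L\<^sup>2" using \<epsilon>(2) pos by (simp add: less_divide_eq mult.commute)
  finally show ?thesis by (rule power_less_imp_less_base) (use pos in simp)
qed

lemma \<delta>: "\<delta> > 0" "\<delta> \<le> 1 / 3"
proof -
  show "\<delta> > 0" using \<xi> T1 by (simp add: \<delta>_def)
  have "\<xi> * 3 \<le> 1 * (3 * real T)" using \<xi> T1 by (intro mult_mono) auto
  then show "\<delta> \<le> 1 / 3" using T1 by (simp add: \<delta>_def field_simps)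
qed

lemma exp_lg: "exp (- lg) = \<delta>" and exp_lh: "real CARD('d) * exp (- lh) = \<delta>"
  using \<xi> T1 by (simp_all add: lg_def lh_def \<delta>_def exp_minus exp_ln)

lemma lg: "lg > 1" and lh: "lh \<ge> lg"
proof -
  have "3 < 3 * real T / \<xi>" using \<xi> T1 by (simp add: less_divide_eq)
  then have "exp 1 < 3 * real T / \<xi>" using exp_le by linarith
  moreover have p: "3 * real T / \<xi> > 0" using \<xi> T1 by simp
  ultimately show "lg > 1" unfolding lg_def by (metis exp_less_cancel_iff exp_ln)
  have "3 * real T * 1 / \<xi> \<le> 3 * real T * real CARD('d) / \<xi>"
    using \<xi> T1 by (intro divide_right_mono mult_left_mono) (auto simp: Suc_leI)
  then show "lh \<ge> lg" unfolding lg_def lh_def using p by simp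
qed

lemma f_hess: "i \<in> {1..n} \<Longrightarrow> lipschitz_hessian (f i) \<rho>"
  using twice_diff hess_lipschitz pos by (auto simp: lipschitz_hessian_def)

sublocale F: lipschitz_hessian F \<rho>
  unfolding F using pos by (intro lipschitz_hessian_avg_fun n f_hess) auto

lemma grad_F: "grad F x = (1 / real n) *\<^sub>R (\<Sum>i=1..n. grad (f i) x)"
  unfolding F by (rule grad_avg_fun(1)[OF twice_diff(1)])

lemma hess_F: "hess F x = (1 / real n) *\<^sub>R (\<Sum>i=1..n. hess (f i) x)"
  unfolding F by (rule hess_avg_fun(1)[OF twice_diff])

lemma sum_grad_dev: "(\<Sum>i=1..n. grad (f i) x - grad F x) = 0"
  unfolding sum_subtractf sum_constant_scaleR grad_F using n by simp

lemma sum_hess_dev: "(\<Sum>i=1..n. hess (f i) x - hess F x) = 0"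
  unfolding sum_subtractf sum_constant_scaleR hess_F using n by simp

lemma hess_f_sym: "i \<in> {1..n} \<Longrightarrow> symmetric_matrix (hess (f i) x)"
  by (rule lipschitz_hessian.hess_symmetric[OF f_hess])

lemma hess_f_bound: "i \<in> {1..n} \<Longrightarrow> norm (hess (f i) x *v h) \<le> L * norm h"
  by (rule lipschitz_hessian.hess_apply_le[OF f_hess grad_lipschitz])

lemma grad_F_lipschitz: "norm (grad F x - grad F y) \<le> L * norm (x - y)"
proof -
  have "grad F x - grad F y = (1 / real n) *\<^sub>R (\<Sum>i=1..n. grad (f i) x - grad (f i) y)"
    by (simp only: grad_F sum_subtractf scaleR_diff_right)
  also have "norm \<dots> \<le> (1 / real n) * (\<Sum>i=1..n. L * norm (x - y))"
    by (simp only: norm_scaleR) (intro mult_mono order_trans[OF norm_sum] sum_mono grad_lipschitz; simp)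
  finally show ?thesis using n by simp
qed

lemma hess_F_bound: "norm (hess F x *v h) \<le> L * norm h"
  by (rule F.hess_apply_le[OF grad_F_lipschitz])

text \<open>The ingredients of an iteration are functions of a single draw and a state, defined for
  stopped states too, so that a fresh draw can be integrated with the state frozen.\<close>

definition "vt t w s = (if t mod S = 0 then batch_grad n f (index_sample (Bg t (st_h s)) (fst w)) (st_x s)
  else batch_grad n f (index_sample (Bg t (st_h s)) (fst w)) (st_x s)
    - batch_grad n f (index_sample (Bg t (st_h s)) (fst w)) (st_y s) + st_v s)"
definition "Ut t w s = batch_hess n f (index_sample (Bh t) (fst (snd w))) (st_x s)"
definition "sub t w s = cubic_subsolver (Ut t w s) (vt t w s) \<tau> (1 / (16 * L)) \<zeta> (1 / 2) \<delta> L (snd (snd w))"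
definition "cg t s = (if t mod S = 0 then 1 else 2) * min n (Bg t (st_h s))"
definition "next t w s = (if cubic (Ut t w s) (vt t w s) \<tau> (fst (sub t w s)) \<le> - (\<tau> * \<zeta> ^ 3 / 24)
  then Running (st_x s + fst (sub t w s)) (st_x s) (vt t w s) (fst (sub t w s))
    (st_c s + cg t s + (snd (sub t w s) + 1) * Bh t)
  else (case cubic_finalsolver (Ut t w s) (vt t w s) \<tau> (1 / (16 * L)) \<epsilon> of None \<Rightarrow> Diverged
    | Some (h, a) \<Rightarrow> Finished (st_x s + h) (st_c s + cg t s + (snd (sub t w s) + 1 + a) * Bh t)))"
definition "st \<omega> t = srvrc_iter n f T Bg Bh (\<lambda>t. \<tau>) S x0 \<epsilon> \<rho> L \<xi> \<omega> t"
text \<open>Zero once the algorithm has stopped, so that the moment bounds extend to all later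
  iterations.\<close>

definition "err t w s = (if st_tag s = 0 then vt t w s - grad F (st_x s) else 0)"

lemma threshold: "4 * \<rho> * \<rho> powr (-3/2) * \<epsilon> powr (3/2) / 24 = \<tau> * \<zeta> ^ 3 / 24"
proof -
  have "\<zeta> ^ 3 = (\<epsilon> / \<rho>) powr (3/2)"
    using pos \<epsilon> by (simp add: \<zeta>_def powr_half_sqrt[symmetric] powr_power)
  also have "\<dots> = \<epsilon> powr (3/2) * \<rho> powr (-3/2)"
    using pos \<epsilon> by (simp add: powr_divide powr_minus_divide)
  finally show ?thesis by simp
qed

lemma srvrc_step_eq:
  "srvrc_step n f T Bg Bh (\<lambda>t. \<tau>) S \<epsilon> \<rho> L \<xi> t w s = (if st_tag s = 0 then next t w s else s)"
proof (cases s)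
  case (Running x y v h c)
  obtain j i q where w: "w = (j, i, q)" by (cases w)
  show ?thesis
    unfolding Running srvrc_step_def w next_def sub_def Ut_def vt_def cg_def \<zeta>_def[symmetric] \<delta>_def[symmetric]
      threshold
    by (simp add: Let_def case_prod_beta split: option.split)
qed (simp_all add: srvrc_step_def)

lemma st_0: "st \<omega> 0 = Running x0 x0 0 0 0"
  and st_Suc: "st \<omega> (Suc t) = (if st_tag (st \<omega> t) = 0 then next t (\<omega> t) (st \<omega> t) else st \<omega> t)"
  by (simp_all add: st_def srvrc_step_eq)

lemma st_past: "k \<le> t \<Longrightarrow> st (comb_seq t \<omega> \<omega>') k = st \<omega> k"
  by (induction k) (simp_all add: st_0 st_Suc comb_seq_def)

lemma st_Suc_running:
  assumes "st_tag (st \<omega> (Suc t)) = 0"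
  shows "st_tag (st \<omega> t) = 0" "st_v (st \<omega> (Suc t)) = vt t (\<omega> t) (st \<omega> t)"
    "st_y (st \<omega> (Suc t)) = st_x (st \<omega> t)" "st_x (st \<omega> (Suc t)) = st_x (st \<omega> t) + st_h (st \<omega> (Suc t))"
    "st_h (st \<omega> (Suc t)) = fst (sub t (\<omega> t) (st \<omega> t))"
    "cubic (Ut t (\<omega> t) (st \<omega> t)) (vt t (\<omega> t) (st \<omega> t)) \<tau> (fst (sub t (\<omega> t) (st \<omega> t))) \<le> - (\<tau> * \<zeta> ^ 3 / 24)"
    "st_c (st \<omega> (Suc t)) = st_c (st \<omega> t) + cg t (st \<omega> t) + (snd (sub t (\<omega> t) (st \<omega> t)) + 1) * Bh t"
proof -
  show 1: "st_tag (st \<omega> t) = 0" using assms by (auto simp: st_Suc split: if_splits)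
  then have nx: "st \<omega> (Suc t) = next t (\<omega> t) (st \<omega> t)" by (simp add: st_Suc)
  show c: "cubic (Ut t (\<omega> t) (st \<omega> t)) (vt t (\<omega> t) (st \<omega> t)) \<tau> (fst (sub t (\<omega> t) (st \<omega> t))) \<le> - (\<tau> * \<zeta> ^ 3 / 24)"
    using assms unfolding nx next_def by (auto split: if_splits option.splits)
  show "st_v (st \<omega> (Suc t)) = vt t (\<omega> t) (st \<omega> t)"
    "st_y (st \<omega> (Suc t)) = st_x (st \<omega> t)" "st_x (st \<omega> (Suc t)) = st_x (st \<omega> t) + st_h (st \<omega> (Suc t))"
    "st_h (st \<omega> (Suc t)) = fst (sub t (\<omega> t) (st \<omega> t))"
    "st_c (st \<omega> (Suc t)) = st_c (st \<omega> t) + cg t (st \<omega> t) + (snd (sub t (\<omega> t) (st \<omega> t)) + 1) * Bh t"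
    unfolding nx next_def using c by simp_all
qed

lemma err_Suc:
  assumes "st_tag (st \<omega> (Suc t)) = 0"
  shows "st_v (st \<omega> (Suc t)) - grad F (st_y (st \<omega> (Suc t))) = err t (\<omega> t) (st \<omega> t)"
  using st_Suc_running[OF assms] by (simp add: err_def)

end

section \<open>Failure probability\<close>

lemma measurable_count_space_op:
  fixes a :: "'w \<Rightarrow> nat" and b :: "'w \<Rightarrow> nat"
  assumes a: "a \<in> N \<rightarrow>\<^sub>M count_space UNIV" and b: "b \<in> N \<rightarrow>\<^sub>M count_space UNIV"
  shows "(\<lambda>z. g (a z) (b z)) \<in> N \<rightarrow>\<^sub>M count_space UNIV"
proof (rule measurable_compose_countable[OF _ a])
  show "(\<lambda>z. g k (b z)) \<in> N \<rightarrow>\<^sub>M count_space UNIV" for k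
    by (rule measurable_compose[OF b]) simp
qed

lemma measurable_round_up: "round_up \<in> borel \<rightarrow>\<^sub>M count_space UNIV"
proof -
  have "(\<lambda>r :: real. \<lceil>r\<rceil>) \<in> borel \<rightarrow>\<^sub>M count_space UNIV" by measurable
  then show ?thesis unfolding round_up_def[abs_def]
    by (rule measurable_compose[of _ borel "count_space UNIV"]) simp
qed

context srvrc
begin

abbreviation "W \<equiv> (draw_measure n :: 'd draws measure)"
abbreviation "WS \<equiv> W \<Otimes>\<^sub>M (state_measure :: (real ^ 'd) srvrc_state measure)"

lemma measurable_Bg: "Bg t \<in> borel \<rightarrow>\<^sub>M count_space UNIV"
proof (cases "t mod S = 0")
  case True
  then have "Bg t = (\<lambda>h. Bg t 0)" by (simp add: Bg fun_eq_iff)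
  then show ?thesis by (metis measurable_const UNIV_I space_count_space)
next
  case False
  then have "Bg t = (\<lambda>h. round_up (min (real n)
         (2640 * L\<^sup>2 * real S * (norm h)\<^sup>2 * (ln (3 * real T / \<xi>))\<^sup>2 / \<epsilon>\<^sup>2)))"
    by (simp add: Bg fun_eq_iff)
  also have "\<dots> \<in> borel \<rightarrow>\<^sub>M count_space UNIV"
    by (rule measurable_compose[OF _ measurable_round_up]) measurable
  finally show ?thesis .
qed

lemma measurable_draws [measurable]:
  "(\<lambda>z. fst (fst z)) \<in> WS \<rightarrow>\<^sub>M index_seq_measure n"
  "(\<lambda>z. fst (snd (fst z))) \<in> WS \<rightarrow>\<^sub>M index_seq_measure n"
  "(\<lambda>z. snd (snd (fst z))) \<in> borel_measurable WS"
proof -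
  have 1: "fst \<in> WS \<rightarrow>\<^sub>M index_seq_measure n \<Otimes>\<^sub>M index_seq_measure n \<Otimes>\<^sub>M sphere_measure"
    unfolding draw_measure_def[symmetric] by (rule measurable_fst)
  show "(\<lambda>z. fst (fst z)) \<in> WS \<rightarrow>\<^sub>M index_seq_measure n"
    by (rule measurable_compose[OF 1 measurable_fst])
  show "(\<lambda>z. fst (snd (fst z))) \<in> WS \<rightarrow>\<^sub>M index_seq_measure n"
    by (rule measurable_compose[OF measurable_compose[OF 1 measurable_snd] measurable_fst])
  have "(\<lambda>z. snd (snd (fst z))) \<in> WS \<rightarrow>\<^sub>M sphere_measure"
    by (rule measurable_compose[OF measurable_compose[OF 1 measurable_snd] measurable_snd])
  then show "(\<lambda>z. snd (snd (fst z))) \<in> borel_measurable WS"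
    by (simp cong: measurable_cong_sets)
qed

lemma measurable_batch: "(\<lambda>z. Bg t (st_h (snd z))) \<in> WS \<rightarrow>\<^sub>M count_space UNIV"
  by (rule measurable_compose[OF _ measurable_Bg]) measurable

lemma measurable_vt: "(\<lambda>z. vt t (fst z) (snd z)) \<in> borel_measurable WS"
proof -
  have x: "(\<lambda>z. batch_grad n f (index_sample (Bg t (st_h (snd z))) (fst (fst z))) (st_x (snd z))) \<in> borel_measurable WS"
    by (rule measurable_batch_grad[OF measurable_batch measurable_draws(1)]) measurable
  have y: "(\<lambda>z. batch_grad n f (index_sample (Bg t (st_h (snd z))) (fst (fst z))) (st_y (snd z))) \<in> borel_measurable WS"
    by (rule measurable_batch_grad[OF measurable_batch measurable_draws(1)]) measurable
  have v: "(\<lambda>z. st_v (snd z)) \<in> borel_measurable WS" by measurable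
  show ?thesis
    unfolding vt_def using x y v
    by (cases "t mod S = 0") (auto intro!: borel_measurable_add borel_measurable_diff)
qed

lemma measurable_Ut: "(\<lambda>z. Ut t (fst z) (snd z)) \<in> borel_measurable WS"
  unfolding Ut_def by (rule measurable_batch_hess[OF measurable_draws(2)]) measurable

lemma measurable_sub: "(\<lambda>z. sub t (fst z) (snd z)) \<in> WS \<rightarrow>\<^sub>M borel \<Otimes>\<^sub>M count_space UNIV"
  unfolding sub_def by (intro measurable_cubic_subsolver measurable_Ut measurable_vt measurable_draws)

lemma measurable_sub_fst: "(\<lambda>z. fst (sub t (fst z) (snd z))) \<in> borel_measurable WS"
  and measurable_sub_snd: "(\<lambda>z. snd (sub t (fst z) (snd z))) \<in> WS \<rightarrow>\<^sub>M count_space UNIV"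
  by (rule measurable_compose[OF measurable_sub measurable_fst], rule measurable_compose[OF measurable_sub measurable_snd])

lemma measurable_sub_value: "(\<lambda>z. cubic (Ut t (fst z) (snd z)) (vt t (fst z) (snd z)) \<tau> (fst (sub t (fst z) (snd z)))) \<in> borel_measurable WS"
  by (intro borel_measurable_cubic measurable_Ut measurable_vt measurable_sub_fst)

lemma measurable_cost:
  "(\<lambda>z. st_c (snd z) + cg t (snd z) + (snd (sub t (fst z) (snd z)) + k) * Bh t) \<in> WS \<rightarrow>\<^sub>M count_space UNIV"
proof -
  have cg: "(\<lambda>z. cg t (snd z)) \<in> WS \<rightarrow>\<^sub>M count_space UNIV"
    unfolding cg_def by (rule measurable_compose[OF measurable_batch]) simp
  have c: "(\<lambda>z. st_c (snd z)) \<in> WS \<rightarrow>\<^sub>M count_space UNIV" by measurable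
  have 1: "(\<lambda>z. st_c (snd z) + cg t (snd z)) \<in> WS \<rightarrow>\<^sub>M count_space UNIV"
    by (rule measurable_count_space_op[OF c cg])
  show ?thesis
    by (rule measurable_count_space_op[OF 1 measurable_sub_snd, of "\<lambda>a b. a + (b + k) * Bh t"])
qed

lemma measurable_next: "(\<lambda>z. next t (fst z) (snd z)) \<in> WS \<rightarrow>\<^sub>M state_measure"
proof -
  define it where "it k z = final_iterate (Ut t (fst z) (snd z)) (vt t (fst z) (snd z)) \<tau> (1 / (16 * L)) k"
    for k and z :: "'d draws \<times> (real ^ 'd) srvrc_state"
  define P where "P k z \<longleftrightarrow> norm (cubic_grad (Ut t (fst z) (snd z)) (vt t (fst z) (snd z)) \<tau> (it k z)) \<le> \<epsilon>"
    for k and z :: "'d draws \<times> (real ^ 'd) srvrc_state"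
  define K where "K z = (LEAST k. P k z)" for z :: "'d draws \<times> (real ^ 'd) srvrc_state"
  have it: "it k \<in> borel_measurable WS" for k
    unfolding it_def[abs_def] final_iterate_def
    by (intro borel_measurable_cubic_gd borel_measurable_cauchy_point measurable_Ut measurable_vt)
  have P [measurable]: "Measurable.pred WS (P k)" for k
  proof -
    have [measurable]: "(\<lambda>z. cubic_grad (Ut t (fst z) (snd z)) (vt t (fst z) (snd z)) \<tau> (it k z)) \<in> borel_measurable WS"
      by (intro borel_measurable_cubic_grad measurable_Ut measurable_vt it)
    show ?thesis unfolding P_def[abs_def] by measurable
  qed
  have K: "K \<in> WS \<rightarrow>\<^sub>M count_space UNIV" unfolding K_def[abs_def] by measurable
  have itK: "(\<lambda>z. it (K z) z) \<in> borel_measurable WS"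
    by (rule measurable_compose_countable[OF it K])
  define g where "g z = (if \<exists>k. P k z then Finished (st_x (snd z) + it (K z) z)
      (st_c (snd z) + cg t (snd z) + (snd (sub t (fst z) (snd z)) + 1) * Bh t + (2 + 2 * K z) * Bh t)
      else Diverged)" for z :: "'d draws \<times> (real ^ 'd) srvrc_state"
  have x: "(\<lambda>z. st_x (snd z)) \<in> borel_measurable WS" by measurable
  have g: "g \<in> WS \<rightarrow>\<^sub>M state_measure"
    unfolding g_def[abs_def]
  proof (intro measurable_If measurable_Finished)
    show "(\<lambda>z. st_x (snd z) + it (K z) z) \<in> borel_measurable WS" by (intro borel_measurable_add x itK)
    show "(\<lambda>z. st_c (snd z) + cg t (snd z) + (snd (sub t (fst z) (snd z)) + 1) * Bh t + (2 + 2 * K z) * Bh t) \<in> WS \<rightarrow>\<^sub>M count_space UNIV"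
      by (rule measurable_count_space_op[OF measurable_cost K, of "\<lambda>a b. a + (2 + 2 * b) * Bh t"])
    have "Measurable.pred WS (\<lambda>z. \<exists>k. P k z)" by measurable
    then show "{z \<in> space WS. \<exists>k. P k z} \<in> sets WS" by (simp add: pred_def)
  qed simp
  have r: "(\<lambda>z. Running (st_x (snd z) + fst (sub t (fst z) (snd z))) (st_x (snd z)) (vt t (fst z) (snd z))
      (fst (sub t (fst z) (snd z))) (st_c (snd z) + cg t (snd z) + (snd (sub t (fst z) (snd z)) + 1) * Bh t))
    \<in> WS \<rightarrow>\<^sub>M state_measure"
    by (intro measurable_Running borel_measurable_add x measurable_sub_fst measurable_vt measurable_cost)
  have [measurable]: "(\<lambda>z. cubic (Ut t (fst z) (snd z)) (vt t (fst z) (snd z)) \<tau> (fst (sub t (fst z) (snd z)))) \<in> borel_measurable WS"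
    by (rule measurable_sub_value)
  have "{z \<in> space WS. cubic (Ut t (fst z) (snd z)) (vt t (fst z) (snd z)) \<tau> (fst (sub t (fst z) (snd z))) \<le> - (\<tau> * \<zeta> ^ 3 / 24)} \<in> sets WS"
    by measurable
  from measurable_If[OF r g this]
  have m1: "(\<lambda>z. if cubic (Ut t (fst z) (snd z)) (vt t (fst z) (snd z)) \<tau> (fst (sub t (fst z) (snd z))) \<le> - (\<tau> * \<zeta> ^ 3 / 24)
    then Running (st_x (snd z) + fst (sub t (fst z) (snd z))) (st_x (snd z)) (vt t (fst z) (snd z))
      (fst (sub t (fst z) (snd z))) (st_c (snd z) + cg t (snd z) + (snd (sub t (fst z) (snd z)) + 1) * Bh t)
    else g z) \<in> WS \<rightarrow>\<^sub>M state_measure" .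
  have gz: "g z = (case cubic_finalsolver (Ut t (fst z) (snd z)) (vt t (fst z) (snd z)) \<tau> (1 / (16 * L)) \<epsilon> of None \<Rightarrow> Diverged
    | Some (h, a) \<Rightarrow> Finished (st_x (snd z) + h) (st_c (snd z) + cg t (snd z) + (snd (sub t (fst z) (snd z)) + 1 + a) * Bh t))" for z
    unfolding g_def cubic_finalsolver_eq final_count_def it_def[symmetric] P_def[symmetric] K_def[symmetric]
    by (simp add: algebra_simps)
  show ?thesis unfolding next_def gz[symmetric] by (rule m1)
qed

lemma measurable_st: "(\<lambda>\<omega>. st \<omega> t) \<in> (draws_measure n :: (nat \<Rightarrow> 'd draws) measure) \<rightarrow>\<^sub>M state_measure"
proof (induction t)
  case 0
  then show ?case by (simp add: st_0)
next
  case (Suc t)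
  let ?D = "draws_measure n :: (nat \<Rightarrow> 'd draws) measure"
  have p: "(\<lambda>\<omega>. (\<omega> t, st \<omega> t)) \<in> ?D \<rightarrow>\<^sub>M WS"
    by (rule measurable_Pair[OF measurable_draw Suc])
  have nx: "(\<lambda>\<omega>. next t (\<omega> t) (st \<omega> t)) \<in> ?D \<rightarrow>\<^sub>M state_measure"
    using measurable_compose[OF p measurable_next] by simp
  have tag: "(\<lambda>\<omega>. st_tag (st \<omega> t)) \<in> ?D \<rightarrow>\<^sub>M count_space UNIV"
    by (rule measurable_compose[OF Suc measurable_st(1)])
  then have "{\<omega> \<in> space ?D. st_tag (st \<omega> t) = 0} \<in> sets ?D" by measurable
  from measurable_If[OF nx Suc this] show ?case by (simp add: st_Suc)
qed

lemma measurable_err: "(\<lambda>z. err t (fst z) (snd z)) \<in> borel_measurable WS"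
proof -
  have "(\<lambda>z. grad F (st_x (snd z))) \<in> borel_measurable WS"
    by (rule measurable_compose[OF _ grad_borel_measurable(2)]) measurable
  moreover have "{z \<in> space WS. st_tag (snd z) = 0} \<in> sets WS" by measurable
  ultimately show ?thesis unfolding err_def
    by (intro measurable_If borel_measurable_diff measurable_vt) auto
qed

section \<open>Moments and tail of the gradient error\<close>

lemma nn_integral_const_on_draws:
  assumes "\<And>j i q. \<Phi> (j, i, q) = \<Psi> j" and m: "\<Phi> \<in> borel_measurable W"
  shows "(\<integral>\<^sup>+ w. \<Phi> w \<partial>W) = (\<integral>\<^sup>+ j. \<Psi> j \<partial>index_seq_measure n)"
proof -
  interpret Sp: prob_space "sphere_measure :: (real ^ 'd) measure" by (rule prob_space_sphere_measure)
  interpret I: prob_space "index_seq_measure n" by (rule prob_space_index_seq_measure)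
  show ?thesis
    unfolding nn_integral_draw_measure[OF m] assms(1)
    using Sp.emeasure_space_1 I.emeasure_space_1 by simp
qed

text \<open>\<open>A0\<close> and \<open>A1\<close> bound \<open>B * b\<^sup>2\<close> for batch
  size \<open>B\<close> and summand size \<open>b\<close>, the variance proxy added by a reset and
  by an ordinary iteration. The 4 in \<open>A1\<close> stems from the bound
  \<open>2 * L * norm h\<close> for a centred gradient difference.\<close>

definition "A0 = \<epsilon>\<^sup>2 / (2640 * lg\<^sup>2)"
definition "A1 = 4 * \<epsilon>\<^sup>2 / (2640 * real S * lg\<^sup>2)"

lemma cosh_power_bound:
  assumes "real B * b\<^sup>2 \<le> A" shows "cosh (r * b) ^ B \<le> exp (r\<^sup>2 / 2 * A)"
proof -
  have "cosh (r * b) ^ B \<le> exp ((r * b)\<^sup>2 / 2) ^ B"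
    by (intro power_mono cosh_le_exp_half_square) simp
  also have "\<dots> = exp (r\<^sup>2 / 2 * (real B * b\<^sup>2))" by (simp add: exp_of_nat_mult[symmetric] power_mult_distrib algebra_simps)
  also have "\<dots> \<le> exp (r\<^sup>2 / 2 * A)" using assms by (simp add: mult_left_mono)
  finally show ?thesis .
qed

lemma batch_grad_full: "batch_grad n f (index_sample B j) x = grad F x" if "\<not> B < n"
  using that by (simp add: batch_grad_def F)

text \<open>A batch size proportional to the squared step cancels the squared size of the gradient
  differences, so the growth factor is a constant although the batch size is random. With a capped
  batch the error equals the inherited \<open>e\<close>.\<close>

lemma err_one_step:
  assumes tag: "st_tag s = 0" and r: "r \<ge> 0"
    and step: "t mod S \<noteq> 0 \<Longrightarrow> st_x s = st_y s + st_h s"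
  shows "(\<integral>\<^sup>+ w. ennreal (cosh (r * norm (err t w s))) \<partial>W) \<le>
    ennreal (if t mod S = 0 then exp (r\<^sup>2 / 2 * A0)
      else exp (r\<^sup>2 / 2 * A1) * cosh (r * norm (st_v s - grad F (st_y s))))"
proof -
  interpret I: prob_space "index_seq_measure n" by (rule prob_space_index_seq_measure)
  define B where "B = Bg t (st_h s)"
  define e where "e = (if t mod S = 0 then 0 else st_v s - grad F (st_y s))"
  define G where "G i = (if t mod S = 0 then grad (f i) (st_x s) - grad F (st_x s)
    else (grad (f i) (st_x s) - grad F (st_x s)) - (grad (f i) (st_y s) - grad F (st_y s)))" for i
  define A where "A = (if t mod S = 0 then A0 else A1)"
  have A: "A \<ge> 0" by (simp add: A_def A0_def A1_def)
  have B1: "B \<ge> 1" unfolding B_def Bg using round_up_pos by simp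
  have errj: "err t (j, i, q) s = (if B < n then e + (\<Sum>k<B. (1 / real B) *\<^sub>R G (j k)) else e)" for j i q
  proof (cases "B < n")
    case True
    have "real B *\<^sub>R ((1 / real B) *\<^sub>R g) = g" for g :: "real ^ 'd" using B1 by simp
    then have c: "(\<Sum>k<B. (1 / real B) *\<^sub>R g) = g" for g :: "real ^ 'd" by (simp only: sum_constant_scaleR card_lessThan)
    show ?thesis
    proof (cases "t mod S = 0")
      case z: True
      have "(\<Sum>k<B. (1 / real B) *\<^sub>R G (j k)) = (1 / real B) *\<^sub>R (\<Sum>k<B. grad (f (j k)) (st_x s)) - grad F (st_x s)"
        unfolding G_def using z by (simp only: refl if_True scaleR_diff_right sum_subtractf c scaleR_sum_right)
      then show ?thesis using True z tag
        by (simp add: err_def vt_def e_def batch_grad_def sum_mset_index_sample B_def[symmetric])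
    next
      case z: False
      have "(\<Sum>k<B. (1 / real B) *\<^sub>R G (j k)) = ((1 / real B) *\<^sub>R (\<Sum>k<B. grad (f (j k)) (st_x s)) - grad F (st_x s))
         - ((1 / real B) *\<^sub>R (\<Sum>k<B. grad (f (j k)) (st_y s)) - grad F (st_y s))"
        unfolding G_def using z by (simp only: if_False scaleR_diff_right sum_subtractf c scaleR_sum_right)
      then show ?thesis using True z tag
        by (simp add: err_def vt_def e_def batch_grad_def sum_mset_index_sample B_def[symmetric])
    qed
  next
    case False
    then show ?thesis using tag by (simp add: err_def vt_def e_def batch_grad_full B_def[symmetric])
  qed
  have m: "(\<lambda>w. ennreal (cosh (r * norm (err t w s)))) \<in> borel_measurable W"
  proof -
    have cont: "continuous_on UNIV (\<lambda>x :: real ^ 'd. cosh (r * norm x))"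
      unfolding cosh_field_def by (intro continuous_intros) auto
    have "(\<lambda>w. err t w s) \<in> borel_measurable W"
      using measurable_compose[OF measurable_Pair[OF measurable_ident measurable_const[of s state_measure]] measurable_err] by simp
    from measurable_compose[OF this borel_measurable_continuous_onI[OF cont]] show ?thesis by simp
  qed
  have "(\<integral>\<^sup>+ w. ennreal (cosh (r * norm (err t w s))) \<partial>W)
    = (\<integral>\<^sup>+ j. ennreal (cosh (r * norm (if B < n then e + (\<Sum>k<B. (1 / real B) *\<^sub>R G (j k)) else e))) \<partial>index_seq_measure n)"
    by (rule nn_integral_const_on_draws[OF _ m]) (simp only: errj)
  also have "\<dots> \<le> ennreal (exp (r\<^sup>2 / 2 * A) * cosh (r * norm e))"
  proof (cases "B < n")
    case False
    have "1 * cosh (r * norm e) \<le> exp (r\<^sup>2 / 2 * A) * cosh (r * norm e)"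
      using A by (intro mult_right_mono) auto
    then show ?thesis using False I.emeasure_space_1 by (simp add: ennreal_leI)
  next
    case True
    define b where "b = (if t mod S = 0 then M else 2 * L * norm (st_h s)) / real B"
    have b0: "b \<ge> 0" using pos by (simp add: b_def)
    have mean: "(\<Sum>i=1..n. (1 / real B) *\<^sub>R G i) = 0"
      using sum_grad_dev[of "st_x s"] sum_grad_dev[of "st_y s"]
      unfolding G_def scaleR_sum_right[symmetric] by (cases "t mod S = 0") (simp_all add: sum_subtractf)
    have Gb: "norm ((1 / real B) *\<^sub>R G i) \<le> b" if i: "i \<in> {1..n}" for i
    proof -
      have "norm (G i) \<le> (if t mod S = 0 then M else 2 * L * norm (st_h s))"
      proof (cases "t mod S = 0")
        case True
        then show ?thesis using grad_deviation[OF i] by (simp add: G_def)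
      next
        case False
        have "G i = (grad (f i) (st_x s) - grad (f i) (st_y s)) - (grad F (st_x s) - grad F (st_y s))"
          using False by (simp add: G_def)
        also have "norm \<dots> \<le> L * norm (st_x s - st_y s) + L * norm (st_x s - st_y s)"
          by (intro order_trans[OF norm_triangle_ineq4] add_mono grad_lipschitz[OF i] grad_F_lipschitz)
        also have "st_x s - st_y s = st_h s" using step[OF False] by simp
        finally show ?thesis using False by simp
      qed
      then show ?thesis using B1 by (simp add: b_def divide_right_mono)
    qed
    have "real B * b\<^sup>2 \<le> A"
    proof (cases "t mod S = 0")
      case z: True
      have "2640 * M\<^sup>2 * lg\<^sup>2 / \<epsilon>\<^sup>2 \<le> real B"
        using True z unfolding B_def Bg lg_def by (simp add: round_up_min_less)
      then have "M\<^sup>2 * (2640 * lg\<^sup>2) \<le> \<epsilon>\<^sup>2 * real B" using \<epsilon> by (simp add: divide_le_eq mult_ac)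
      then have "M\<^sup>2 / real B \<le> A0" using B1 lg by (simp add: A0_def divide_le_eq le_divide_eq mult_ac)
      then show ?thesis using z B1 by (simp add: b_def A_def power_divide power2_eq_square)
    next
      case z: False
      have "2640 * L\<^sup>2 * real S * (norm (st_h s))\<^sup>2 * lg\<^sup>2 / \<epsilon>\<^sup>2 \<le> real B"
        using True z unfolding B_def Bg lg_def by (simp add: round_up_min_less)
      then have "(2 * L * norm (st_h s))\<^sup>2 * (2640 * real S * lg\<^sup>2) \<le> 4 * \<epsilon>\<^sup>2 * real B"
        using \<epsilon> by (simp add: divide_le_eq power_mult_distrib mult_ac)
      then have "(2 * L * norm (st_h s))\<^sup>2 / real B \<le> A1"
        using B1 lg S1 by (simp add: A1_def divide_le_eq le_divide_eq mult_ac)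
      then show ?thesis using z B1 by (simp add: b_def A_def power_divide power2_eq_square)
    qed
    then have "cosh (r * b) ^ B * cosh (r * norm e) \<le> exp (r\<^sup>2 / 2 * A) * cosh (r * norm e)"
      by (intro mult_right_mono cosh_power_bound) auto
    then show ?thesis
      using order_trans[OF nn_integral_cosh_norm_sample_sum[OF n mean Gb r b0, of e B] ennreal_leI] True by simp
  qed
  finally show ?thesis by (cases "t mod S = 0") (simp_all add: A_def e_def)
qed

text \<open>Each iteration since the last reset contributes one factor
  \<open>exp (r\<^sup>2 / 2 * A1)\<close>, and a reset discards the old error. After stopping the
  potential is 1, which lies below every bound.\<close>

lemma err_potential:
  assumes r: "r \<ge> 0"
  shows "(\<integral>\<^sup>+ \<omega>. ennreal (cosh (r * norm (err t (\<omega> t) (st \<omega> t)))) \<partial>draws_measure n)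
    \<le> ennreal (exp (r\<^sup>2 / 2 * (A0 + real (t mod S) * A1)))"
proof (induction t)
  let ?D = "draws_measure n :: (nat \<Rightarrow> 'd draws) measure"
  interpret D: prob_space ?D by (rule prob_space_draws_measure)
  interpret W: prob_space W by (rule prob_space_draw_measure)
  have cont: "continuous_on UNIV (\<lambda>x :: real ^ 'd. cosh (r * norm x))"
    unfolding cosh_field_def by (intro continuous_intros) auto
  have cm: "(\<lambda>z. ennreal (cosh (r * norm (err t (fst z) (snd z))))) \<in> borel_measurable WS" for t
    using measurable_compose[OF measurable_err borel_measurable_continuous_onI[OF cont]] by simp
  have split: "(\<integral>\<^sup>+ \<omega>. ennreal (cosh (r * norm (err t (\<omega> t) (st \<omega> t)))) \<partial>?D)
    = (\<integral>\<^sup>+ \<omega>. (\<integral>\<^sup>+ w. ennreal (cosh (r * norm (err t w (st \<omega> t)))) \<partial>W) \<partial>?D)" for t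
    by (rule nn_integral_draws_step[OF measurable_st]) (use cm[of t] in \<open>simp_all add: st_past case_prod_beta\<close>)
  have A: "A0 \<ge> 0" "A1 \<ge> 0" by (simp_all add: A0_def A1_def)
  have reset: "(\<integral>\<^sup>+ \<omega>. (\<integral>\<^sup>+ w. ennreal (cosh (r * norm (err t w (st \<omega> t)))) \<partial>W) \<partial>?D) \<le> ennreal (exp (r\<^sup>2 / 2 * A0))"
    if t: "t mod S = 0" for t
  proof -
    have "(\<integral>\<^sup>+ w. ennreal (cosh (r * norm (err t w s))) \<partial>W) \<le> ennreal (exp (r\<^sup>2 / 2 * A0))" for s
    proof (cases "st_tag s = 0")
      case True
      then show ?thesis using err_one_step[OF True r, of t] t by simp
    next
      case False
      have "1 \<le> ennreal (exp (r\<^sup>2 / 2 * A0))" using A by (simp add: ennreal_leI[of 1, simplified])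
      then show ?thesis using False W.emeasure_space_1 by (simp add: err_def)
    qed
    then have "(\<integral>\<^sup>+ \<omega>. (\<integral>\<^sup>+ w. ennreal (cosh (r * norm (err t w (st \<omega> t)))) \<partial>W) \<partial>?D)
      \<le> (\<integral>\<^sup>+ \<omega>. ennreal (exp (r\<^sup>2 / 2 * A0)) \<partial>?D)" by (intro nn_integral_mono)
    then show ?thesis using D.emeasure_space_1 by simp
  qed
  {
    case 0
    then show ?case unfolding split using reset[of 0] by simp
  next
    case (Suc t)
    show ?case
    proof (cases "Suc t mod S = 0")
      case True
      then show ?thesis unfolding split using reset[OF True] by simp
    next
      case False
      then have md: "Suc t mod S = Suc (t mod S)" using mod_Suc[of t S] by (cases "Suc (t mod S) = S") simp_all
      define C where "C = exp (r\<^sup>2 / 2 * A1)"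
      have C: "C \<ge> 1" using A by (simp add: C_def)
      have "(\<integral>\<^sup>+ w. ennreal (cosh (r * norm (err (Suc t) w (st \<omega> (Suc t))))) \<partial>W)
        \<le> ennreal C * ennreal (cosh (r * norm (err t (\<omega> t) (st \<omega> t))))" for \<omega>
      proof (cases "st_tag (st \<omega> (Suc t)) = 0")
        case True
        have "st_x (st \<omega> (Suc t)) = st_y (st \<omega> (Suc t)) + st_h (st \<omega> (Suc t))"
          using st_Suc_running[OF True] by simp
        from err_one_step[OF True r this, of "Suc t"] False show ?thesis
          by (simp add: err_Suc[OF True] C_def ennreal_mult[symmetric])
      next
        case False
        have "1 * 1 \<le> C * cosh (r * norm (err t (\<omega> t) (st \<omega> t)))" using C by (intro mult_mono cosh_real_ge_1) auto
        then show ?thesis using False W.emeasure_space_1 C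
          by (simp add: err_def ennreal_mult[symmetric] ennreal_leI[of 1, simplified])
      qed
      then have "(\<integral>\<^sup>+ \<omega>. (\<integral>\<^sup>+ w. ennreal (cosh (r * norm (err (Suc t) w (st \<omega> (Suc t))))) \<partial>W) \<partial>?D)
        \<le> (\<integral>\<^sup>+ \<omega>. ennreal C * ennreal (cosh (r * norm (err t (\<omega> t) (st \<omega> t)))) \<partial>?D)"
        by (intro nn_integral_mono)
      also have "\<dots> = ennreal C * (\<integral>\<^sup>+ \<omega>. ennreal (cosh (r * norm (err t (\<omega> t) (st \<omega> t)))) \<partial>?D)"
      proof (rule nn_integral_cmult)
        show "(\<lambda>\<omega>. ennreal (cosh (r * norm (err t (\<omega> t) (st \<omega> t))))) \<in> borel_measurable ?D"
          using measurable_compose[OF measurable_Pair[OF measurable_draw measurable_st] cm[of t]] by simp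
      qed
      also have "\<dots> \<le> ennreal C * ennreal (exp (r\<^sup>2 / 2 * (A0 + real (t mod S) * A1)))"
        by (intro mult_left_mono Suc) simp
      also have "\<dots> = ennreal (exp (r\<^sup>2 / 2 * (A0 + real (Suc t mod S) * A1)))"
        unfolding md C_def by (simp add: ennreal_mult[symmetric] exp_add[symmetric] algebra_simps)
      finally show ?thesis unfolding split .
    qed
  }
qed

lemma err_tail:
  "emeasure (draws_measure n) {\<omega>. \<epsilon> / 10 \<le> norm (err t (\<omega> t) (st \<omega> t))} \<le> ennreal \<delta>"
proof -
  let ?D = "draws_measure n :: (nat \<Rightarrow> 'd draws) measure"
  \<comment> \<open>The minimiser of the Chernoff exponent: the threshold
    \<open>\<epsilon> / 10\<close> divided by the total variance proxy
    \<open>5 * \<epsilon>\<^sup>2 / (2640 * lg\<^sup>2)\<close>.\<close>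
  define r where "r = 528 / 10 * lg\<^sup>2 / \<epsilon>"
  have r: "r > 0" using lg \<epsilon> by (simp add: r_def)
  let ?u = "\<lambda>\<omega>. cosh (r * norm (err t (\<omega> t) (st \<omega> t)))"
  have m: "(\<lambda>\<omega>. ennreal (?u \<omega>)) \<in> borel_measurable ?D"
  proof -
    have cont: "continuous_on UNIV (\<lambda>x :: real ^ 'd. cosh (r * norm x))"
      unfolding cosh_field_def by (intro continuous_intros) auto
    have "(\<lambda>\<omega>. err t (\<omega> t) (st \<omega> t)) \<in> borel_measurable ?D"
      using measurable_compose[OF measurable_Pair[OF measurable_draw measurable_st] measurable_err] by simp
    from measurable_compose[OF this borel_measurable_continuous_onI[OF cont]] show ?thesis by simp
  qed
  define c where "c = cosh (r * (\<epsilon> / 10))"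
  have c: "c > 0" by (simp add: c_def)
  have "emeasure ?D {\<omega>. \<epsilon> / 10 \<le> norm (err t (\<omega> t) (st \<omega> t))}
    \<le> emeasure ?D {\<omega> \<in> space ?D. 1 \<le> ennreal (1 / c) * ennreal (?u \<omega>)}"
  proof (rule emeasure_mono)
    show "{\<omega>. \<epsilon> / 10 \<le> norm (err t (\<omega> t) (st \<omega> t))} \<subseteq> {\<omega> \<in> space ?D. 1 \<le> ennreal (1 / c) * ennreal (?u \<omega>)}"
    proof
      fix \<omega> assume "\<omega> \<in> {\<omega>. \<epsilon> / 10 \<le> norm (err t (\<omega> t) (st \<omega> t))}"
      then have "r * (\<epsilon> / 10) \<le> r * norm (err t (\<omega> t) (st \<omega> t))" using r by simp
      then have "c \<le> ?u \<omega>" unfolding c_def using r \<epsilon> by (subst cosh_real_nonneg_le_iff) auto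
      then have "1 \<le> 1 / c * ?u \<omega>" using c by simp
      then show "\<omega> \<in> {\<omega> \<in> space ?D. 1 \<le> ennreal (1 / c) * ennreal (?u \<omega>)}"
        using c by (simp add: ennreal_mult[symmetric] ennreal_leI[of 1, simplified])
    qed
    show "{\<omega> \<in> space ?D. 1 \<le> ennreal (1 / c) * ennreal (?u \<omega>)} \<in> sets ?D" using m by measurable
  qed
  also have "\<dots> \<le> ennreal (1 / c) * (\<integral>\<^sup>+ \<omega>. ennreal (?u \<omega>) * indicator (space ?D) \<omega> \<partial>?D)"
    by (rule nn_integral_Markov_inequality) (use m sets.top[of ?D] in auto)
  also have "\<dots> = ennreal (1 / c) * (\<integral>\<^sup>+ \<omega>. ennreal (?u \<omega>) \<partial>?D)" by simp
  also have "\<dots> \<le> ennreal (1 / c) * ennreal (exp (r\<^sup>2 / 2 * (A0 + real (t mod S) * A1)))"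
    using r by (intro mult_left_mono err_potential) auto
  also have "\<dots> = ennreal (exp (r\<^sup>2 / 2 * (A0 + real (t mod S) * A1)) / c)"
    using c by (simp add: ennreal_mult[symmetric])
  also have "\<dots> \<le> ennreal \<delta>"
  proof (rule ennreal_leI)
    have A1: "A1 \<ge> 0" by (simp add: A1_def)
    have "real (t mod S) * A1 \<le> real S * A1"
      using S1 A1 by (intro mult_right_mono) (auto simp: less_imp_le)
    also have "\<dots> = 4 * \<epsilon>\<^sup>2 / (2640 * lg\<^sup>2)" using S1 by (simp add: A1_def)
    finally have "A0 + real (t mod S) * A1 \<le> 5 * (\<epsilon>\<^sup>2 / (2640 * lg\<^sup>2))" by (simp add: A0_def)
    then have "r\<^sup>2 / 2 * (A0 + real (t mod S) * A1) \<le> r\<^sup>2 / 2 * (5 * (\<epsilon>\<^sup>2 / (2640 * lg\<^sup>2)))"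
      by (intro mult_left_mono) auto
    also have "\<dots> = 264 / 100 * lg\<^sup>2"
      using lg \<epsilon> by (simp add: r_def power_divide power_mult_distrib) (simp add: power2_eq_square power4_eq_xxxx field_simps)
    finally have 1: "exp (r\<^sup>2 / 2 * (A0 + real (t mod S) * A1)) \<le> exp (264 / 100 * lg\<^sup>2)" by simp
    have re: "r * (\<epsilon> / 10) = 528 / 100 * lg\<^sup>2" using \<epsilon> by (simp add: r_def)
    have "2 * c = exp (528 / 100 * lg\<^sup>2) + exp (- (528 / 100 * lg\<^sup>2))"
      unfolding c_def re cosh_field_def by simp
    then have "exp (528 / 100 * lg\<^sup>2) \<le> 2 * c" by simp
    then have 2: "1 / c \<le> 2 * exp (- (528 / 100 * lg\<^sup>2))" using c by (simp add: exp_minus field_simps)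
    have "exp (r\<^sup>2 / 2 * (A0 + real (t mod S) * A1)) * (1 / c) \<le> exp (264 / 100 * lg\<^sup>2) * (2 * exp (- (528 / 100 * lg\<^sup>2)))"
      by (rule mult_mono[OF 1 2]) (use c in auto)
    also have "\<dots> = 2 * exp (- (264 / 100 * lg\<^sup>2))" by (simp add: exp_add[symmetric])
    also have "\<dots> \<le> exp 1 * exp (- (264 / 100 * lg\<^sup>2))"
      using exp_ge_add_one_self[of 1] by (intro mult_right_mono) auto
    also have "\<dots> = exp (1 - 264 / 100 * lg\<^sup>2)" by (simp add: exp_add[symmetric])
    also have "\<dots> \<le> exp (- lg)"
    proof -
      have "lg * 1 \<le> lg\<^sup>2" unfolding power2_eq_square using lg by (intro mult_left_mono) auto
      then show ?thesis using lg by simp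
    qed
    finally show "exp (r\<^sup>2 / 2 * (A0 + real (t mod S) * A1)) / c \<le> \<delta>" by (simp add: exp_lg)
  qed
  finally show ?thesis .
qed


section \<open>Failure events of a single iteration\<close>

lemma event_tail:
  assumes Q: "{z. Q (fst z) (snd z)} \<in> sets WS" and p: "\<And>s. emeasure W {w. Q w s} \<le> p"
  shows "{\<omega>. Q (\<omega> t) (st \<omega> t)} \<in> sets (draws_measure n)"
    and "emeasure (draws_measure n) {\<omega>. Q (\<omega> t) (st \<omega> t)} \<le> p"
proof -
  let ?D = "draws_measure n :: (nat \<Rightarrow> 'd draws) measure"
  interpret D: prob_space ?D by (rule prob_space_draws_measure)
  have pm: "(\<lambda>\<omega>. (\<omega> t, st \<omega> t)) \<in> ?D \<rightarrow>\<^sub>M WS" by (rule measurable_Pair[OF measurable_draw measurable_st])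
  from measurable_sets[OF pm Q] show ms: "{\<omega>. Q (\<omega> t) (st \<omega> t)} \<in> sets ?D"
    by (simp add: vimage_def)
  have sec: "{w. Q w s} \<in> sets W" for s
  proof -
    have "(\<lambda>w. (w, s)) \<in> W \<rightarrow>\<^sub>M WS" by (intro measurable_Pair measurable_ident measurable_const) simp_all
    from measurable_sets[OF this Q] show ?thesis by (simp add: vimage_def)
  qed
  have "emeasure ?D {\<omega>. Q (\<omega> t) (st \<omega> t)} = (\<integral>\<^sup>+ \<omega>. indicator {\<omega>. Q (\<omega> t) (st \<omega> t)} \<omega> \<partial>?D)"
    by (rule nn_integral_indicator[OF ms, symmetric])
  also have "\<dots> = (\<integral>\<^sup>+ \<omega>. indicator {z. Q (fst z) (snd z)} (\<omega> t, st \<omega> t) \<partial>?D)"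
    by (intro nn_integral_cong) (simp add: indicator_def)
  \<comment> \<open>The fresh draw is integrated with the state frozen; \<open>p\<close> bounds the
    inner integral for every state.\<close>
  also have "\<dots> = (\<integral>\<^sup>+ \<omega>. (\<integral>\<^sup>+ w. indicator {z. Q (fst z) (snd z)} (w, st \<omega> t) \<partial>W) \<partial>?D)"
    by (rule nn_integral_draws_step[OF measurable_st]) (use Q in \<open>simp_all add: st_past case_prod_beta\<close>)
  also have "\<dots> = (\<integral>\<^sup>+ \<omega>. emeasure W {w. Q w (st \<omega> t)} \<partial>?D)"
    by (intro nn_integral_cong, subst nn_integral_indicator[OF sec, symmetric], intro nn_integral_cong)
      (simp add: indicator_def)
  also have "\<dots> \<le> (\<integral>\<^sup>+ \<omega>. p \<partial>?D)" by (intro nn_integral_mono p)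
  also have "\<dots> = p" using D.emeasure_space_1 by simp
  finally show "emeasure ?D {\<omega>. Q (\<omega> t) (st \<omega> t)} \<le> p" .
qed

text \<open>A strict inequality for some vector instead of a bound on \<open>spectral_norm\<close>:
  as a union of open conditions the event is Borel although the quantifier ranges over an
  uncountable set. The quantifier in \<open>sub_bad\<close> is handled alike.\<close>

definition "hess_bad t (w :: 'd draws) s \<longleftrightarrow> (\<exists>u. sqrt (\<rho> * \<epsilon>) / 7 * norm u < norm ((Ut t w s - hess F (st_x s)) *v u))"
definition "sub_bad t w s \<longleftrightarrow> - (\<tau> * \<zeta> ^ 3 / 24) < cubic (Ut t w s) (vt t w s) \<tau> (fst (sub t w s))
  \<and> (\<exists>y. cubic (Ut t w s) (vt t w s) \<tau> y < - (\<tau> * \<zeta> ^ 3 / 12))"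
text \<open>A null event, listed so that outside the bad set the sampled Hessians are symmetric and
  bounded by \<open>L\<close> without exception.\<close>

definition "index_bad (w :: 'd draws) \<longleftrightarrow> (\<exists>k. fst (snd w) k \<notin> {1..n})"

lemma hess_bad_sets: "{z. hess_bad t (fst z) (snd z)} \<in> sets WS"
proof -
  let ?O = "{A :: real ^ 'd ^ 'd. \<exists>u. sqrt (\<rho> * \<epsilon>) / 7 * norm u < norm (A *v u)}"
  have "?O = (\<Union>u. {A. sqrt (\<rho> * \<epsilon>) / 7 * norm u < norm (A *v u)})" by auto
  moreover have "open {A :: real ^ 'd ^ 'd. sqrt (\<rho> * \<epsilon>) / 7 * norm u < norm (A *v u)}" for u
  proof -
    have "continuous_on UNIV (\<lambda>A :: real ^ 'd ^ 'd. A *v u)"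
      unfolding matrix_vector_mult_def by (intro continuous_on_vec_lambda continuous_intros continuous_on_component)
    then show ?thesis by (intro open_Collect_less continuous_intros)
  qed
  ultimately have O: "?O \<in> sets borel" by (intro borel_open) auto
  have "(\<lambda>z. hess F (st_x (snd z))) \<in> borel_measurable WS"
    by (rule measurable_compose[OF _ hess_borel_measurable]) measurable
  then have "(\<lambda>z. Ut t (fst z) (snd z) - hess F (st_x (snd z))) \<in> borel_measurable WS"
    by (intro borel_measurable_diff measurable_Ut)
  from measurable_sets[OF this O] show ?thesis by (simp add: vimage_def hess_bad_def space_pair_measure)
qed

lemma sub_bad_sets: "{z. sub_bad t (fst z) (snd z)} \<in> sets WS"
proof -
  let ?O = "{p :: (real ^ 'd ^ 'd) \<times> (real ^ 'd). \<exists>y. cubic (fst p) (snd p) \<tau> y < - (\<tau> * \<zeta> ^ 3 / 12)}"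
  have "?O = (\<Union>y. {p. cubic (fst p) (snd p) \<tau> y < - (\<tau> * \<zeta> ^ 3 / 12)})" by auto
  moreover have "open {p :: (real ^ 'd ^ 'd) \<times> (real ^ 'd). cubic (fst p) (snd p) \<tau> y < - (\<tau> * \<zeta> ^ 3 / 12)}" for y
  proof -
    have "continuous_on UNIV (\<lambda>p :: (real ^ 'd ^ 'd) \<times> (real ^ 'd). fst p *v y)"
      unfolding matrix_vector_mult_def by (intro continuous_on_vec_lambda continuous_intros continuous_on_component)
    then show ?thesis unfolding cubic_def by (intro open_Collect_less continuous_intros) auto
  qed
  ultimately have O: "?O \<in> sets borel" by (intro borel_open) auto
  have "(\<lambda>z. (Ut t (fst z) (snd z), vt t (fst z) (snd z))) \<in> WS \<rightarrow>\<^sub>M borel"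
    by (intro borel_measurable_Pair measurable_Ut measurable_vt)
  from measurable_sets[OF this O]
  have 1: "{z. \<exists>y. cubic (Ut t (fst z) (snd z)) (vt t (fst z) (snd z)) \<tau> y < - (\<tau> * \<zeta> ^ 3 / 12)} \<in> sets WS"
    by (simp add: vimage_def space_pair_measure)
  have [measurable]: "(\<lambda>z. cubic (Ut t (fst z) (snd z)) (vt t (fst z) (snd z)) \<tau> (fst (sub t (fst z) (snd z)))) \<in> borel_measurable WS"
    by (rule measurable_sub_value)
  have "{z \<in> space WS. - (\<tau> * \<zeta> ^ 3 / 24) < cubic (Ut t (fst z) (snd z)) (vt t (fst z) (snd z)) \<tau> (fst (sub t (fst z) (snd z)))} \<in> sets WS"
    by measurable
  from sets.Int[OF this 1] show ?thesis
    by (simp add: sub_bad_def space_pair_measure Collect_conj_eq[symmetric])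
qed

lemma err_bad_sets: "{z. \<epsilon> / 10 \<le> norm (err t (fst z) (snd z))} \<in> sets WS"
proof -
  have [measurable]: "(\<lambda>z. err t (fst z) (snd z)) \<in> borel_measurable WS" by (rule measurable_err)
  have "{z \<in> space WS. \<epsilon> / 10 \<le> norm (err t (fst z) (snd z))} \<in> sets WS" by measurable
  then show ?thesis by (simp add: space_pair_measure)
qed

lemma index_bad_sets: "{z. index_bad (fst z)} \<in> sets WS"
proof -
  have "{z \<in> space WS. fst (snd (fst z)) k \<notin> {1..n}} \<in> sets WS" for k
  proof -
    have "(\<lambda>z. fst (snd (fst z)) k) \<in> WS \<rightarrow>\<^sub>M count_space UNIV"
      by (rule measurable_compose[OF measurable_draws(2) measurable_index_component])
    from measurable_sets[OF this, of "- {1..n}"] show ?thesis by (simp add: vimage_def space_pair_measure Compl_eq)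
  qed
  then have "(\<Union>k. {z \<in> space WS. fst (snd (fst z)) k \<notin> {1..n}}) \<in> sets WS" by (intro sets.countable_UN) auto
  moreover have "(\<Union>k. {z \<in> space WS. fst (snd (fst z)) k \<notin> {1..n}}) = {z. index_bad (fst z)}"
    by (auto simp: index_bad_def space_pair_measure)
  ultimately show ?thesis by (simp only:)
qed

lemma emeasure_draw_le:
  assumes Q: "{w. Q w} \<in> sets W"
    and le: "\<And>j. AE i in index_seq_measure n. emeasure sphere_measure {q. Q (j, i, q)} \<le> p"
  shows "emeasure W {w. Q w} \<le> p"
proof -
  interpret I: prob_space "index_seq_measure n" by (rule prob_space_index_seq_measure)
  have m: "indicator {w. Q w} \<in> borel_measurable W" using Q by simp
  have sec: "{q. Q (j, i, q)} \<in> sets sphere_measure" for j i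
  proof -
    have "(\<lambda>q. (j, i, q)) \<in> sphere_measure \<rightarrow>\<^sub>M W"
      unfolding draw_measure_def by (intro measurable_Pair measurable_const measurable_ident) simp_all
    from measurable_sets[OF this Q] show ?thesis by (simp add: vimage_def)
  qed
  have "emeasure W {w. Q w} = (\<integral>\<^sup>+ w. indicator {w. Q w} w \<partial>W)" using Q by simp
  also have "\<dots> = (\<integral>\<^sup>+ j. (\<integral>\<^sup>+ i. (\<integral>\<^sup>+ q. indicator {w. Q w} (j, i, q) \<partial>sphere_measure) \<partial>index_seq_measure n) \<partial>index_seq_measure n)"
    by (rule nn_integral_draw_measure[OF m])
  also have "\<dots> = (\<integral>\<^sup>+ j. (\<integral>\<^sup>+ i. emeasure sphere_measure {q. Q (j, i, q)} \<partial>index_seq_measure n) \<partial>index_seq_measure n)"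
    by (intro nn_integral_cong, subst nn_integral_indicator[OF sec, symmetric], intro nn_integral_cong)
      (simp add: indicator_def)
  also have "\<dots> \<le> (\<integral>\<^sup>+ j. (\<integral>\<^sup>+ i. p \<partial>index_seq_measure n) \<partial>index_seq_measure n)"
    using le by (intro nn_integral_mono nn_integral_mono_AE)
  also have "\<dots> = p" using I.emeasure_space_1 by simp
  finally show ?thesis .
qed

lemma section_sets: "{z. Q (fst z) (snd z)} \<in> sets WS \<Longrightarrow> {w. Q w s} \<in> sets W"
proof -
  assume Q: "{z. Q (fst z) (snd z)} \<in> sets WS"
  have "(\<lambda>w. (w, s)) \<in> W \<rightarrow>\<^sub>M WS" by (intro measurable_Pair measurable_ident measurable_const) simp_all
  from measurable_sets[OF this Q] show ?thesis by (simp add: vimage_def)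
qed

lemma index_bad_tail: "emeasure W {w. index_bad w} \<le> 0"
proof (rule emeasure_draw_le)
  show "{w. index_bad w} \<in> sets W" by (rule section_sets[OF index_bad_sets])
  show "AE i in index_seq_measure n. emeasure sphere_measure {q. index_bad (j, i, q :: real ^ 'd)} \<le> 0" for j
    using AE_index_seq_measure[OF n] by eventually_elim (simp add: index_bad_def)
qed

lemma Ut_sym: "\<forall>k. fst (snd w) k \<in> {1..n} \<Longrightarrow> symmetric_matrix (Ut t w s)"
  unfolding Ut_def batch_hess_def sum_mset_index_sample F[symmetric]
  by (auto intro!: symmetric_matrix_scaleR symmetric_matrix_sum hess_f_sym F.hess_symmetric)

lemma Ut_bound: "\<forall>k. fst (snd w) k \<in> {1..n} \<Longrightarrow> norm (Ut t w s *v u) \<le> L * norm u"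
proof -
  assume r: "\<forall>k. fst (snd w) k \<in> {1..n}"
  let ?B = "Bh t"
  have B: "?B \<ge> 1" unfolding Bh by (rule round_up_pos)
  have "spectral_norm ((1 / real ?B) *\<^sub>R (\<Sum>k<?B. hess (f (fst (snd w) k)) (st_x s))) \<le> L"
  proof -
    have "spectral_norm ((1 / real ?B) *\<^sub>R (\<Sum>k<?B. hess (f (fst (snd w) k)) (st_x s)))
      \<le> (1 / real ?B) * (\<Sum>k<?B. spectral_norm (hess (f (fst (snd w) k)) (st_x s)))"
      by (intro order_trans[OF spectral_norm_scaleR_le] mult_left_mono spectral_norm_sum_le) auto
    also have "\<dots> \<le> (1 / real ?B) * (\<Sum>k<?B. L)"
      using r by (intro mult_left_mono sum_mono spectral_norm_le hess_f_bound) auto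
    finally show ?thesis using B by simp
  qed
  then have "norm (((1 / real ?B) *\<^sub>R (\<Sum>k<?B. hess (f (fst (snd w) k)) (st_x s))) *v u) \<le> L * norm u"
    using spectral_norm_apply mult_right_mono norm_ge_zero order_trans by meson
  then show ?thesis
    unfolding Ut_def batch_hess_def sum_mset_index_sample F[symmetric] using hess_F_bound by simp
qed

text \<open>The matrix and the vector of the model do not involve the third component of the draw,
  so \<open>j\<close> and \<open>i\<close> are frozen and only the perturbation is random.\<close>

lemma sub_bad_tail: "emeasure W {w. sub_bad t w s} \<le> ennreal \<delta>"
proof (rule emeasure_draw_le)
  show "{w. sub_bad t w s} \<in> sets W" by (rule section_sets[OF sub_bad_sets])
  fix j :: "nat \<Rightarrow> nat"
  show "AE i in index_seq_measure n. emeasure sphere_measure {q. sub_bad t (j, i, q) s} \<le> ennreal \<delta>"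
    using AE_index_seq_measure[OF n]
  proof eventually_elim
    fix i :: "nat \<Rightarrow> nat" assume i: "\<forall>k. i k \<in> {1..n}"
    define U where "U = Ut t (j, i, 0 :: real ^ 'd) s"
    define v where "v = vt t (j, i, 0 :: real ^ 'd) s"
    have UV: "Ut t (j, i, q) s = U" "vt t (j, i, q) s = v" for q :: "real ^ 'd" by (simp_all add: U_def v_def Ut_def vt_def)
    have U: "symmetric_matrix U" "\<And>u. norm (U *v u) \<le> L * norm u"
      unfolding U_def using i by (auto intro: Ut_sym Ut_bound)
    show "emeasure sphere_measure {q. sub_bad t (j, i, q) s} \<le> ennreal \<delta>"
    proof (cases "\<exists>y. cubic U v \<tau> y < - (\<tau> * \<zeta> ^ 3 / 12)")
      case True
      then obtain y where y: "cubic U v \<tau> y < - (\<tau> * \<zeta> ^ 3 / 12)" by blast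
      have "{q. sub_bad t (j, i, q) s} = {q. - (\<tau> * \<zeta> ^ 3 / 24)
          < cubic U v \<tau> (fst (cubic_subsolver U v \<tau> (1 / (16 * L)) \<zeta> (1 / 2) \<delta> L q))}"
        unfolding sub_bad_def sub_def UV using True by simp
      also have "emeasure sphere_measure \<dots> \<le> ennreal \<delta>"
        by (rule cubic_subsolver_failure_prob[OF U _ \<zeta> _ \<delta> y]) (use pos small in simp_all)
      finally show ?thesis .
    next
      case False
      then have "{q. sub_bad t (j, i, q) s} = {}" unfolding sub_bad_def UV by simp
      then show ?thesis by simp
    qed
  qed
qed

text \<open>The moment order \<open>p\<close> is \<open>lh\<close> rounded up. With summand
  differences \<open>2 * L\<close> the base of the tail bound is at most 1/3 as soon as
  \<open>588 * p \<le> 1200 * lh\<^sup>2\<close>, which follows from \<open>p \<le> 2 * lh\<close>.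
  Since 1/3 is below 1/e, the dimension times \<open>exp (- lh)\<close>, that is \<delta>,
  remains.\<close>

lemma hess_bad_tail: "emeasure W {w. hess_bad t w s} \<le> ennreal \<delta>"
proof (cases "Bh t < n")
  case False
  then have "{w :: 'd draws. hess_bad t w s} = {}"
    using pos \<epsilon> by (auto simp: hess_bad_def Ut_def batch_hess_def F[symmetric] not_less)
  then show ?thesis by (simp only: emeasure_empty) simp
next
  case True
  interpret Sp: prob_space "sphere_measure :: (real ^ 'd) measure" by (rule prob_space_sphere_measure)
  interpret I: prob_space "index_seq_measure n" by (rule prob_space_index_seq_measure)
  define B where "B = Bh t"
  have B1: "B \<ge> 1" unfolding B_def Bh by (rule round_up_pos)
  define Y where "Y i = hess (f i) (st_x s) - hess F (st_x s)" for i
  interpret matrix_sampling n Y "2 * L" B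
  proof
    show "(\<Sum>i=1..n. Y i) = 0" unfolding Y_def by (rule sum_hess_dev)
    show "i \<in> {1..n} \<Longrightarrow> symmetric_matrix (Y i)" for i
      unfolding Y_def by (intro symmetric_matrix_diff hess_f_sym F.hess_symmetric)
    show "norm ((Y i - Y k) *v v) \<le> 2 * L * norm v" if "i \<in> {1..n}" "k \<in> {1..n}" for i k v
    proof -
      have "(Y i - Y k) *v v = hess (f i) (st_x s) *v v - hess (f k) (st_x s) *v v"
        by (simp add: Y_def matrix_vector_mult_diff_rdistrib)
      also have "norm \<dots> \<le> L * norm v + L * norm v"
        by (intro order_trans[OF norm_triangle_ineq4] add_mono hess_f_bound that)
      finally show ?thesis by simp
    qed
  qed (rule n)
  define R where "R = real B * (sqrt (\<rho> * \<epsilon>) / 7)"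
  have \<rho>\<epsilon>: "\<rho> * \<epsilon> > 0" using pos \<epsilon> by simp
  have R: "R > 0" using B1 \<rho>\<epsilon> by (simp add: R_def)
  have eq: "hess_bad t (j, i, q) s \<longleftrightarrow> (\<exists>v. norm ((\<Sum>k<B. Y (i k)) *v v) > R * norm v)" for j i q
  proof -
    have "real B *\<^sub>R (Ut t (j, i, q) s - hess F (st_x s)) = (\<Sum>k<B. Y (i k))"
      using True B1 unfolding Ut_def batch_hess_def sum_mset_index_sample Y_def B_def[symmetric]
      by (simp add: sum_subtractf scaleR_diff_right sum_constant_scaleR del: sum_constant)
    then have "(\<Sum>k<B. Y (i k)) *v v = real B *\<^sub>R ((Ut t (j, i, q) s - hess F (st_x s)) *v v)" for v
      by (metis scaleR_matrix_vector_assoc)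
    then have "norm ((\<Sum>k<B. Y (i k)) *v v) = real B * norm ((Ut t (j, i, q) s - hess F (st_x s)) *v v)" for v
      by simp
    then show ?thesis using B1 by (simp add: hess_bad_def R_def mult.assoc)
  qed
  define p where "p = nat \<lceil>lh\<rceil>"
  have lh1: "lh \<ge> 1" using lg lh by simp
  have p: "lh \<le> real p" "real p \<le> 2 * lh" using lh1 unfolding p_def by linarith+
  have Bge: "1200 * L\<^sup>2 * lh\<^sup>2 / (\<rho> * \<epsilon>) \<le> real B"
    using True unfolding B_def Bh lh_def by (rule round_up_min_less)
  have ratio: "real p * (2 * L)\<^sup>2 * real B / R\<^sup>2 \<le> 1 / 3"
  proof -
    have "R\<^sup>2 = real B * real B * (\<rho> * \<epsilon>) / 49"
      using \<rho>\<epsilon> by (simp add: R_def power_mult_distrib power_divide power2_eq_square[of "real B"])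
    moreover have "real p * (2 * L)\<^sup>2 * real B * 3 \<le> real B * real B * (\<rho> * \<epsilon>) / 49"
    proof -
      have "1200 * L\<^sup>2 * lh\<^sup>2 \<le> real B * (\<rho> * \<epsilon>)" using Bge \<rho>\<epsilon> by (simp add: divide_le_eq)
      moreover have "real p * 1 \<le> 2 * lh * lh" using p(2) lh1 by (intro mult_mono) auto
      then have "L\<^sup>2 * (588 * real p) \<le> L\<^sup>2 * (1200 * lh\<^sup>2)"
        by (intro mult_left_mono) (auto simp: power2_eq_square)
      ultimately have "49 * (real p * (2 * L)\<^sup>2 * 3) \<le> real B * (\<rho> * \<epsilon>)"
        by (simp add: power_mult_distrib mult_ac)
      then have "real B * (49 * (real p * (2 * L)\<^sup>2 * 3)) \<le> real B * (real B * (\<rho> * \<epsilon>))" by (intro mult_left_mono) auto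
      then show ?thesis by (simp add: mult_ac)
    qed
    ultimately show ?thesis using R by (simp add: divide_le_eq mult_ac)
  qed
  have tail: "emeasure (index_seq_measure n) {i. \<exists>v. norm ((\<Sum>k<B. Y (i k)) *v v) > R * norm v} \<le> ennreal \<delta>"
  proof -
    have "(real p * (2 * L)\<^sup>2 * real B / R\<^sup>2) ^ p * real CARD('d) \<le> (1 / 3) ^ p * real CARD('d)"
      using ratio by (intro mult_right_mono power_mono) auto
    also have "(1 / 3 :: real) ^ p \<le> exp (-1) ^ p"
    proof (rule power_mono)
      have "1 / (3 :: real) \<le> 1 / exp 1" using exp_le by (intro divide_left_mono) auto
      then show "1 / (3 :: real) \<le> exp (-1)" by (simp add: exp_minus inverse_eq_divide)
    qed simp
    also have "exp (-1 :: real) ^ p = exp (- real p)" by (simp add: exp_of_nat_mult[symmetric])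
    also have "\<dots> \<le> exp (- lh)" using p by simp
    also have "exp (- lh) * real CARD('d) = \<delta>" using exp_lh by (simp add: mult.commute)
    finally have "(real p * (2 * L)\<^sup>2 * real B / R\<^sup>2) ^ p * real CARD('d) \<le> \<delta>" by simp
    then show ?thesis using order_trans[OF matrix_sampling_tail[OF R, of p] ennreal_leI] by blast
  qed
  have Q: "{w. hess_bad t w s} \<in> sets W" by (rule section_sets[OF hess_bad_sets])
  have sI: "{i. \<exists>v. norm ((\<Sum>k<B. Y (i k)) *v v) > R * norm v} \<in> sets (index_seq_measure n)"
  proof -
    have "(\<lambda>i. (undefined, i, undefined)) \<in> index_seq_measure n \<rightarrow>\<^sub>M W"
      unfolding draw_measure_def by (intro measurable_Pair measurable_const measurable_ident) simp_all
    from measurable_sets[OF this Q] show ?thesis by (simp add: vimage_def eq)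
  qed
  have m: "(indicator {w. hess_bad t w s} :: _ \<Rightarrow> ennreal) \<in> borel_measurable W" using Q by simp
  have "emeasure W {w. hess_bad t w s} = (\<integral>\<^sup>+ w. indicator {w. hess_bad t w s} w \<partial>W)" using Q by simp
  also have "\<dots> = (\<integral>\<^sup>+ j. (\<integral>\<^sup>+ i. (\<integral>\<^sup>+ q. indicator {w. hess_bad t w s} (j, i, q) \<partial>sphere_measure) \<partial>index_seq_measure n) \<partial>index_seq_measure n)"
    by (rule nn_integral_draw_measure[OF m])
  also have "\<dots> = (\<integral>\<^sup>+ j. (\<integral>\<^sup>+ i. indicator {i. \<exists>v. norm ((\<Sum>k<B. Y (i k)) *v v) > R * norm v} i \<partial>index_seq_measure n) \<partial>index_seq_measure n)"
    using Sp.emeasure_space_1 by (intro nn_integral_cong) (simp add: indicator_def eq)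
  also have "\<dots> \<le> (\<integral>\<^sup>+ j. ennreal \<delta> \<partial>index_seq_measure n)"
    using tail sI by (intro nn_integral_mono) simp
  also have "\<dots> = ennreal \<delta>" using I.emeasure_space_1 by simp
  finally show ?thesis .
qed

definition "bad t w s \<longleftrightarrow> \<epsilon> / 10 \<le> norm (err t w s) \<or> hess_bad t w s \<or> sub_bad t w s \<or> index_bad w"

theorem bad_prob:
  "{\<omega>. \<exists>t<T. bad t (\<omega> t) (st \<omega> t)} \<in> sets (draws_measure n)"
  "measure (draws_measure n) {\<omega>. \<exists>t<T. bad t (\<omega> t) (st \<omega> t)} \<le> \<xi>"
proof -
  let ?D = "draws_measure n :: (nat \<Rightarrow> 'd draws) measure"
  interpret D: prob_space ?D by (rule prob_space_draws_measure)
  let ?E = "\<lambda>t. {\<omega>. \<epsilon> / 10 \<le> norm (err t (\<omega> t) (st \<omega> t))}"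
  let ?H = "\<lambda>t. {\<omega>. hess_bad t (\<omega> t) (st \<omega> t)}"
  let ?S = "\<lambda>t. {\<omega>. sub_bad t (\<omega> t) (st \<omega> t)}"
  let ?I = "\<lambda>t. {\<omega>. index_bad (\<omega> t)}"
  have E: "?E t \<in> sets ?D" for t
    by (rule event_tail(1)[OF err_bad_sets, of t top]) simp
  note H = event_tail[OF hess_bad_sets hess_bad_tail]
  note Sb = event_tail[OF sub_bad_sets sub_bad_tail]
  note Ib = event_tail[of "\<lambda>w s. index_bad w", OF index_bad_sets index_bad_tail]
  have eq: "{\<omega>. \<exists>t<T. bad t (\<omega> t) (st \<omega> t)} = (\<Union>t<T. ?E t \<union> ?H t \<union> ?S t \<union> ?I t)"
    by (auto simp: bad_def)
  have ms: "?E t \<union> ?H t \<union> ?S t \<union> ?I t \<in> sets ?D" for t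
    by (intro sets.Un E H(1) Sb(1) Ib(1))
  show "{\<omega>. \<exists>t<T. bad t (\<omega> t) (st \<omega> t)} \<in> sets ?D" unfolding eq using ms by (intro sets.finite_UN) auto
  have one: "emeasure ?D (?E t \<union> ?H t \<union> ?S t \<union> ?I t) \<le> ennreal (3 * \<delta>)" for t
  proof -
    have "emeasure ?D (?E t \<union> ?H t \<union> ?S t \<union> ?I t)
      \<le> emeasure ?D (?E t) + emeasure ?D (?H t) + emeasure ?D (?S t) + emeasure ?D (?I t)"
      by (intro order_trans[OF emeasure_subadditive] add_mono order_refl sets.Un E H(1) Sb(1) Ib(1))
    also have "\<dots> \<le> ennreal \<delta> + ennreal \<delta> + ennreal \<delta> + 0"
      by (intro add_mono err_tail H(2) Sb(2) Ib(2))
    also have "\<dots> = ennreal (3 * \<delta>)" using \<delta> by (simp add: ennreal_plus[symmetric] del: ennreal_plus)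
    finally show ?thesis .
  qed
  have "emeasure ?D (\<Union>t<T. ?E t \<union> ?H t \<union> ?S t \<union> ?I t)
    \<le> (\<Sum>t<T. emeasure ?D (?E t \<union> ?H t \<union> ?S t \<union> ?I t))"
    using ms by (intro emeasure_subadditive_finite) auto
  also have "\<dots> \<le> (\<Sum>t<T. ennreal (3 * \<delta>))" by (intro sum_mono one)
  also have "\<dots> = ennreal (real T * (3 * \<delta>))"
    using \<delta> by (simp add: ennreal_of_nat_eq_real_of_nat ennreal_mult[symmetric])
  also have "real T * (3 * \<delta>) = \<xi>" using T1 by (simp add: \<delta>_def)
  finally have "emeasure ?D {\<omega>. \<exists>t<T. bad t (\<omega> t) (st \<omega> t)} \<le> ennreal \<xi>" unfolding eq .
  then show "measure ?D {\<omega>. \<exists>t<T. bad t (\<omega> t) (st \<omega> t)} \<le> \<xi>"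
    using \<xi> by (simp add: D.emeasure_eq_measure)
qed

end

section \<open>Descent, stopping and cost\<close>

text \<open>For a step of length \<open>p * \<zeta>\<close>, in units of decrease, the gradient
  error is \<open>p / 10\<close> and the Hessian error \<open>p\<^sup>2 / 14\<close>. A quarter of
  the cube and 7/60 = 1/6 - 1/20 are available to pay for them.\<close>

lemma decrease_arith:
  fixes p :: real assumes "p \<ge> 0"
  shows "p / 10 + p\<^sup>2 / 14 \<le> p ^ 3 / 4 + 7 / 60"
proof -
  have "0 \<le> p * (p - 1 / 2)\<^sup>2" using assms by simp
  then have 1: "p\<^sup>2 - p / 4 \<le> p ^ 3" by (simp add: power2_eq_square power3_eq_cube algebra_simps)
  have "0 \<le> (p - 1 / 2)\<^sup>2" by simp
  then have 2: "p - 1 / 4 \<le> p\<^sup>2" by (simp add: power2_eq_square algebra_simps)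
  show ?thesis using 1 2 assms by linarith
qed

text \<open>The decrease controls cubes of step lengths, whereas batch sizes grow with their
  squares: short steps are covered by the constant, long ones by the cube.\<close>

lemma square_le_cube_div:
  fixes a z :: real assumes "a \<ge> 0" "z > 0"
  shows "a\<^sup>2 \<le> z\<^sup>2 + a ^ 3 / z"
proof (cases "a \<le> z")
  case True
  then have "a\<^sup>2 \<le> z\<^sup>2" using assms by (intro power_mono) auto
  then show ?thesis using assms by (simp add: add_increasing2)
next
  case False
  then have "a\<^sup>2 * z \<le> a ^ 3" using assms by (simp add: power2_eq_square power3_eq_cube mult_left_mono)
  then have "a\<^sup>2 \<le> a ^ 3 / z" using assms by (simp add: le_divide_eq)
  then show ?thesis by (simp add: add_increasing)
qed

lemma round_up_le: "0 \<le> r \<Longrightarrow> real (round_up r) \<le> r + 1"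
  unfolding round_up_def by (simp add: max_def)

lemma min_scale_le:
  fixes a c y :: real assumes "a \<ge> 0" "c \<ge> 1"
  shows "min a (c * y) \<le> c * min a y"
proof (cases "a \<le> y")
  case True
  then show ?thesis using assms mult_right_mono[of 1 c a] by (simp add: min_absorb1)
next
  case False
  then show ?thesis by (simp add: min_absorb2)
qed

section \<open>Dimensionless parameters and their estimates\<close>

context srvrc
begin

text \<open>\<open>q\<close> is the ratio of \<open>L\<close> to the curvature tolerance and
  \<open>P\<close> the initial gap in units of decrease. The cost is estimated in such quantities
  and translated back in \<open>cost_terms\<close>.\<close>

definition "q = L / (\<rho> * \<zeta>)"
definition "P = \<Delta>F / (\<rho> * \<zeta> ^ 3)"
definition "Nm = min (real n) (M\<^sup>2 / \<epsilon>\<^sup>2)"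
definition "Hm = min (real n) (L\<^sup>2 / (\<rho> * \<epsilon>))"
definition "\<Lambda> = log_factor T CARD('d) \<xi> L \<rho> \<epsilon>"
definition "K = subsolver_steps CARD('d) \<tau> \<zeta> L \<delta>"

lemma q2: "q > 2" using small pos \<zeta> by (simp add: q_def less_divide_eq)

lemma P0: "P > 0" using pos \<zeta> by (simp add: P_def)

definition "A = min (real n) (q * sqrt Nm)"

lemma q_sq: "L\<^sup>2 / (\<rho> * \<epsilon>) = q\<^sup>2"
proof -
  have "(\<rho> * \<zeta>)\<^sup>2 = \<rho> * (\<rho> * \<zeta>\<^sup>2)" by (simp add: power2_eq_square)
  then show ?thesis unfolding \<rho>\<zeta>2 by (simp add: q_def power_divide)
qed

lemma Hm1: "Hm \<ge> 1"
proof -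
  have "1 \<le> q\<^sup>2" using q2 by (simp add: one_le_power)
  then show ?thesis using n by (simp add: Hm_def q_sq)
qed

lemma Nm0: "Nm > 0" using n pos \<epsilon> by (simp add: Nm_def)

lemma A0: "A \<ge> 0" using q2 Nm0 by (simp add: A_def)

lemma \<Lambda>_eq: "\<Lambda> = lh + ln q"
  by (simp add: \<Lambda>_def log_factor_def lh_def q_def \<rho>\<zeta>)

lemma \<Lambda>: "\<Lambda> \<ge> 1" "lg \<le> \<Lambda>" "lh \<le> \<Lambda>" "ln q \<le> \<Lambda>"
proof -
  have "0 \<le> ln q" using q2 by simp
  then show "\<Lambda> \<ge> 1" "lg \<le> \<Lambda>" "lh \<le> \<Lambda>" "ln q \<le> \<Lambda>" using lg lh unfolding \<Lambda>_eq by auto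
qed

lemma d_over_\<delta>: "real CARD('d) / \<delta> = exp lh"
  using \<xi> T1 by (simp add: lh_def \<delta>_def)

text \<open>Since \<open>sqrt d / \<delta> \<le> exp lh\<close> for the dimension \<open>d\<close>,
  both logarithms in the iteration cap are linear in \<Lambda>. This is one of the three powers of
  \<Lambda> in the cost; the Hessian batch supplies the other two.\<close>

lemma K_le: "real K \<le> 1100000 * q * \<Lambda>"
proof -
  let ?r = "480 / (1 / (16 * L) * \<tau> * \<zeta> * (1 / 2)) * (6 * ln (1 + sqrt (real CARD('d)) / \<delta>) + 32 * ln (12 / (1 / (16 * L) * \<tau> * \<zeta> * (1 / 2))))"
  have e: "480 / (1 / (16 * L) * \<tau> * \<zeta> * (1 / 2)) = 3840 * q" "12 / (1 / (16 * L) * \<tau> * \<zeta> * (1 / 2)) = 96 * q"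
    by (simp_all add: q_def)
  have two: "(2 :: real) \<le> exp 1" using exp_ge_add_one_self[of 1] by simp
  have "(96 :: real) \<le> 2 ^ 7" by simp
  also have "\<dots> \<le> exp 1 ^ 7" using two by (intro power_mono) auto
  also have "\<dots> = exp (7 :: real)" by (simp flip: exp_of_nat_mult)
  finally have "ln 96 \<le> ln (exp (7 :: real))" by (subst ln_le_cancel_iff) auto
  then have "ln 96 \<le> (7 :: real)" by simp
  then have l1: "ln (96 * q) \<le> 8 * \<Lambda>" using q2 \<Lambda> by (simp add: ln_mult_pos)
  have "sqrt (real CARD('d)) \<le> real CARD('d)" by (intro real_le_lsqrt) (auto simp: power2_eq_square)
  then have "sqrt (real CARD('d)) / \<delta> \<le> exp lh"
    unfolding d_over_\<delta>[symmetric] using \<delta> by (simp add: divide_right_mono)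
  moreover have "1 \<le> exp lh" using lg lh by simp
  ultimately have "1 + sqrt (real CARD('d)) / \<delta> \<le> 2 * exp lh" by linarith
  also have "\<dots> \<le> exp 1 * exp \<Lambda>" using two \<Lambda> by (intro mult_mono) auto
  also have "\<dots> = exp (1 + \<Lambda>)" by (simp add: exp_add)
  finally have "ln (1 + sqrt (real CARD('d)) / \<delta>) \<le> ln (exp (1 + \<Lambda>))"
    using \<delta> by (subst ln_le_cancel_iff) (auto intro: add_pos_nonneg)
  then have "ln (1 + sqrt (real CARD('d)) / \<delta>) \<le> 1 + \<Lambda>" by simp
  then have "6 * ln (1 + sqrt (real CARD('d)) / \<delta>) + 32 * ln (96 * q) \<le> 268 * \<Lambda>" using l1 \<Lambda>(1) by linarith
  then have r: "?r \<le> 3840 * q * (268 * \<Lambda>)" unfolding e using q2 by (intro mult_left_mono) auto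
  have "0 \<le> ln (1 + sqrt (real CARD('d)) / \<delta>)" "0 \<le> ln (96 * q)" using \<delta> q2 by auto
  then have "0 \<le> ?r" unfolding e using q2 by simp
  then have "real K \<le> ?r + 1" unfolding K_def subsolver_steps_def by (rule round_up_le)
  moreover have "1 \<le> q * \<Lambda>" using q2 \<Lambda>(1) mult_mono[of 1 q 1 \<Lambda>] by simp
  ultimately show ?thesis using r by linarith
qed

lemma \<Lambda>2: "lg\<^sup>2 \<le> \<Lambda>\<^sup>2" "lh\<^sup>2 \<le> \<Lambda>\<^sup>2" "1 \<le> \<Lambda>\<^sup>2"
  using \<Lambda> lg lh by (auto intro: power_mono one_le_power)

lemma Bh_le: "real (Bh k) \<le> 1300 * \<Lambda>\<^sup>2 * Hm"
proof -
  define y where "y = L\<^sup>2 / (\<rho> * \<epsilon>)"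
  have y: "y \<ge> 0" using pos \<epsilon> by (simp add: y_def)
  have "1200 * L\<^sup>2 * lh\<^sup>2 / (\<rho> * \<epsilon>) = 1200 * lh\<^sup>2 * y" by (simp add: y_def)
  then have "Bh k = round_up (min (real n) (1200 * lh\<^sup>2 * y))" by (simp add: Bh lh_def)
  then have "real (Bh k) \<le> min (real n) (1200 * lh\<^sup>2 * y) + 1"
    using y by (simp add: round_up_le)
  also have "min (real n) (1200 * lh\<^sup>2 * y) \<le> min (real n) (1200 * \<Lambda>\<^sup>2 * y)"
    using \<Lambda>2 y by (intro min.mono mult_right_mono) auto
  also have "\<dots> \<le> 1200 * \<Lambda>\<^sup>2 * Hm" unfolding Hm_def y_def[symmetric]
    using \<Lambda>2 by (intro min_scale_le) auto
  also have "1 \<le> \<Lambda>\<^sup>2 * Hm" using \<Lambda>2(3) Hm1 mult_mono[of 1 "\<Lambda>\<^sup>2" 1 Hm] by simp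
  finally have "real (Bh k) \<le> 1201 * (\<Lambda>\<^sup>2 * Hm)" by (simp add: mult.commute)
  moreover have "0 \<le> \<Lambda>\<^sup>2 * Hm" using Hm1 by simp
  ultimately show ?thesis by linarith
qed

text \<open>If rounding \<open>sqrt Nm / q\<close> up gives at least 2, the quotient exceeds 1 and
  rounding at most doubles it. For \<open>S = 1\<close> every iteration is a reset and no ordinary
  batch has to be estimated.\<close>

lemma S_bounds: "sqrt Nm \<le> q * real S" "S \<ge> 2 \<Longrightarrow> q < sqrt Nm" "S \<ge> 2 \<Longrightarrow> q * real S \<le> 2 * sqrt Nm"
proof -
  have S_eq: "S = round_up (sqrt Nm / q)"
    unfolding S Nm_def[symmetric] q_def \<rho>\<zeta> by (simp add: mult.commute)
  have "sqrt Nm / q \<le> real S" unfolding S_eq by (rule round_up_ge)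
  then show "sqrt Nm \<le> q * real S" using q2 by (simp add: divide_le_eq mult.commute)
  show 1: "q < sqrt Nm" if "S \<ge> 2"
  proof (rule ccontr)
    assume "\<not> ?thesis"
    then have "sqrt Nm / q \<le> 1" using q2 by (simp add: divide_le_eq)
    then have "nat \<lceil>sqrt Nm / q\<rceil> \<le> 1" by (simp add: ceiling_le_iff)
    then have "S = 1" unfolding S_eq round_up_def by simp
    then show False using that by simp
  qed
  show "q * real S \<le> 2 * sqrt Nm" if "S \<ge> 2"
  proof -
    have "real S \<le> sqrt Nm / q + 1" unfolding S_eq using Nm0 q2 by (intro round_up_le) auto
    then have "q * real S \<le> q * (sqrt Nm / q + 1)" using q2 by (intro mult_left_mono) auto
    also have "\<dots> = sqrt Nm + q" using q2 by (simp add: distrib_left)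
    finally show ?thesis using 1[OF that] by simp
  qed
qed

lemma cube_scale: "\<rho> powr (1/2) * \<epsilon> powr (-3/2) = 1 / (\<rho> * \<zeta> ^ 3)"
proof -
  have "\<epsilon> powr (3/2) = \<epsilon> * sqrt \<epsilon>"
    using \<epsilon> powr_add[of \<epsilon> 1 "1/2"] by (simp add: powr_half_sqrt)
  moreover have "\<rho> * \<zeta> ^ 3 = (\<rho> * \<zeta>\<^sup>2) * \<zeta>" by (simp add: power2_eq_square power3_eq_cube)
  then have "\<rho> * \<zeta> ^ 3 = \<epsilon> * (sqrt \<epsilon> / sqrt \<rho>)"
    unfolding \<rho>\<zeta>2 by (simp add: \<zeta>_def real_sqrt_divide)
  ultimately show ?thesis
    using pos \<epsilon> by (simp add: powr_half_sqrt powr_minus_divide)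
qed

lemma T_ge: "25 * P \<le> real T"
proof -
  have "25 * \<Delta>F * \<rho> powr (1/2) * \<epsilon> powr (-3/2) = 25 * \<Delta>F * (\<rho> powr (1/2) * \<epsilon> powr (-3/2))" by simp
  also have "\<dots> = 25 * P" unfolding cube_scale by (simp add: P_def)
  finally show ?thesis unfolding T using round_up_ge by metis
qed

lemma st_stays: "st_tag (st \<omega> t) \<noteq> 0 \<Longrightarrow> t \<le> k \<Longrightarrow> st \<omega> k = st \<omega> t"
  by (induction k) (auto simp: st_Suc le_Suc_eq)

section \<open>Deterministic analysis on the good event\<close>

context
  fixes \<omega> :: "nat \<Rightarrow> 'd draws"
  assumes good: "\<And>t. t < T \<Longrightarrow> \<not> bad t (\<omega> t) (st \<omega> t)"
begin

definition "xs t = st_x (st \<omega> t)"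
definition "vs t = vt t (\<omega> t) (st \<omega> t)"
definition "Us t = Ut t (\<omega> t) (st \<omega> t)"
definition "hs t = fst (sub t (\<omega> t) (st \<omega> t))"

lemma good_grad: "t < T \<Longrightarrow> st_tag (st \<omega> t) = 0 \<Longrightarrow> norm (vs t - grad F (xs t)) \<le> \<epsilon> / 10"
  using good[of t] by (auto simp: bad_def err_def vs_def xs_def)

lemma good_hess: "t < T \<Longrightarrow> norm ((Us t - hess F (xs t)) *v u) \<le> \<rho> * \<zeta> / 7 * norm u"
  using good[of t] by (auto simp: bad_def hess_bad_def Us_def xs_def \<rho>\<zeta> not_less)

lemma good_index: "t < T \<Longrightarrow> \<forall>k. fst (snd (\<omega> t)) k \<in> {1..n}"
  using good[of t] by (auto simp: bad_def index_bad_def)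

lemma good_Us: assumes "t < T" shows "symmetric_matrix (Us t)" "norm (Us t *v u) \<le> L * norm u"
  unfolding Us_def using Ut_sym[OF good_index[OF assms]] Ut_bound[OF good_index[OF assms]] by auto

lemma good_sub:
  "t < T \<Longrightarrow> - (\<tau> * \<zeta> ^ 3 / 24) < cubic (Us t) (vs t) \<tau> (hs t) \<Longrightarrow> - (\<tau> * \<zeta> ^ 3 / 12) \<le> cubic (Us t) (vs t) \<tau> y"
  using good[of t] by (auto simp: bad_def sub_bad_def Us_def vs_def hs_def not_less)

text \<open>The model contains \<open>2 / 3\<close> of the scaled cube of the step and the Taylor
  bound spends \<open>1 / 6\<close>. Of the remaining half, one quarter absorbs the errors through
  \<open>decrease_arith\<close> and the other is kept.\<close>

lemma step_decrease:
  assumes t: "t < T" and tag: "st_tag (st \<omega> (Suc t)) = 0"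
  shows "F (xs (Suc t)) + \<rho> * \<zeta> ^ 3 / 20 + \<rho> / 4 * norm (hs t) ^ 3 \<le> F (xs t)"
proof -
  note r = st_Suc_running[OF tag]
  define x h v U p where "x = xs t" and "h = hs t" and "v = vs t" and "U = Us t" and "p = norm h / \<zeta>"
  have p: "p \<ge> 0" "norm h = p * \<zeta>" using \<zeta> by (simp_all add: p_def)
  have x': "xs (Suc t) = x + h" using r by (simp add: xs_def x_def h_def hs_def)
  have m: "v \<bullet> h + (h \<bullet> (U *v h)) / 2 + 4 * \<rho> / 6 * norm h ^ 3 \<le> - (\<rho> * \<zeta> ^ 3 / 6)"
    using r(6) by (simp add: cubic_def vs_def Us_def hs_def v_def U_def h_def)
  have 1: "F (x + h) \<le> F x + grad F x \<bullet> h + h \<bullet> (hess F x *v h) / 2 + \<rho> / 6 * norm h ^ 3" by (rule F.taylor)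
  have 2: "grad F x \<bullet> h \<le> v \<bullet> h + \<epsilon> / 10 * norm h"
  proof -
    have "(grad F x - v) \<bullet> h \<le> norm (grad F x - v) * norm h" by (rule norm_cauchy_schwarz)
    also have "\<dots> \<le> \<epsilon> / 10 * norm h"
      using good_grad[OF t r(1)] by (intro mult_right_mono) (simp_all add: x_def v_def norm_minus_commute)
    finally show ?thesis by (simp add: inner_diff_left)
  qed
  have 3: "h \<bullet> (hess F x *v h) \<le> h \<bullet> (U *v h) + \<rho> * \<zeta> / 7 * (norm h)\<^sup>2"
  proof -
    have "- (h \<bullet> ((U - hess F x) *v h)) \<le> norm h * norm ((U - hess F x) *v h)"
      using Cauchy_Schwarz_ineq2[of h "(U - hess F x) *v h"] by linarith
    also have "\<dots> \<le> norm h * (\<rho> * \<zeta> / 7 * norm h)"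
      unfolding U_def x_def by (intro mult_left_mono good_hess t) auto
    finally show ?thesis
      by (simp add: matrix_vector_mult_diff_rdistrib inner_diff_right power2_eq_square mult_ac)
  qed
  define R where "R = \<rho> * \<zeta> ^ 3"
  have R: "R > 0" using pos \<zeta> by (simp add: R_def)
  have "(\<rho> * \<zeta>\<^sup>2) / 10 * norm h = R * (p / 10)"
    unfolding p(2) R_def by (simp add: power2_eq_square power3_eq_cube)
  then have e1: "\<epsilon> / 10 * norm h = R * (p / 10)" unfolding \<rho>\<zeta>2 .
  have e2: "\<rho> * \<zeta> / 7 * (norm h)\<^sup>2 / 2 = R * (p\<^sup>2 / 14)"
    unfolding p(2) R_def by (simp add: power2_eq_square power3_eq_cube)
  have e3: "\<rho> * norm h ^ 3 = R * p ^ 3"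
    unfolding p(2) R_def by (simp add: power3_eq_cube)
  have "R * (p / 10 + p\<^sup>2 / 14) \<le> R * (p ^ 3 / 4 + 7 / 60)"
    using decrease_arith[OF p(1)] R by (intro mult_left_mono) auto
  then have e4: "R * (p / 10) + R * (p\<^sup>2 / 14) \<le> (R * p ^ 3) / 4 + 7 / 60 * R" by (simp add: distrib_left)
  have "F (x + h) + R / 20 + (R * p ^ 3) / 4 \<le> F x"
  proof -
    have combine: "c + R / 20 + Y / 4 \<le> a"
      if "c \<le> a + g + H / 2 + Y / 6" "g \<le> vh + E1" "H \<le> uh + 2 * E2" "vh + uh / 2 + 4 * Y / 6 \<le> - (R / 6)"
        "E1 + E2 \<le> Y / 4 + 7 / 60 * R" for a c g H vh uh E1 E2 Y :: real
      using that unfolding add_divide_distrib by linarith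
    show ?thesis
    proof (rule combine)
      show "F (x + h) \<le> F x + grad F x \<bullet> h + h \<bullet> (hess F x *v h) / 2 + (R * p ^ 3) / 6"
        using 1 unfolding e3[symmetric] by simp
      show "grad F x \<bullet> h \<le> v \<bullet> h + R * (p / 10)" using 2 unfolding e1 .
      show "h \<bullet> (hess F x *v h) \<le> h \<bullet> (U *v h) + 2 * (R * (p\<^sup>2 / 14))" using 3 e2 by linarith
      show "v \<bullet> h + h \<bullet> (U *v h) / 2 + 4 * (R * p ^ 3) / 6 \<le> - (R / 6)"
      proof -
        have "4 * \<rho> / 6 * norm h ^ 3 = 4 * (R * p ^ 3) / 6" unfolding e3[symmetric] by simp
        then show ?thesis using m unfolding R_def[symmetric] by linarith
      qed
    qed (rule e4)
  qed
  then have "F (x + h) + R / 20 + (\<rho> * norm h ^ 3) / 4 \<le> F x" unfolding e3 .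
  then show ?thesis unfolding x' by (simp add: x_def h_def R_def)
qed

lemma potential:
  assumes "t \<le> T" "st_tag (st \<omega> t) = 0"
  shows "F (xs t) + real t * (\<rho> * \<zeta> ^ 3 / 20) + \<rho> / 4 * (\<Sum>k<t. norm (hs k) ^ 3) \<le> F x0"
  using assms
proof (induction t)
  case 0
  then show ?case by (simp add: xs_def st_0)
next
  case (Suc t)
  have "st_tag (st \<omega> t) = 0" using st_Suc_running(1)[OF Suc.prems(2)] .
  then have "F (xs t) + real t * (\<rho> * \<zeta> ^ 3 / 20) + \<rho> / 4 * (\<Sum>k<t. norm (hs k) ^ 3) \<le> F x0"
    using Suc by simp
  moreover have "F (xs (Suc t)) + \<rho> * \<zeta> ^ 3 / 20 + \<rho> / 4 * norm (hs t) ^ 3 \<le> F (xs t)"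
    using step_decrease Suc.prems by simp
  moreover have "real (Suc t) * (\<rho> * \<zeta> ^ 3 / 20) = real t * (\<rho> * \<zeta> ^ 3 / 20) + \<rho> * \<zeta> ^ 3 / 20"
    by (simp only: of_nat_Suc distrib_right mult_1 add.commute)
  moreover have "\<rho> / 4 * (\<Sum>k<Suc t. norm (hs k) ^ 3) = \<rho> / 4 * (\<Sum>k<t. norm (hs k) ^ 3) + \<rho> / 4 * norm (hs t) ^ 3"
    by (simp only: sum.lessThan_Suc distrib_left)
  ultimately show ?case by linarith
qed

text \<open>The telescoped decrease is at most \<open>\<Delta>F\<close>, which bounds the number of
  steps by \<open>20 * P\<close> and the sum of cubes by \<open>4 * P * \<zeta> ^ 3\<close>; hence
  24 for the squares.\<close>

lemma running_bounds:
  assumes "t \<le> T" "st_tag (st \<omega> t) = 0"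
  shows "real t \<le> 20 * P" "(\<Sum>k<t. (norm (hs k))\<^sup>2) \<le> 24 * P * \<zeta>\<^sup>2"
proof -
  have "(INF x. F x) \<le> F (xs t)" using bounded_below by (intro cINF_lower) auto
  then have le: "real t * (\<rho> * \<zeta> ^ 3 / 20) + \<rho> / 4 * (\<Sum>k<t. norm (hs k) ^ 3) \<le> \<Delta>F"
    using potential[OF assms] gap by linarith
  have nn: "0 \<le> \<rho> / 4 * (\<Sum>k<t. norm (hs k) ^ 3)" using pos by (simp add: sum_nonneg)
  have c: "\<rho> * \<zeta> ^ 3 > 0" using pos \<zeta> by simp
  have "real t * (\<rho> * \<zeta> ^ 3) \<le> 20 * \<Delta>F" using le nn by simp
  then show tP: "real t \<le> 20 * P" using c by (simp add: P_def le_divide_eq)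
  have "0 \<le> real t * (\<rho> * \<zeta> ^ 3 / 20)" using c by simp
  then have "\<rho> * (\<Sum>k<t. norm (hs k) ^ 3) \<le> 4 * \<Delta>F" using le by simp
  also have "4 * \<Delta>F = \<rho> * (4 * P * \<zeta> ^ 3)" using c pos \<zeta> by (simp add: P_def)
  finally have s3: "(\<Sum>k<t. norm (hs k) ^ 3) \<le> 4 * P * \<zeta> ^ 3" using pos by simp
  have "(\<Sum>k<t. (norm (hs k))\<^sup>2) \<le> (\<Sum>k<t. \<zeta>\<^sup>2 + norm (hs k) ^ 3 / \<zeta>)"
    by (intro sum_mono square_le_cube_div \<zeta>) simp
  also have "\<dots> = real t * \<zeta>\<^sup>2 + (\<Sum>k<t. norm (hs k) ^ 3) / \<zeta>"
    by (simp add: sum.distrib sum_divide_distrib)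
  also have "\<dots> \<le> 20 * P * \<zeta>\<^sup>2 + 4 * P * \<zeta> ^ 3 / \<zeta>"
    using tP s3 \<zeta> by (intro add_mono mult_right_mono divide_right_mono) auto
  also have "\<dots> = 24 * P * \<zeta>\<^sup>2" using \<zeta> by (simp add: power2_eq_square power3_eq_cube)
  finally show "(\<Sum>k<t. (norm (hs k))\<^sup>2) \<le> 24 * P * \<zeta>\<^sup>2" .
qed

text \<open>Running through all \<open>T\<close> iterations, at least \<open>25 * P\<close> of them,
  would contradict the bound \<open>20 * P\<close>.\<close>

lemma stops: "\<exists>t<T. st_tag (st \<omega> t) = 0 \<and> st_tag (st \<omega> (Suc t)) \<noteq> 0"
proof (rule ccontr)
  assume no: "\<not> ?thesis"
  have "t \<le> T \<Longrightarrow> st_tag (st \<omega> t) = 0" for t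
  proof (induction t)
    case (Suc t)
    then have "t < T" "st_tag (st \<omega> t) = 0" by auto
    then show ?case using no by blast
  qed (simp add: st_0)
  from running_bounds(1)[OF order_refl this[OF order_refl]] show False using T_ge P0 by linarith
qed

context
  fixes t
  assumes t: "t < T" and run: "st_tag (st \<omega> t) = 0" and stop: "st_tag (st \<omega> (Suc t)) \<noteq> 0"
begin

lemma stop_value: "- (\<tau> * \<zeta> ^ 3 / 24) < cubic (Us t) (vs t) \<tau> (hs t)"
proof (rule ccontr)
  assume "\<not> ?thesis"
  then have "st_tag (st \<omega> (Suc t)) = 0"
    using run by (simp add: st_Suc next_def Us_def vs_def hs_def)
  then show False using stop by simp
qed

lemma stop_low: "- (\<tau> * \<zeta> ^ 3 / 12) \<le> cubic (Us t) (vs t) \<tau> y"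
  by (rule good_sub[OF t stop_value])

text \<open>At the stopping iteration the Cauchy point missed the threshold too, since the subsolver
  would have returned it. Hence the linear term is bounded, gradient descent is stable, and the
  lower bound on the model limits the number of final steps.\<close>

lemma stop_final:
  "\<exists>\<Delta> N. cubic_finalsolver (Us t) (vs t) \<tau> (1 / (16 * L)) \<epsilon> = Some (\<Delta>, 2 + 2 * N)
    \<and> norm (cubic_grad (Us t) (vs t) \<tau> \<Delta>) \<le> \<epsilon> \<and> vs t \<bullet> \<Delta> \<le> 0 \<and> real N \<le> 32 / 3 * q"
proof -
  obtain e l where eb: "eigenbasis (Us t) e l" using symmetric_matrix_eigenbasis[OF good_Us(1)[OF t]] by blast
  have T3: "\<tau> * \<zeta> ^ 3 > 0" using pos \<zeta> by simp
  have "- (\<tau> * \<zeta> ^ 3 / 24) < cubic (Us t) (vs t) \<tau> (cauchy_point (Us t) (vs t) \<tau>)"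
  proof (rule ccontr)
    assume low: "\<not> ?thesis"
    then have "hs t = cauchy_point (Us t) (vs t) \<tau>"
      unfolding hs_def sub_def Us_def vs_def cubic_subsolver_eq by (simp add: Let_def)
    then show False using stop_value low by simp
  qed
  then have "norm (vs t) \<le> 2 * L * \<zeta>"
    using T3 pos small by (intro cauchy_point_shallow_norm_le[of \<tau>, OF _ \<zeta> _ good_Us(2)[OF t]]) auto
  then have "\<tau> * norm (vs t) \<le> \<tau> * (2 * L * \<zeta>)" using pos by (intro mult_left_mono) auto
  also have "\<dots> = 4 * L * (2 * (\<rho> * \<zeta>))" by simp
  also have "\<dots> \<le> 4 * L * L" using small pos by (intro mult_left_mono) auto
  also have "\<dots> \<le> 41 / 10 * L\<^sup>2" by (simp add: power2_eq_square)
  finally have vb: "\<tau> * norm (vs t) \<le> 41 / 10 * L\<^sup>2" .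
  interpret C: cubic_descent "Us t" "vs t" \<tau> L e l
    by unfold_locales (use good_Us[OF t] eb pos vb in auto)
  obtain N where N: "cubic_finalsolver (Us t) (vs t) \<tau> (1 / (16 * L)) \<epsilon> = Some (C.x N, 2 + 2 * N)"
    "norm (cubic_grad (Us t) (vs t) \<tau> (C.x N)) \<le> \<epsilon>" "real N \<le> 32 * L * (\<tau> * \<zeta> ^ 3 / 12) / \<epsilon>\<^sup>2"
    using C.finalsolver_terminates[OF stop_low \<epsilon>(1)] by blast
  have "32 * L * (\<tau> * \<zeta> ^ 3 / 12) / (\<rho> * \<zeta>\<^sup>2)\<^sup>2 = 32 / 3 * q"
    unfolding q_def using pos \<zeta> by (simp add: power2_eq_square power3_eq_cube)
  then have "32 * L * (\<tau> * \<zeta> ^ 3 / 12) / \<epsilon>\<^sup>2 = 32 / 3 * q" unfolding \<rho>\<zeta>2 .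
  then show ?thesis using N C.b_x_nonpos by metis
qed

text \<open>A final step of length at most \<open>16 / 10 * \<zeta>\<close> lets gradient and
  Hessian of \<open>F\<close> at the new point be compared with those of the model. The resulting
  factors 8 and 4 both end below \<open>64 * \<epsilon> powr (3/2)\<close>.\<close>

lemma stop_result:
  "\<exists>x_out c N. st \<omega> T = Finished x_out c \<and> crit_measure \<rho> F x_out \<le> 1300 * \<epsilon> powr (3/2) \<and> real N \<le> 32 / 3 * q
    \<and> c = st_c (st \<omega> t) + cg t (st \<omega> t) + (snd (sub t (\<omega> t) (st \<omega> t)) + 1 + (2 + 2 * N)) * Bh t"
proof -
  obtain D N where fin: "cubic_finalsolver (Us t) (vs t) \<tau> (1 / (16 * L)) \<epsilon> = Some (D, 2 + 2 * N)"
    and gD: "norm (cubic_grad (Us t) (vs t) \<tau> D) \<le> \<epsilon>" and vD: "vs t \<bullet> D \<le> 0" and N: "real N \<le> 32 / 3 * q"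
    using stop_final by blast
  define c where "c = st_c (st \<omega> t) + cg t (st \<omega> t) + (snd (sub t (\<omega> t) (st \<omega> t)) + 1 + (2 + 2 * N)) * Bh t"
  have "st \<omega> (Suc t) = Finished (xs t + D) c"
    using run stop_value fin by (simp add: st_Suc next_def Us_def vs_def hs_def xs_def c_def)
  then have fT: "st \<omega> T = Finished (xs t + D) c" using st_stays[of \<omega> "Suc t" T] t by simp
  define U v x where "U = Us t" and "v = vs t" and "x = xs t"
  define p where "p = norm D / \<zeta>"
  have p: "p \<ge> 0" "norm D = p * \<zeta>" using \<zeta> by (simp_all add: p_def)
  define R where "R = \<rho> * \<zeta> ^ 3"
  have R: "R > 0" using pos \<zeta> by (simp add: R_def)
  \<comment> \<open>A small model gradient and \<open>v \<bullet> D \<le> 0\<close> bound the value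
    by \<open>p / 2 - p ^ 3 / 3\<close> units, while the model stays above minus one third of a
    unit; long steps are excluded.\<close>
  have p16: "p \<le> 16 / 10"
  proof (rule ccontr)
    assume "\<not> ?thesis"
    then have pb: "p > 16 / 10" by simp
    have "cubic_grad U v \<tau> D \<bullet> D \<le> \<epsilon> * norm D"
      using norm_cauchy_schwarz[of "cubic_grad U v \<tau> D" D] mult_right_mono[OF gD norm_ge_zero[of D]]
      unfolding U_def v_def by linarith
    also have "\<epsilon> * norm D = (\<rho> * \<zeta>\<^sup>2) * norm D" unfolding \<rho>\<zeta>2 ..
    also have "\<dots> = R * p" unfolding p(2) R_def by (simp add: power2_eq_square power3_eq_cube)
    finally have 1: "cubic_grad U v \<tau> D \<bullet> D \<le> R * p" .
    have "\<tau> / 12 * norm D ^ 3 = R * p ^ 3 / 3" unfolding p(2) R_def by (simp add: power3_eq_cube)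
    moreover have "- (R / 3) \<le> cubic U v \<tau> D" using stop_low[of D] by (simp add: U_def v_def R_def)
    ultimately have "R * p ^ 3 / 3 \<le> R / 3 + R * p / 2"
      using 1 vD unfolding cubic_eq_grad v_def[symmetric] by linarith
    then have "R * (p ^ 3) \<le> R * (1 + 3 / 2 * p)" by (simp add: algebra_simps)
    then have "p ^ 3 \<le> 1 + 3 / 2 * p" using R by (simp only: mult_le_cancel_left_pos)
    moreover have "(16 / 10 * (16 / 10)) * p \<le> p * p * p" using pb by (intro mult_mono) auto
    then have "256 / 100 * p \<le> p ^ 3" by (simp add: power3_eq_cube)
    ultimately show False using pb by linarith
  qed
  have gradb: "norm (grad F (x + D)) \<le> 8 * \<epsilon>"
  proof -
    have split: "grad F (x + D) = (grad F (x + D) - grad F x - hess F x *v D) - (v - grad F x) - (U - hess F x) *v D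
        + cubic_grad U v \<tau> D - (\<tau> / 2 * norm D) *\<^sub>R D"
      by (simp add: cubic_grad_def matrix_vector_mult_diff_rdistrib)
    have "norm (grad F (x + D)) \<le> norm (grad F (x + D) - grad F x - hess F x *v D) + norm (v - grad F x)
        + norm ((U - hess F x) *v D) + norm (cubic_grad U v \<tau> D) + norm ((\<tau> / 2 * norm D) *\<^sub>R D)"
      by (subst split) (intro order_trans[OF norm_triangle_ineq4] order_trans[OF norm_triangle_ineq] add_mono order_refl)
    also have "\<dots> \<le> \<rho> / 2 * (norm D)\<^sup>2 + \<epsilon> / 10 + \<rho> * \<zeta> / 7 * norm D + \<epsilon> + 2 * \<rho> * (norm D)\<^sup>2"
      unfolding U_def v_def x_def
      using pos by (intro add_mono F.grad_taylor good_grad[OF t run] good_hess[OF t] gD) (simp add: power2_eq_square)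
    also have "\<dots> = \<epsilon> * (5 / 2 * p\<^sup>2 + 1 / 10 + p / 7 + 1)"
    proof -
      have "\<rho> * (norm D)\<^sup>2 = \<rho> * \<zeta>\<^sup>2 * p\<^sup>2" "\<rho> * \<zeta> * norm D = \<rho> * \<zeta>\<^sup>2 * p"
        unfolding p(2) by (simp_all add: power2_eq_square)
      then have "\<rho> * (norm D)\<^sup>2 = \<epsilon> * p\<^sup>2" "\<rho> * \<zeta> * norm D = \<epsilon> * p" unfolding \<rho>\<zeta>2 .
      then show ?thesis by (simp add: distrib_left)
    qed
    also have "\<dots> \<le> \<epsilon> * 8"
    proof (rule mult_left_mono)
      have "p\<^sup>2 \<le> (16 / 10)\<^sup>2" using p p16 by (intro power_mono) auto
      then have "p\<^sup>2 \<le> 256 / 100" by (simp add: power2_eq_square)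
      then show "5 / 2 * p\<^sup>2 + 1 / 10 + p / 7 + 1 \<le> 8" using p16 by linarith
    qed (use \<epsilon> in simp)
    finally show ?thesis by simp
  qed
  have lamU: "- (2 * (\<rho> * \<zeta>)) \<le> lambda_min U"
  proof (rule ccontr)
    assume "\<not> ?thesis"
    then have neg: "lambda_min U < - (2 * (\<rho> * \<zeta>))" by simp
    obtain w where w: "norm w = 1" "U *v w = lambda_min U *\<^sub>R w"
      using lambda_min_eigenvector[OF good_Us(1)[OF t]] unfolding U_def by blast
    \<comment> \<open>A step of length \<zeta> along the bottom eigenvector, with the sign that
      makes the linear term nonpositive: too negative a curvature would push the model below its
      lower bound.\<close>
    define y where "y = (if v \<bullet> w \<le> 0 then \<zeta> else - \<zeta>) *\<^sub>R w"
    have ny: "norm y = \<zeta>" using w \<zeta> by (simp add: y_def)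
    have vy: "v \<bullet> y \<le> 0" using \<zeta> by (auto simp: y_def mult_nonneg_nonpos)
    have "U *v y = lambda_min U *\<^sub>R y" using w by (simp add: y_def matrix_vector_mult_scaleR)
    then have "y \<bullet> (U *v y) = lambda_min U * \<zeta>\<^sup>2" by (simp add: dot_square_norm ny)
    also have "\<dots> < - (2 * (\<rho> * \<zeta>)) * \<zeta>\<^sup>2" using neg \<zeta> by (intro mult_strict_right_mono) auto
    also have "\<dots> = - (2 * R)" by (simp add: R_def power2_eq_square power3_eq_cube)
    finally have "y \<bullet> (U *v y) / 2 < - R" by simp
    moreover have "\<tau> / 6 * norm y ^ 3 = 2 / 3 * R" by (simp add: ny R_def)
    ultimately have "cubic U v \<tau> y < - (R / 3)" using vy unfolding cubic_def by linarith
    then show False using stop_low[of y] by (simp add: U_def v_def R_def)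
  qed
  have lam: "- (4 * (\<rho> * \<zeta>)) \<le> lambda_min (hess F (x + D))"
  proof -
    have "spectral_norm (hess F (x + D) - U) \<le> spectral_norm (hess F (x + D) - hess F x) + spectral_norm (hess F x - U)"
      using spectral_norm_triangle[of "hess F (x + D) - hess F x" "hess F x - U"] by simp
    also have "spectral_norm (hess F (x + D) - hess F x) \<le> \<rho> * norm D" using F.hess_lip[of "x + D" x] by simp
    also have "\<rho> * norm D \<le> 16 / 10 * (\<rho> * \<zeta>)" using p16 pos \<zeta> by (simp add: p(2) mult_left_mono mult_right_mono)
    also have "spectral_norm (hess F x - U) \<le> \<rho> * \<zeta> / 7"
    proof (rule spectral_norm_le)
      fix u
      have "norm ((hess F x - U) *v u) = norm ((U - hess F x) *v u)"
        by (simp add: matrix_vector_mult_diff_rdistrib norm_minus_commute)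
      then show "norm ((hess F x - U) *v u) \<le> \<rho> * \<zeta> / 7 * norm u"
        using good_hess[OF t] by (simp add: U_def x_def)
    qed
    finally have "spectral_norm (hess F (x + D) - U) \<le> 16 / 10 * (\<rho> * \<zeta>) + \<rho> * \<zeta> / 7" by simp
    moreover have "lambda_min U - spectral_norm (hess F (x + D) - U) \<le> lambda_min (hess F (x + D))"
      by (rule lambda_min_diff_le[OF F.hess_symmetric]) (simp add: U_def good_Us(1)[OF t])
    moreover have "\<rho> * \<zeta> > 0" using pos \<zeta> by simp
    ultimately show ?thesis using lamU by linarith
  qed
  have "crit_measure \<rho> F (x + D) \<le> 1300 * \<epsilon> powr (3/2)"
    unfolding crit_measure_def
  proof (rule max.boundedI)
    have "norm (grad F (x + D)) powr (3/2) \<le> (8 * \<epsilon>) powr (3/2)" using gradb by (intro powr_mono2) auto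
    also have "\<dots> = 8 powr (3/2) * \<epsilon> powr (3/2)" using \<epsilon> by (simp add: powr_mult)
    also have "8 powr (3/2) \<le> (8 :: real) powr 2" by (intro powr_mono) auto
    also have "(8 :: real) powr 2 = 64" by (simp add: powr_numeral)
    finally show "norm (grad F (x + D)) powr (3/2) \<le> 1300 * \<epsilon> powr (3/2)"
      using powr_ge_zero[of \<epsilon> "3/2"] by (simp add: mult_right_mono; linarith)
    let ?l = "lambda_min (hess F (x + D))"
    have "- (?l ^ 3) \<le> (4 * (\<rho> * \<zeta>)) ^ 3"
    proof (cases "?l \<ge> 0")
      case True
      have "0 \<le> (4 * (\<rho> * \<zeta>)) ^ 3" using pos \<zeta> by simp
      then show ?thesis using True zero_le_power[of ?l 3] by linarith
    next
      case False
      then have "(- ?l) ^ 3 \<le> (4 * (\<rho> * \<zeta>)) ^ 3" using lam by (intro power_mono) auto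
      then show ?thesis by simp
    qed
    also have "(4 * (\<rho> * \<zeta>)) ^ 3 = 64 * (\<rho> * \<zeta>) ^ 3" by (simp add: power_mult_distrib)
    also have "(\<rho> * \<zeta>) ^ 3 = \<epsilon> powr (3/2) * \<rho> powr (3/2)"
    proof -
      have "(\<rho> * \<zeta>) ^ 3 = sqrt (\<rho> * \<epsilon>) ^ 3" by (simp only: \<rho>\<zeta>)
      also have "\<dots> = (\<rho> * \<epsilon>) powr (3/2)" using pos \<epsilon> by (simp add: powr_half_sqrt[symmetric] powr_power)
      finally show ?thesis using pos \<epsilon> by (simp add: powr_mult)
    qed
    finally have "- (?l ^ 3) / \<rho> powr (3/2) \<le> 64 * \<epsilon> powr (3/2)"
      using pos by (subst pos_divide_le_eq) (auto simp: mult.assoc)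
    then show "- (?l ^ 3) / \<rho> powr (3/2) \<le> 1300 * \<epsilon> powr (3/2)"
      using powr_ge_zero[of \<epsilon> "3/2"] by linarith
  qed
  then show ?thesis using fT N unfolding c_def x_def by blast
qed

end

section \<open>Counting oracle calls\<close>

lemma cost_sub: "snd (sub k (\<omega> k) (st \<omega> k)) + 1 \<le> 2 * K + 4"
  unfolding sub_def K_def
  using cubic_subsolver_cost[of "Ut k (\<omega> k) (st \<omega> k)" "vt k (\<omega> k) (st \<omega> k)" \<tau> L \<zeta> \<delta> "snd (snd (\<omega> k))"] by simp

lemma Bh_const: "Bh k = Bh 0"
  by (simp add: Bh)

lemma cost_running:
  "st_tag (st \<omega> t) = 0 \<Longrightarrow> st_c (st \<omega> t) \<le> (\<Sum>k<t. cg k (st \<omega> k)) + t * (2 * K + 4) * Bh 0"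
proof (induction t)
  case 0
  then show ?case by (simp add: st_0)
next
  case (Suc t)
  note r = st_Suc_running[OF Suc.prems]
  have "(snd (sub t (\<omega> t) (st \<omega> t)) + 1) * Bh t \<le> (2 * K + 4) * Bh 0"
    unfolding Bh_const[of t] by (intro mult_right_mono cost_sub) simp
  then show ?case using Suc.IH[OF r(1)] unfolding r(7) by (simp add: algebra_simps)
qed

definition "Xr = min (real n) (2640 * M\<^sup>2 * lg\<^sup>2 / \<epsilon>\<^sup>2)"
text \<open>The factor of the squared step in an ordinary batch; zero for \<open>S = 1\<close>,
  where no ordinary iteration occurs.\<close>

definition "Q = (if S \<ge> 2 then 2640 * L\<^sup>2 * real S * lg\<^sup>2 / \<epsilon>\<^sup>2 else 0)"

text \<open>The batch of iteration \<open>k + 1\<close> is sized by the step of iteration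
  \<open>k\<close>, so squared steps are summed up to \<open>t - 1\<close> only. The 2 per iteration
  pays for rounding, doubled where two gradients per index are evaluated.\<close>

lemma cost_grad:
  "st_tag (st \<omega> t) = 0 \<Longrightarrow> (\<Sum>k\<le>t. real (cg k (st \<omega> k)))
    \<le> (real (t div S) + 1) * Xr + 2 * (real t + 1) + 2 * Q * (\<Sum>k<t. (norm (hs k))\<^sup>2)"
proof (induction t)
  case 0
  have "real (cg 0 (st \<omega> 0)) \<le> real (round_up Xr)"
    by (simp add: cg_def Bg Xr_def lg_def)
  also have "\<dots> \<le> Xr + 1" by (rule round_up_le) (simp add: Xr_def)
  finally show ?case by simp
next
  case (Suc t)
  note r = st_Suc_running[OF Suc.prems]
  have X0: "Xr \<ge> 0" by (simp add: Xr_def)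
  have IH: "(\<Sum>k\<le>t. real (cg k (st \<omega> k))) \<le> (real (t div S) + 1) * Xr + 2 * (real t + 1) + 2 * Q * (\<Sum>k<t. (norm (hs k))\<^sup>2)"
    by (rule Suc.IH[OF r(1)])
  have Q0: "Q \<ge> 0" by (simp add: Q_def)
  show ?case
  proof (cases "Suc t mod S = 0")
    case True
    have "real (cg (Suc t) (st \<omega> (Suc t))) \<le> real (round_up Xr)"
      using True by (simp add: cg_def Bg Xr_def lg_def)
    also have "\<dots> \<le> Xr + 1" by (rule round_up_le[OF X0])
    finally have c: "real (cg (Suc t) (st \<omega> (Suc t))) \<le> Xr + 1" .
    have "Suc t div S = Suc (t div S)" using True by (simp add: div_Suc)
    moreover have "0 \<le> 2 * Q * (norm (hs t))\<^sup>2" using Q0 by simp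
    ultimately show ?thesis using IH c by (simp add: algebra_simps)
  next
    case False
    then have S2: "S \<ge> 2" using S1 by (cases "S = 1") auto
    define Z where "Z = 2640 * L\<^sup>2 * real S * (norm (st_h (st \<omega> (Suc t))))\<^sup>2 * lg\<^sup>2 / \<epsilon>\<^sup>2"
    have Z0: "Z \<ge> 0" by (simp add: Z_def)
    have "real (cg (Suc t) (st \<omega> (Suc t))) \<le> 2 * real (round_up (min (real n) Z))"
      using False by (simp add: cg_def Bg Z_def lg_def)
    also have "\<dots> \<le> 2 * (min (real n) Z + 1)" using Z0 by (intro mult_left_mono round_up_le) auto
    also have "\<dots> \<le> 2 * (Z + 1)" by simp
    also have "Z = Q * (norm (hs t))\<^sup>2" using S2 by (simp add: Z_def Q_def r(5) hs_def)
    finally have c: "real (cg (Suc t) (st \<omega> (Suc t))) \<le> 2 * (Q * (norm (hs t))\<^sup>2 + 1)" .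
    have "real (t div S) * Xr \<le> real (Suc t div S) * Xr"
      using X0 by (intro mult_right_mono) (auto intro: div_le_mono)
    then show ?thesis using IH c by (simp add: algebra_simps)
  qed
qed

text \<open>After the first reset there are at most \<open>20 * P / S\<close> more. Bounding
  \<open>Nm\<close> by \<open>n\<close> or, through \<open>sqrt Nm \<le> q * S\<close>, by
  \<open>S * q * sqrt Nm\<close> gives the two arguments of the minimum in \<open>A\<close>.\<close>

lemma reset_cost:
  assumes "real t \<le> 20 * P"
  shows "(real (t div S) + 1) * Xr \<le> 2640 * \<Lambda>\<^sup>2 * (Nm + 20 * (P * A))"
proof -
  define y where "y = M\<^sup>2 / \<epsilon>\<^sup>2"
  have y: "y \<ge> 0" by (simp add: y_def)
  have "Xr = min (real n) (2640 * lg\<^sup>2 * y)" by (simp add: Xr_def y_def mult.commute mult.left_commute)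
  also have "\<dots> \<le> min (real n) (2640 * \<Lambda>\<^sup>2 * y)"
    using \<Lambda>2 y by (intro min.mono mult_right_mono) auto
  also have "\<dots> \<le> 2640 * \<Lambda>\<^sup>2 * Nm"
    unfolding Nm_def y_def[symmetric] using \<Lambda>2 by (intro min_scale_le) auto
  finally have X: "Xr \<le> 2640 * \<Lambda>\<^sup>2 * Nm" .
  define k where "k = real (t div S)"
  have "real (t div S * S) \<le> real t" by (rule of_nat_mono) (rule div_times_less_eq_dividend)
  then have kS: "k * real S \<le> 20 * P" using assms by (simp add: k_def)
  have k0: "k \<ge> 0" by (simp add: k_def)
  have "k * Nm \<le> 20 * (P * A)"
  proof -
    have "k * 1 \<le> k * real S" using k0 S1 by (intro mult_left_mono) auto
    then have "k * Nm \<le> 20 * P * real n"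
      using kS Nm0 k0 P0 by (intro mult_mono) (auto simp: Nm_def)
    moreover have "k * Nm \<le> 20 * P * (q * sqrt Nm)"
    proof -
      have "k * Nm = k * (sqrt Nm * sqrt Nm)" using Nm0 by simp
      also have "\<dots> \<le> k * ((q * real S) * sqrt Nm)"
        using S_bounds(1) k0 Nm0 by (intro mult_left_mono mult_right_mono) auto
      also have "\<dots> = (k * real S) * (q * sqrt Nm)" by simp
      also have "\<dots> \<le> 20 * P * (q * sqrt Nm)" using kS q2 Nm0 by (intro mult_right_mono) auto
      finally show ?thesis .
    qed
    ultimately show ?thesis unfolding A_def by (simp add: min_def)
  qed
  then have "(k + 1) * Nm \<le> Nm + 20 * (P * A)" by (simp add: distrib_right)
  then have "2640 * \<Lambda>\<^sup>2 * ((k + 1) * Nm) \<le> 2640 * \<Lambda>\<^sup>2 * (Nm + 20 * (P * A))" by (intro mult_left_mono) auto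
  moreover have "(k + 1) * Xr \<le> (k + 1) * (2640 * \<Lambda>\<^sup>2 * Nm)" using X k0 by (intro mult_left_mono) auto
  ultimately show ?thesis unfolding k_def[symmetric] by (simp add: mult_ac)
qed

text \<open>For \<open>S \<ge> 2\<close> the minimum in \<open>A\<close> is its second argument, and
  \<open>q * S \<le> 2 * sqrt Nm\<close> trades the factor \<open>S\<close> of the batch size for
  \<open>sqrt Nm\<close>. The rest is
  \<open>L\<^sup>2 * \<zeta>\<^sup>2 / \<epsilon>\<^sup>2 = q\<^sup>2\<close>.\<close>

lemma step_cost:
  assumes "s \<le> 24 * P * \<zeta>\<^sup>2"
  shows "2 * Q * s \<le> 253440 * \<Lambda>\<^sup>2 * (P * A)"
proof (cases "S \<ge> 2")
  case True
  note b = S_bounds(2,3)[OF True]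
  have Q: "Q = 2640 * L\<^sup>2 * real S * lg\<^sup>2 / \<epsilon>\<^sup>2" using True by (simp add: Q_def)
  have "q * sqrt Nm \<le> sqrt Nm * sqrt Nm" using b q2 Nm0 by (intro mult_right_mono) auto
  then have "q * sqrt Nm \<le> real n" using Nm0 by (simp add: Nm_def)
  then have A: "A = q * sqrt Nm" by (simp add: A_def)
  have sc: "L\<^sup>2 * \<zeta>\<^sup>2 / \<epsilon>\<^sup>2 = q\<^sup>2"
  proof -
    have "L\<^sup>2 * \<zeta>\<^sup>2 / (\<rho> * \<zeta>\<^sup>2)\<^sup>2 = q\<^sup>2" using pos \<zeta> by (simp add: q_def power2_eq_square)
    then show ?thesis unfolding \<rho>\<zeta>2 .
  qed
  have "Q \<ge> 0" by (simp add: Q)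
  then have "2 * Q * s \<le> 2 * Q * (24 * P * \<zeta>\<^sup>2)" using assms by (intro mult_left_mono) auto
  also have "\<dots> = 126720 * lg\<^sup>2 * P * real S * (L\<^sup>2 * \<zeta>\<^sup>2 / \<epsilon>\<^sup>2)" by (simp add: Q)
  also have "\<dots> = 126720 * lg\<^sup>2 * (P * q * (q * real S))" unfolding sc by (simp add: power2_eq_square)
  also have "\<dots> \<le> 126720 * \<Lambda>\<^sup>2 * (P * q * (q * real S))"
    using \<Lambda>2 P0 q2 by (intro mult_right_mono) auto
  also have "\<dots> \<le> 126720 * \<Lambda>\<^sup>2 * (P * q * (2 * sqrt Nm))"
    using b P0 q2 by (intro mult_left_mono) auto
  finally show ?thesis by (simp add: A)
next
  case False
  then show ?thesis using P0 A0 by (simp add: Q_def)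
qed

lemma hess_cost:
  assumes "real t \<le> 20 * P" "real N \<le> 32 / 3 * q"
  shows "real (((t + 1) * (2 * K + 4) + (2 + 2 * N)) * Bh 0) \<le> 60000000000 * \<Lambda> ^ 3 * (q * (P + 1) * Hm)"
proof -
  have q\<Lambda>: "2 \<le> q * \<Lambda>" using q2 \<Lambda>(1) mult_mono[of 2 q 1 \<Lambda>] by simp
  have "(real t + 1) * (2 * real K + 4) \<le> (20 * (P + 1)) * (2300000 * (q * \<Lambda>))"
    using assms(1) K_le q\<Lambda> P0 by (intro mult_mono) auto
  moreover have "2 + 2 * real N \<le> 24 * (q * \<Lambda>)"
  proof -
    have "q * 1 \<le> q * \<Lambda>" using q2 \<Lambda>(1) by (intro mult_left_mono) auto
    then show ?thesis using assms(2) q2 by linarith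
  qed
  moreover have "1 * (q * \<Lambda>) \<le> (P + 1) * (q * \<Lambda>)" using P0 q\<Lambda> by (intro mult_right_mono) auto
  ultimately have "(real t + 1) * (2 * real K + 4) + (2 + 2 * real N) \<le> 46000024 * ((P + 1) * (q * \<Lambda>))" by linarith
  then have "((real t + 1) * (2 * real K + 4) + (2 + 2 * real N)) * real (Bh 0)
      \<le> 46000024 * ((P + 1) * (q * \<Lambda>)) * (1300 * \<Lambda>\<^sup>2 * Hm)"
    using Bh_le[of 0] P0 q\<Lambda> by (intro mult_mono) auto
  also have "\<dots> = 59800031200 * (\<Lambda> ^ 3 * (q * (P + 1) * Hm))" by (simp add: power2_eq_square power3_eq_cube)
  also have "\<dots> \<le> 60000000000 * (\<Lambda> ^ 3 * (q * (P + 1) * Hm))"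
    using \<Lambda>(1) q2 P0 Hm1 by (intro mult_right_mono) auto
  moreover have "real (((t + 1) * (2 * K + 4) + (2 + 2 * N)) * Bh 0)
      = ((real t + 1) * (2 * real K + 4) + (2 + 2 * real N)) * real (Bh 0)"
    by (simp only: of_nat_add of_nat_mult of_nat_numeral of_nat_1)
  ultimately show ?thesis by (simp only: mult.assoc)
qed

text \<open>The gradient terms carry only \<open>\<Lambda>\<^sup>2\<close>; raising this to the cube
  and absorbing the rounding of the gradient batches into the Hessian term gives one common
  prefactor.\<close>

lemma cost_total:
  assumes t: "t < T" and run: "st_tag (st \<omega> t) = 0" and N: "real N \<le> 32 / 3 * q"
  shows "real (st_c (st \<omega> t) + cg t (st \<omega> t) + (snd (sub t (\<omega> t) (st \<omega> t)) + 1 + (2 + 2 * N)) * Bh t)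
    \<le> 10 ^ 15 * \<Lambda> ^ 3 * (Nm + P * A + q * (P + 1) * Hm)"
proof -
  note rb = running_bounds[OF less_imp_le[OF t] run]
  let ?g = "\<Sum>k<t. cg k (st \<omega> k)"
  have "(snd (sub t (\<omega> t) (st \<omega> t)) + 1 + (2 + 2 * N)) * Bh t \<le> ((2 * K + 4) + (2 + 2 * N)) * Bh 0"
    unfolding Bh_const[of t] using cost_sub[of t] by (intro mult_right_mono) auto
  then have "st_c (st \<omega> t) + cg t (st \<omega> t) + (snd (sub t (\<omega> t) (st \<omega> t)) + 1 + (2 + 2 * N)) * Bh t
      \<le> ?g + cg t (st \<omega> t) + ((t + 1) * (2 * K + 4) + (2 + 2 * N)) * Bh 0"
    using cost_running[OF run] by (simp add: algebra_simps)
  then have "real (st_c (st \<omega> t) + cg t (st \<omega> t) + (snd (sub t (\<omega> t) (st \<omega> t)) + 1 + (2 + 2 * N)) * Bh t)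
      \<le> real (?g + cg t (st \<omega> t) + ((t + 1) * (2 * K + 4) + (2 + 2 * N)) * Bh 0)" by (rule of_nat_mono)
  also have "\<dots> = (\<Sum>k\<le>t. real (cg k (st \<omega> k))) + real (((t + 1) * (2 * K + 4) + (2 + 2 * N)) * Bh 0)"
    by (simp only: of_nat_add of_nat_sum lessThan_Suc_atMost[symmetric] sum.lessThan_Suc)
  finally have c: "real (st_c (st \<omega> t) + cg t (st \<omega> t) + (snd (sub t (\<omega> t) (st \<omega> t)) + 1 + (2 + 2 * N)) * Bh t)
    \<le> (\<Sum>k\<le>t. real (cg k (st \<omega> k))) + real (((t + 1) * (2 * K + 4) + (2 + 2 * N)) * Bh 0)" .
  define a b e where "a = \<Lambda> ^ 3 * Nm" and "b = \<Lambda> ^ 3 * (P * A)" and "e = \<Lambda> ^ 3 * (q * (P + 1) * Hm)"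
  have L3: "\<Lambda>\<^sup>2 \<le> \<Lambda> ^ 3" "1 \<le> \<Lambda> ^ 3" using \<Lambda>(1) by (auto intro: power_increasing one_le_power)
  have nn: "0 \<le> P * A" "0 \<le> Nm" using P0 A0 Nm0 by auto
  have "2640 * \<Lambda>\<^sup>2 * (Nm + 20 * (P * A)) \<le> 2640 * \<Lambda> ^ 3 * (Nm + 20 * (P * A))"
    using L3 nn by (intro mult_right_mono) auto
  also have "\<dots> = 2640 * a + 52800 * b" by (simp add: a_def b_def algebra_simps)
  finally have 1: "(real (t div S) + 1) * Xr \<le> 2640 * a + 52800 * b" using reset_cost[OF rb(1)] by linarith
  have "253440 * \<Lambda>\<^sup>2 * (P * A) \<le> 253440 * \<Lambda> ^ 3 * (P * A)" using L3 nn by (intro mult_right_mono) auto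
  then have 2: "2 * Q * (\<Sum>k<t. (norm (hs k))\<^sup>2) \<le> 253440 * b" using step_cost[OF rb(2)] unfolding b_def mult.assoc by (rule order_trans[rotated])
  have 3: "real (((t + 1) * (2 * K + 4) + (2 + 2 * N)) * Bh 0) \<le> 60000000000 * e"
    using hess_cost[OF rb(1) N] by (simp add: e_def mult.assoc)
  have "1 * (P + 1) \<le> q * (P + 1)" using q2 P0 by (intro mult_right_mono) auto
  also have "\<dots> = q * (P + 1) * 1" by simp
  also have "\<dots> \<le> q * (P + 1) * Hm" using q2 P0 Hm1 by (intro mult_left_mono) auto
  also have "\<dots> = 1 * (q * (P + 1) * Hm)" by simp
  also have "\<dots> \<le> e" unfolding e_def using L3 q2 P0 Hm1 by (intro mult_right_mono) auto
  finally have "P + 1 \<le> e" by simp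
  then have 4: "2 * (real t + 1) \<le> 40 * e" using rb(1) by simp
  have "0 \<le> a" "0 \<le> b" "0 \<le> e" using nn \<Lambda>(1) q2 P0 Hm1 by (auto simp: a_def b_def e_def)
  then have "real (st_c (st \<omega> t) + cg t (st \<omega> t) + (snd (sub t (\<omega> t) (st \<omega> t)) + 1 + (2 + 2 * N)) * Bh t)
    \<le> 10 ^ 15 * (a + b + e)" using c 1 2 3 4 cost_grad[OF run] by simp
  also have "\<dots> = 10 ^ 15 * \<Lambda> ^ 3 * (Nm + P * A + q * (P + 1) * Hm)"
    by (simp add: a_def b_def e_def distrib_left)
  finally show ?thesis .
qed

end

text \<open>\<open>P\<close> contributes a factor \<open>sqrt \<rho>\<close>, which is distributed
  over the minimum in \<open>A\<close>; with \<open>sqrt Nm = min (sqrt n) (M / \<epsilon>)\<close>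
  the three arguments of the stated minimum appear.\<close>

lemma cost_terms:
  "P * A = \<Delta>F / \<epsilon> powr (3/2) * min (sqrt \<rho> * real n) (min (L * sqrt (real n) / sqrt \<epsilon>) (L * M / \<epsilon> powr (3/2)))"
  "q * (P + 1) = L * \<Delta>F / \<epsilon>\<^sup>2 + L / sqrt (\<rho> * \<epsilon>)"
proof -
  have e32: "\<epsilon> powr (3/2) = \<epsilon> * sqrt \<epsilon>"
    using \<epsilon> powr_add[of \<epsilon> 1 "1/2"] by (simp add: powr_half_sqrt)
  have "P = \<Delta>F * (1 / (\<rho> * \<zeta> ^ 3))" by (simp add: P_def)
  also have "\<dots> = \<Delta>F / \<epsilon> powr (3/2) * sqrt \<rho>"
    unfolding cube_scale[symmetric] using pos by (simp add: powr_half_sqrt powr_minus_divide)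
  finally have P: "P = \<Delta>F / \<epsilon> powr (3/2) * sqrt \<rho>" .
  have q: "q = L / (sqrt \<rho> * sqrt \<epsilon>)" unfolding q_def \<rho>\<zeta> by (simp add: real_sqrt_mult)
  have min_scale: "c * min a b = min (c * a) (c * b)" if "c \<ge> 0" for a b c :: real
    using that by (simp add: min_mult_distrib_left)
  have "sqrt Nm = min (sqrt (real n)) (sqrt (M\<^sup>2 / \<epsilon>\<^sup>2))" by (simp add: Nm_def min_def)
  also have "sqrt (M\<^sup>2 / \<epsilon>\<^sup>2) = M / \<epsilon>" using pos \<epsilon> by (simp add: real_sqrt_divide)
  finally have "sqrt Nm = min (sqrt (real n)) (M / \<epsilon>)" .
  then have "sqrt \<rho> * A = min (sqrt \<rho> * real n) (min (sqrt \<rho> * (q * sqrt (real n))) (sqrt \<rho> * (q * (M / \<epsilon>))))"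
    using q2 pos by (simp add: A_def min_scale)
  also have "sqrt \<rho> * (q * sqrt (real n)) = L * sqrt (real n) / sqrt \<epsilon>" using pos by (simp add: q)
  also have "sqrt \<rho> * (q * (M / \<epsilon>)) = L * M / \<epsilon> powr (3/2)" using pos by (simp add: q e32)
  finally show "P * A = \<Delta>F / \<epsilon> powr (3/2) * min (sqrt \<rho> * real n) (min (L * sqrt (real n) / sqrt \<epsilon>) (L * M / \<epsilon> powr (3/2)))"
    by (simp only: P mult.assoc)
  have "q * P = L * \<Delta>F / (\<rho> * \<zeta>\<^sup>2)\<^sup>2" by (simp add: q_def P_def power2_eq_square power3_eq_cube)
  then have "q * P = L * \<Delta>F / \<epsilon>\<^sup>2" unfolding \<rho>\<zeta>2 .
  moreover have "q = L / sqrt (\<rho> * \<epsilon>)" unfolding q_def \<rho>\<zeta> ..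
  ultimately show "q * (P + 1) = L * \<Delta>F / \<epsilon>\<^sup>2 + L / sqrt (\<rho> * \<epsilon>)" by (simp add: distrib_left)
qed

text \<open>By Weyl's bound the bottom eigenvalue of the Hessian is \<rho>-Lipschitz as a function
  of the point, hence Borel.\<close>

lemma crit_measure_borel: "crit_measure \<rho> F \<in> borel_measurable borel"
proof -
  have "\<bar>lambda_min (hess F x) - lambda_min (hess F y)\<bar> \<le> \<rho> * norm (x - y)" for x y
    using lambda_min_diff_le[OF F.hess_symmetric F.hess_symmetric, of x y]
      lambda_min_diff_le[OF F.hess_symmetric F.hess_symmetric, of y x]
      F.hess_lip[of x y] F.hess_lip[of y x] by (simp add: norm_minus_commute)
  then have "\<rho>-lipschitz_on UNIV (\<lambda>x. lambda_min (hess F x))"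
    using pos by (intro lipschitz_onI) (auto simp: dist_norm)
  then have "(\<lambda>x. lambda_min (hess F x)) \<in> borel_measurable borel"
    by (intro borel_measurable_continuous_onI lipschitz_on_continuous_on)
  moreover have "grad F \<in> borel_measurable borel" by (rule grad_borel_measurable)
  ultimately show ?thesis unfolding crit_measure_def[abs_def] by measurable
qed

text \<open>The success event contains the complement of the bad event, but monotonicity of the
  measure also asks for its measurability; for this it is rewritten through the tag and the fields
  of the final state.\<close>

theorem srvrc_success:
  "1 - \<xi> \<le> \<P>(\<omega> in draws_measure n. \<exists>x_out c. st \<omega> T = Finished x_out c \<and>
      crit_measure \<rho> F x_out \<le> 1300 * \<epsilon> powr (3/2) \<and>
      real c \<le> 10 ^ 15 * \<Lambda> ^ 3 * (Nm + P * A + q * (P + 1) * Hm))"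
proof -
  let ?D = "draws_measure n :: (nat \<Rightarrow> 'd draws) measure"
  interpret D: prob_space ?D by (rule prob_space_draws_measure)
  let ?C = "10 ^ 15 * \<Lambda> ^ 3 * (Nm + P * A + q * (P + 1) * Hm)"
  let ?E = "{\<omega> \<in> space ?D. \<exists>x_out c. st \<omega> T = Finished x_out c \<and>
      crit_measure \<rho> F x_out \<le> 1300 * \<epsilon> powr (3/2) \<and> real c \<le> ?C}"
  let ?B = "{\<omega> :: nat \<Rightarrow> 'd draws. \<exists>t<T. bad t (\<omega> t) (st \<omega> t)}"
  have fin: "(\<exists>x_out c. s = Finished x_out c \<and> crit_measure \<rho> F x_out \<le> 1300 * \<epsilon> powr (3/2) \<and> real c \<le> ?C)
      \<longleftrightarrow> st_tag s = 1 \<and> crit_measure \<rho> F (st_x s) \<le> 1300 * \<epsilon> powr (3/2) \<and> real (st_c s) \<le> ?C" for s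
    by (cases s) auto
  note [measurable] = measurable_st crit_measure_borel
  have "{s \<in> space state_measure. st_tag s = 1 \<and> crit_measure \<rho> F (st_x s) \<le> 1300 * \<epsilon> powr (3/2) \<and> real (st_c s) \<le> ?C}
      \<in> sets state_measure" by measurable
  from measurable_sets[OF measurable_st this] have E: "?E \<in> sets ?D"
    unfolding fin by (simp add: vimage_def Collect_conj_eq)
  have sub: "space ?D - ?B \<subseteq> ?E"
  proof
    fix \<omega> assume "\<omega> \<in> space ?D - ?B"
    then have good: "\<And>t. t < T \<Longrightarrow> \<not> bad t (\<omega> t) (st \<omega> t)" by auto
    obtain t where t: "t < T" "st_tag (st \<omega> t) = 0" "st_tag (st \<omega> (Suc t)) \<noteq> 0" using stops[OF good] by blast
    show "\<omega> \<in> ?E"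
      using stop_result[OF good t] cost_total[OF good t(1,2)] by fastforce
  qed
  have "1 - \<xi> \<le> 1 - D.prob ?B" using bad_prob(2) by simp
  also have "\<dots> = D.prob (space ?D - ?B)" by (rule D.prob_compl[OF bad_prob(1), symmetric])
  also have "\<dots> \<le> D.prob ?E" by (rule D.finite_measure_mono[OF sub E])
  finally show ?thesis .
qed

end

theorem corollary5p2:
  fixes f :: "nat \<Rightarrow> real ^ 'd \<Rightarrow> real"
    and F :: "real ^ 'd \<Rightarrow> real"
    and x0 :: "real ^ 'd"
    and n T S :: nat
    and \<Delta>F L \<rho> M \<xi> \<epsilon> :: real
    and Bg :: "nat \<Rightarrow> real ^ 'd \<Rightarrow> nat"
    and Bh :: "nat \<Rightarrow> nat"
  assumes n: "n \<ge> 1"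
    and F: "F = avg_fun n f"
    and pos: "\<Delta>F > 0" "L > 0" "\<rho> > 0" "M > 0"
    and twice_diff: "\<And>i x. i \<in> {1..n} \<Longrightarrow> f i differentiable (at x)"
      "\<And>i x. i \<in> {1..n} \<Longrightarrow> grad (f i) differentiable (at x)"
    and bounded_below: "bdd_below (range F)"
    and gap: "F x0 - (INF x. F x) \<le> \<Delta>F"
    and grad_lipschitz: "\<And>i x y. i \<in> {1..n} \<Longrightarrow>
      norm (grad (f i) x - grad (f i) y) \<le> L * norm (x - y)"
    and hess_lipschitz: "\<And>i x y. i \<in> {1..n} \<Longrightarrow>
      spectral_norm (hess (f i) x - hess (f i) y) \<le> \<rho> * norm (x - y)"
    and grad_deviation: "\<And>i x. i \<in> {1..n} \<Longrightarrow> norm (grad (f i) x - grad F x) \<le> M"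
    and \<xi>: "0 < \<xi>" "\<xi> < 1"
    and \<epsilon>: "0 < \<epsilon>" "\<epsilon> < L\<^sup>2 / (4 * \<rho>)"
    and S: "S = round_up (sqrt (\<rho> * \<epsilon>) / L * sqrt (min (real n) (M\<^sup>2 / \<epsilon>\<^sup>2)))"
    and T: "T = round_up (25 * \<Delta>F * \<rho> powr (1/2) * \<epsilon> powr (-3/2))"
    and Bh: "\<And>t. Bh t = round_up (min (real n)
      (1200 * L\<^sup>2 * (ln (3 * real T * real CARD('d) / \<xi>))\<^sup>2 / (\<rho> * \<epsilon>)))"
    and Bg: "\<And>t h. Bg t h =
      (if t mod S \<noteq> 0
       then round_up (min (real n)
         (2640 * L\<^sup>2 * real S * (norm h)\<^sup>2 * (ln (3 * real T / \<xi>))\<^sup>2 / \<epsilon>\<^sup>2))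
       else round_up (min (real n) (2640 * M\<^sup>2 * (ln (3 * real T / \<xi>))\<^sup>2 / \<epsilon>\<^sup>2)))"
  shows "\<P>(\<omega> in draws_measure n.
    \<exists>x_out c. srvrc_free n f T Bg Bh (\<lambda>t. 4 * \<rho>) S x0 \<epsilon> \<rho> L \<xi> \<omega> = Finished x_out c \<and>
      crit_measure \<rho> F x_out \<le> 1300 * \<epsilon> powr (3/2) \<and>
      real c \<le> soft_O_const * log_factor T CARD('d) \<xi> L \<rho> \<epsilon> ^ 3 *
        (min (real n) (M\<^sup>2 / \<epsilon>\<^sup>2)
         + \<Delta>F / \<epsilon> powr (3/2) *
           min (sqrt \<rho> * real n) (min (L * sqrt (real n) / sqrt \<epsilon>) (L * M / \<epsilon> powr (3/2)))
         + (L * \<Delta>F / \<epsilon>\<^sup>2 + L / sqrt (\<rho> * \<epsilon>)) * min (real n) (L\<^sup>2 / (\<rho> * \<epsilon>))))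
    \<ge> 1 - \<xi>"
proof -
  interpret srvrc f F x0 n T S \<Delta>F L \<rho> M \<xi> \<epsilon> Bg Bh
    by unfold_locales (fact assms)+
  show ?thesis
    using srvrc_success
    unfolding cost_terms \<Lambda>_def Nm_def Hm_def st_def srvrc_free_def soft_O_const_def .
qed

end
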